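(* Let $V$ be a complex vector space of finite dimension $n$, let $G$ be $\mathrm{O}(V)$ or $\mathrm{Sp}(V)$, let $r\ge 1$, and let $\underline V=V\oplus\mathbb C\eta$ be a one-dimensional extension of $V$. Let $\underline G$ be the enhanced group associated with $G$. Then: (1) $\displaystyle \mathrm{End}_G(\underline V^{\otimes r})=\Big(\bigoplus_{0\le s,t\le r,\ s-t\neq 0\text{ even}}\mathcal B_{st}\Big)\oplus \mathcal B(\varepsilon,n,r)$; (2) $\mathrm{End}_{G\times\mathbf G_m}(\underline V^{\otimes r})=\mathcal B(\varepsilon,n,r)$; (3) $\mathrm{End}_{\underline G\rtimes\mathbf G_m}(\underline V^{\otimes r})=\mathcal B(\varepsilon,n,r)^V$.
   Context: All vector spaces are over $\mathbb C$. $G$ is the isometry group of a nondegenerate bilinear form $\omega$ on $V$, symmetric for $\mathrm{O}(V)$ ($\varepsilon=1$), skew-symmetric for $\mathrm{Sp}(V)$ ($\varepsilon=-1$, $n$ even). Let $(f_p)_{1\le p\le n}$ be a basis of $V$ and $(f^p)$ the dual basis: $\omega(f_p,f^q)=\delta_{pq}$. Groups. $\underline G=G\times V$ with product $(g_1,v_1)(g_2,v_2)=(g_1g_2,g_1v_2+v_1)$ acts on $\underline V$ by $(g,v)(u+a\eta)=gu+av+a\eta$ ($u\in V$, $a\in\mathbb C$); $e^v:=(1,v)$. $\mathbf G_m=\mathbb C^\times$ acts on $\underline V$ by $c\cdot(u+a\eta)=u+ca\eta$. $G$ acts by $g(u+a\eta)=gu+a\eta$. All are regarded as subgroups of $\mathrm{GL}(\underline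 V)$; $G\times\mathbf G_m$ and $\underline G\rtimes\mathbf G_m$ are the subgroups generated by $G,\mathbf G_m$ and by $\underline G,\mathbf G_m$. $\Phi$ is the diagonal action of $\mathrm{GL}(\underline V)$ on $\underline V^{\otimes r}$, $\Phi(g)(v_1\otimes\cdots\otimes v_r)=gv_1\otimes\cdots\otimes gv_r$. For a subgroup $H$, $\mathrm{End}_H$ denotes the endomorphisms commuting with $H$. Tensor spaces. $\underline r=\{1,\dots,r\}$. For $I\subseteq\underline r$, $\underline V_I^{\otimes r}=V_1\otimes\cdots\otimes V_r$ with $V_i=V$ if $i\in I$ and $V_i=\mathbb C\eta$ otherwise, so $\underline V^{\otimes r}=\bigoplus_I\underline V_I^{\otimes r}$. $\mathfrak S_r$ acts by $\Psi(\sigma)(v_1\otimes\cdots\otimes v_r)=v_{\sigma^{-1}(1)}\otimes\cdots\otimes v_{\sigma^{-1}(r)}$, and $\Psi_l$ is the analogous action of $\mathfrak S_l$ on $V^{\otimes l}$. For $\sharp I=l\ge1$, $I=\{i_1<\dots<i_l\}$ and $\sigma\in\mathrm{End}_{\mathbb C}(V^{\otimes l})$, $\sigma^I\in\mathrm{End}_{\mathbb C}(\underline V^{\otimes r})$ acts on $\underline V_I^{\otimes r}$ as $\sigma$ on the tensor slots $i_1,\dots,i_l$ (taken in this order), and is zero on $\underline V_J^{\otimes r}$ for $J\ne I$. Enhanced Brauer algebra. $\mathcal B_l(\varepsilon n)=\mathrm{End}_G(V^{\otimes l})$ and $\mathcal B_l^{(I)}(\varepsilon n)=\{\sigma^I:\sigma\in\mathcal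 B_l(\varepsilon n)\}$ for $\sharp I=l\ge 1$. $\mathcal B(\varepsilon,n,r)$ is the subalgebra of $\mathrm{End}_{\mathbb C}(\underline V^{\otimes r})$ generated by $\Psi(\mathfrak S_r)$ and all $\mathcal B_l^{(I)}(\varepsilon n)$ with $1\le l\le r$, $\sharp I=l$. For $M\subseteq\mathrm{End}_{\mathbb C}(\underline V^{\otimes r})$, $M^V=\{\phi\in M:\Phi(e^v)\phi=\phi\,\Phi(e^v)\ \forall v\in V\}$. The spaces $\mathcal B_{st}$. For $I=\{i_1<\dots<i_l\}$, $J=\{j_1<\dots<j_l\}$, choose $\varepsilon_{J,I}\in\mathfrak S_r$ with $\varepsilon_{J,I}(i_k)=j_k$ for all $k$; $E_{JI}$ equals $\Psi(\varepsilon_{J,I})$ on $\underline V_I^{\otimes r}$ and $0$ on the other $\underline V_K^{\otimes r}$ (independent of the choice). For $1\le i<j\le l$, $\tau_{ij}\in\mathrm{End}(V^{\otimes l})$ sends $v_1\otimes\cdots\otimes v_l$ to $\omega(v_i,v_j)\sum_{p=1}^n$ of the tensor obtained by replacing $v_i$ by $f_p$ and $v_j$ by $f^p$. $Z_l$ is the set of normalized Brauer diagrams on $2l$ dots, i.e. of collections $z=\{i_1,j_1\},\dots,\{i_m,j_m\}$ ($m\ge0$, $i_p<j_p$) of pairwise disjoint two-element subsets of $\{1,\dots,l\}$, and $\tau_z=\prod_p\tau_{i_pj_p}$ (commuting factors; $\tau_z=\mathrm{id}$ for $z$ empty). For $K\subseteq L\subseteq\underline r$ with $\sharp L-\sharp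 K$ even and nonzero, $P(K,L)$ is the set of partitions $U=\{\{i_1,j_1\},\dots,\{i_m,j_m\}\}$ of $L\setminus K$ into two-element sets ($i_p<j_p$). $\mathcal D_U^{KL}:\underline V_K^{\otimes r}\to\underline V_L^{\otimes r}$ is the composite (in any order) over pairs $\{i,j\}\in U$ of the maps replacing the entries $\eta$ in slots $i,j$ by $\sum_p f_p$ (slot $i$) $\otimes f^p$ (slot $j$); $\mathcal C_U^{KL}:\underline V_L^{\otimes r}\to\underline V_K^{\otimes r}$ is the composite over $\{i,j\}\in U$ of the maps multiplying by $\omega(v_i,v_j)$ and replacing $v_i,v_j$ by $\eta$. For $\sharp I=s$, $\sharp J=t$ with $s-t$ nonzero and even, put $$\mathcal B_{IJ}=\sum_{J'\supseteq I,\,\sharp J'=t}\ \sum_{\sigma\in\mathfrak S_t}\sum_{U\in P(I,J')}\sum_{z\in Z_s}\mathbb C\,E_{JJ'}(\Psi_t(\sigma))^{J'}\mathcal D_U^{IJ'}(\tau_z)^I\quad(s<t),$$ $$\mathcal B_{IJ}=\sum_{J'\subseteq I,\,\sharp J'=t}\ \sum_{\sigma\in\mathfrak S_t}\sum_{z\in Z_t}\sum_{U\in P(J',I)}\mathbb C\,E_{JJ'}(\Psi_t(\sigma))^{J'}(\tau_z)^{J'}\mathcal C_U^{J'I}\quad(s>t),$$ subspaces of $\mathrm{Hom}_{\mathbb C}(\underline V_I^{\otimes r},\underline V_J^{\otimes r})$, viewed in $\mathrm{End}_{\mathbb C}(\underline V^{\otimes r})$ by extension by zero. When $s=0$ (resp.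 $t=0$) the factors $(\tau_z)^\emptyset$, $(\Psi_0(\sigma))^\emptyset$ are read as the identity of $\underline V_\emptyset^{\otimes r}$. Finally $\mathcal B_{st}=\bigoplus_{\sharp I=s}\bigoplus_{\sharp J=t}\mathcal B_{IJ}$. *)

theory Defs
  imports
    Complex_Main
    "HOL-Library.Function_Algebras"
    "HOL-Library.Product_Plus"
    "HOL-Library.Disjoint_Sets"
    "HOL-Combinatorics.Permutations"
    "HOL-Algebra.Generated_Groups"
begin

section \<open>Complex vector spaces\<close>

class complex_vector = ab_group_add +
  fixes scaleC :: "complex \<Rightarrow> 'a \<Rightarrow> 'a"  (infixr \<open>*\<^sub>C\<close> 75)
  assumes scaleC_add_right: "a *\<^sub>C (x + y) = a *\<^sub>C x + a *\<^sub>C y"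
    and scaleC_add_left: "(a + b) *\<^sub>C x = a *\<^sub>C x + b *\<^sub>C x"
    and scaleC_scaleC: "a *\<^sub>C (b *\<^sub>C x) = (a * b) *\<^sub>C x"
    and scaleC_one: "1 *\<^sub>C x = x"

abbreviation clinear :: "('a::complex_vector \<Rightarrow> 'b::complex_vector) \<Rightarrow> bool"
  where "clinear \<equiv> Vector_Spaces.linear (*\<^sub>C) (*\<^sub>C)"

global_interpretation complex_vector: vector_space "scaleC :: complex \<Rightarrow> 'a \<Rightarrow> 'a::complex_vector"
  defines cdependent = complex_vector.dependent
    and csubspace = complex_vector.subspace
    and cspan = complex_vector.span
  by unfold_locales (simp_all add: scaleC_add_right scaleC_add_left scaleC_scaleC scaleC_one)

interpretation complex_vector_pair: vector_space_pair
  "scaleC :: complex \<Rightarrow> 'a \<Rightarrow> 'a::complex_vector" "scaleC :: complex \<Rightarrow> 'b \<Rightarrow> 'b::complex_vector"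
  by unfold_locales

instantiation complex :: complex_vector
begin
definition "a *\<^sub>C (z::complex) = a * z"
instance by standard (simp_all add: scaleC_complex_def algebra_simps)
end

instantiation prod :: (complex_vector, complex_vector) complex_vector
begin
definition "a *\<^sub>C z = (a *\<^sub>C fst z, a *\<^sub>C snd z)"
instance by standard
    (simp_all add: scaleC_prod_def scaleC_add_right scaleC_add_left scaleC_scaleC scaleC_one)
end

instantiation "fun" :: (type, complex_vector) complex_vector
begin
definition "a *\<^sub>C f = (\<lambda>x. a *\<^sub>C f x)"
instance by standard
    (simp_all add: scaleC_fun_def plus_fun_def scaleC_add_right scaleC_add_left scaleC_scaleC scaleC_one)
end

text \<open>Linear maps between subspaces are represented by total functions vanishing off their source;
  hence they add, scale and compose as plain functions, and extension by zero is the identity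
  on representatives.\<close>

definition Hom :: "'a::complex_vector set \<Rightarrow> 'b::complex_vector set \<Rightarrow> ('a \<Rightarrow> 'b) set"
  where "Hom S S' = {h. (\<forall>x\<in>S. h x \<in> S') \<and> (\<forall>x\<in>S. \<forall>y\<in>S. h (x + y) = h x + h y)
    \<and> (\<forall>c. \<forall>x\<in>S. h (c *\<^sub>C x) = c *\<^sub>C h x) \<and> (\<forall>x. x \<notin> S \<longrightarrow> h x = 0)}"

definition idmap :: "'a::complex_vector set \<Rightarrow> 'a \<Rightarrow> 'a"
  where "idmap S x = (if x \<in> S then x else 0)"

definition is_subalgebra :: "'a::complex_vector set \<Rightarrow> ('a \<Rightarrow> 'a) set \<Rightarrow> bool"
  where "is_subalgebra S A \<longleftrightarrow> A \<subseteq> Hom S S \<and> csubspace A \<and> idmap S \<in> A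
    \<and> (\<forall>\<phi>\<in>A. \<forall>\<psi>\<in>A. \<phi> \<circ> \<psi> \<in> A)"

definition subspace_sum :: "'i set \<Rightarrow> ('i \<Rightarrow> 'a::complex_vector set) \<Rightarrow> 'a set"
  where "subspace_sum K W = {\<Sum>i\<in>K. x i | x. \<forall>i\<in>K. x i \<in> W i}"

definition is_direct_sum :: "'a::complex_vector set \<Rightarrow> 'i set \<Rightarrow> ('i \<Rightarrow> 'a set) \<Rightarrow> bool"
  where "is_direct_sum S K W \<longleftrightarrow> finite K \<and> (\<forall>i\<in>K. csubspace (W i)) \<and> S = subspace_sum K W
    \<and> (\<forall>x. (\<forall>i\<in>K. x i \<in> W i) \<and> (\<Sum>i\<in>K. x i) = 0 \<longrightarrow> (\<forall>i\<in>K. x i = 0))"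


section \<open>Tensor powers\<close>

text \<open>Tensor slots are numbered from 0, so the index set of the slots is \<open>{..<r}\<close>.\<close>

definition multilinear :: "nat \<Rightarrow> ('a::complex_vector list \<Rightarrow> 'b::complex_vector) \<Rightarrow> bool"
  where "multilinear l F \<longleftrightarrow> (\<forall>vs i. length vs = l \<and> i < l \<longrightarrow> clinear (\<lambda>x. F (vs[i := x])))"

text \<open>The pure tensor \<open>v\<^sub>1 \<otimes> \<dots> \<otimes> v\<^sub>l\<close> is modelled as evaluation at \<open>(v\<^sub>1,\<dots>,v\<^sub>l)\<close> on the \<open>l\<close>-linear
  forms, and the \<open>l\<close>-th tensor power as the span of the pure tensors. The universal property is
  the lemma \<open>tlift\<close> below.\<close>

type_synonym 'a tensor = "('a list \<Rightarrow> complex) \<Rightarrow> complex"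

definition pure :: "'a::complex_vector list \<Rightarrow> 'a tensor"
  where "pure vs = (\<lambda>m. if multilinear (length vs) m then m vs else 0)"

definition tpow :: "nat \<Rightarrow> 'a::complex_vector tensor set"
  where "tpow l = cspan {pure vs | vs. length vs = l}"

definition tlift :: "nat \<Rightarrow> ('a::complex_vector list \<Rightarrow> 'b::complex_vector) \<Rightarrow> 'a tensor \<Rightarrow> 'b"
  where "tlift l F = (THE h. h \<in> Hom (tpow l) UNIV \<and> (\<forall>vs. length vs = l \<longrightarrow> h (pure vs) = F vs))"

lemma separating_functional:
  assumes "\<And>\<phi> :: 'a::complex_vector \<Rightarrow> complex. clinear \<phi> \<Longrightarrow> \<phi> x = \<phi> y"
  shows "x = y"
proof (rule ccontr)
  assume "x \<noteq> y"
  then have "\<not> cdependent {x - y}"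
    by (simp add: complex_vector.dependent_single)
  then obtain \<phi> :: "'a \<Rightarrow> complex" where \<phi>: "clinear \<phi>" "\<phi> (x - y) = 1"
    using complex_vector_pair.linear_independent_extend[of "{x - y}" "\<lambda>_. 1"] by auto
  then show False
    using assms[OF \<phi>(1)] complex_vector_pair.linear_diff[OF \<phi>(1), of x y] by simp
qed

lemma tlift:
  fixes F :: "'a::complex_vector list \<Rightarrow> 'b::complex_vector"
  assumes F: "multilinear l F"
  shows "tlift l F \<in> Hom (tpow l) UNIV" and "length vs = l \<Longrightarrow> tlift l F (pure vs) = F vs"
proof -
  let ?P = "{pure vs | vs :: 'a list. length vs = l}"
  obtain B where B: "B \<subseteq> ?P" "\<not> cdependent B" "?P \<subseteq> cspan B"
    using complex_vector.maximal_independent_subset[of ?P] by blast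
  define rep where "rep b = (SOME vs. length vs = l \<and> b = pure vs)" for b :: "'a tensor"
  have rep: "length (rep b) = l \<and> b = pure (rep b)" if "b \<in> B" for b
    unfolding rep_def by (rule someI_ex) (use B(1) that in blast)
  obtain g where g: "clinear g" "\<And>b. b \<in> B \<Longrightarrow> g b = F (rep b)"
    using complex_vector_pair.linear_independent_extend[OF B(2), of "\<lambda>b. F (rep b)"] by blast
  have gF: "g (pure vs) = F vs" if vs: "length vs = l" for vs :: "'a list"
  proof (rule separating_functional)
    fix \<phi> :: "'b \<Rightarrow> complex" assume \<phi>: "clinear \<phi>"
    define m where "m = \<phi> \<circ> F"
    have m: "multilinear l m"
      unfolding multilinear_def
    proof (intro allI impI)
      fix us :: "'a list" and i assume "length us = l \<and> i < l"
      then have "clinear (\<lambda>x. F (us[i := x]))" using F by (auto simp: multilinear_def)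
      from Vector_Spaces.linear_compose[OF this \<phi>]
      show "clinear (\<lambda>x. m (us[i := x]))" by (simp add: m_def o_def)
    qed
    have ev: "clinear (\<lambda>x :: 'a tensor. x m)"
      by (simp add: Vector_Spaces.linear_iff complex_vector.vector_space_axioms plus_fun_def scaleC_fun_def)
    have "pure vs m = (\<phi> \<circ> g) (pure vs)"
    proof (rule complex_vector_pair.linear_eq_on[OF ev Vector_Spaces.linear_compose[OF g(1) \<phi>]])
      show "pure vs \<in> cspan B" using B(3) vs by blast
      show "b m = (\<phi> \<circ> g) b" if "b \<in> B" for b
      proof -
        have "b m = m (rep b)" by (subst conjunct2[OF rep[OF that]]) (simp add: pure_def m conjunct1[OF rep[OF that]])
        then show ?thesis using g(2)[OF that] by (simp add: m_def)
      qed
    qed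
    then show "\<phi> (g (pure vs)) = \<phi> (F vs)" using m vs by (simp add: pure_def m_def)
  qed
  define h where "h x = (if x \<in> tpow l then g x else 0)" for x :: "'a tensor"
  have sub: "csubspace (tpow l :: 'a tensor set)" unfolding tpow_def by simp
  have pure_in: "pure vs \<in> tpow l" if "length vs = l" for vs :: "'a list"
    unfolding tpow_def using that by (auto intro!: complex_vector.span_base)
  have h_Hom: "h \<in> Hom (tpow l) UNIV"
    using complex_vector_pair.linear_add[OF g(1)] complex_vector_pair.linear_scale[OF g(1)]
    by (simp add: Hom_def h_def complex_vector.subspace_add[OF sub] complex_vector.subspace_scale[OF sub])
  have h_pure: "h (pure vs) = F vs" if "length vs = l" for vs
    using pure_in[OF that] gF[OF that] by (simp add: h_def)
  have uniq: "k = h" if k: "k \<in> Hom (tpow l) UNIV \<and> (\<forall>vs. length vs = l \<longrightarrow> k (pure vs) = F vs)" for k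
  proof
    fix x
    have k_add: "k (y + z) = k y + k z" if "y \<in> tpow l" "z \<in> tpow l" for y z
      using k that unfolding Hom_def by blast
    have k_scale: "k (c *\<^sub>C y) = c *\<^sub>C k y" if "y \<in> tpow l" for c y
      using k that unfolding Hom_def by blast
    have eq: "csubspace {x \<in> tpow l. k x = g x}"
    proof (rule complex_vector.subspaceI)
      have "k (0 *\<^sub>C 0) = 0 *\<^sub>C k 0" using complex_vector.subspace_0[OF sub] by (rule k_scale)
      then show "0 \<in> {x \<in> tpow l. k x = g x}"
        using complex_vector.subspace_0[OF sub] complex_vector_pair.linear_0[OF g(1)] by simp
    qed (use complex_vector_pair.linear_add[OF g(1)] complex_vector_pair.linear_scale[OF g(1)] in
        \<open>simp_all add: k_add k_scale complex_vector.subspace_add[OF sub] complex_vector.subspace_scale[OF sub]\<close>)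
    have "?P \<subseteq> {x \<in> tpow l. k x = g x}"
    proof
      fix x assume "x \<in> ?P"
      then obtain vs where vs: "x = pure vs" "length vs = l" by blast
      then have "k x = F vs" using k by simp
      then show "x \<in> {x \<in> tpow l. k x = g x}" using vs pure_in gF by simp
    qed
    from complex_vector.span_minimal[OF this eq]
    have "x \<in> tpow l \<Longrightarrow> k x = h x" by (auto simp: tpow_def h_def)
    moreover have "x \<notin> tpow l \<Longrightarrow> k x = h x" using h_Hom k unfolding Hom_def by simp
    ultimately show "k x = h x" by blast
  qed
  have "tlift l F = h"
    unfolding tlift_def by (rule the_equality[OF _ uniq]) (use h_Hom h_pure in auto)
  then show "tlift l F \<in> Hom (tpow l) UNIV" and "length vs = l \<Longrightarrow> tlift l F (pure vs) = F vs"
    using h_Hom h_pure by auto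
qed

definition diag_action :: "nat \<Rightarrow> ('a::complex_vector \<Rightarrow> 'a) \<Rightarrow> 'a tensor \<Rightarrow> 'a tensor"
  where "diag_action l g = tlift l (\<lambda>vs. pure (map g vs))"

definition perm_action :: "nat \<Rightarrow> (nat \<Rightarrow> nat) \<Rightarrow> 'a::complex_vector tensor \<Rightarrow> 'a tensor"
  where "perm_action l \<sigma> = tlift l (\<lambda>vs. pure (permute_list (Hilbert_Choice.inv \<sigma>) vs))"

definition End_grp :: "nat \<Rightarrow> ('a::complex_vector \<Rightarrow> 'a) set \<Rightarrow> ('a tensor \<Rightarrow> 'a tensor) set"
  where "End_grp l H = {\<phi> \<in> Hom (tpow l) (tpow l).
    \<forall>g\<in>H. diag_action l g \<circ> \<phi> = \<phi> \<circ> diag_action l g}"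


section \<open>The groups\<close>

definition GL :: "('a::complex_vector \<Rightarrow> 'a) monoid"
  where "GL = \<lparr>carrier = {g. clinear g \<and> bij g}, mult = (\<circ>), one = id\<rparr>"

definition nondegenerate_bilinear :: "('v::complex_vector \<Rightarrow> 'v \<Rightarrow> complex) \<Rightarrow> bool"
  where "nondegenerate_bilinear \<omega> \<longleftrightarrow> (\<forall>u. clinear (\<omega> u)) \<and> (\<forall>v. clinear (\<lambda>u. \<omega> u v))
    \<and> (\<forall>u. (\<forall>v. \<omega> u v = 0) \<longrightarrow> u = 0) \<and> (\<forall>v. (\<forall>u. \<omega> u v = 0) \<longrightarrow> v = 0)"

definition isometry_group :: "('v::complex_vector \<Rightarrow> 'v \<Rightarrow> complex) \<Rightarrow> ('v \<Rightarrow> 'v) set"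
  where "isometry_group \<omega> = {g \<in> carrier GL. \<forall>u v. \<omega> (g u) (g v) = \<omega> u v}"

text \<open>The pair \<open>(u, a)\<close> stands for the vector \<open>u + a\<eta>\<close>.\<close>

type_synonym 'v ext = "'v \<times> complex"

abbreviation \<eta> :: "'v::complex_vector ext" where "\<eta> \<equiv> (0, 1)"

definition enhanced_group ::
    "('v::complex_vector \<Rightarrow> 'v \<Rightarrow> complex) \<Rightarrow> (('v \<Rightarrow> 'v) \<times> 'v) monoid"
  where "enhanced_group \<omega> = \<lparr>carrier = isometry_group \<omega> \<times> UNIV,
    mult = (\<lambda>(g1, v1) (g2, v2). (g1 \<circ> g2, g1 v2 + v1)), one = (id, 0)\<rparr>"

definition enhanced_act :: "('v \<Rightarrow> 'v) \<times> 'v \<Rightarrow> 'v::complex_vector ext \<Rightarrow> 'v ext"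
  where "enhanced_act = (\<lambda>(g, v) (u, a). (g u + a *\<^sub>C v, a))"

definition Enh_in_GL :: "('v::complex_vector \<Rightarrow> 'v \<Rightarrow> complex) \<Rightarrow> ('v ext \<Rightarrow> 'v ext) set"
  where "Enh_in_GL \<omega> = enhanced_act ` carrier (enhanced_group \<omega>)"

definition G_in_GL :: "('v::complex_vector \<Rightarrow> 'v \<Rightarrow> complex) \<Rightarrow> ('v ext \<Rightarrow> 'v ext) set"
  where "G_in_GL \<omega> = {\<lambda>(u, a). (g u, a) | g. g \<in> isometry_group \<omega>}"

definition Gm_in_GL :: "('v::complex_vector ext \<Rightarrow> 'v ext) set"
  where "Gm_in_GL = {\<lambda>(u, a). (u, c * a) | c. c \<noteq> 0}"

definition G_times_Gm :: "('v::complex_vector \<Rightarrow> 'v \<Rightarrow> complex) \<Rightarrow> ('v ext \<Rightarrow> 'v ext) set"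
  where "G_times_Gm \<omega> = generate GL (G_in_GL \<omega> \<union> Gm_in_GL)"

definition Enh_semidirect_Gm :: "('v::complex_vector \<Rightarrow> 'v \<Rightarrow> complex) \<Rightarrow> ('v ext \<Rightarrow> 'v ext) set"
  where "Enh_semidirect_Gm \<omega> = generate GL (Enh_in_GL \<omega> \<union> Gm_in_GL)"


section \<open>The summands of the tensor power of the extension\<close>

definition summand_proj :: "nat \<Rightarrow> nat set \<Rightarrow> 'v::complex_vector ext tensor \<Rightarrow> 'v ext tensor"
  where "summand_proj r I = tlift r (\<lambda>ws. pure
    (map (\<lambda>i. if i \<in> I then (fst (ws ! i), 0) else (0, snd (ws ! i))) [0..<r]))"

text \<open>\<open>slots_in\<close> identifies the \<open>card I\<close>-th tensor power of \<open>V\<close> with the summand of \<open>I\<close> by filling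
  the remaining slots with \<open>\<eta>\<close>; \<open>slots_out\<close> is the inverse identification, extended by zero to
  the other summands.\<close>

definition slots_in :: "nat \<Rightarrow> nat set \<Rightarrow> 'v::complex_vector tensor \<Rightarrow> 'v ext tensor"
  where "slots_in r I = tlift (card I) (\<lambda>vs. pure
    (map (\<lambda>i. if i \<in> I then (vs ! card {k \<in> I. k < i}, 0) else \<eta>) [0..<r]))"

definition slots_out :: "nat \<Rightarrow> nat set \<Rightarrow> 'v::complex_vector ext tensor \<Rightarrow> 'v tensor"
  where "slots_out r I = tlift r (\<lambda>ws.
    (\<Prod>i\<in>{..<r} - I. snd (ws ! i)) *\<^sub>C pure (map (\<lambda>i. fst (ws ! i)) (sorted_list_of_set I)))"

definition on_summand ::
    "nat \<Rightarrow> nat set \<Rightarrow> ('v tensor \<Rightarrow> 'v tensor) \<Rightarrow> 'v::complex_vector ext tensor \<Rightarrow> 'v ext tensor"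
  where "on_summand r I \<sigma> = slots_in r I \<circ> \<sigma> \<circ> slots_out r I"


section \<open>The enhanced Brauer algebra\<close>

definition brauer ::
    "('v::complex_vector \<Rightarrow> 'v \<Rightarrow> complex) \<Rightarrow> nat \<Rightarrow> ('v tensor \<Rightarrow> 'v tensor) set"
  where "brauer \<omega> l = End_grp l (isometry_group \<omega>)"

definition enhanced_brauer ::
    "('v::complex_vector \<Rightarrow> 'v \<Rightarrow> complex) \<Rightarrow> nat \<Rightarrow> ('v ext tensor \<Rightarrow> 'v ext tensor) set"
  where "enhanced_brauer \<omega> r = is_subalgebra (tpow r) hull
    ({perm_action r \<sigma> | \<sigma>. \<sigma> permutes {..<r}} \<union>
     {on_summand r I \<sigma> | I \<sigma>. I \<subseteq> {..<r} \<and> I \<noteq> {} \<and> \<sigma> \<in> brauer \<omega> (card I)})"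

definition translation_invariants ::
    "nat \<Rightarrow> ('v::complex_vector ext tensor \<Rightarrow> 'v ext tensor) set \<Rightarrow> ('v ext tensor \<Rightarrow> 'v ext tensor) set"
  where "translation_invariants r M = {\<phi> \<in> M. \<forall>v.
    diag_action r (enhanced_act (id, v)) \<circ> \<phi> = \<phi> \<circ> diag_action r (enhanced_act (id, v))}"


section \<open>The spaces of Brauer-type maps between different summands\<close>

definition transfer_perm :: "nat \<Rightarrow> nat set \<Rightarrow> nat set \<Rightarrow> nat \<Rightarrow> nat"
  where "transfer_perm r J I = (SOME \<sigma>. \<sigma> permutes {..<r} \<and>
    (\<forall>k < card I. \<sigma> (sorted_list_of_set I ! k) = sorted_list_of_set J ! k))"

definition E_map :: "nat \<Rightarrow> nat set \<Rightarrow> nat set \<Rightarrow> 'v::complex_vector ext tensor \<Rightarrow> 'v ext tensor"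
  where "E_map r J I = perm_action r (transfer_perm r J I) \<circ> summand_proj r I"

text \<open>In the following, \<open>f p\<close> and \<open>fd p\<close> for \<open>1 \<le> p \<le> n\<close> are a basis of \<open>V\<close> and its dual basis
  with respect to \<open>\<omega>\<close>.\<close>

definition is_basis :: "nat \<Rightarrow> (nat \<Rightarrow> 'v::complex_vector) \<Rightarrow> bool"
  where "is_basis n f \<longleftrightarrow> inj_on f {1..n} \<and> \<not> cdependent (f ` {1..n}) \<and> cspan (f ` {1..n}) = UNIV"

definition is_dual_basis :: "('v::complex_vector \<Rightarrow> 'v \<Rightarrow> complex) \<Rightarrow>
    nat \<Rightarrow> (nat \<Rightarrow> 'v) \<Rightarrow> (nat \<Rightarrow> 'v) \<Rightarrow> bool"
  where "is_dual_basis \<omega> n f fd \<longleftrightarrow>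
    (\<forall>p\<in>{1..n}. \<forall>q\<in>{1..n}. \<omega> (f p) (fd q) = (if p = q then 1 else 0))"

definition tau :: "('v::complex_vector \<Rightarrow> 'v \<Rightarrow> complex) \<Rightarrow> nat \<Rightarrow> (nat \<Rightarrow> 'v) \<Rightarrow> (nat \<Rightarrow> 'v) \<Rightarrow>
    nat \<Rightarrow> nat \<Rightarrow> nat \<Rightarrow> 'v tensor \<Rightarrow> 'v tensor"
  where "tau \<omega> n f fd l i j = tlift l (\<lambda>vs.
    \<omega> (vs ! i) (vs ! j) *\<^sub>C (\<Sum>p=1..n. pure (vs[i := f p, j := fd p])))"

text \<open>Unordered pairs \<open>{i, j}\<close> with \<open>i < j\<close> are two-element sets, whose members are recovered by
  \<open>Min\<close> and \<open>Max\<close>.\<close>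

definition brauer_diagrams :: "nat \<Rightarrow> nat set set set"
  where "brauer_diagrams l = {z. (\<forall>e\<in>z. e \<subseteq> {..<l} \<and> card e = 2) \<and> disjoint z}"

definition pairings :: "nat set \<Rightarrow> nat set \<Rightarrow> nat set set set"
  where "pairings K L = {U. partition_on (L - K) U \<and> (\<forall>e\<in>U. card e = 2)}"

text \<open>The maps attached to disjoint pairs commute, so the folds below do not depend on an
  enumeration of the pairs.\<close>

definition tau_diagram :: "('v::complex_vector \<Rightarrow> 'v \<Rightarrow> complex) \<Rightarrow> nat \<Rightarrow> (nat \<Rightarrow> 'v) \<Rightarrow> (nat \<Rightarrow> 'v) \<Rightarrow>
    nat \<Rightarrow> nat set set \<Rightarrow> 'v tensor \<Rightarrow> 'v tensor"
  where "tau_diagram \<omega> n f fd l z =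
    Finite_Set.fold (\<lambda>e h. tau \<omega> n f fd l (Min e) (Max e) \<circ> h) (idmap (tpow l)) z"

definition insert_pair :: "nat \<Rightarrow> (nat \<Rightarrow> 'v) \<Rightarrow> (nat \<Rightarrow> 'v) \<Rightarrow>
    nat \<Rightarrow> nat \<Rightarrow> nat \<Rightarrow> 'v::complex_vector ext tensor \<Rightarrow> 'v ext tensor"
  where "insert_pair n f fd r i j = tlift r (\<lambda>ws.
    (snd (ws ! i) * snd (ws ! j)) *\<^sub>C (\<Sum>p=1..n. pure (ws[i := (f p, 0), j := (fd p, 0)])))"

definition contract_pair :: "('v::complex_vector \<Rightarrow> 'v \<Rightarrow> complex) \<Rightarrow>
    nat \<Rightarrow> nat \<Rightarrow> nat \<Rightarrow> 'v ext tensor \<Rightarrow> 'v ext tensor"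
  where "contract_pair \<omega> r i j = tlift r (\<lambda>ws.
    \<omega> (fst (ws ! i)) (fst (ws ! j)) *\<^sub>C pure (ws[i := \<eta>, j := \<eta>]))"

definition D_map :: "nat \<Rightarrow> (nat \<Rightarrow> 'v) \<Rightarrow> (nat \<Rightarrow> 'v) \<Rightarrow> nat \<Rightarrow> nat set \<Rightarrow>
    nat set set \<Rightarrow> 'v::complex_vector ext tensor \<Rightarrow> 'v ext tensor"
  where "D_map n f fd r K U =
    Finite_Set.fold (\<lambda>e h. insert_pair n f fd r (Min e) (Max e) \<circ> h) (summand_proj r K) U"

definition C_map :: "('v::complex_vector \<Rightarrow> 'v \<Rightarrow> complex) \<Rightarrow> nat \<Rightarrow> nat set \<Rightarrow>
    nat set set \<Rightarrow> 'v ext tensor \<Rightarrow> 'v ext tensor"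
  where "C_map \<omega> r L U =
    Finite_Set.fold (\<lambda>e h. contract_pair \<omega> r (Min e) (Max e) \<circ> h) (summand_proj r L) U"

definition B_IJ :: "('v::complex_vector \<Rightarrow> 'v \<Rightarrow> complex) \<Rightarrow> nat \<Rightarrow> (nat \<Rightarrow> 'v) \<Rightarrow> (nat \<Rightarrow> 'v) \<Rightarrow>
    nat \<Rightarrow> nat set \<Rightarrow> nat set \<Rightarrow> ('v ext tensor \<Rightarrow> 'v ext tensor) set"
  where "B_IJ \<omega> n f fd r I J = (let s = card I; t = card J in
    if s < t then
      cspan {E_map r J J' \<circ> on_summand r J' (perm_action t \<sigma>) \<circ> D_map n f fd r I U
              \<circ> on_summand r I (tau_diagram \<omega> n f fd s z)
            | J' \<sigma> U z. I \<subseteq> J' \<and> J' \<subseteq> {..<r} \<and> card J' = t \<and> \<sigma> permutes {..<t}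
                \<and> U \<in> pairings I J' \<and> z \<in> brauer_diagrams s}
    else
      cspan {E_map r J J' \<circ> on_summand r J' (perm_action t \<sigma>)
              \<circ> on_summand r J' (tau_diagram \<omega> n f fd t z) \<circ> C_map \<omega> r I U
            | J' \<sigma> z U. J' \<subseteq> I \<and> card J' = t \<and> \<sigma> permutes {..<t}
                \<and> z \<in> brauer_diagrams t \<and> U \<in> pairings J' I})"

text \<open>The sum is automatically direct, since the maps in the summand of \<open>(I, J)\<close> are supported on
  the summand of \<open>I\<close> and have values in the summand of \<open>J\<close>.\<close>

definition B_st :: "('v::complex_vector \<Rightarrow> 'v \<Rightarrow> complex) \<Rightarrow> nat \<Rightarrow> (nat \<Rightarrow> 'v) \<Rightarrow> (nat \<Rightarrow> 'v) \<Rightarrow>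
    nat \<Rightarrow> nat \<Rightarrow> nat \<Rightarrow> ('v ext tensor \<Rightarrow> 'v ext tensor) set"
  where "B_st \<omega> n f fd r s t = subspace_sum
    ({I. I \<subseteq> {..<r} \<and> card I = s} \<times> {J. J \<subseteq> {..<r} \<and> card J = t})
    (\<lambda>(I, J). B_IJ \<omega> n f fd r I J)"

end

theory Submission
  imports Defs
begin

text \<open>Tensors of the extended space are evaluated at products of the functionals \<open>\<omega>(\<cdot>, u)\<close> and the
  \<open>\<eta>\<close>-coordinate, which turns the component of an endomorphism between the summands of \<open>I\<close> and \<open>J\<close>
  into a multilinear form on \<open>V\<close> in \<open>card I + card J\<close> variables. The endomorphism commutes with \<open>G\<close>
  iff all these forms are invariant, and with \<open>\<^bold>G\<^sub>m\<close> iff they vanish for \<open>card I \<noteq> card J\<close>. The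
  forms of the diagram maps are exactly the products of \<open>\<omega>\<close> over perfect matchings of the
  variables, so (1) reduces to the first fundamental theorem: these products span the invariant forms.

  For the latter, differentiating one-parameter subgroups gives invariance under
  \<open>y \<mapsto> \<omega>(y, u) x - \<epsilon> \<omega>(y, x) u\<close>; summing over a pair of dual bases yields
  \<open>(n - \<epsilon>) F + \<Sum>\<^sub>i s\<^sub>k\<^sub>i F = \<epsilon> \<Sum>\<^sub>i \<omega>(v\<^sub>i, v\<^sub>k) c\<^sub>k\<^sub>i F\<close> with transpositions \<open>s\<close> and contractions \<open>c\<close>. By
  induction the right-hand side is in the span \<open>W\<close> of the matching forms. If \<open>F\<close> is orthogonal to \<open>W\<close>
  for a Hermitian form on coordinates, both sides vanish, and summing over \<open>k\<close> gives
  \<open>\<Sum>\<^sub>a\<^sub>b \<parallel>E\<^sub>a\<^sub>b F\<parallel>\<^sup>2 = \<epsilon> m \<parallel>F\<parallel>\<^sup>2\<close> for \<open>m\<close> variables. This forces \<open>F = 0\<close> if \<open>\<epsilon> = -1\<close>; if \<open>\<epsilon> = 1\<close> it forces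
  \<open>F\<close> to be supported on words using every letter of an orthonormal basis exactly once, and a
  reflection then gives \<open>F = - F\<close>.\<close>

section \<open>Multilinear forms and bilinear spaces\<close>

text \<open>Differentiation sees only the identity component of \<open>G\<close>. For \<epsilon> = 1
  this component has the determinant as an extra invariant, which lives on words using each letter
  once; this is why a reflection has to finish the argument. Positivity comes from the Hermitian
  form on coordinates. It is preserved by permutations of the variables, as is the span of the
  matching forms, so transpositions map the orthogonal complement of that span to itself; and E_ba
  is adjoint to E_ab. The norm sum is thus the Casimir element of gl_n paired with \<open>F\<close>:
  it equals n m |F|^2 plus the sum of <F, s_ij F> over i \<noteq> j. The relation turns the second
  part into m (\<epsilon> - n) |F|^2, so that n cancels. On the algebraic side, every space of the
  theorem is shown to be some \<open>equivariant r Q\<close>: all components are invariant and only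
  the pairs (I, J) with \<open>Q I J\<close> carry a nonzero one. The three claims become statements
  about \<open>Q\<close>. The first fundamental theorem enters twice: it identifies
  \<open>B_IJ\<close>, and it kills the components with card I + card J odd, since a set of odd size
  has no perfect matching.\<close>

lemma clinear_iff:
  "clinear h \<longleftrightarrow> (\<forall>x y. h (x + y) = h x + h y) \<and> (\<forall>c x. h (c *\<^sub>C x) = c *\<^sub>C h x)"
  by (simp add: Vector_Spaces.linear_iff complex_vector.vector_space_axioms)

lemma clinearI:
  assumes "\<And>x y. h (x + y) = h x + h y" "\<And>c x. h (c *\<^sub>C x) = c *\<^sub>C h x"
  shows "clinear h"
  using assms by (simp add: clinear_iff)

lemmas clinear_add = complex_vector_pair.linear_add
lemmas clinear_scale = complex_vector_pair.linear_scale
lemmas clinear_0 = complex_vector_pair.linear_0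
lemmas clinear_diff = complex_vector_pair.linear_diff
lemmas clinear_neg = complex_vector_pair.linear_neg
lemmas clinear_sum = complex_vector_pair.linear_sum

lemma clinear_compose: "clinear g \<Longrightarrow> clinear h \<Longrightarrow> clinear (\<lambda>x. h (g x))"
  by (simp add: clinear_iff)

lemma clinear_compose_sum:
  assumes "\<And>i. i \<in> K \<Longrightarrow> clinear (h i)"
  shows "clinear (\<lambda>x. \<Sum>i\<in>K. h i x)"
  using assms by (auto simp: clinear_iff sum.distrib complex_vector.scale_sum_right)

lemma clinear_compose_scale: "clinear h \<Longrightarrow> clinear (\<lambda>x. c *\<^sub>C h x)"
  by (auto simp: clinear_iff scaleC_add_right scaleC_scaleC mult.commute)

lemma clinear_ident: "clinear (\<lambda>x. x)"
  by (simp add: clinear_iff)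

lemma clinear_inv:
  assumes lin: "clinear g" and bij: "bij g"
  shows "clinear (Hilbert_Choice.inv g)"
proof (rule clinearI)
  let ?h = "Hilbert_Choice.inv g"
  have gh: "g (?h x) = x" and hg: "?h (g y) = y" for x y
    using bij by (simp_all add: bij_is_surj surj_f_inv_f bij_is_inj inv_f_f)
  fix x y c
  have "?h (g (?h x) + g (?h y)) = ?h x + ?h y" unfolding clinear_add[OF lin, symmetric] by (rule hg)
  then show "?h (x + y) = ?h x + ?h y" by (simp only: gh)
  have "?h (c *\<^sub>C g (?h x)) = c *\<^sub>C ?h x" unfolding clinear_scale[OF lin, symmetric] by (rule hg)
  then show "?h (c *\<^sub>C x) = c *\<^sub>C ?h x" by (simp only: gh)
qed

section \<open>Multilinear forms in variables indexed by a set\<close>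

text \<open>Assignments are total and the second conjunct makes \<open>F\<close> ignore them off
  \<open>A\<close>. Removing slots, as contractions do, then changes \<open>A\<close> but not the
  type of \<open>F\<close>, and slots may be elements of \<open>nat + nat\<close>.\<close>

definition multilinear_on ::
    "'i set \<Rightarrow> (('i \<Rightarrow> 'a::complex_vector) \<Rightarrow> 'b::complex_vector) \<Rightarrow> bool"
  where "multilinear_on A F \<longleftrightarrow> (\<forall>v. \<forall>i\<in>A. clinear (\<lambda>x. F (v(i := x))))
    \<and> (\<forall>v w. (\<forall>i\<in>A. v i = w i) \<longrightarrow> F v = F w)"

lemma multilinear_on_clinear: "multilinear_on A F \<Longrightarrow> i \<in> A \<Longrightarrow> clinear (\<lambda>x. F (v(i := x)))"
  by (simp add: multilinear_on_def)

lemma multilinear_on_cong: "multilinear_on A F \<Longrightarrow> (\<And>i. i \<in> A \<Longrightarrow> v i = w i) \<Longrightarrow> F v = F w"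
  unfolding multilinear_on_def by blast

text \<open>Expanding the slots of a subset only, with the other entries of \<open>v\<close> left
  free, gives an induction hypothesis that applies to \<open>v(a := e b)\<close>.\<close>

lemma multilinear_on_expand_partial:
  assumes F: "multilinear_on A F" and fin: "finite A'" "finite B" and sub: "A' \<subseteq> A"
    and v: "\<And>i. i \<in> A' \<Longrightarrow> v i = (\<Sum>b\<in>B. c i b *\<^sub>C e b)"
  shows "F v = (\<Sum>w\<in>PiE A' (\<lambda>_. B). (\<Prod>i\<in>A'. c i (w i)) *\<^sub>C
    F (\<lambda>i. if i \<in> A' then e (w i) else v i))"
  using fin(1) sub v
proof (induction A' arbitrary: v)
  case empty
  then show ?case by (simp add: scaleC_one)
next
  case (insert a A')
  have lin: "clinear (\<lambda>x. F (v(a := x)))"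
    using F insert.prems by (auto intro: multilinear_on_clinear)
  \<comment> \<open>A word on \<open>insert a A'\<close> is a letter at \<open>a\<close> together
    with a word on \<open>A'\<close>; the latter is recovered because it is \<open>undefined\<close>
    at \<open>a\<close>.\<close>
  have inj: "inj_on (\<lambda>(b, w). w(a := b)) (B \<times> PiE A' (\<lambda>_. B))"
  proof (rule inj_onI, clarsimp)
    fix b b' and w w' assume w: "w \<in> PiE A' (\<lambda>_. B)" "w' \<in> PiE A' (\<lambda>_. B)" and eq: "w(a := b) = w'(a := b')"
    have "w x = w' x" for x
      using fun_cong[OF eq, of x] PiE_arb[OF w(1) insert.hyps(2)] PiE_arb[OF w(2) insert.hyps(2)]
      by (cases "x = a") auto
    moreover have "b = b'" using fun_cong[OF eq, of a] by simp
    ultimately show "b = b' \<and> w = w'" by auto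
  qed
  have "F v = F (v(a := (\<Sum>b\<in>B. c a b *\<^sub>C e b)))"
    using insert.prems(2)[of a] by (metis fun_upd_triv insertI1)
  also have "\<dots> = (\<Sum>b\<in>B. c a b *\<^sub>C F (v(a := e b)))"
    by (simp add: clinear_sum[OF lin] clinear_scale[OF lin])
  also have "\<dots> = (\<Sum>b\<in>B. c a b *\<^sub>C (\<Sum>w\<in>PiE A' (\<lambda>_. B). (\<Prod>i\<in>A'. c i (w i)) *\<^sub>C
      F (\<lambda>i. if i \<in> A' then e (w i) else (v(a := e b)) i)))"
    by (intro sum.cong refl arg_cong2[where f = scaleC] insert.IH)
      (use insert.prems insert.hyps in auto)
  also have "\<dots> = (\<Sum>(b, w)\<in>B \<times> PiE A' (\<lambda>_. B). (c a b * (\<Prod>i\<in>A'. c i (w i))) *\<^sub>C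
      F (\<lambda>i. if i \<in> A' then e (w i) else (v(a := e b)) i))"
    by (simp add: sum.cartesian_product complex_vector.scale_sum_right scaleC_scaleC)
  also have "\<dots> = (\<Sum>(b, w)\<in>B \<times> PiE A' (\<lambda>_. B). (\<Prod>i\<in>insert a A'. c i ((w(a := b)) i)) *\<^sub>C
      F (\<lambda>i. if i \<in> insert a A' then e ((w(a := b)) i) else v i))"
  proof (rule sum.cong[OF refl], clarify)
    fix b w assume "b \<in> B" "w \<in> PiE A' (\<lambda>_. B)"
    have "(\<Prod>i\<in>A'. c i (w i)) = (\<Prod>i\<in>A'. c i ((w(a := b)) i))"
      by (rule prod.cong) (use insert.hyps in auto)
    moreover have "(\<lambda>i. if i \<in> A' then e (w i) else (v(a := e b)) i)
       = (\<lambda>i. if i \<in> insert a A' then e ((w(a := b)) i) else v i)"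
      using insert.hyps by (auto simp: fun_eq_iff)
    ultimately show "(c a b * (\<Prod>i\<in>A'. c i (w i))) *\<^sub>C
      F (\<lambda>i. if i \<in> A' then e (w i) else (v(a := e b)) i) = (\<Prod>i\<in>insert a A'. c i ((w(a := b)) i)) *\<^sub>C
      F (\<lambda>i. if i \<in> insert a A' then e ((w(a := b)) i) else v i)"
      using insert.hyps by simp
  qed
  also have "\<dots> = (\<Sum>w\<in>PiE (insert a A') (\<lambda>_. B). (\<Prod>i\<in>insert a A'. c i (w i)) *\<^sub>C
      F (\<lambda>i. if i \<in> insert a A' then e (w i) else v i))"
    unfolding PiE_insert_eq by (subst sum.reindex[OF inj]) (simp add: o_def case_prod_unfold)
  finally show ?case .
qed

lemma multilinear_on_expand:
  assumes F: "multilinear_on A F" and fin: "finite A" "finite B"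
    and v: "\<And>i. i \<in> A \<Longrightarrow> v i = (\<Sum>b\<in>B. c i b *\<^sub>C e b)"
  shows "F v = (\<Sum>w\<in>PiE A (\<lambda>_. B). (\<Prod>i\<in>A. c i (w i)) *\<^sub>C F (e \<circ> w))"
proof -
  have "F (\<lambda>i. if i \<in> A then e (w i) else v i) = F (e \<circ> w)" for w
    by (rule multilinear_on_cong[OF F]) simp
  then show ?thesis
    using multilinear_on_expand_partial[OF F fin(1) fin(2) subset_refl, of v c e] v by simp
qed

lemma multilinear_onI:
  assumes "\<And>v i x y. i \<in> A \<Longrightarrow> F (v(i := x + y)) = F (v(i := x)) + F (v(i := y))"
    and "\<And>v i c x. i \<in> A \<Longrightarrow> F (v(i := c *\<^sub>C x)) = c *\<^sub>C F (v(i := x))"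
    and "\<And>v w. (\<And>i. i \<in> A \<Longrightarrow> v i = w i) \<Longrightarrow> F v = F w"
  shows "multilinear_on A F"
  unfolding multilinear_on_def by (intro conjI allI ballI impI clinearI; rule assms; blast)

lemma multilinear_on_upd:
  assumes "multilinear_on A F" "i \<in> A"
  shows "F (v(i := x + y)) = F (v(i := x)) + F (v(i := y))"
    and "F (v(i := c *\<^sub>C x)) = c *\<^sub>C F (v(i := x))"
    and "F (v(i := 0)) = 0"
    and "F (v(i := x - y)) = F (v(i := x)) - F (v(i := y))"
    and "F (v(i := - x)) = - F (v(i := x))"
    and "F (v(i := sum h K)) = (\<Sum>k\<in>K. F (v(i := h k)))"
  using multilinear_on_clinear[OF assms, of v]
  by (rule clinear_add clinear_scale clinear_0 clinear_diff clinear_neg clinear_sum)+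

lemma csubspace_multilinear_on: "csubspace {F. multilinear_on A F}"
proof (rule complex_vector.subspaceI)
  show "0 \<in> {F. multilinear_on A F}"
    by (auto intro!: multilinear_onI)
  show "F + H \<in> {F. multilinear_on A F}" if "F \<in> {F. multilinear_on A F}" "H \<in> {F. multilinear_on A F}" for F H
  proof -
    have m: "multilinear_on A F" "multilinear_on A H" using that by auto
    have "multilinear_on A (F + H)"
    proof (rule multilinear_onI)
      show "(F + H) v = (F + H) w" if "\<And>i. i \<in> A \<Longrightarrow> v i = w i" for v w
        using multilinear_on_cong[OF m(1), of v w] multilinear_on_cong[OF m(2), of v w] that by simp
    qed (simp_all add: multilinear_on_upd[OF m(1)] multilinear_on_upd[OF m(2)] scaleC_add_right)
    then show ?thesis by simp
  qed
  show "c *\<^sub>C F \<in> {F. multilinear_on A F}" if "F \<in> {F. multilinear_on A F}" for c F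
  proof -
    have m: "multilinear_on A F" using that by auto
    have "multilinear_on A (c *\<^sub>C F)"
    proof (rule multilinear_onI)
      show "(c *\<^sub>C F) v = (c *\<^sub>C F) w" if "\<And>i. i \<in> A \<Longrightarrow> v i = w i" for v w
        using multilinear_on_cong[OF m, of v w] that by (simp add: scaleC_fun_def)
    qed (simp_all add: multilinear_on_upd[OF m] scaleC_fun_def scaleC_add_right scaleC_scaleC mult.commute)
    then show ?thesis by simp
  qed
qed

text \<open>Product rule over the slots: linearity in slot \<open>k\<close> gives a combination of
  scalar functions with coefficients 1, \<open>a\<close> and \<open>c\<close>, and only the
  \<open>a\<close> term contributes something new at 0. The space carries no topology, so the curve
  x + a(t) X x + c(t) Y x is differentiated only inside \<open>F\<close>. The \<open>c\<close> term
  is there for the part cos t - 1 of a rotation.\<close>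

lemma has_derivative_multilinear:
  fixes F :: "('i \<Rightarrow> 'a::complex_vector) \<Rightarrow> complex"
  assumes F: "multilinear_on A F" and fin: "finite A'" "A' \<subseteq> A"
    and a: "a 0 = 0" "(a has_field_derivative 1) (at 0)"
    and c: "c 0 = 0" "(c has_field_derivative 0) (at 0)"
  shows "((\<lambda>t. F (\<lambda>i. if i \<in> A' then v i + a t *\<^sub>C X (v i) + c t *\<^sub>C Y (v i) else v i))
    has_field_derivative (\<Sum>i\<in>A'. F (v(i := X (v i))))) (at 0)"
  using fin
proof (induction A' arbitrary: v)
  case empty
  then show ?case by simp
next
  case (insert k A')
  define \<Phi> where "\<Phi> v t = F (\<lambda>i. if i \<in> A' then v i + a t *\<^sub>C X (v i) + c t *\<^sub>C Y (v i) else v i)" for v t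
  have IH: "(\<Phi> v has_field_derivative (\<Sum>i\<in>A'. F (v(i := X (v i))))) (at 0)" for v
    unfolding \<Phi>_def by (rule insert.IH) (use insert.prems in simp)
  have eq: "F (\<lambda>i. if i \<in> insert k A' then v i + a t *\<^sub>C X (v i) + c t *\<^sub>C Y (v i) else v i)
     = \<Phi> v t + a t * \<Phi> (v(k := X (v k))) t + c t * \<Phi> (v(k := Y (v k))) t" for t
  proof -
    let ?u = "\<lambda>i. if i \<in> A' then v i + a t *\<^sub>C X (v i) + c t *\<^sub>C Y (v i) else v i"
    have lin: "clinear (\<lambda>x. F (?u(k := x)))"
      using F insert.prems by (auto intro: multilinear_on_clinear)
    have "\<Phi> (v(k := x)) t = F (?u(k := x))" for x
      unfolding \<Phi>_def by (rule arg_cong[where f = F]) (use insert.hyps in \<open>auto simp: fun_eq_iff\<close>)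
    note P = this this[of "v k"]
    have "(\<lambda>i. if i \<in> insert k A' then v i + a t *\<^sub>C X (v i) + c t *\<^sub>C Y (v i) else v i)
       = ?u(k := v k + a t *\<^sub>C X (v k) + c t *\<^sub>C Y (v k))"
      by (auto simp: fun_eq_iff)
    then show ?thesis using P
      by (simp only: clinear_add[OF lin] clinear_scale[OF lin] fun_upd_triv scaleC_complex_def)
  qed
  have "((\<lambda>t. \<Phi> v t + a t * \<Phi> (v(k := X (v k))) t + c t * \<Phi> (v(k := Y (v k))) t) has_field_derivative
     (\<Sum>i\<in>A'. F (v(i := X (v i)))) + F (v(k := X (v k)))) (at 0)"
  proof -
    have "\<Phi> (v(k := X (v k))) 0 = F (v(k := X (v k)))"
      unfolding \<Phi>_def by (rule arg_cong[where f = F]) (auto simp: fun_eq_iff a c)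
    then show ?thesis
      by (auto intro!: derivative_eq_intros IH a c simp: a c)
  qed
  then show ?case using insert.hyps unfolding eq by (simp add: add.commute fun_upd_def)
qed

locale bilinear_space =
  fixes \<omega> :: "'v::complex_vector \<Rightarrow> 'v \<Rightarrow> complex" and f fd :: "nat \<Rightarrow> 'v" and n :: nat
    and \<epsilon> :: complex
  assumes basis: "is_basis n f" and nondeg: "nondegenerate_bilinear \<omega>"
    and dual: "is_dual_basis \<omega> n f fd"
    and sym: "\<omega> v u = \<epsilon> * \<omega> u v" and eps: "\<epsilon> = 1 \<or> \<epsilon> = - 1"
begin

lemma clinear_omega: "clinear (\<omega> u)" "clinear (\<lambda>u. \<omega> u v)"
  using nondeg by (auto simp: nondegenerate_bilinear_def)

lemma omega_simps:
  "\<omega> (x + y) z = \<omega> x z + \<omega> y z" "\<omega> z (x + y) = \<omega> z x + \<omega> z y"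
  "\<omega> (c *\<^sub>C x) z = c * \<omega> x z" "\<omega> z (c *\<^sub>C x) = c * \<omega> z x"
  "\<omega> (x - y) z = \<omega> x z - \<omega> y z" "\<omega> z (x - y) = \<omega> z x - \<omega> z y"
  "\<omega> (- x) z = - \<omega> x z" "\<omega> z (- x) = - \<omega> z x"
  "\<omega> 0 z = 0" "\<omega> z 0 = 0"
  "\<omega> (sum h K) z = (\<Sum>k\<in>K. \<omega> (h k) z)" "\<omega> z (sum h K) = (\<Sum>k\<in>K. \<omega> z (h k))"
  using clinear_add[OF clinear_omega(1)] clinear_add[OF clinear_omega(2)]
    clinear_scale[OF clinear_omega(1)] clinear_scale[OF clinear_omega(2)]
    clinear_diff[OF clinear_omega(1)] clinear_diff[OF clinear_omega(2)]
    clinear_neg[OF clinear_omega(1)] clinear_neg[OF clinear_omega(2)]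
    clinear_0[OF clinear_omega(1)] clinear_0[OF clinear_omega(2)]
    clinear_sum[OF clinear_omega(1)] clinear_sum[OF clinear_omega(2)]
  by (simp_all add: scaleC_complex_def)

lemma omega_dual: "p \<in> {1..n} \<Longrightarrow> q \<in> {1..n} \<Longrightarrow> \<omega> (f p) (fd q) = (if p = q then 1 else 0)"
  using dual by (simp add: is_dual_basis_def)

lemma expand_basis: "x = (\<Sum>p=1..n. \<omega> x (fd p) *\<^sub>C f p)"
proof -
  have "x \<in> cspan (f ` {1..n})" using basis by (simp add: is_basis_def)
  then show ?thesis
  proof (induction rule: complex_vector.span_induct_alt)
    case base
    then show ?case by (simp add: omega_simps)
  next
    case (step c x y)
    then obtain q where q: "q \<in> {1..n}" "x = f q" by auto
    have "(\<Sum>p=1..n. \<omega> (f q) (fd p) *\<^sub>C f p) = (\<Sum>p=1..n. if p = q then f p else 0)"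
      by (rule sum.cong[OF refl]) (use q(1) in \<open>simp add: omega_dual scaleC_one\<close>)
    then have "(\<Sum>p=1..n. \<omega> (f q) (fd p) *\<^sub>C f p) = f q" using q(1) by simp
    then show ?case
      using step.IH q
      by (simp add: omega_simps scaleC_add_left sum.distrib flip: scaleC_scaleC complex_vector.scale_sum_right)
  qed
qed

text \<open>That the dual family spans follows from nondegeneracy: the remainder pairs to zero with
  every \<open>f q\<close>, hence with everything.\<close>

lemma expand_dual: "x = (\<Sum>p=1..n. \<omega> (f p) x *\<^sub>C fd p)"
proof -
  let ?z = "x - (\<Sum>p=1..n. \<omega> (f p) x *\<^sub>C fd p)"
  have 1: "\<omega> (f q) ?z = 0" if q: "q \<in> {1..n}" for q
  proof -
    have "(\<Sum>p=1..n. \<omega> (f p) x * \<omega> (f q) (fd p)) = (\<Sum>p=1..n. if p = q then \<omega> (f p) x else 0)"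
      by (rule sum.cong[OF refl]) (use q in \<open>auto simp: omega_dual\<close>)
    then show ?thesis using q by (simp add: omega_simps)
  qed
  have "\<omega> y ?z = 0" for y
  proof -
    have "\<omega> y ?z = \<omega> (\<Sum>p=1..n. \<omega> y (fd p) *\<^sub>C f p) ?z" by (subst expand_basis[of y]) simp
    also have "\<dots> = 0" unfolding omega_simps(11) omega_simps(3) by (rule sum.neutral) (use 1 in auto)
    finally show ?thesis .
  qed
  then have "?z = 0" using nondeg unfolding nondegenerate_bilinear_def by blast
  then show ?thesis by simp
qed

lemma omega_expand:
  "(\<Sum>p=1..n. \<omega> x (fd p) * \<omega> (f p) y) = \<omega> x y"
  "(\<Sum>p=1..n. \<omega> (f p) x * \<omega> (fd p) y) = \<omega> x y"
proof -
  have "\<omega> (\<Sum>p=1..n. \<omega> x (fd p) *\<^sub>C f p) y = \<omega> x y"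
    "\<omega> (\<Sum>p=1..n. \<omega> (f p) x *\<^sub>C fd p) y = \<omega> x y"
    by (simp_all only: expand_basis[symmetric] expand_dual[symmetric])
  then show "(\<Sum>p=1..n. \<omega> x (fd p) * \<omega> (f p) y) = \<omega> x y"
    "(\<Sum>p=1..n. \<omega> (f p) x * \<omega> (fd p) y) = \<omega> x y"
    by (simp_all only: omega_simps)
qed

lemma nondegD: "(\<And>y. \<omega> x y = 0) \<Longrightarrow> x = 0" "(\<And>x. \<omega> x y = 0) \<Longrightarrow> y = 0"
  using nondeg unfolding nondegenerate_bilinear_def by blast+

lemma isometryI:
  assumes "clinear g" "\<And>x. g (h x) = x" "\<And>x. h (g x) = x" "\<And>u v. \<omega> (g u) (g v) = \<omega> u v"
  shows "g \<in> isometry_group \<omega>"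
proof -
  have "bij g" by (rule o_bij[of h]) (use assms in \<open>auto simp: fun_eq_iff\<close>)
  then show ?thesis using assms by (simp add: isometry_group_def GL_def)
qed

lemma isometryD:
  assumes "g \<in> isometry_group \<omega>"
  shows "clinear g" "bij g" "\<omega> (g u) (g v) = \<omega> u v" "g (Hilbert_Choice.inv g x) = x" "Hilbert_Choice.inv g (g x) = x"
proof -
  show "clinear g" "bij g" "\<omega> (g u) (g v) = \<omega> u v"
    using assms by (auto simp: isometry_group_def GL_def)
  then show "g (Hilbert_Choice.inv g x) = x" "Hilbert_Choice.inv g (g x) = x"
    by (auto simp: bij_is_surj surj_f_inv_f bij_is_inj inv_f_f)
qed

lemma isometry_inv:
  assumes g: "g \<in> isometry_group \<omega>"
  shows "Hilbert_Choice.inv g \<in> isometry_group \<omega>"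
proof (rule isometryI[where h = g])
  note D = isometryD[OF g]
  show "g (Hilbert_Choice.inv g x) = x" "Hilbert_Choice.inv g (g x) = x" for x by (rule D)+
  show "clinear (Hilbert_Choice.inv g)" by (rule clinear_inv[OF D(1,2)])
  show "\<omega> (Hilbert_Choice.inv g u) (Hilbert_Choice.inv g v) = \<omega> u v" for u v
    using D(3)[of "Hilbert_Choice.inv g u" "Hilbert_Choice.inv g v"] by (simp add: D)
qed

section \<open>Explicit isometries and orthonormal bases\<close>

lemma transvection:
  assumes "\<epsilon> = - 1"
  shows "(\<lambda>x. x + (t * \<omega> x u) *\<^sub>C u) \<in> isometry_group \<omega>"
proof (rule isometryI[where h = "\<lambda>x. x + (- t * \<omega> x u) *\<^sub>C u"])
  have uu: "\<omega> u u = 0" using sym[of u u] assms by simp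
  have anti: "\<omega> u v = - \<omega> v u" for u v using sym[of u v] assms by simp
  show "clinear (\<lambda>x. x + (t * \<omega> x u) *\<^sub>C u)"
    by (rule clinearI) (simp_all add: omega_simps algebra_simps scaleC_add_left scaleC_add_right scaleC_scaleC)
  show "(x + (- t * \<omega> x u) *\<^sub>C u) + (t * \<omega> (x + (- t * \<omega> x u) *\<^sub>C u) u) *\<^sub>C u = x" for x
    by (simp add: omega_simps uu)
  show "(x + (t * \<omega> x u) *\<^sub>C u) + (- t * \<omega> (x + (t * \<omega> x u) *\<^sub>C u) u) *\<^sub>C u = x" for x
    by (simp add: omega_simps uu)
  show "\<omega> (x + (t * \<omega> x u) *\<^sub>C u) (y + (t * \<omega> y u) *\<^sub>C u) = \<omega> x y" for x y
    using anti[of u y] by (simp add: omega_simps uu)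
qed

text \<open>For an orthonormal pair this is u -> cos t u + sin t v, v -> cos t v - sin t u, and the
  identity on the orthogonal complement. It is written as identity plus a sine part plus a (cos t -
  1) part to fit \<open>has_derivative_multilinear\<close>.\<close>

definition rotation :: "complex \<Rightarrow> 'v \<Rightarrow> 'v \<Rightarrow> 'v \<Rightarrow> 'v"
  where "rotation t u v x = x + sin t *\<^sub>C (\<omega> x u *\<^sub>C v - \<omega> x v *\<^sub>C u)
    + (cos t - 1) *\<^sub>C (\<omega> x u *\<^sub>C u + \<omega> x v *\<^sub>C v)"

lemma rotation:
  assumes e: "\<epsilon> = 1" and uv: "\<omega> u u = 1" "\<omega> v v = 1" "\<omega> u v = 0"
  shows "rotation t u v \<in> isometry_group \<omega>"
proof -
  have sy: "\<omega> x y = \<omega> y x" for x y using sym[of x y] e by simp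
  have vu: "\<omega> v u = 0" using sy[of v u] uv by simp
  have cs: "cos t * cos t + sin t * sin t = 1" for t :: complex
    using sin_cos_squared_add[of t] by (simp add: power2_eq_square add.commute)
  have lin: "clinear (rotation t u v)" for t
    by (rule clinearI) (simp_all add: rotation_def omega_simps algebra_simps scaleC_add_left scaleC_add_right scaleC_scaleC
        complex_vector.scale_right_diff_distrib complex_vector.scale_left_diff_distrib)
  have iso: "\<omega> (rotation t u v x) (rotation t u v y) = \<omega> x y" for x y t
  proof -
    \<comment> \<open>Computed for free scalars: the defect is a multiple of c * c + s * s - 1,
      which vanishes for sine and cosine.\<close>
    have *: "\<omega> (x + s *\<^sub>C (a *\<^sub>C v - b *\<^sub>C u) + (c - 1) *\<^sub>C (a *\<^sub>C u + b *\<^sub>C v))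
       (y + s *\<^sub>C (a' *\<^sub>C v - b' *\<^sub>C u) + (c - 1) *\<^sub>C (a' *\<^sub>C u + b' *\<^sub>C v))
       = \<omega> x y + (c * c + s * s - 1) * (a * a' + b * b')"
      if "\<omega> x u = a" "\<omega> x v = b" "\<omega> y u = a'" "\<omega> y v = b'" for a b a' b' c s
      using that sy[of u y] sy[of v y] by (simp add: omega_simps uv vu algebra_simps)
    show ?thesis unfolding rotation_def by (subst *) (simp_all add: cs)
  qed
  have inv: "rotation t u v (rotation s u v x) = x" if "s = - t" for s t x
  proof -
    have 1: "\<omega> (rotation s u v x) u = cos s * \<omega> x u - sin s * \<omega> x v"
      "\<omega> (rotation s u v x) v = sin s * \<omega> x u + cos s * \<omega> x v"
      by (simp_all add: rotation_def omega_simps uv vu algebra_simps)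
    define a b where "a = \<omega> x u" and "b = \<omega> x v"
    define z where "z = rotation s u v x"
    define C S where "C = cos t" and "S = sin t"
    have za: "\<omega> z u = C * a + S * b" "\<omega> z v = C * b - S * a"
      using 1 by (simp_all add: z_def a_def b_def C_def S_def that)
    have "rotation t u v z = z + (S * \<omega> z u + (C - 1) * \<omega> z v) *\<^sub>C v + ((C - 1) * \<omega> z u - S * \<omega> z v) *\<^sub>C u"
      by (simp add: rotation_def C_def S_def scaleC_add_left scaleC_add_right scaleC_scaleC algebra_simps
        complex_vector.scale_right_diff_distrib complex_vector.scale_left_diff_distrib)
    moreover have "z = x + (- S * a + (C - 1) * b) *\<^sub>C v + ((C - 1) * a + S * b) *\<^sub>C u"
      by (simp add: z_def a_def b_def rotation_def C_def S_def that scaleC_add_left scaleC_add_right scaleC_scaleC algebra_simps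
        complex_vector.scale_right_diff_distrib complex_vector.scale_left_diff_distrib)
    ultimately have "rotation t u v z = x + ((- S * a + (C - 1) * b) + (S * \<omega> z u + (C - 1) * \<omega> z v)) *\<^sub>C v
       + (((C - 1) * a + S * b) + ((C - 1) * \<omega> z u - S * \<omega> z v)) *\<^sub>C u"
      by (simp only: scaleC_add_left add_ac)
    moreover have "(- S * a + (C - 1) * b) + (S * \<omega> z u + (C - 1) * \<omega> z v) = (C * C + S * S - 1) * b"
      "((C - 1) * a + S * b) + ((C - 1) * \<omega> z u - S * \<omega> z v) = (C * C + S * S - 1) * a"
      unfolding za by (simp_all add: algebra_simps)
    ultimately show ?thesis using cs[of t] by (simp add: z_def C_def S_def)
  qed
  show ?thesis
    by (rule isometryI[where h = "rotation (- t) u v"]) (simp_all add: lin iso inv)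
qed

lemma reflection:
  assumes e: "\<epsilon> = 1" and u: "\<omega> u u = 1"
  shows "(\<lambda>x. x - (2 * \<omega> x u) *\<^sub>C u) \<in> isometry_group \<omega>"
proof (rule isometryI[where h = "\<lambda>x. x - (2 * \<omega> x u) *\<^sub>C u"])
  have sy: "\<omega> x y = \<omega> y x" for x y using sym[of x y] e by simp
  show "clinear (\<lambda>x. x - (2 * \<omega> x u) *\<^sub>C u)"
    by (rule clinearI) (simp_all add: omega_simps algebra_simps scaleC_add_left scaleC_scaleC
        complex_vector.scale_right_diff_distrib)
  show *: "x - (2 * \<omega> x u) *\<^sub>C u - (2 * \<omega> (x - (2 * \<omega> x u) *\<^sub>C u) u) *\<^sub>C u = x" for x
    by (simp add: omega_simps u)
  then show "x - (2 * \<omega> x u) *\<^sub>C u - (2 * \<omega> (x - (2 * \<omega> x u) *\<^sub>C u) u) *\<^sub>C u = x" for x .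
  show "\<omega> (x - (2 * \<omega> x u) *\<^sub>C u) (y - (2 * \<omega> y u) *\<^sub>C u) = \<omega> x y" for x y
    using sy[of u y] by (simp add: omega_simps u)
qed

text \<open>Take an orthonormal family of maximal size. Every vector orthogonal to it is isotropic,
  since otherwise division by a complex square root of \<omega> z z would extend the family. By
  polarization the form vanishes on the orthogonal complement, which is then zero by
  nondegeneracy.\<close>

lemma orthonormal_basis:
  assumes e: "\<epsilon> = 1"
  obtains b where "is_basis n b" "is_dual_basis \<omega> n b b"
proof -
  have sy: "\<omega> x y = \<omega> y x" for x y using sym[of x y] e by simp
  have inj_f: "inj_on f {1..n}" and ind_f: "\<not> cdependent (f ` {1..n})"
    and span_f: "cspan (f ` {1..n}) = UNIV" using basis by (auto simp: is_basis_def)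
  define P where "P B \<longleftrightarrow> finite B \<and> (\<forall>x\<in>B. \<forall>y\<in>B. \<omega> x y = (if x = y then 1 else 0))" for B
  have coeff: "\<omega> (\<Sum>b\<in>B. c b *\<^sub>C b) d = c d" if "P B" "d \<in> B" for B c d
  proof -
    have "\<omega> (\<Sum>b\<in>B. c b *\<^sub>C b) d = (\<Sum>b\<in>B. if b = d then c b else 0)"
      unfolding omega_simps by (rule sum.cong) (use that in \<open>auto simp: P_def\<close>)
    then show ?thesis using that by (simp add: P_def)
  qed
  have ind: "\<not> cdependent B" if "P B" for B
  proof
    assume "cdependent B"
    moreover have "finite B" using that by (simp add: P_def)
    ultimately have "\<exists>c. (\<exists>d\<in>B. c d \<noteq> 0) \<and> (\<Sum>b\<in>B. c b *\<^sub>C b) = 0"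
      by (simp only: complex_vector.dependent_finite)
    then obtain c d where c: "(\<Sum>b\<in>B. c b *\<^sub>C b) = 0" and d: "d \<in> B" "c d \<noteq> 0" by blast
    show False using coeff[OF that d(1), of c] d(2) unfolding c by (simp add: omega_simps)
  qed
  have bound: "card B \<le> n" if "P B" for B
  proof -
    have "finite B \<and> card B \<le> card (f ` {1..n})"
      by (rule complex_vector.independent_span_bound[OF _ ind[OF that]]) (simp_all add: span_f del: One_nat_def)
    then show ?thesis using card_image[OF inj_f] by simp
  qed
  have "\<exists>B. P B \<and> (\<forall>B'. P B' \<longrightarrow> card B' \<le> card B)"
  proof (rule ex_has_greatest_nat)
    show "P {}" by (simp add: P_def)
    show "\<forall>B. P B \<longrightarrow> card B < Suc n" using bound by (simp add: le_imp_less_Suc)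
  qed
  then obtain B where B: "P B" and max: "\<And>B'. P B' \<Longrightarrow> card B' \<le> card B" by blast
  have fB: "finite B" using B by (simp add: P_def)
  define pr where "pr x = x - (\<Sum>b\<in>B. \<omega> x b *\<^sub>C b)" for x
  have pr: "\<omega> (pr x) d = 0" if "d \<in> B" for x d
    using coeff[OF B that] by (simp add: pr_def omega_simps(5))
  have noiso: "\<omega> z z = 0" if z: "\<forall>d\<in>B. \<omega> z d = 0" for z
  proof (rule ccontr)
    assume nz: "\<omega> z z \<noteq> 0"
    obtain s where s: "\<omega> z z = s * s"
      using power2_csqrt[of "\<omega> z z"] by (metis power2_eq_square)
    then have s0: "s \<noteq> 0" using nz by auto
    define y where "y = inverse s *\<^sub>C z"
    have yy: "\<omega> y y = 1" unfolding y_def omega_simps s using s0 by (simp add: field_simps)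
    have yd: "\<omega> y d = 0" "\<omega> d y = 0" if "d \<in> B" for d
      using z that sy[of d y] by (auto simp: y_def omega_simps)
    have "y \<notin> B" using yd[of y] yy by auto
    moreover have "P (insert y B)"
      unfolding P_def
    proof (intro conjI ballI)
      show "finite (insert y B)" using fB by simp
      show "\<omega> x x' = (if x = x' then 1 else 0)" if "x \<in> insert y B" "x' \<in> insert y B" for x x'
        using that B \<open>y \<notin> B\<close> yy yd by (cases "x = y"; cases "x' = y") (simp_all add: P_def)
    qed
    ultimately show False using max[of "insert y B"] fB by simp
  qed
  have "x \<in> cspan B" for x
  proof -
    have "pr x = 0"
    proof (rule nondegD(1))
      fix y
      have o: "\<forall>d\<in>B. \<omega> (pr x + pr y) d = 0" using pr by (simp add: omega_simps)
      have "\<omega> (pr x) (pr y) = 0"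
        using noiso[OF o] noiso[of "pr x"] noiso[of "pr y"] pr sy[of "pr y" "pr x"]
        by (simp add: omega_simps)
      then show "\<omega> (pr x) y = 0"
        using pr by (simp add: pr_def[of y] omega_simps)
    qed
    then have "x = (\<Sum>b\<in>B. \<omega> x b *\<^sub>C b)" by (simp add: pr_def)
    also have "\<dots> \<in> cspan B"
      by (intro complex_vector.span_sum complex_vector.span_scale complex_vector.span_base)
    finally show ?thesis .
  qed
  then have spanB: "cspan B = UNIV" by auto
  have "card B = n"
  proof -
    have "finite (f ` {1..n}) \<and> card (f ` {1..n}) \<le> card B"
      by (rule complex_vector.independent_span_bound[OF fB ind_f]) (simp add: spanB)
    then show ?thesis using bound[OF B] card_image[OF inj_f] by simp
  qed
  then obtain b where b: "bij_betw b {1..n} B"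
    using finite_same_card_bij[of "{1..n}" B] fB by auto
  have "is_basis n b" using b ind[OF B] spanB by (auto simp: is_basis_def bij_betw_def)
  moreover have "is_dual_basis \<omega> n b b"
    unfolding is_dual_basis_def
  proof (intro ballI)
    fix p q assume pq: "p \<in> {1..n}" "q \<in> {1..n}"
    have "b p \<in> B" "b q \<in> B" using bij_betw_apply[OF b] pq by blast+
    moreover have "b p = b q \<longleftrightarrow> p = q" using bij_betw_imp_inj_on[OF b] pq by (simp add: inj_on_eq_iff)
    ultimately show "\<omega> (b p) (b q) = (if p = q then 1 else 0)" using B by (simp add: P_def)
  qed
  ultimately show ?thesis by (rule that)
qed


section \<open>Invariant forms, infinitesimal invariance and contractions\<close>

definition invariant :: "(('i \<Rightarrow> 'v) \<Rightarrow> 'c) \<Rightarrow> bool"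
  where "invariant F \<longleftrightarrow> (\<forall>g\<in>isometry_group \<omega>. \<forall>v. F (g \<circ> v) = F v)"

lemma one_parameter_invariance:
  fixes F :: "('i \<Rightarrow> 'v) \<Rightarrow> complex"
  assumes F: "multilinear_on A F" "finite A" "invariant F"
    and a: "a 0 = 0" "(a has_field_derivative 1) (at 0)"
    and c: "c 0 = 0" "(c has_field_derivative 0) (at 0)"
    and g: "\<And>t. (\<lambda>x. x + a t *\<^sub>C X x + c t *\<^sub>C Y x) \<in> isometry_group \<omega>"
  shows "(\<Sum>i\<in>A. F (v(i := X (v i)))) = 0"
proof -
  have "F (\<lambda>i. if i \<in> A then v i + a t *\<^sub>C X (v i) + c t *\<^sub>C Y (v i) else v i) = F v" for t
  proof -
    have "F (\<lambda>i. if i \<in> A then v i + a t *\<^sub>C X (v i) + c t *\<^sub>C Y (v i) else v i)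
       = F ((\<lambda>x. x + a t *\<^sub>C X x + c t *\<^sub>C Y x) \<circ> v)"
      by (rule multilinear_on_cong[OF F(1)]) simp
    also have "\<dots> = F v" using F(3) g[of t] unfolding invariant_def by blast
    finally show ?thesis .
  qed
  then have "((\<lambda>t. F v) has_field_derivative (\<Sum>i\<in>A. F (v(i := X (v i))))) (at 0)"
    using has_derivative_multilinear[OF F(1,2) subset_refl a c, of v X Y] by simp
  then show ?thesis using DERIV_unique[OF _ DERIV_const] by blast
qed

text \<open>For \<epsilon> = -1 the operator is the polarization of y -> \<omega>(y, u) u, the
  velocity of a transvection. For \<epsilon> = 1 the sum is bilinear in (u, x), so it suffices to
  insert vectors of an orthonormal basis: two distinct ones give the velocity of a rotation, two
  equal ones give 0.\<close>

lemma lie_invariance: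
  fixes F :: "('i \<Rightarrow> 'v) \<Rightarrow> complex"
  assumes F: "multilinear_on A F" "finite A" "invariant F"
  shows "(\<Sum>i\<in>A. F (v(i := \<omega> (v i) u *\<^sub>C x - (\<epsilon> * \<omega> (v i) x) *\<^sub>C u))) = 0"
  using eps
proof
  assume e: "\<epsilon> = - 1"
  have Q: "(\<Sum>i\<in>A. F (v(i := \<omega> (v i) u *\<^sub>C u))) = 0" for u
  proof (rule one_parameter_invariance[OF F, where a = "\<lambda>t. t" and c = "\<lambda>t. 0" and Y = "\<lambda>_. 0"])
    show "(\<lambda>x. x + t *\<^sub>C \<omega> x u *\<^sub>C u + 0 *\<^sub>C 0) \<in> isometry_group \<omega>" for t
      using transvection[OF e, of t u] by (simp add: scaleC_scaleC)
  qed auto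
  have "(\<Sum>i\<in>A. F (v(i := \<omega> (v i) u *\<^sub>C x - (\<epsilon> * \<omega> (v i) x) *\<^sub>C u)))
      = (\<Sum>i\<in>A. F (v(i := \<omega> (v i) (u + x) *\<^sub>C (u + x))) - F (v(i := \<omega> (v i) u *\<^sub>C u))
          - F (v(i := \<omega> (v i) x *\<^sub>C x)))"
    by (rule sum.cong[OF refl])
      (simp add: e omega_simps scaleC_add_left scaleC_add_right multilinear_on_upd[OF F(1)])
  also have "\<dots> = 0" by (simp add: sum_subtractf Q)
  finally show ?thesis .
next
  assume e: "\<epsilon> = 1"
  obtain b where b: "is_basis n b" "is_dual_basis \<omega> n b b" using orthonormal_basis[OF e] .
  interpret b: bilinear_space \<omega> b b n \<epsilon>
    by (rule bilinear_space.intro[OF b(1) nondeg b(2) sym eps])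
  define S where "S u x = (\<Sum>i\<in>A. F (v(i := \<omega> (v i) u *\<^sub>C x - (\<epsilon> * \<omega> (v i) x) *\<^sub>C u)))" for u x
  have lin1: "clinear (\<lambda>u. S u x)" for x
    by (rule clinearI) (simp_all add: S_def omega_simps scaleC_add_left scaleC_add_right multilinear_on_upd[OF F(1)]
      sum.distrib sum_subtractf scaleC_complex_def algebra_simps sum_distrib_left)
  have lin2: "clinear (S u)" for u
    by (rule clinearI) (simp_all add: S_def omega_simps scaleC_add_left scaleC_add_right multilinear_on_upd[OF F(1)]
      sum.distrib sum_subtractf scaleC_complex_def algebra_simps sum_distrib_left)
  have base: "S (b p) (b q) = 0" if pq: "p \<in> {1..n}" "q \<in> {1..n}" for p q
  proof (cases "p = q")
    case True
    then show ?thesis by (simp add: S_def e multilinear_on_upd[OF F(1)])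
  next
    case False
    have "(\<Sum>i\<in>A. F (v(i := \<omega> (v i) (b p) *\<^sub>C b q - \<omega> (v i) (b q) *\<^sub>C b p))) = 0"
    proof (rule one_parameter_invariance[OF F, where a = "\<lambda>t. sin t" and c = "\<lambda>t. cos t - 1"
        and Y = "\<lambda>x. \<omega> x (b p) *\<^sub>C b p + \<omega> x (b q) *\<^sub>C b q"])
      show "(\<lambda>x. x + sin t *\<^sub>C (\<omega> x (b p) *\<^sub>C b q - \<omega> x (b q) *\<^sub>C b p) +
          (cos t - 1) *\<^sub>C (\<omega> x (b p) *\<^sub>C b p + \<omega> x (b q) *\<^sub>C b q)) \<in> isometry_group \<omega>" for t
        using rotation[OF e, of "b p" "b q" t] b.omega_dual[OF pq] b.omega_dual[OF pq(1,1)]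
          b.omega_dual[OF pq(2,2)] False
        unfolding rotation_def[abs_def] by simp
    qed (auto intro!: derivative_eq_intros)
    then show ?thesis by (simp add: S_def e)
  qed
  have "S u x = S (\<Sum>p=1..n. \<omega> u (b p) *\<^sub>C b p) (\<Sum>p=1..n. \<omega> x (b p) *\<^sub>C b p)"
    using b.expand_basis by metis
  also have "\<dots> = 0"
    unfolding clinear_sum[OF lin1] clinear_sum[OF lin2] clinear_scale[OF lin1] clinear_scale[OF lin2]
    by (intro sum.neutral ballI) (simp add: base del: One_nat_def)
  finally show ?thesis by (simp add: S_def)
qed

definition contraction :: "'i \<Rightarrow> 'i \<Rightarrow> (('i \<Rightarrow> 'v) \<Rightarrow> complex) \<Rightarrow> ('i \<Rightarrow> 'v) \<Rightarrow> complex"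
  where "contraction i j F v = (\<Sum>p=1..n. F (v(i := f p, j := fd p)))"

text \<open>The Casimir element of the Lie algebra of \<open>G\<close> acts on the pair of slots \<open>k\<close>, \<open>i\<close> as a
  combination of their transposition and of their contraction.\<close>

lemma casimir_identity:
  fixes F :: "('i \<Rightarrow> 'v) \<Rightarrow> complex"
  assumes F: "multilinear_on A F" "finite A" "invariant F" and k: "k \<in> A"
  shows "(of_nat n - \<epsilon>) * F v + (\<Sum>i\<in>A - {k}. F (v \<circ> transpose k i))
    = (\<Sum>i\<in>A - {k}. \<epsilon> * \<omega> (v i) (v k) * contraction k i F v)"
proof -
  \<comment> \<open>Infinitesimal invariance is used at the tuple \<open>v(k := f p)\<close> with u
    = \<open>fd p\<close> and x = \<open>v k\<close>, and summed over p. The term i = k gives n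
    (from \<omega>(f p, fd p) = 1) minus \<epsilon> (from expanding \<open>v k\<close> in the dual
    basis); every other i gives a transposition minus a contraction.\<close>
  let ?X = "\<lambda>p y. \<omega> y (fd p) *\<^sub>C v k - (\<epsilon> * \<omega> y (v k)) *\<^sub>C fd p"
  have "0 = (\<Sum>p=1..n. \<Sum>i\<in>A. F ((v(k := f p))(i := ?X p ((v(k := f p)) i))))"
    by (simp only: lie_invariance[OF F] sum.neutral_const)
  also have "\<dots> = (\<Sum>i\<in>A. \<Sum>p=1..n. F ((v(k := f p))(i := ?X p ((v(k := f p)) i))))"
    by (rule sum.swap)
  also have "\<dots> = (\<Sum>p=1..n. F ((v(k := f p))(k := ?X p ((v(k := f p)) k))))
     + (\<Sum>i\<in>A - {k}. \<Sum>p=1..n. F ((v(k := f p))(i := ?X p ((v(k := f p)) i))))"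
    by (rule sum.remove[OF F(2) k])
  also have "(\<Sum>p=1..n. F ((v(k := f p))(k := ?X p ((v(k := f p)) k)))) = (of_nat n - \<epsilon>) * F v"
  proof -
    have "(\<Sum>p=1..n. F ((v(k := f p))(k := ?X p ((v(k := f p)) k))))
      = F (v(k := \<Sum>p=1..n. \<omega> (f p) (fd p) *\<^sub>C v k - \<epsilon> *\<^sub>C (\<omega> (f p) (v k) *\<^sub>C fd p)))"
      by (simp add: multilinear_on_upd(6)[OF F(1) k] scaleC_scaleC)
    also have "(\<Sum>p=1..n. \<omega> (f p) (fd p) *\<^sub>C v k - \<epsilon> *\<^sub>C (\<omega> (f p) (v k) *\<^sub>C fd p))
      = (\<Sum>p=1..n. \<omega> (f p) (fd p)) *\<^sub>C v k - \<epsilon> *\<^sub>C (\<Sum>p=1..n. \<omega> (f p) (v k) *\<^sub>C fd p)"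
      by (simp add: sum_subtractf complex_vector.scale_sum_left complex_vector.scale_sum_right)
    also have "(\<Sum>p=1..n. \<omega> (f p) (fd p)) = (\<Sum>p=1..n. 1)"
      by (rule sum.cong[OF refl]) (use omega_dual in auto)
    also have "(\<Sum>p=1..n. 1) = (of_nat n :: complex)" by simp
    also have "F (v(k := of_nat n *\<^sub>C v k - \<epsilon> *\<^sub>C (\<Sum>p=1..n. \<omega> (f p) (v k) *\<^sub>C fd p))) = (of_nat n - \<epsilon>) * F v"
      by (simp only: expand_dual[symmetric] multilinear_on_upd[OF F(1) k] fun_upd_triv scaleC_complex_def
          left_diff_distrib)
    finally show ?thesis .
  qed
  also have "(\<Sum>i\<in>A - {k}. \<Sum>p=1..n. F ((v(k := f p))(i := ?X p ((v(k := f p)) i))))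
    = (\<Sum>i\<in>A - {k}. F (v \<circ> transpose k i) - \<epsilon> * \<omega> (v i) (v k) * contraction k i F v)"
  proof (rule sum.cong[OF refl])
    fix i assume i: "i \<in> A - {k}"
    then have iA: "i \<in> A" and ik: "i \<noteq> k" by auto
    have "(\<Sum>p=1..n. F ((v(k := f p))(i := ?X p ((v(k := f p)) i))))
      = (\<Sum>p=1..n. \<omega> (v i) (fd p) * F (v(i := v k, k := f p)))
        - \<epsilon> * \<omega> (v i) (v k) * contraction k i F v"
    proof -
      have tw: "v(i := v k, k := f p) = v(k := f p, i := v k)" for p
        using ik by (simp add: fun_upd_twist)
      show ?thesis
        unfolding tw using ik
        by (simp add: multilinear_on_upd[OF F(1) iA] sum_subtractf contraction_def
          sum_distrib_left scaleC_complex_def mult.assoc)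
    qed
    also have "(\<Sum>p=1..n. \<omega> (v i) (fd p) * F (v(i := v k, k := f p)))
      = F (v(i := v k, k := \<Sum>p=1..n. \<omega> (v i) (fd p) *\<^sub>C f p))"
      by (simp add: multilinear_on_upd[OF F(1) k] scaleC_complex_def)
    also have "\<dots> = F (v(i := v k, k := v i))"
      by (simp only: expand_basis[symmetric])
    also have "v(i := v k, k := v i) = v \<circ> transpose k i"
      using ik by (auto simp: fun_eq_iff transpose_def)
    finally show "(\<Sum>p=1..n. F ((v(k := f p))(i := ?X p ((v(k := f p)) i))))
      = F (v \<circ> transpose k i) - \<epsilon> * \<omega> (v i) (v k) * contraction k i F v" .
  qed
  finally show ?thesis by (simp add: sum_subtractf algebra_simps)
qed

lemma multilinear_on_contraction:
  fixes F :: "('i \<Rightarrow> 'v) \<Rightarrow> complex"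
  assumes F: "multilinear_on A F" and ij: "i \<in> A" "j \<in> A" "i \<noteq> j"
  shows "multilinear_on (A - {i, j}) (contraction i j F)"
proof (rule multilinear_onI)
  fix v :: "'i \<Rightarrow> 'v" and k and x y :: 'v and c assume k: "k \<in> A - {i, j}"
  then have kA: "k \<in> A" by simp
  have tw: "v(k := x, i := y, j := z) = v(i := y, j := z, k := x)" for x y z
    using k by (auto simp: fun_eq_iff)
  show "contraction i j F (v(k := x + y)) = contraction i j F (v(k := x)) + contraction i j F (v(k := y))"
    unfolding contraction_def tw by (simp add: multilinear_on_upd[OF F kA] sum.distrib)
  show "contraction i j F (v(k := c *\<^sub>C x)) = c *\<^sub>C contraction i j F (v(k := x))"
    unfolding contraction_def tw
    by (simp add: multilinear_on_upd[OF F kA] scaleC_complex_def sum_distrib_left)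
next
  fix v w :: "'i \<Rightarrow> 'v" assume vw: "\<And>k. k \<in> A - {i, j} \<Longrightarrow> v k = w k"
  show "contraction i j F v = contraction i j F w"
    unfolding contraction_def
    by (intro sum.cong refl multilinear_on_cong[OF F]) (use vw in auto)
qed

text \<open>The sum of the tensors of \<open>f p\<close> and \<open>fd p\<close> is fixed by
  isometries: expand \<open>g (f p)\<close> in the basis, move \<open>g\<close> inside \<omega> to
  the other argument as its inverse, and recollect the second factor.\<close>

lemma contraction_isometry_invariant:
  assumes g: "g \<in> isometry_group \<omega>" and F: "multilinear_on A F" "i \<in> A" "j \<in> A" "i \<noteq> j"
  shows "(\<Sum>p=1..n. F (v(i := g (f p), j := g (fd p)))) = contraction i j F v"
proof -
  note D = isometryD[OF g]
  let ?h = "Hilbert_Choice.inv g"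
  have twi: "v(i := x, j := y) = v(j := y, i := x)" for x y using F(4) by (simp add: fun_upd_twist)
  have om: "\<omega> (g x) y = \<omega> x (?h y)" for x y using D(3)[of x "?h y"] by (simp only: D)
  have "(\<Sum>p=1..n. F (v(i := g (f p), j := g (fd p))))
    = (\<Sum>p=1..n. F (v(i := \<Sum>q=1..n. \<omega> (g (f p)) (fd q) *\<^sub>C f q, j := g (fd p))))"
    by (simp only: expand_basis[symmetric])
  also have "\<dots> = (\<Sum>p=1..n. \<Sum>q=1..n. \<omega> (f p) (?h (fd q)) * F (v(i := f q, j := g (fd p))))"
    unfolding twi om by (simp only: multilinear_on_upd[OF F(1,2)] scaleC_complex_def)
  also have "\<dots> = (\<Sum>q=1..n. \<Sum>p=1..n. \<omega> (f p) (?h (fd q)) * F (v(i := f q, j := g (fd p))))"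
    by (rule sum.swap)
  also have "\<dots> = (\<Sum>q=1..n. F (v(i := f q, j := g (\<Sum>p=1..n. \<omega> (f p) (?h (fd q)) *\<^sub>C fd p))))"
    by (simp only: clinear_sum[OF D(1)] clinear_scale[OF D(1)] multilinear_on_upd[OF F(1,3)] scaleC_complex_def)
  also have "\<dots> = (\<Sum>q=1..n. F (v(i := f q, j := fd q)))"
    by (simp only: expand_dual[symmetric] D)
  finally show ?thesis by (simp add: contraction_def)
qed

lemma invariant_contraction:
  assumes F: "multilinear_on A F" "invariant F" and ij: "i \<in> A" "j \<in> A" "i \<noteq> j"
  shows "invariant (contraction i j F)"
  unfolding invariant_def
proof (intro ballI allI)
  fix g v assume g: "g \<in> isometry_group \<omega>"
  let ?h = "Hilbert_Choice.inv g"
  note D = isometryD[OF g]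
  have "contraction i j F (g \<circ> v) = (\<Sum>p=1..n. F (g \<circ> (v(i := ?h (f p), j := ?h (fd p)))))"
    unfolding contraction_def
    by (intro sum.cong refl arg_cong[where f = F]) (auto simp: fun_eq_iff D)
  also have "\<dots> = (\<Sum>p=1..n. F (v(i := ?h (f p), j := ?h (fd p))))"
    using F(2) g unfolding invariant_def by (intro sum.cong refl) blast
  also have "\<dots> = contraction i j F v"
    by (rule contraction_isometry_invariant[OF isometry_inv[OF g] F(1) ij])
  finally show "contraction i j F (g \<circ> v) = contraction i j F v" .
qed

end

section \<open>The first fundamental theorem\<close>

text \<open>Coordinate functions are total, and only their values on \<open>X\<close> enter, so the
  form is semidefinite; norm zero means vanishing on \<open>X\<close>.\<close>

definition ip :: "'x set \<Rightarrow> ('x \<Rightarrow> complex) \<Rightarrow> ('x \<Rightarrow> complex) \<Rightarrow> complex"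
  where "ip X g h = (\<Sum>x\<in>X. cnj (g x) * h x)"

lemma ip_self: "ip X g g = of_real (\<Sum>x\<in>X. (cmod (g x))\<^sup>2)"
  unfolding ip_def of_real_sum by (rule sum.cong[OF refl]) (simp add: mult.commute[of "cnj _"] flip: complex_norm_square)

lemma ip_self_eq_0: "finite X \<Longrightarrow> ip X g g = 0 \<Longrightarrow> x \<in> X \<Longrightarrow> g x = 0"
  unfolding ip_self of_real_eq_0_iff by (simp add: sum_nonneg_eq_0_iff)

lemma ip_simps:
  "ip X (g + g') h = ip X g h + ip X g' h" "ip X g (h + h') = ip X g h + ip X g h'"
  "ip X (g - g') h = ip X g h - ip X g' h" "ip X g (h - h') = ip X g h - ip X g h'"
  "ip X (c *\<^sub>C g) h = cnj c * ip X g h" "ip X g (c *\<^sub>C h) = c * ip X g h"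
  "ip X 0 h = 0" "ip X g 0 = 0" "ip X g (sum k K) = (\<Sum>j\<in>K. ip X g (k j))"
proof -
  show "ip X (g + g') h = ip X g h + ip X g' h" "ip X g (h + h') = ip X g h + ip X g h'"
    by (simp_all add: ip_def distrib_right distrib_left sum.distrib)
  show "ip X (g - g') h = ip X g h - ip X g' h" "ip X g (h - h') = ip X g h - ip X g h'"
    by (simp_all add: ip_def left_diff_distrib right_diff_distrib sum_subtractf)
  show "ip X (c *\<^sub>C g) h = cnj c * ip X g h" "ip X g (c *\<^sub>C h) = c * ip X g h"
    by (simp_all add: ip_def scaleC_fun_def scaleC_complex_def sum_distrib_left mult_ac)
  show "ip X 0 h = 0" "ip X g 0 = 0" by (simp_all add: ip_def)
  have "(sum k K) x = (\<Sum>j\<in>K. k j x)" for x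
    by (induction K rule: infinite_finite_induct) simp_all
  then show "ip X g (sum k K) = (\<Sum>j\<in>K. ip X g (k j))"
    unfolding ip_def sum_distrib_left by (simp add: sum_distrib_left) (rule sum.swap)
qed

text \<open>Gram-Schmidt by induction on the spanning set. The new vector minus its projection,
  \<open>b'\<close>, may have norm zero, as \<open>S\<close> can be dependent and the form is only
  semidefinite.\<close>

lemma orthogonal_projection:
  assumes "finite S" "finite X"
  shows "\<exists>w\<in>cspan S. \<forall>s\<in>cspan S. ip X s (F - w) = 0"
  using assms(1)
proof (induction S arbitrary: F)
  case empty
  have "ip X s (F - 0) = 0" if "s \<in> cspan {}" for s
    using that by (simp add: ip_simps del: zero_fun_def)
  then show ?case using complex_vector.span_zero by blast
next
  case (insert b S)
  obtain sb where sb: "sb \<in> cspan S" "\<And>s. s \<in> cspan S \<Longrightarrow> ip X s (b - sb) = 0"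
    using insert.IH[of b] by blast
  obtain w where w: "w \<in> cspan S" "\<And>s. s \<in> cspan S \<Longrightarrow> ip X s (F - w) = 0"
    using insert.IH[of F] by blast
  define b' where "b' = b - sb"
  define c where "c = ip X b' (F - w) / ip X b' b'"
  have sub: "cspan S \<subseteq> cspan (insert b S)" by (rule complex_vector.span_mono) auto
  have b': "b' \<in> cspan (insert b S)"
    unfolding b'_def
    by (rule complex_vector.span_diff) (use sub sb in \<open>auto intro: complex_vector.span_base\<close>)
  have c: "ip X b' (F - (w + c *\<^sub>C b')) = 0"
  proof (cases "ip X b' b' = 0")
    \<comment> \<open>Here \<open>b'\<close> vanishes on \<open>X\<close>, so orthogonality to it is
      automatic whatever \<open>c\<close> is.\<close>
    case True
    then have "b' x = 0" if "x \<in> X" for x using that ip_self_eq_0[OF assms(2)] by blast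
    then show ?thesis by (simp add: ip_def)
  next
    case False
    then show ?thesis by (simp only: diff_diff_eq[symmetric] ip_simps(4,6)) (simp add: c_def ip_simps)
  qed
  show ?case
  proof (intro bexI ballI)
    show "w + c *\<^sub>C b' \<in> cspan (insert b S)"
      using w(1) sub b' by (auto intro: complex_vector.span_add complex_vector.span_scale)
    fix s assume "s \<in> cspan (insert b S)"
    then obtain k where k: "s - k *\<^sub>C b \<in> cspan S"
      using complex_vector.span_breakdown_eq by blast
    have t: "(s - k *\<^sub>C b) + k *\<^sub>C sb \<in> cspan S"
      using k sb(1) by (intro complex_vector.span_add complex_vector.span_scale)
    have s: "s = ((s - k *\<^sub>C b) + k *\<^sub>C sb) + k *\<^sub>C b'"
      by (simp add: b'_def complex_vector.scale_right_diff_distrib)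
    have "ip X ((s - k *\<^sub>C b) + k *\<^sub>C sb) (F - (w + c *\<^sub>C b')) = 0"
      using w(2)[OF t] sb(2)[OF t]
      by (simp only: diff_diff_eq[symmetric] ip_simps(4,6) b'_def) simp
    then show "ip X s (F - (w + c *\<^sub>C b')) = 0"
      by (subst s) (simp only: ip_simps(1,5) c mult_zero_right add_0_right)
  qed
qed

section \<open>The Casimir element of gl acting on words\<close>

lemma sum_swap3:
  "(\<Sum>a\<in>A. \<Sum>i\<in>I. \<Sum>j\<in>J. g a i j) = (\<Sum>i\<in>I. \<Sum>j\<in>J. \<Sum>a\<in>A. (g a i j :: 'a::comm_monoid_add))"
proof -
  have "(\<Sum>a\<in>A. \<Sum>i\<in>I. \<Sum>j\<in>J. g a i j) = (\<Sum>i\<in>I. \<Sum>a\<in>A. \<Sum>j\<in>J. g a i j)" by (rule sum.swap)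
  also have "\<dots> = (\<Sum>i\<in>I. \<Sum>j\<in>J. \<Sum>a\<in>A. g a i j)" by (intro sum.cong refl sum.swap)
  finally show ?thesis .
qed

text \<open>The action of the matrix unit \<open>E\<^sub>a\<^sub>b\<close> on the coordinates \<open>c\<close> of a multilinear form.\<close>

definition matrix_unit :: "'i set \<Rightarrow> (('i \<Rightarrow> nat) \<Rightarrow> complex) \<Rightarrow> nat \<Rightarrow> nat \<Rightarrow> ('i \<Rightarrow> nat) \<Rightarrow> complex"
  where "matrix_unit A c a b w = (\<Sum>i\<in>A. if w i = a then c (w(i := b)) else 0)"

text \<open>As E_ba is adjoint to E_ab, the left side is \<open>c\<close> paired with its image
  under the sum of all E_ba E_ab. This Casimir element acts on a single slot as the number of
  letters and on two different slots as their transposition; the proof checks this by expanding the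
  squares.\<close>

lemma gl_casimir_norm:
  fixes c :: "('i \<Rightarrow> nat) \<Rightarrow> complex"
  assumes A: "finite A" and N: "finite N"
  defines "W \<equiv> PiE A (\<lambda>_. N)"
  shows "(\<Sum>a\<in>N. \<Sum>b\<in>N. ip W (matrix_unit A c a b) (matrix_unit A c a b))
    = of_nat (card N) * of_nat (card A) * ip W c c
      + (\<Sum>i\<in>A. \<Sum>j\<in>A - {i}. \<Sum>w\<in>W. cnj (c w) * c (w \<circ> transpose i j))"
proof -
  define t where "t a b w i j = (if w i = a \<and> w j = a then cnj (c (w(i := b))) * c (w(j := b)) else 0)"
    for a b :: nat and w :: "'i \<Rightarrow> nat" and i j
  define T where "T i j = (\<Sum>b\<in>N. \<Sum>w\<in>W. if w i = w j then cnj (c (w(i := b))) * c (w(j := b)) else 0)"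
    for i j
  have WN: "w i \<in> N" if "w \<in> W" "i \<in> A" for w i using that by (auto simp: W_def)
  have upd: "w(i := b) \<in> W" if "w \<in> W" "i \<in> A" "b \<in> N" for w i b
    using that PiE_fun_upd[of b "\<lambda>_. N" i w A] by (simp add: W_def insert_absorb)
  have tr: "w \<circ> transpose i j \<in> W" if "w \<in> W" "i \<in> A" "j \<in> A" for w i j
    using that by (auto simp: W_def transpose_def PiE_iff extensional_def)
  have "(\<Sum>a\<in>N. \<Sum>b\<in>N. ip W (matrix_unit A c a b) (matrix_unit A c a b))
    = (\<Sum>a\<in>N. \<Sum>b\<in>N. \<Sum>w\<in>W. \<Sum>i\<in>A. \<Sum>j\<in>A. t a b w i j)"
    unfolding ip_def matrix_unit_def cnj_sum sum_product t_def
    by (intro sum.cong refl) simp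
  also have "\<dots> = (\<Sum>b\<in>N. \<Sum>w\<in>W. \<Sum>a\<in>N. \<Sum>i\<in>A. \<Sum>j\<in>A. t a b w i j)" by (rule sum_swap3)
  also have "\<dots> = (\<Sum>b\<in>N. \<Sum>w\<in>W. \<Sum>i\<in>A. \<Sum>j\<in>A. \<Sum>a\<in>N. t a b w i j)"
    by (intro sum.cong refl sum_swap3)
  also have "\<dots> = (\<Sum>b\<in>N. \<Sum>i\<in>A. \<Sum>j\<in>A. \<Sum>w\<in>W. \<Sum>a\<in>N. t a b w i j)"
    by (intro sum.cong refl sum_swap3)
  also have "\<dots> = (\<Sum>i\<in>A. \<Sum>j\<in>A. \<Sum>b\<in>N. \<Sum>w\<in>W. \<Sum>a\<in>N. t a b w i j)" by (rule sum_swap3)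
  also have "\<dots> = (\<Sum>i\<in>A. \<Sum>j\<in>A. T i j)"
    unfolding T_def
  proof (intro sum.cong refl)
    fix i j b w assume *: "i \<in> A" "j \<in> A" "w \<in> W"
    have "(\<Sum>a\<in>N. t a b w i j) = (\<Sum>a\<in>N. if a = w i then
      (if w i = w j then cnj (c (w(i := b))) * c (w(j := b)) else 0) else 0)"
      by (rule sum.cong) (auto simp: t_def)
    also have "\<dots> = (if w i = w j then cnj (c (w(i := b))) * c (w(j := b)) else 0)"
      using WN[OF *(3,1)] N by simp
    finally show "(\<Sum>a\<in>N. t a b w i j) = (if w i = w j then cnj (c (w(i := b))) * c (w(j := b)) else 0)" .
  qed
  also have "\<dots> = (\<Sum>i\<in>A. T i i + (\<Sum>j\<in>A - {i}. T i j))"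
    by (intro sum.cong refl sum.remove A)
  also have "\<dots> = (\<Sum>i\<in>A. of_nat (card N) * ip W c c
      + (\<Sum>j\<in>A - {i}. \<Sum>w\<in>W. cnj (c w) * c (w \<circ> transpose i j)))"
  proof (intro sum.cong refl arg_cong2[where f = plus])
    fix i assume i: "i \<in> A"
    have "T i i = (\<Sum>(b, w)\<in>N \<times> W. cnj (c (w(i := b))) * c (w(i := b)))"
      by (simp add: T_def sum.cartesian_product)
    \<comment> \<open>Exchanging the free letter \<open>b\<close> with the letter of
      \<open>w\<close> at \<open>i\<close> is an involution of N \<times> W.\<close>
    also have "\<dots> = (\<Sum>(b, w)\<in>N \<times> W. cnj (c w) * c w)"
      by (rule sum.reindex_bij_witness[where i = "\<lambda>(b, w). (w i, w(i := b))" and j = "\<lambda>(b, w). (w i, w(i := b))"])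
        (auto simp: i WN upd)
    also have "\<dots> = of_nat (card N) * ip W c c"
      by (simp add: ip_def flip: sum.cartesian_product)
    finally show "T i i = of_nat (card N) * ip W c c" .
    fix j assume "j \<in> A - {i}"
    then have j: "j \<in> A" "j \<noteq> i" by auto
    have fW: "finite W" using A N by (simp add: W_def finite_PiE)
    have "T i j = (\<Sum>(b, w)\<in>N \<times> W. if w i = w j then cnj (c (w(i := b))) * c (w(j := b)) else 0)"
      by (simp add: T_def sum.cartesian_product)
    also have "\<dots> = (\<Sum>(b, w)\<in>{x \<in> N \<times> W. snd x i = snd x j}. cnj (c (w(i := b))) * c (w(j := b)))"
      unfolding sum.inter_filter[OF finite_cartesian_product[OF N fW]]
      by (intro sum.cong refl) (auto split: if_splits)
    \<comment> \<open>The pairs (b, w) with w i = w j correspond to words via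
      \<open>w(i := b)\<close>: the overwritten letter is still present at \<open>j\<close>.\<close>
    also have "\<dots> = (\<Sum>w\<in>W. cnj (c w) * c (w \<circ> transpose i j))"
    proof (rule sum.reindex_bij_witness[where i = "\<lambda>u. (u i, u(i := u j))" and j = "\<lambda>(b, w). w(i := b)"])
      fix x assume "x \<in> {x \<in> N \<times> W. snd x i = snd x j}"
      then obtain b w where x: "x = (b, w)" "b \<in> N" "w \<in> W" "w i = w j" by auto
      have "w(i := b) \<circ> transpose i j = w(j := b)"
        using x j by (auto simp: fun_eq_iff transpose_def)
      then show "cnj (c (case x of (b, w) \<Rightarrow> w(i := b))) * c ((case x of (b, w) \<Rightarrow> w(i := b)) \<circ> transpose i j) =
        (case x of (b, w) \<Rightarrow> cnj (c (w(i := b))) * c (w(j := b)))"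
        using x by simp
      show "((case x of (b, w) \<Rightarrow> w(i := b)) i,
         (case x of (b, w) \<Rightarrow> w(i := b))(i := (case x of (b, w) \<Rightarrow> w(i := b)) j)) = x"
        using x j by (auto simp: fun_eq_iff)
      show "(case x of (b, w) \<Rightarrow> w(i := b)) \<in> W" using x i upd by auto
    next
      fix u assume u: "u \<in> W"
      show "(case (u i, u(i := u j)) of (b, w) \<Rightarrow> w(i := b)) = u" by simp
      show "(u i, u(i := u j)) \<in> {x \<in> N \<times> W. snd x i = snd x j}"
        using u i j WN upd by auto
    qed
    finally show "T i j = (\<Sum>w\<in>W. cnj (c w) * c (w \<circ> transpose i j))" .
  qed
  finally show ?thesis by (simp add: sum.distrib mult_ac)
qed

text \<open>For each slot the relation replaces the sum of the transposition terms by \<epsilon>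
  minus the number of letters, which cancels the diagonal contribution up to \<epsilon>.\<close>

lemma matrix_unit_norm:
  fixes c :: "('i \<Rightarrow> nat) \<Rightarrow> complex"
  assumes A: "finite A" and N: "finite N"
  defines "W \<equiv> PiE A (\<lambda>_. N)"
  assumes c: "\<And>k w. k \<in> A \<Longrightarrow> w \<in> W \<Longrightarrow>
    (of_nat (card N) - \<epsilon>) * c w + (\<Sum>i\<in>A - {k}. c (w \<circ> transpose k i)) = 0"
  shows "(\<Sum>a\<in>N. \<Sum>b\<in>N. ip W (matrix_unit A c a b) (matrix_unit A c a b)) = \<epsilon> * of_nat (card A) * ip W c c"
proof -
  have "(\<Sum>j\<in>A - {i}. \<Sum>w\<in>W. cnj (c w) * c (w \<circ> transpose i j)) = (\<epsilon> - of_nat (card N)) * ip W c c"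
    if i: "i \<in> A" for i
  proof -
    have "(\<Sum>j\<in>A - {i}. \<Sum>w\<in>W. cnj (c w) * c (w \<circ> transpose i j))
      = (\<Sum>w\<in>W. cnj (c w) * (\<Sum>j\<in>A - {i}. c (w \<circ> transpose i j)))"
      unfolding sum_distrib_left by (rule sum.swap)
    also have "\<dots> = (\<Sum>w\<in>W. cnj (c w) * ((\<epsilon> - of_nat (card N)) * c w))"
    proof (intro sum.cong refl arg_cong2[where f = times])
      fix w assume "w \<in> W"
      from c[OF i this] show "(\<Sum>j\<in>A - {i}. c (w \<circ> transpose i j)) = (\<epsilon> - of_nat (card N)) * c w"
        by (simp add: algebra_simps eq_neg_iff_add_eq_0)
    qed
    finally show ?thesis by (simp add: ip_def sum_distrib_left mult_ac)
  qed
  then have "(\<Sum>i\<in>A. \<Sum>j\<in>A - {i}. \<Sum>w\<in>W. cnj (c w) * c (w \<circ> transpose i j))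
    = of_nat (card A) * ((\<epsilon> - of_nat (card N)) * ip W c c)"
    by simp
  then show ?thesis
    using gl_casimir_norm[OF A N, of c] by (simp add: W_def algebra_simps)
qed

lemma skew_words_vanish:
  fixes c :: "('i \<Rightarrow> nat) \<Rightarrow> complex"
  assumes A: "finite A" "A \<noteq> {}" and N: "finite N"
  defines "W \<equiv> PiE A (\<lambda>_. N)"
  assumes c: "\<And>k w. k \<in> A \<Longrightarrow> w \<in> W \<Longrightarrow>
    (of_nat (card N) - (- 1)) * c w + (\<Sum>i\<in>A - {k}. c (w \<circ> transpose k i)) = 0"
    and w: "w \<in> W"
  shows "c w = 0"
proof -
  have fW: "finite W" using A N by (simp add: W_def finite_PiE)
  define S where "S = (\<Sum>a\<in>N. \<Sum>b\<in>N. \<Sum>w\<in>W. (cmod (matrix_unit A c a b w))\<^sup>2)"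
  have "complex_of_real S = (\<Sum>a\<in>N. \<Sum>b\<in>N. ip W (matrix_unit A c a b) (matrix_unit A c a b))"
    by (simp add: S_def ip_self)
  also have "\<dots> = of_real (- real (card A) * (\<Sum>w\<in>W. (cmod (c w))\<^sup>2))"
    using matrix_unit_norm[OF A(1) N, of "- 1" c] c by (simp add: W_def ip_self)
  finally have "S = - real (card A) * (\<Sum>w\<in>W. (cmod (c w))\<^sup>2)" by (simp only: of_real_eq_iff)
  moreover have "S \<ge> 0" by (simp add: S_def sum_nonneg)
  moreover have "real (card A) > 0" using A by (simp add: card_gt_0_iff)
  ultimately have "(\<Sum>w\<in>W. (cmod (c w))\<^sup>2) \<le> 0" by (simp add: mult_le_0_iff zero_le_mult_iff)
  then have "(\<Sum>w\<in>W. (cmod (c w))\<^sup>2) = 0" by (simp add: antisym sum_nonneg)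
  then show ?thesis using fW w by (simp add: sum_nonneg_eq_0_iff)
qed

text \<open>E_aa multiplies the coordinate at \<open>w\<close> by the multiplicity \<mu>_a(w), and
  these multiplicities add up to m = \<open>card A\<close>. Hence m |c|^2, being the sum of
  \<mu>_a(w) |c(w)|^2, is at most the sum of \<mu>_a(w)^2 |c(w)|^2, which is at most the sum of all
  |E_ab c|^2, and this is again m |c|^2. Equality forces \<mu>_a(w) \<le> 1 wherever c(w) is
  nonzero, and E_ab c = 0 for distinct a, b.\<close>

lemma symmetric_words_multilinear:
  fixes c :: "('i \<Rightarrow> nat) \<Rightarrow> complex"
  assumes A: "finite A" "A \<noteq> {}" and N: "finite N"
  defines "W \<equiv> PiE A (\<lambda>_. N)"
  assumes c: "\<And>k w. k \<in> A \<Longrightarrow> w \<in> W \<Longrightarrow>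
    (of_nat (card N) - 1) * c w + (\<Sum>i\<in>A - {k}. c (w \<circ> transpose k i)) = 0"
    and w: "w \<in> W" "c w \<noteq> 0" and a: "a \<in> N"
  shows "card {i \<in> A. w i = a} = 1"
proof -
  have fW: "finite W" using A N by (simp add: W_def finite_PiE)
  have WN: "w i \<in> N" if "w \<in> W" "i \<in> A" for w i using that by (auto simp: W_def)
  define \<mu> where "\<mu> a w = card {i \<in> A. w i = a}" for a and w :: "'i \<Rightarrow> nat"
  \<comment> \<open>The defect in this chain of inequalities, term by term; each term is nonnegative
    because m \<le> m^2 for natural m, and they sum to 0.\<close>
  define R where "R a b w = (cmod (matrix_unit A c a b w))\<^sup>2 - (if a = b then real (\<mu> a w) * (cmod (c w))\<^sup>2 else 0)"
    for a b w
  have diag: "matrix_unit A c a a w = of_nat (\<mu> a w) * c w" for a w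
  proof -
    have "matrix_unit A c a a w = (\<Sum>i\<in>A. if w i = a then c w else 0)"
      unfolding matrix_unit_def by (intro sum.cong refl) auto
    also have "\<dots> = (\<Sum>i\<in>{i \<in> A. w i = a}. c w)" by (rule sum.inter_filter[symmetric, OF A(1)])
    finally show ?thesis by (simp add: \<mu>_def)
  qed
  have sq: "real m \<le> (real m)\<^sup>2" for m
    by (cases m) (auto simp: power2_eq_square)
  have R_nonneg: "R a b w \<ge> 0" for a b w
    using mult_right_mono[OF sq, of "(cmod (c w))\<^sup>2" "\<mu> a w"]
    by (auto simp: R_def diag norm_mult power_mult_distrib)
  have count: "(\<Sum>a\<in>N. \<mu> a w) = card A" if "w \<in> W" for w
  proof -
    have "(\<Sum>a\<in>N. \<mu> a w) = (\<Sum>a\<in>N. \<Sum>i\<in>{i \<in> A. w i = a}. 1)" by (simp add: \<mu>_def)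
    also have "\<dots> = (\<Sum>i\<in>A. 1)" by (rule sum.group) (use A N WN that in auto)
    finally show ?thesis by simp
  qed
  have "complex_of_real (\<Sum>a\<in>N. \<Sum>b\<in>N. \<Sum>w\<in>W. (cmod (matrix_unit A c a b w))\<^sup>2)
      = (\<Sum>a\<in>N. \<Sum>b\<in>N. ip W (matrix_unit A c a b) (matrix_unit A c a b))"
    by (simp add: ip_self)
  also have "\<dots> = of_real (real (card A) * (\<Sum>w\<in>W. (cmod (c w))\<^sup>2))"
    using matrix_unit_norm[OF A(1) N, of 1 c] c by (simp add: W_def ip_self)
  finally have 1: "(\<Sum>a\<in>N. \<Sum>b\<in>N. \<Sum>w\<in>W. (cmod (matrix_unit A c a b w))\<^sup>2)
      = real (card A) * (\<Sum>w\<in>W. (cmod (c w))\<^sup>2)" by (simp only: of_real_eq_iff)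
  have "(\<Sum>a\<in>N. \<Sum>b\<in>N. \<Sum>w\<in>W. if a = b then real (\<mu> a w) * (cmod (c w))\<^sup>2 else 0)
    = (\<Sum>a\<in>N. \<Sum>b\<in>N. if b = a then (\<Sum>w\<in>W. real (\<mu> a w) * (cmod (c w))\<^sup>2) else 0)"
    by (intro sum.cong refl) auto
  also have "\<dots> = (\<Sum>a\<in>N. \<Sum>w\<in>W. real (\<mu> a w) * (cmod (c w))\<^sup>2)"
    using N by (intro sum.cong refl) simp
  also have "\<dots> = (\<Sum>w\<in>W. (\<Sum>a\<in>N. real (\<mu> a w)) * (cmod (c w))\<^sup>2)"
    unfolding sum_distrib_right by (rule sum.swap)
  also have "\<dots> = (\<Sum>w\<in>W. real (card A) * (cmod (c w))\<^sup>2)"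
    by (intro sum.cong refl) (simp add: count flip: of_nat_sum)
  finally have "(\<Sum>a\<in>N. \<Sum>b\<in>N. \<Sum>w\<in>W. R a b w) = 0"
    using 1 by (simp add: R_def sum_subtractf sum_distrib_left)
  then have R0: "R a b w = 0" if "a \<in> N" "b \<in> N" "w \<in> W" for a b w
    using that N fW R_nonneg by (simp add: sum_nonneg_eq_0_iff sum_nonneg)
  have le1: "\<mu> d w \<le> 1" if "d \<in> N" for d
  proof -
    have "((real (\<mu> d w))\<^sup>2 - real (\<mu> d w)) * (cmod (c w))\<^sup>2 = 0"
      using R0[OF that that w(1)] by (simp add: R_def diag norm_mult power_mult_distrib algebra_simps)
    then have "real (\<mu> d w) * (real (\<mu> d w) - 1) = 0"
      using w(2) by (simp add: power2_eq_square algebra_simps)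
    then show ?thesis by auto
  qed
  \<comment> \<open>If \<open>a\<close> did not occur in \<open>w\<close>, replacing the letter at
    one slot \<open>k\<close> by \<open>a\<close> and applying E_ab with b = \<open>w k\<close>
    would give back the nonzero c(w), although E_ab c = 0.\<close>
  have "\<mu> a w \<noteq> 0"
  proof
    assume z: "\<mu> a w = 0"
    then have no: "w i \<noteq> a" if "i \<in> A" for i using that A(1) by (auto simp: \<mu>_def)
    obtain k where k: "k \<in> A" using A(2) by blast
    let ?u = "w(k := a)"
    have u: "?u \<in> W"
      using PiE_fun_upd[of a "\<lambda>_. N" k w A] w(1) a k by (simp add: W_def insert_absorb)
    have "matrix_unit A c a (w k) ?u = (\<Sum>i\<in>A. if i = k then c w else 0)"
      unfolding matrix_unit_def by (intro sum.cong refl) (auto dest: no)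
    then have "matrix_unit A c a (w k) ?u = c w" using k A(1) by simp
    then show False using R0[OF a WN[OF w(1) k] u] no[OF k] w(2) by (auto simp: R_def)
  qed
  with le1[OF a] show ?thesis by (simp add: \<mu>_def)
qed

lemma cspan_linear_image:
  assumes "clinear h" and "\<And>x. x \<in> S \<Longrightarrow> h x \<in> cspan T" and "x \<in> cspan S"
  shows "h x \<in> cspan T"
proof -
  have "h x \<in> cspan (h ` S)"
    using complex_vector_pair.linear_span_image[OF assms(1), of S] assms(3) by auto
  moreover have "cspan (h ` S) \<subseteq> cspan T"
    by (rule complex_vector.span_minimal) (use assms(2) in auto)
  ultimately show ?thesis by blast
qed

section \<open>Perfect matchings and their forms\<close>

text \<open>Lists of ordered pairs allow recursion on the edges. One matching has several lists, but
  reordering them leaves \<open>mform\<close> unchanged and reversing an edge multiplies it by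
  \<epsilon>, so the span is the same.\<close>

definition matchings :: "'i set \<Rightarrow> ('i \<times> 'i) list set"
  where "matchings A = {ps. distinct (map fst ps @ map snd ps) \<and> set (map fst ps @ map snd ps) = A}"

lemma matchings_Nil: "[] \<in> matchings {}"
  by (simp add: matchings_def)

lemma matchings_Cons:
  "(i, j) # ps \<in> matchings A \<longleftrightarrow> i \<in> A \<and> j \<in> A \<and> i \<noteq> j \<and> ps \<in> matchings (A - {i, j})"
  unfolding matchings_def by auto

lemma finite_matchings:
  assumes "finite A"
  shows "finite (matchings A)"
proof (rule finite_subset)
  show "matchings A \<subseteq> {ps. set ps \<subseteq> A \<times> A \<and> length ps \<le> card A}"
  proof
    fix ps assume "ps \<in> matchings A"
    then have d: "distinct (map fst ps)" and s: "fst ` set ps \<subseteq> A" "snd ` set ps \<subseteq> A"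
      by (auto simp: matchings_def)
    have "length ps = card (fst ` set ps)" using distinct_card[OF d] by simp
    also have "\<dots> \<le> card A" by (rule card_mono[OF assms s(1)])
    finally show "ps \<in> {ps. set ps \<subseteq> A \<times> A \<and> length ps \<le> card A}"
      using s by (auto simp: mem_Times_iff)
  qed
  show "finite {ps. set ps \<subseteq> A \<times> A \<and> length ps \<le> card A}"
    by (rule finite_lists_length_le) (use assms in simp)
qed

lemma transpose_matching:
  assumes "ps \<in> matchings A" "i \<in> A" "k \<in> A"
  shows "map (map_prod (transpose i k) (transpose i k)) ps \<in> matchings A"
proof -
  have inj: "inj_on (transpose i k) (set (map fst ps @ map snd ps))"
    by (meson inj_on_subset inj_transpose subset_UNIV)
  have eq: "map fst (map (map_prod (transpose i k) (transpose i k)) ps) @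
      map snd (map (map_prod (transpose i k) (transpose i k)) ps)
    = map (transpose i k) (map fst ps @ map snd ps)"
    by simp
  have "transpose i k ` A = A"
    using assms(2,3) by (auto simp: transpose_def image_iff)
  then show ?thesis
    using assms(1) inj unfolding matchings_def mem_Collect_eq eq
    by (metis distinct_map set_map)
qed

context bilinear_space
begin

definition mform :: "('i \<times> 'i) list \<Rightarrow> ('i \<Rightarrow> 'v) \<Rightarrow> complex"
  where "mform ps v = (\<Prod>(i, j)\<leftarrow>ps. \<omega> (v i) (v j))"

lemma mform_simps: "mform [] v = 1" "mform ((i, j) # ps) v = \<omega> (v i) (v j) * mform ps v"
  by (simp_all add: mform_def)

lemma multilinear_on_pair:
  fixes H :: "('i \<Rightarrow> 'v) \<Rightarrow> complex"
  assumes H: "multilinear_on (A - {i, j}) H" and ij: "i \<in> A" "j \<in> A" "i \<noteq> j"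
  shows "multilinear_on A (\<lambda>v. \<omega> (v i) (v j) * H v)"
proof (rule multilinear_onI)
  have ind: "H (v(k := x)) = H v" if "k = i \<or> k = j" for v k x
    by (rule multilinear_on_cong[OF H]) (use that in auto)
  fix v :: "'i \<Rightarrow> 'v" and k x y c assume k: "k \<in> A"
  consider "k = i" | "k = j" | "k \<in> A - {i, j}" using k by auto
  then show "\<omega> ((v(k := x + y)) i) ((v(k := x + y)) j) * H (v(k := x + y))
      = \<omega> ((v(k := x)) i) ((v(k := x)) j) * H (v(k := x)) + \<omega> ((v(k := y)) i) ((v(k := y)) j) * H (v(k := y))"
    by cases (use ij in \<open>auto simp: ind omega_simps multilinear_on_upd[OF H] algebra_simps\<close>)
  consider "k = i" | "k = j" | "k \<in> A - {i, j}" using k by auto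
  then show "\<omega> ((v(k := c *\<^sub>C x)) i) ((v(k := c *\<^sub>C x)) j) * H (v(k := c *\<^sub>C x))
      = c *\<^sub>C (\<omega> ((v(k := x)) i) ((v(k := x)) j) * H (v(k := x)))"
    by cases (use ij in \<open>auto simp: ind omega_simps multilinear_on_upd[OF H] scaleC_complex_def\<close>)
next
  fix v w :: "'i \<Rightarrow> 'v" assume vw: "\<And>k. k \<in> A \<Longrightarrow> v k = w k"
  have "H v = H w" by (rule multilinear_on_cong[OF H]) (use vw in auto)
  then show "\<omega> (v i) (v j) * H v = \<omega> (w i) (w j) * H w" using vw ij by simp
qed

lemma multilinear_on_mform: "ps \<in> matchings A \<Longrightarrow> multilinear_on A (mform ps)"
proof (induction ps arbitrary: A)
  case Nil
  then show ?case by (auto simp: matchings_def mform_simps intro!: multilinear_onI)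
next
  case (Cons p ps)
  obtain i j where p: "p = (i, j)" by (cases p)
  then show ?case
    using Cons multilinear_on_pair[of A i j "mform ps"] by (simp add: matchings_Cons mform_simps[abs_def])
qed

lemma invariant_mform: "invariant (mform ps)"
  unfolding invariant_def
proof (intro ballI allI)
  fix g v assume "g \<in> isometry_group \<omega>"
  then show "mform ps (g \<circ> v) = mform ps v"
    by (induction ps) (auto simp: mform_simps isometryD)
qed

lemma csubspace_invariant: "csubspace {F :: ('i \<Rightarrow> 'v) \<Rightarrow> complex. invariant F}"
  by (rule complex_vector.subspaceI) (simp_all add: invariant_def scaleC_fun_def)

lemma cspan_mform_invariant:
  assumes "F \<in> cspan (mform ` matchings A)"
  shows "multilinear_on A F" "invariant F"
proof -
  have "cspan (mform ` matchings A) \<subseteq> {F. multilinear_on A F}"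
    by (rule complex_vector.span_minimal[OF _ csubspace_multilinear_on]) (auto intro: multilinear_on_mform)
  moreover have "cspan (mform ` matchings A) \<subseteq> {F. invariant F}"
    by (rule complex_vector.span_minimal[OF _ csubspace_invariant]) (auto intro: invariant_mform)
  ultimately show "multilinear_on A F" "invariant F" using assms by auto
qed

lemma cspan_mform_transpose:
  assumes "F \<in> cspan (mform ` matchings A)" "i \<in> A" "k \<in> A"
  shows "(\<lambda>v. F (v \<circ> transpose i k)) \<in> cspan (mform ` matchings A)"
proof (rule cspan_linear_image[OF _ _ assms(1)])
  show "clinear (\<lambda>F v. F (v \<circ> transpose i k))"
    by (rule clinearI) (auto simp: fun_eq_iff scaleC_fun_def)
  fix F assume "F \<in> mform ` matchings A"
  then obtain ps where ps: "ps \<in> matchings A" "F = mform ps" by blast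
  have "mform ps (v \<circ> transpose i k) = mform (map (map_prod (transpose i k) (transpose i k)) ps) v" for v
    by (simp add: mform_def o_def case_prod_unfold)
  then have "(\<lambda>v. F (v \<circ> transpose i k)) = mform (map (map_prod (transpose i k) (transpose i k)) ps)"
    by (simp add: ps fun_eq_iff)
  then show "(\<lambda>v. F (v \<circ> transpose i k)) \<in> cspan (mform ` matchings A)"
    using transpose_matching[OF ps(1) assms(2,3)] by (auto intro: complex_vector.span_base)
qed

lemma cspan_mform_pair:
  assumes "H \<in> cspan (mform ` matchings (A - {i, j}))" "i \<in> A" "j \<in> A" "i \<noteq> j"
  shows "(\<lambda>v. \<omega> (v i) (v j) * H v) \<in> cspan (mform ` matchings A)"
proof (rule cspan_linear_image[OF _ _ assms(1)])
  show "clinear (\<lambda>H v. \<omega> (v i) (v j) * H v)"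
    by (rule clinearI) (auto simp: fun_eq_iff scaleC_fun_def scaleC_complex_def algebra_simps)
  fix H assume "H \<in> mform ` matchings (A - {i, j})"
  then obtain ps where ps: "ps \<in> matchings (A - {i, j})" "H = mform ps" by blast
  have "(\<lambda>v. \<omega> (v i) (v j) * H v) = mform ((i, j) # ps)"
    by (simp add: fun_eq_iff mform_simps ps)
  moreover have "(i, j) # ps \<in> matchings A" using ps assms by (simp add: matchings_Cons)
  ultimately show "(\<lambda>v. \<omega> (v i) (v j) * H v) \<in> cspan (mform ` matchings A)"
    by (auto intro: complex_vector.span_base)
qed

text \<open>Gives both signs one basis to take coordinates in. For \<epsilon> = 1 it must be
  orthonormal, so that the reflection in a basis vector acts on words by signs.\<close>

lemma adapted_basis:
  obtains b bd where "bilinear_space \<omega> b bd n \<epsilon>" "\<epsilon> = 1 \<Longrightarrow> bd = b"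
proof (cases "\<epsilon> = 1")
  case True
  obtain b where b: "is_basis n b" "is_dual_basis \<omega> n b b" using orthonormal_basis[OF True] .
  show ?thesis
    by (rule that[of b b, OF bilinear_space.intro[OF b(1) nondeg b(2) sym eps]]) simp
next
  case False
  show ?thesis by (rule that[of f fd, OF bilinear_space_axioms]) (use False in simp)
qed

text \<open>A form orthogonal to all matching forms is annihilated by the Casimir relation, so that its
  coordinates satisfy the hypotheses of \<open>skew_words_vanish\<close> or \<open>symmetric_words_multilinear\<close>;
  in the symmetric case a reflection changes its sign.\<close>

theorem first_fundamental_theorem:
  fixes F :: "('i \<Rightarrow> 'v) \<Rightarrow> complex"
  assumes "finite A" "multilinear_on A F" "invariant F"
  shows "F \<in> cspan (mform ` matchings A)"
  using assms
proof (induction "card A" arbitrary: A F rule: less_induct)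
  case less
  note A = less.prems(1)
  let ?M = "cspan (mform ` matchings A) :: (('i \<Rightarrow> 'v) \<Rightarrow> complex) set"
  show ?case
  proof (cases "A = {}")
    case True
    have "F v = F (\<lambda>_. 0)" for v
      by (rule multilinear_on_cong[OF less.prems(2)]) (use True in simp)
    then have "F = F (\<lambda>_. 0) *\<^sub>C mform []"
      by (simp add: fun_eq_iff scaleC_fun_def scaleC_complex_def mform_simps)
    moreover have "mform [] \<in> ?M"
      using matchings_Nil True by (auto intro: complex_vector.span_base)
    ultimately show ?thesis by (metis complex_vector.span_scale)
  next
    case False
    obtain b bd where "bilinear_space \<omega> b bd n \<epsilon>" and bd: "\<epsilon> = 1 \<Longrightarrow> bd = b"
      using adapted_basis by blast
    then interpret b: bilinear_space \<omega> b bd n \<epsilon> by simp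
    define N where "N = {1..n}"
    define W where "W = PiE A (\<lambda>_. N)"
    define ev where "ev F w = F (b \<circ> w)" for F :: "('i \<Rightarrow> 'v) \<Rightarrow> complex" and w :: "'i \<Rightarrow> nat"
    have N: "finite N" "card N = n" by (simp_all add: N_def)
    have fW: "finite W" using A N by (simp add: W_def finite_PiE)
    have lin: "clinear ev" by (rule clinearI) (auto simp: ev_def fun_eq_iff scaleC_fun_def)
    have tr: "w \<circ> transpose i j \<in> W" if "w \<in> W" "i \<in> A" "j \<in> A" for w i j
      using that by (auto simp: W_def transpose_def PiE_iff extensional_def)
    have span_ev: "cspan (ev ` mform ` matchings A) = ev ` ?M"
      by (rule complex_vector_pair.linear_span_image[OF lin])
    \<comment> \<open>\<open>F0\<close> has as coordinates the orthogonal projection of those of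
      \<open>F\<close>; the rest of the proof shows that \<open>F - F0\<close> vanishes.\<close>
    obtain F0 where F0: "F0 \<in> ?M" and orth: "\<And>G. G \<in> ?M \<Longrightarrow> ip W (ev G) (ev F - ev F0) = 0"
      using orthogonal_projection[of "ev ` mform ` matchings A" W "ev F"] finite_matchings[OF A] fW
      unfolding span_ev by auto
    define F' where "F' = F - F0"
    have F': "multilinear_on A F'" "invariant F'"
      using complex_vector.subspace_diff[OF csubspace_multilinear_on, of F A F0]
        complex_vector.subspace_diff[OF csubspace_invariant, of F F0] less.prems
        cspan_mform_invariant[OF F0] by (simp_all add: F'_def)
    have orth: "ip W (ev G) (ev F') = 0" if "G \<in> ?M" for G
      using orth[OF that] clinear_diff[OF lin, of F F0] by (simp add: F'_def)
    have rel: "(of_nat (card N) - \<epsilon>) * ev F' w + (\<Sum>i\<in>A - {k}. ev F' (w \<circ> transpose k i)) = 0"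
      if k: "k \<in> A" and w: "w \<in> W" for k w
    proof -
      \<comment> \<open>\<open>R\<close> is the contraction side of the Casimir identity and lies in
        the span by induction, contractions having two slots fewer. Its coordinates are also given
        by the transposition side, which is orthogonal to the span because the span is stable under
        transpositions. So \<open>R\<close> is orthogonal to itself.\<close>
      define R where "R = (\<Sum>i\<in>A - {k}. \<epsilon> *\<^sub>C (\<lambda>v. \<omega> (v i) (v k) * contraction k i F' v))"
      have R: "R \<in> ?M"
        unfolding R_def
      proof (intro complex_vector.span_sum complex_vector.span_scale)
        fix i assume i: "i \<in> A - {k}"
        have "card (A - {i, k}) < card A"
          by (rule psubset_card_mono) (use A k i in auto)
        moreover have "multilinear_on (A - {i, k}) (contraction k i F')"
          using multilinear_on_contraction[OF F'(1) k, of i] i by (auto simp: insert_commute)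
        ultimately have "contraction k i F' \<in> cspan (mform ` matchings (A - {i, k}))"
          using less.hyps A invariant_contraction[OF F' k, of i] i by auto
        then show "(\<lambda>v. \<omega> (v i) (v k) * contraction k i F' v) \<in> ?M"
          by (rule cspan_mform_pair) (use i k in auto)
      qed
      have sum_app: "(sum h K) x = (\<Sum>i\<in>K. h i x)" for h :: "'i \<Rightarrow> ('i \<Rightarrow> 'v) \<Rightarrow> complex" and K x
        by (induction K rule: infinite_finite_induct) simp_all
      have evR: "ev R w = (of_nat (card N) - \<epsilon>) * ev F' w + (\<Sum>i\<in>A - {k}. ev F' (w \<circ> transpose k i))" for w
        using casimir_identity[OF F'(1) A F'(2) k, of "b \<circ> w"]
        by (simp add: ev_def R_def sum_app scaleC_fun_def scaleC_complex_def N o_assoc mult.assoc)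
      have "ip W (ev G) (ev R) = 0" if G: "G \<in> ?M" for G
      proof -
        have sw: "(\<Sum>w\<in>W. cnj (ev G w) * ev F' (w \<circ> transpose k i)) = 0" if i: "i \<in> A" for i
        proof -
          have inv: "w \<circ> transpose k i \<circ> transpose k i = w" for w :: "'i \<Rightarrow> nat"
            by (simp add: fun_eq_iff)
          have "(\<Sum>w\<in>W. cnj (ev G w) * ev F' (w \<circ> transpose k i))
            = (\<Sum>w\<in>W. cnj (ev G (w \<circ> transpose k i)) * ev F' w)"
            by (rule sum.reindex_bij_witness[where i = "\<lambda>w. w \<circ> transpose k i" and j = "\<lambda>w. w \<circ> transpose k i"])
              (use tr k i in \<open>simp_all add: inv\<close>)
          also have "\<dots> = ip W (ev (\<lambda>v. G (v \<circ> transpose k i))) (ev F')"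
            by (simp add: ip_def ev_def o_assoc)
          also have "\<dots> = 0" by (rule orth[OF cspan_mform_transpose[OF G k i]])
          finally show ?thesis .
        qed
        have "ip W (ev G) (ev R) = (of_nat (card N) - \<epsilon>) * ip W (ev G) (ev F')
          + (\<Sum>w\<in>W. \<Sum>i\<in>A - {k}. cnj (ev G w) * ev F' (w \<circ> transpose k i))"
          by (simp add: ip_def evR distrib_left sum.distrib sum_distrib_left mult_ac)
        also have "(\<Sum>w\<in>W. \<Sum>i\<in>A - {k}. cnj (ev G w) * ev F' (w \<circ> transpose k i))
          = (\<Sum>i\<in>A - {k}. \<Sum>w\<in>W. cnj (ev G w) * ev F' (w \<circ> transpose k i))"
          by (rule sum.swap)
        also have "\<dots> = 0" by (rule sum.neutral) (use sw in auto)
        finally show ?thesis using orth[OF G] by simp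
      qed
      from ip_self_eq_0[OF fW this[OF R] w] show ?thesis using evR by simp
    qed
    have zero: "ev F' w = 0" if w: "w \<in> W" for w
      using eps
    proof
      assume e: "\<epsilon> = - 1"
      show ?thesis
        by (rule skew_words_vanish[OF A False N(1) rel[unfolded W_def e] w[unfolded W_def]])
    next
      assume e: "\<epsilon> = 1"
      show ?thesis
      proof (rule ccontr)
        assume nz: "ev F' w \<noteq> 0"
        obtain k where k: "k \<in> A" using False by blast
        then have "w k \<in> {1..n}" using w by (auto simp: W_def N_def)
        \<comment> \<open>The word \<open>w\<close> has at least one letter, so the basis is
          nonempty and \<open>b 1\<close> can serve for the reflection.\<close>
        then have one: "1 \<in> N" by (auto simp: N_def)
        have "card {i \<in> A. w i = 1} = 1"
          by (rule symmetric_words_multilinear[OF A False N(1) rel[unfolded W_def e] w[unfolded W_def] nz one])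
        then obtain i0 where i0: "{i \<in> A. w i = 1} = {i0}" by (auto simp: card_1_singleton_iff)
        define g where "g x = x - (2 * \<omega> x (b 1)) *\<^sub>C b 1" for x
        have o: "\<omega> (b p) (b q) = (if p = q then 1 else 0)" if "p \<in> N" "q \<in> N" for p q
          using b.omega_dual[of p q] that bd[OF e] by (simp add: N_def)
        have g: "g \<in> isometry_group \<omega>"
          using reflection[OF e o[OF one one, simplified]] by (simp add: g_def[abs_def])
        have g1: "g (b 1) = - b 1"
        proof -
          have "g (b 1) = b 1 - (1 + 1) *\<^sub>C b 1" unfolding g_def o[OF one one] by simp
          then show ?thesis by (simp only: scaleC_add_left scaleC_one) simp
        qed
        have gp: "g (b p) = b p" if "p \<in> N" "p \<noteq> 1" for p
          using o[OF that(1) one] that by (simp add: g_def)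
        have "ev F' w = F' (g \<circ> (b \<circ> w))" using F'(2) g by (simp add: ev_def invariant_def)
        \<comment> \<open>The reflection negates \<open>b 1\<close>, which stands in slot
          \<open>i0\<close> only, and fixes the other basis vectors.\<close>
        also have "\<dots> = F' ((b \<circ> w)(i0 := - b 1))"
        proof (rule multilinear_on_cong[OF F'(1)])
          fix i assume i: "i \<in> A"
          have "w i \<in> N" using w i by (auto simp: W_def)
          moreover have "w i = 1 \<longleftrightarrow> i = i0" using i0 i by auto
          ultimately show "(g \<circ> (b \<circ> w)) i = ((b \<circ> w)(i0 := - b 1)) i"
            using g1 gp by (cases "i = i0") auto
        qed
        also have "\<dots> = - F' ((b \<circ> w)(i0 := b 1))"
          by (rule multilinear_on_upd(5)[OF F'(1)]) (use i0 in auto)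
        also have "(b \<circ> w)(i0 := b 1) = b \<circ> w"
        proof -
          have "w i0 = 1" using i0 by blast
          then show ?thesis by (auto simp: fun_eq_iff)
        qed
        finally show False using nz by (simp add: ev_def o_def eq_neg_iff_add_eq_0 flip: mult_2)
      qed
    qed
    have "F' v = 0" for v
    proof -
      have "F' v = (\<Sum>w\<in>PiE A (\<lambda>_. N). (\<Prod>i\<in>A. \<omega> (v i) (bd (w i))) *\<^sub>C F' (b \<circ> w))"
        by (rule multilinear_on_expand[OF F'(1) A N(1), where c = "\<lambda>i p. \<omega> (v i) (bd p)"])
          (unfold N_def, rule b.expand_basis)
      also have "\<dots> = 0"
        by (rule sum.neutral) (use zero in \<open>auto simp: ev_def W_def\<close>)
      finally show ?thesis .
    qed
    then have "F = F0" by (auto simp: F'_def fun_eq_iff)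
    then show ?thesis using F0 by simp
  qed
qed

end

section \<open>Tensor powers\<close>

lemma csubspace_tpow: "csubspace (tpow l)"
  by (simp add: tpow_def)

lemma pure_in_tpow: "length vs = l \<Longrightarrow> pure vs \<in> tpow l"
  unfolding tpow_def by (auto intro: complex_vector.span_base)

lemma HomI:
  assumes "\<And>x. x \<in> S \<Longrightarrow> h x \<in> S'" "\<And>x y. x \<in> S \<Longrightarrow> y \<in> S \<Longrightarrow> h (x + y) = h x + h y"
    "\<And>c x. x \<in> S \<Longrightarrow> h (c *\<^sub>C x) = c *\<^sub>C h x" "\<And>x. x \<notin> S \<Longrightarrow> h x = 0"
  shows "h \<in> Hom S S'"
  using assms by (simp add: Hom_def)

lemma HomD:
  assumes "h \<in> Hom S S'"
  shows "x \<in> S \<Longrightarrow> h x \<in> S'" "x \<in> S \<Longrightarrow> y \<in> S \<Longrightarrow> h (x + y) = h x + h y"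
    "x \<in> S \<Longrightarrow> h (c *\<^sub>C x) = c *\<^sub>C h x" "x \<notin> S \<Longrightarrow> h x = 0"
  using assms by (auto simp: Hom_def)

lemma Hom_0: "h \<in> Hom S S' \<Longrightarrow> csubspace S \<Longrightarrow> h 0 = 0"
  using HomD(3)[of h S S' 0 0] complex_vector.subspace_0[of S] by simp

lemma Hom_sum:
  assumes "h \<in> Hom S S'" "csubspace S" "\<And>k. k \<in> K \<Longrightarrow> x k \<in> S"
  shows "h (sum x K) = (\<Sum>k\<in>K. h (x k))"
  using assms(3)
proof (induction K rule: infinite_finite_induct)
  case (insert a K)
  have "sum x K \<in> S" by (rule complex_vector.subspace_sum[OF assms(2)]) (use insert.prems in auto)
  then show ?case using insert HomD(2)[OF assms(1), of "x a" "sum x K"] by simp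
qed (simp_all add: Hom_0[OF assms(1,2)])

lemma Hom_mono: "h \<in> Hom S S' \<Longrightarrow> S' \<subseteq> S'' \<Longrightarrow> h \<in> Hom S S''"
  by (auto simp: Hom_def)

lemma Hom_comp:
  assumes h: "h \<in> Hom S S'" and k: "k \<in> Hom S' S''" "csubspace S'"
  shows "k \<circ> h \<in> Hom S S''"
  by (rule HomI) (simp_all add: HomD[OF h] HomD[OF k(1)] Hom_0[OF k])

lemma csubspace_Hom:
  assumes "csubspace S'"
  shows "csubspace (Hom S S')"
proof (rule complex_vector.subspaceI)
  show "0 \<in> Hom S S'" by (rule HomI) (simp_all add: complex_vector.subspace_0[OF assms])
  show "h + k \<in> Hom S S'" if "h \<in> Hom S S'" "k \<in> Hom S S'" for h k
    by (rule HomI) (simp_all add: HomD[OF that(1)] HomD[OF that(2)]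
        complex_vector.subspace_add[OF assms] scaleC_add_right)
  show "c *\<^sub>C h \<in> Hom S S'" if "h \<in> Hom S S'" for c h
    by (rule HomI) (simp_all add: scaleC_fun_def HomD[OF that]
        complex_vector.subspace_scale[OF assms] scaleC_add_right scaleC_scaleC mult.commute)
qed

lemma idmap_Hom: "csubspace S \<Longrightarrow> idmap S \<in> Hom S S"
  by (rule HomI) (auto simp: idmap_def complex_vector.subspace_add complex_vector.subspace_scale)

lemma Hom_idmap:
  assumes "h \<in> Hom S S'" "csubspace S"
  shows "h \<circ> idmap S = h"
  using HomD(4)[OF assms(1)] Hom_0[OF assms] by (auto simp: fun_eq_iff idmap_def)

lemma idmap_Hom_comp: "h \<in> Hom S S' \<Longrightarrow> csubspace S' \<Longrightarrow> idmap S' \<circ> h = h"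
  by (auto simp: fun_eq_iff idmap_def) (metis HomD(1,4) complex_vector.subspace_0)

lemma tpow_eqI:
  assumes h: "h \<in> Hom (tpow l) UNIV" and k: "k \<in> Hom (tpow l) UNIV"
    and eq: "\<And>vs. length vs = l \<Longrightarrow> h (pure vs) = k (pure vs)" and x: "x \<in> tpow l"
  shows "h x = k x"
proof -
  have sub: "csubspace {x \<in> tpow l. h x = k x}"
    by (rule complex_vector.subspaceI)
      (auto simp: HomD[OF h] HomD[OF k] Hom_0[OF h csubspace_tpow] Hom_0[OF k csubspace_tpow]
        complex_vector.subspace_0[OF csubspace_tpow] complex_vector.subspace_add[OF csubspace_tpow]
        complex_vector.subspace_scale[OF csubspace_tpow])
  have "tpow l \<subseteq> {x \<in> tpow l. h x = k x}"
    unfolding tpow_def[of l]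
    by (rule complex_vector.span_minimal[OF _ sub[unfolded tpow_def]])
      (use eq pure_in_tpow in \<open>auto simp: tpow_def\<close>)
  then show ?thesis using x by blast
qed

lemma Hom_tpow_eqI:
  assumes h: "h \<in> Hom (tpow l) S" and k: "k \<in> Hom (tpow l) S'"
    and eq: "\<And>vs. length vs = l \<Longrightarrow> h (pure vs) = k (pure vs)"
  shows "h = k"
proof
  fix x
  show "h x = k x"
    using tpow_eqI[OF Hom_mono[OF h subset_UNIV] Hom_mono[OF k subset_UNIV] eq]
      HomD(4)[OF h] HomD(4)[OF k] by (cases "x \<in> tpow l") auto
qed

lemma Hom_tpow_range:
  assumes h: "h \<in> Hom (tpow l) UNIV" and S: "csubspace S"
    and eq: "\<And>vs. length vs = l \<Longrightarrow> h (pure vs) \<in> S"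
  shows "h \<in> Hom (tpow l) S"
proof -
  have sub: "csubspace {x \<in> tpow l. h x \<in> S}"
    by (rule complex_vector.subspaceI)
      (auto simp: HomD[OF h] Hom_0[OF h csubspace_tpow] S complex_vector.subspace_0
        complex_vector.subspace_add csubspace_tpow complex_vector.subspace_scale)
  have "tpow l \<subseteq> {x \<in> tpow l. h x \<in> S}"
    unfolding tpow_def[of l]
    by (rule complex_vector.span_minimal[OF _ sub[unfolded tpow_def]])
      (use eq pure_in_tpow in \<open>auto simp: tpow_def\<close>)
  then show ?thesis using h by (auto simp: Hom_def)
qed

lemma tlift_Hom:
  assumes "multilinear l F" "\<And>vs. length vs = l \<Longrightarrow> F vs \<in> tpow k"
  shows "tlift l F \<in> Hom (tpow l) (tpow k)"
  by (rule Hom_tpow_range[OF tlift(1)[OF assms(1)] csubspace_tpow]) (simp add: tlift(2)[OF assms(1)] assms(2))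

lemma multilinear_clinear: "multilinear l F \<Longrightarrow> length vs = l \<Longrightarrow> i < l \<Longrightarrow> clinear (\<lambda>x. F (vs[i := x]))"
  by (simp add: multilinear_def)

lemma multilinearI:
  assumes "\<And>vs i. length vs = l \<Longrightarrow> i < l \<Longrightarrow> clinear (\<lambda>x. F (vs[i := x]))"
  shows "multilinear l F"
  using assms by (simp add: multilinear_def)

lemma pure_eval: "length vs = l \<Longrightarrow> multilinear l m \<Longrightarrow> pure vs m = m vs"
  by (simp add: pure_def)

lemma multilinear_pure: "multilinear l pure"
proof (rule multilinearI, rule clinearI)
  fix vs :: "'a list" and i x y c assume l: "length vs = l" "i < l"
  show "pure (vs[i := x + y]) = pure (vs[i := x]) + pure (vs[i := y])"
    using clinear_add[OF multilinear_clinear[OF _ l]] by (auto simp: fun_eq_iff pure_def l)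
  show "pure (vs[i := c *\<^sub>C x]) = c *\<^sub>C pure (vs[i := x])"
    using clinear_scale[OF multilinear_clinear[OF _ l]] by (auto simp: fun_eq_iff pure_def l scaleC_fun_def)
qed

text \<open>Maps on tensor powers are computed below through their transposes, acting on multilinear forms.\<close>

lemma scaleC_apply: "(c *\<^sub>C h) x = c *\<^sub>C h x"
  by (simp add: scaleC_fun_def)

lemma tpow_eval_eqI:
  assumes h: "h \<in> Hom (tpow l) (tpow k)" and x: "x \<in> tpow l"
    and eq: "\<And>vs. length vs = l \<Longrightarrow> h (pure vs) m = (\<Sum>a\<in>K. c a * m' a vs)"
    and m': "\<And>a. a \<in> K \<Longrightarrow> multilinear l (m' a)"
  shows "h x m = (\<Sum>a\<in>K. c a * x (m' a))"
proof -
  let ?h = "\<lambda>x. if x \<in> tpow l then h x m else 0"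
  let ?k = "\<lambda>x. if x \<in> tpow l then (\<Sum>a\<in>K. c a * x (m' a)) else 0"
  have "?h x = ?k x"
  proof (rule tpow_eqI[OF _ _ _ x])
    show "?h \<in> Hom (tpow l) UNIV"
      by (rule HomI) (auto simp: complex_vector.subspace_add[OF csubspace_tpow]
        complex_vector.subspace_scale[OF csubspace_tpow] HomD[OF h] scaleC_apply)
    show "?k \<in> Hom (tpow l) UNIV"
      by (rule HomI) (auto simp: complex_vector.subspace_add[OF csubspace_tpow]
        complex_vector.subspace_scale[OF csubspace_tpow] scaleC_apply scaleC_complex_def
        algebra_simps sum.distrib sum_distrib_left)
    fix vs :: "'a list" assume l: "length vs = l"
    then have "(\<Sum>a\<in>K. c a * pure vs (m' a)) = (\<Sum>a\<in>K. c a * m' a vs)"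
      by (intro sum.cong refl) (simp add: pure_eval m')
    then show "?h (pure vs) = ?k (pure vs)" using eq[OF l] pure_in_tpow[OF l] by simp
  qed
  then show ?thesis using x by simp
qed

lemma tpow_eval_eq1:
  assumes h: "h \<in> Hom (tpow l) (tpow k)" and x: "x \<in> tpow l"
    and eq: "\<And>vs. length vs = l \<Longrightarrow> h (pure vs) m = c * m' vs" and m': "multilinear l m'"
  shows "h x m = c * x m'"
  using tpow_eval_eqI[OF h x, where m = m and K = "{()}" and c = "\<lambda>_. c" and m' = "\<lambda>_. m'"] eq m' by simp

text \<open>A tensor is a function of arbitrary functions on lists. It is linear in its multilinear
  argument only because it lies in the span of the pure tensors, where evaluation is linear.\<close>

lemma tpow_form_linear:
  assumes x: "x \<in> tpow l" and m: "\<And>a. a \<in> K \<Longrightarrow> multilinear l (m a)"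
    and m0: "multilinear l m0" and eq: "\<And>vs. length vs = l \<Longrightarrow> m0 vs = (\<Sum>a\<in>K. c a * m a vs)"
  shows "x m0 = (\<Sum>a\<in>K. c a * x (m a))"
proof -
  have "idmap (tpow l) x m0 = (\<Sum>a\<in>K. c a * x (m a))"
    by (rule tpow_eval_eqI[OF idmap_Hom[OF csubspace_tpow] x])
      (use eq m in \<open>auto simp: idmap_def pure_in_tpow pure_eval m0\<close>)
  then show ?thesis using x by (simp add: idmap_def)
qed

lemma multilinear_on_list:
  assumes "multilinear l F"
  shows "multilinear_on {..<l} (\<lambda>v. F (map v [0..<l]))"
proof -
  have upd: "map (v(i := x)) [0..<l] = (map v [0..<l])[i := x]" if "i < l" for v :: "nat \<Rightarrow> 'a" and i x
    by (rule nth_equalityI) (use that in \<open>auto simp: nth_list_update\<close>)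
  show ?thesis
    unfolding multilinear_on_def
  proof (intro conjI allI ballI impI)
    fix v :: "nat \<Rightarrow> 'a" and i assume "i \<in> {..<l}"
    then have i: "i < l" by simp
    show "clinear (\<lambda>x. F (map (v(i := x)) [0..<l]))"
      unfolding upd[OF i] by (rule multilinear_clinear[OF assms _ i]) simp
  next
    fix v w :: "nat \<Rightarrow> 'a" assume "\<forall>i\<in>{..<l}. v i = w i"
    then have "map v [0..<l] = map w [0..<l]" by auto
    then show "F (map v [0..<l]) = F (map w [0..<l])" by (rule arg_cong)
  qed
qed

section \<open>Order-preserving numbering of a set of slots\<close>

definition enum :: "nat set \<Rightarrow> nat \<Rightarrow> nat"
  where "enum I k = sorted_list_of_set I ! k"

text \<open>Inverse of \<open>enum I\<close> on \<open>I\<close>, in the form in which positions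
  occur in \<open>slots_in\<close>; \<open>enum\<close> is the form that fits
  \<open>slots_out\<close>.\<close>

definition rank :: "nat set \<Rightarrow> nat \<Rightarrow> nat"
  where "rank I i = card {k \<in> I. k < i}"

lemma enum_in: "finite I \<Longrightarrow> k < card I \<Longrightarrow> enum I k \<in> I"
  unfolding enum_def by (metis length_sorted_list_of_set nth_mem set_sorted_list_of_set)

lemma enum_less: "finite I \<Longrightarrow> k < k' \<Longrightarrow> k' < card I \<Longrightarrow> enum I k < enum I k'"
  unfolding enum_def
  by (rule sorted_wrt_nth_less[OF strict_sorted_list_of_set]) auto

lemma enum_surj: "finite I \<Longrightarrow> i \<in> I \<Longrightarrow> \<exists>k<card I. i = enum I k"
  unfolding enum_def by (metis in_set_conv_nth length_sorted_list_of_set set_sorted_list_of_set)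

lemma enum_less_iff: "finite I \<Longrightarrow> k < card I \<Longrightarrow> k' < card I \<Longrightarrow> enum I k < enum I k' \<longleftrightarrow> k < k'"
  using enum_less[of I k k'] enum_less[of I k' k] by (metis less_asym linorder_neqE_nat)

lemma rank_enum:
  assumes "finite I" "k < card I"
  shows "rank I (enum I k) = k"
proof -
  have "{j \<in> I. j < enum I k} = enum I ` {..<k}"
  proof (intro equalityI subsetI)
    fix j assume "j \<in> {j \<in> I. j < enum I k}"
    then obtain k' where "k' < card I" "j = enum I k'" "enum I k' < enum I k"
      using enum_surj[OF assms(1)] by auto
    then show "j \<in> enum I ` {..<k}" using assms enum_less_iff by auto
  qed (use assms in \<open>auto intro: enum_in enum_less\<close>)
  moreover have "inj_on (enum I) {..<k}"
    by (rule inj_onI) (metis assms enum_less lessThan_iff less_trans linorder_neqE_nat less_irrefl)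
  ultimately show ?thesis by (simp add: rank_def card_image)
qed

lemma enum_rank: "finite I \<Longrightarrow> i \<in> I \<Longrightarrow> enum I (rank I i) = i"
  using enum_surj rank_enum by metis

lemma rank_less: "finite I \<Longrightarrow> i \<in> I \<Longrightarrow> rank I i < card I"
  using enum_surj rank_enum by metis

lemma bij_enum: "finite I \<Longrightarrow> bij_betw (enum I) {..<card I} I"
  by (rule bij_betw_byWitness[where f' = "rank I"]) (auto simp: rank_enum enum_rank enum_in rank_less)

lemma map_sorted_list: "finite I \<Longrightarrow> map g (sorted_list_of_set I) = map (g \<circ> enum I) [0..<card I]"
  by (rule nth_equalityI) (auto simp: enum_def)

section \<open>Multilinearity of the structure maps\<close>

text \<open>The structure maps send a list to sums of scalar multiples of pure tensors, and an
  argument slot influences either the scalar or one entry of the resulting list, never both.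
  Checking these two cases replaces a separate proof for each map.\<close>

lemma multilinear_slots:
  fixes G :: "'a::complex_vector list \<Rightarrow> 'b::complex_vector list"
  assumes "\<And>vs i. length vs = l \<Longrightarrow> i < l \<Longrightarrow>
      (\<exists>ys. clinear (\<lambda>x. c (vs[i := x])) \<and> (\<forall>x. G (vs[i := x]) = ys))
    \<or> (\<exists>ys a L b. length ys = k \<and> a < k \<and> clinear L \<and> (\<forall>x. c (vs[i := x]) = b \<and> G (vs[i := x]) = ys[a := L x]))"
  shows "multilinear l (\<lambda>vs. c vs *\<^sub>C pure (G vs))"
proof (rule multilinearI)
  fix vs :: "'a list" and i assume l: "length vs = l" "i < l"
  from assms[OF l] show "clinear (\<lambda>x. c (vs[i := x]) *\<^sub>C pure (G (vs[i := x])))"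
  proof (elim disjE exE conjE)
    fix ys assume "clinear (\<lambda>x. c (vs[i := x]))" "\<forall>x. G (vs[i := x]) = ys"
    then show ?thesis
      by (auto simp: clinear_iff scaleC_add_left scaleC_complex_def scaleC_scaleC)
  next
    fix ys a L b assume *: "length ys = k" "a < k" "clinear L"
      "\<forall>x. c (vs[i := x]) = b \<and> G (vs[i := x]) = ys[a := L x]"
    have "clinear (\<lambda>x. b *\<^sub>C pure (ys[a := L x]))"
      by (intro clinear_compose_scale clinear_compose[OF *(3) multilinear_clinear[OF multilinear_pure *(1,2)]])
    then show ?thesis using * by simp
  qed
qed

lemma multilinear_slots1:
  fixes G :: "'a::complex_vector list \<Rightarrow> 'b::complex_vector list"
  assumes "\<And>vs i. length vs = l \<Longrightarrow> i < l \<Longrightarrow>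
    \<exists>ys a L. length ys = k \<and> a < k \<and> clinear L \<and> (\<forall>x. G (vs[i := x]) = ys[a := L x])"
  shows "multilinear l (\<lambda>vs. pure (G vs))"
proof -
  have "multilinear l (\<lambda>vs. 1 *\<^sub>C pure (G vs))"
    by (rule multilinear_slots[where k = k]) (use assms in metis)
  then show ?thesis by (simp add: scaleC_one)
qed

lemma multilinear_sum:
  assumes "\<And>p. p \<in> K \<Longrightarrow> multilinear l (F p)"
  shows "multilinear l (\<lambda>vs. \<Sum>p\<in>K. F p vs)"
  using assms unfolding multilinear_def by (auto intro: clinear_compose_sum)

lemma multilinear_prod:
  assumes "\<And>i. i < l \<Longrightarrow> clinear (\<phi> i)"
  shows "multilinear l (\<lambda>vs. \<Prod>i<l. (\<phi> i (vs ! i) :: complex))"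
proof (rule multilinearI)
  fix vs :: "'a list" and k assume l: "length vs = l" "k < l"
  have "(\<Prod>i<l. \<phi> i (vs[k := x] ! i)) = (\<Prod>i\<in>{..<l} - {k}. \<phi> i (vs ! i)) *\<^sub>C \<phi> k x" for x
  proof -
    have "(\<Prod>i<l. \<phi> i (vs[k := x] ! i)) = \<phi> k (vs[k := x] ! k) * (\<Prod>i\<in>{..<l} - {k}. \<phi> i (vs[k := x] ! i))"
      by (rule prod.remove) (use l in auto)
    also have "(\<Prod>i\<in>{..<l} - {k}. \<phi> i (vs[k := x] ! i)) = (\<Prod>i\<in>{..<l} - {k}. \<phi> i (vs ! i))"
      by (rule prod.cong) (use l in auto)
    finally show ?thesis using l by (simp add: scaleC_complex_def mult.commute)
  qed
  then show "clinear (\<lambda>x. \<Prod>i<l. \<phi> i (vs[k := x] ! i))"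
    using clinear_compose_scale[OF assms[OF l(2)]] by simp
qed

lemma clinear_fst: "clinear fst" and clinear_snd: "clinear snd"
  by (rule clinearI; simp add: scaleC_prod_def)+

lemma clinear_slot: "clinear (\<lambda>z. if b then (fst z, 0) else (0, snd z))"
  by (rule clinearI) (auto simp: scaleC_prod_def scaleC_complex_def)

lemma clinear_in_ext: "clinear (\<lambda>x. (x, 0::complex))"
  by (rule clinearI) (auto simp: scaleC_prod_def scaleC_complex_def)

lemma map_nth_upd: "i < length vs \<Longrightarrow> length vs = r \<Longrightarrow>
    map (\<lambda>k. L k (vs[i := x] ! k)) [0..<r] = (map (\<lambda>k. L k (vs ! k)) [0..<r])[i := L i x]"
  by (rule nth_equalityI) (auto simp: nth_list_update)

lemma multilinear_diag:
  assumes "clinear g"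
  shows "multilinear l (\<lambda>vs. pure (map g vs))"
  by (rule multilinear_slots1[where k = l]) (metis assms length_map map_update)

lemma diag_action_pure: "clinear g \<Longrightarrow> length vs = l \<Longrightarrow> diag_action l g (pure vs) = pure (map g vs)"
  unfolding diag_action_def by (rule tlift(2)[OF multilinear_diag])

lemma diag_action_Hom: "clinear g \<Longrightarrow> diag_action l g \<in> Hom (tpow l) (tpow l)"
  unfolding diag_action_def by (rule tlift_Hom[OF multilinear_diag]) (auto intro: pure_in_tpow)

lemma multilinear_perm:
  assumes \<sigma>: "\<sigma> permutes {..<l}"
  shows "multilinear l (\<lambda>vs. pure (permute_list (Hilbert_Choice.inv \<sigma>) vs))"
proof (rule multilinear_slots1[where k = l])
  fix vs :: "'a list" and i assume l: "length vs = l" "i < l"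
  have "permute_list (Hilbert_Choice.inv \<sigma>) (vs[i := x]) = (permute_list (Hilbert_Choice.inv \<sigma>) vs)[\<sigma> i := x]" for x
  proof (rule nth_equalityI)
    fix k assume "k < length (permute_list (Hilbert_Choice.inv \<sigma>) (vs[i := x]))"
    then have k: "k < l" using l by simp
    then have k': "Hilbert_Choice.inv \<sigma> k < l" using permutes_in_image[OF permutes_inv[OF \<sigma>], of k] by simp
    have "Hilbert_Choice.inv \<sigma> k = i \<longleftrightarrow> k = \<sigma> i"
      using permutes_inverses[OF \<sigma>] by metis
    then show "permute_list (Hilbert_Choice.inv \<sigma>) (vs[i := x]) ! k = (permute_list (Hilbert_Choice.inv \<sigma>) vs)[\<sigma> i := x] ! k"
      using k k' l by (auto simp: permute_list_def nth_list_update)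
  qed simp
  moreover have "\<sigma> i < l" using l permutes_in_image[OF \<sigma>, of i] by simp
  ultimately show "\<exists>ys a L. length ys = l \<and> a < l \<and> clinear L \<and>
      (\<forall>x. permute_list (Hilbert_Choice.inv \<sigma>) (vs[i := x]) = ys[a := L x])"
    using l clinear_ident by (metis length_permute_list)
qed

lemma perm_action_pure: "\<sigma> permutes {..<l} \<Longrightarrow> length vs = l \<Longrightarrow>
    perm_action l \<sigma> (pure vs) = pure (permute_list (Hilbert_Choice.inv \<sigma>) vs)"
  unfolding perm_action_def by (rule tlift(2)[OF multilinear_perm])

lemma perm_action_Hom: "\<sigma> permutes {..<l} \<Longrightarrow> perm_action l \<sigma> \<in> Hom (tpow l) (tpow l)"
  unfolding perm_action_def by (rule tlift_Hom[OF multilinear_perm]) (auto intro: pure_in_tpow)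

lemma multilinear_proj:
  "multilinear r (\<lambda>ws. pure (map (\<lambda>i. if i \<in> I then (fst (ws ! i), 0) else (0, snd (ws ! i))) [0..<r])
     :: 'v::complex_vector ext tensor)"
proof (rule multilinear_slots1[where k = r])
  fix vs :: "'v ext list" and i assume l: "length vs = r" "i < r"
  let ?L = "\<lambda>k z. if k \<in> I then (fst z, 0) else (0, snd z :: complex)"
  show "\<exists>ys a L. length ys = r \<and> a < r \<and> clinear L \<and>
    (\<forall>x. map (\<lambda>k. if k \<in> I then (fst (vs[i := x] ! k), 0) else (0, snd (vs[i := x] ! k))) [0..<r] = ys[a := L x])"
    by (intro exI[of _ "map (\<lambda>k. ?L k (vs ! k)) [0..<r]"] exI[of _ i] exI[of _ "?L i"])
      (use l map_nth_upd[of i vs r ?L] clinear_slot in auto)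
qed

lemma summand_proj_pure: "length ws = r \<Longrightarrow> summand_proj r I (pure ws) =
    pure (map (\<lambda>i. if i \<in> I then (fst (ws ! i), 0) else (0, snd (ws ! i))) [0..<r])"
  unfolding summand_proj_def by (rule tlift(2)[OF multilinear_proj])

lemma summand_proj_Hom: "summand_proj r I \<in> Hom (tpow r) (tpow r)"
  unfolding summand_proj_def by (rule tlift_Hom[OF multilinear_proj]) (auto intro: pure_in_tpow)

lemma multilinear_slots_in:
  assumes I: "I \<subseteq> {..<r}"
  shows "multilinear (card I) (\<lambda>vs. pure (map (\<lambda>i. if i \<in> I then (vs ! card {k \<in> I. k < i}, 0) else \<eta>) [0..<r])
    :: 'v::complex_vector ext tensor)"
proof (rule multilinear_slots1[where k = r])
  fix vs :: "'v list" and k assume l: "length vs = card I" "k < card I"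
  have fin: "finite I" using I by (rule finite_subset) simp
  have e: "enum I k < r" using enum_in[OF fin l(2)] I by auto
  have "map (\<lambda>i. if i \<in> I then (vs[k := x] ! rank I i, 0) else \<eta>) [0..<r]
    = (map (\<lambda>i. if i \<in> I then (vs ! rank I i, 0) else \<eta>) [0..<r])[enum I k := (x, 0)]" for x
  proof (rule nth_equalityI)
    fix i assume "i < length (map (\<lambda>i. if i \<in> I then (vs[k := x] ! rank I i, 0) else \<eta>) [0..<r])"
    then have i: "i < r" by simp
    show "map (\<lambda>i. if i \<in> I then (vs[k := x] ! rank I i, 0) else \<eta>) [0..<r] ! i
      = (map (\<lambda>i. if i \<in> I then (vs ! rank I i, 0) else \<eta>) [0..<r])[enum I k := (x, 0)] ! i"
      using i l e enum_in[OF fin l(2)] rank_enum[OF fin l(2)] enum_rank[OF fin, of i] rank_less[OF fin, of i]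
      by (auto simp: nth_list_update)
  qed simp
  then show "\<exists>ys a L. length ys = r \<and> a < r \<and> clinear L \<and>
     (\<forall>x. map (\<lambda>i. if i \<in> I then (vs[k := x] ! card {k \<in> I. k < i}, 0) else \<eta>) [0..<r] = ys[a := L x])"
    using e clinear_in_ext unfolding rank_def
    by (intro exI[of _ "map (\<lambda>i. if i \<in> I then (vs ! card {k \<in> I. k < i}, 0) else \<eta>) [0..<r]"] exI[of _ "enum I k"]
      exI[of _ "\<lambda>x. (x, 0)"]) simp
qed

lemma slots_in_pure: "I \<subseteq> {..<r} \<Longrightarrow> length vs = card I \<Longrightarrow> slots_in r I (pure vs) =
    pure (map (\<lambda>i. if i \<in> I then (vs ! rank I i, 0) else \<eta>) [0..<r])"
  unfolding slots_in_def rank_def by (rule tlift(2)[OF multilinear_slots_in])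

lemma slots_in_Hom: "I \<subseteq> {..<r} \<Longrightarrow> slots_in r I \<in> Hom (tpow (card I)) (tpow r)"
  unfolding slots_in_def by (rule tlift_Hom[OF multilinear_slots_in]) (auto intro: pure_in_tpow)

lemma clinear_prod_upd:
  assumes l: "length vs = r" "i < r" and S: "i \<in> S" "S \<subseteq> {..<r}" and \<phi>: "\<And>k. clinear (\<phi> k)"
  shows "clinear (\<lambda>x. \<Prod>k\<in>S. (\<phi> k (vs[i := x] ! k) :: complex))"
proof -
  have "(\<Prod>k\<in>S. \<phi> k (vs[i := x] ! k)) = (\<Prod>k\<in>S - {i}. \<phi> k (vs ! k)) *\<^sub>C \<phi> i x" for x
  proof -
    have "(\<Prod>k\<in>S. \<phi> k (vs[i := x] ! k)) = \<phi> i (vs[i := x] ! i) * (\<Prod>k\<in>S - {i}. \<phi> k (vs[i := x] ! k))"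
      by (rule prod.remove) (use S finite_subset in auto)
    also have "(\<Prod>k\<in>S - {i}. \<phi> k (vs[i := x] ! k)) = (\<Prod>k\<in>S - {i}. \<phi> k (vs ! k))"
      by (rule prod.cong) auto
    finally show ?thesis using l by (simp add: scaleC_complex_def mult.commute)
  qed
  then show ?thesis using clinear_compose_scale[OF \<phi>] by simp
qed

lemma multilinear_slots_out:
  assumes I: "I \<subseteq> {..<r}"
  shows "multilinear r (\<lambda>ws. (\<Prod>i\<in>{..<r} - I. snd (ws ! i)) *\<^sub>C
    (pure (map (\<lambda>i. fst (ws ! i)) (sorted_list_of_set I)) :: 'v::complex_vector tensor))"
proof (rule multilinear_slots[where k = "card I"])
  fix vs :: "'v ext list" and i assume l: "length vs = r" "i < r"
  have fin: "finite I" using I by (rule finite_subset) simp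
  let ?G = "\<lambda>ws :: 'v ext list. map (\<lambda>i. fst (ws ! i)) (sorted_list_of_set I)"
  let ?c = "\<lambda>ws :: 'v ext list. \<Prod>i\<in>{..<r} - I. snd (ws ! i)"
  show "(\<exists>ys. clinear (\<lambda>x. ?c (vs[i := x])) \<and> (\<forall>x. ?G (vs[i := x]) = ys))
    \<or> (\<exists>ys a L b. length ys = card I \<and> a < card I \<and> clinear L \<and>
        (\<forall>x. ?c (vs[i := x]) = b \<and> ?G (vs[i := x]) = ys[a := L x]))"
  proof (cases "i \<in> I")
    case True
    have "?c (vs[i := x]) = ?c vs" for x
    proof (rule prod.cong[OF refl])
      fix k assume "k \<in> {..<r} - I"
      then have "i \<noteq> k" using True by auto
      then show "snd (vs[i := x] ! k) = snd (vs ! k)" by simp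
    qed
    moreover have "?G (vs[i := x]) = (?G vs)[rank I i := fst x]" for x
    proof (rule nth_equalityI)
      fix k assume "k < length (?G (vs[i := x]))"
      then have k: "k < card I" by simp
      have "enum I k = i \<longleftrightarrow> k = rank I i" using k True fin by (metis enum_rank rank_enum)
      then show "?G (vs[i := x]) ! k = (?G vs)[rank I i := fst x] ! k"
        using k l fin enum_in[OF fin k] I by (auto simp: enum_def nth_list_update)
    qed simp
    ultimately show ?thesis
      using rank_less[OF fin True] clinear_fst by (intro disjI2 exI[of _ "?G vs"] exI[of _ "rank I i"]) auto
  next
    case False
    have "?G (vs[i := x]) = ?G vs" for x
    proof (rule map_cong[OF refl])
      fix k assume "k \<in> set (sorted_list_of_set I)"
      then have "i \<noteq> k" using False fin by auto
      then show "fst (vs[i := x] ! k) = fst (vs ! k)" by simp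
    qed
    moreover have "clinear (\<lambda>x. ?c (vs[i := x]))"
      by (rule clinear_prod_upd[OF l]) (use False l clinear_snd in auto)
    ultimately show ?thesis by blast
  qed
qed

lemma slots_out_pure: "I \<subseteq> {..<r} \<Longrightarrow> length ws = r \<Longrightarrow> slots_out r I (pure ws) =
    (\<Prod>i\<in>{..<r} - I. snd (ws ! i)) *\<^sub>C pure (map (\<lambda>i. fst (ws ! i)) (sorted_list_of_set I))"
  unfolding slots_out_def by (rule tlift(2)[OF multilinear_slots_out])

lemma slots_out_Hom: "I \<subseteq> {..<r} \<Longrightarrow> slots_out r I \<in> Hom (tpow r) (tpow (card I))"
  unfolding slots_out_def
  by (rule tlift_Hom[OF multilinear_slots_out], assumption,
      rule complex_vector.subspace_scale[OF csubspace_tpow], rule pure_in_tpow, simp)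

text \<open>Common shape of \<open>tau\<close>, \<open>insert_pair\<close> and
  \<open>contract_pair\<close>: read two slots into a scalar, then overwrite them.\<close>

lemma multilinear_pair_pure:
  fixes c :: "'a::complex_vector \<Rightarrow> 'a \<Rightarrow> complex"
  assumes ij: "i < l" "j < l" "i \<noteq> j" and c: "\<And>y. clinear (\<lambda>x. c x y)" "\<And>x. clinear (c x)"
  shows "multilinear l (\<lambda>vs. c (vs ! i) (vs ! j) *\<^sub>C pure (vs[i := y, j := z]))"
proof (rule multilinear_slots[where k = l])
  fix vs :: "'a list" and k assume l: "length vs = l" "k < l"
  consider "k = i" | "k = j" | "k \<noteq> i" "k \<noteq> j" by blast
  then show "(\<exists>ys. clinear (\<lambda>x. c (vs[k := x] ! i) (vs[k := x] ! j)) \<and> (\<forall>x. vs[k := x, i := y, j := z] = ys))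
    \<or> (\<exists>ys a L b. length ys = l \<and> a < l \<and> clinear L \<and>
       (\<forall>x. c (vs[k := x] ! i) (vs[k := x] ! j) = b \<and> vs[k := x, i := y, j := z] = ys[a := L x]))"
  proof cases
    case 1
    then show ?thesis using c ij l by simp
  next
    case 2
    have "vs[j := x, i := y, j := z] = vs[i := y, j := z]" for x
      using ij by (simp add: list_update_swap)
    then show ?thesis using c ij l 2 by simp
  next
    case 3
    then have "vs[k := x, i := y, j := z] = vs[i := y, j := z, k := x]" for x
      by (simp add: list_update_swap)
    then show ?thesis
      using 3 l clinear_ident by (intro disjI2 exI[of _ "vs[i := y, j := z]"] exI[of _ k] exI[of _ "\<lambda>x. x"]) simp
  qed
qed

section \<open>Tensors on the extended space\<close>

definition fill :: "nat \<Rightarrow> nat set \<Rightarrow> (nat \<Rightarrow> 'v::complex_vector) \<Rightarrow> 'v ext list"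
  where "fill r I v = map (\<lambda>i. if i \<in> I then (v i, 0) else \<eta>) [0..<r]"

definition tens :: "nat \<Rightarrow> nat set \<Rightarrow> (nat \<Rightarrow> 'v::complex_vector) \<Rightarrow> 'v ext tensor"
  where "tens r I v = pure (fill r I v)"

lemma length_fill [simp]: "length (fill r I v) = r"
  by (simp add: fill_def)

lemma nth_fill [simp]: "i < r \<Longrightarrow> fill r I v ! i = (if i \<in> I then (v i, 0) else \<eta>)"
  by (simp add: fill_def)

lemma tens_in_tpow [simp]: "tens r I v \<in> tpow r"
  by (simp add: tens_def pure_in_tpow)

lemma tens_cong: "(\<And>i. i \<in> I \<Longrightarrow> v i = w i) \<Longrightarrow> tens r I v = tens r I w"
  by (simp add: tens_def fill_def cong: if_cong)

lemma tens_clinear: "i \<in> I \<Longrightarrow> I \<subseteq> {..<r} \<Longrightarrow> clinear (\<lambda>x. tens r I (v(i := x)))"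
proof -
  assume i: "i \<in> I" "I \<subseteq> {..<r}"
  then have "fill r I (v(i := x)) = (fill r I v)[i := (x, 0)]" for x
    by (intro nth_equalityI) (auto simp: nth_list_update)
  then show ?thesis
    unfolding tens_def
    using clinear_compose[OF clinear_in_ext multilinear_clinear[OF multilinear_pure, of "fill r I v" r i]] i
    by auto
qed

context bilinear_space
begin

section \<open>Test forms and coordinates of tensors\<close>

text \<open>The test form of the summand of \<open>J\<close>: it vanishes on the other summands
  (\<open>kform_fill\<close>). As \<omega> is nondegenerate, every functional on V is some
  \<omega>(\<cdot>, u), so these forms separate tensors (\<open>tensor_ext_eqI\<close>);
  \<open>vform\<close> does the same for V alone.\<close>

definition kform :: "nat \<Rightarrow> nat set \<Rightarrow> (nat \<Rightarrow> 'v) \<Rightarrow> 'v ext list \<Rightarrow> complex"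
  where "kform r J u ws = (\<Prod>i<r. if i \<in> J then \<omega> (fst (ws ! i)) (u i) else snd (ws ! i))"

definition vform :: "nat \<Rightarrow> (nat \<Rightarrow> 'v) \<Rightarrow> 'v list \<Rightarrow> complex"
  where "vform l u vs = (\<Prod>i<l. \<omega> (vs ! i) (u i))"

lemma multilinear_kform: "multilinear r (kform r J u)"
proof -
  have "clinear (\<lambda>z. if i \<in> J then \<omega> (fst z) (u i) else snd z)" for i
    by (rule clinearI) (auto simp: omega_simps scaleC_prod_def scaleC_complex_def)
  then have "multilinear r (\<lambda>ws. \<Prod>i<r. (\<lambda>z. if i \<in> J then \<omega> (fst z) (u i) else snd z) (ws ! i))"
    by (rule multilinear_prod)
  then show ?thesis by (simp add: kform_def[abs_def])
qed

lemma multilinear_vform: "multilinear l (vform l u)"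
proof -
  have "multilinear l (\<lambda>vs. \<Prod>i<l. (\<lambda>z. \<omega> z (u i)) (vs ! i))"
    by (rule multilinear_prod) (rule clinear_omega)
  then show ?thesis by (simp add: vform_def[abs_def])
qed

lemma kform_cong: "(\<And>i. i \<in> J \<Longrightarrow> i < r \<Longrightarrow> u i = u' i) \<Longrightarrow> kform r J u = kform r J u'"
  by (auto simp: kform_def fun_eq_iff intro!: prod.cong)

lemma vform_cong: "(\<And>i. i < l \<Longrightarrow> u i = u' i) \<Longrightarrow> vform l u = vform l u'"
  by (auto simp: vform_def fun_eq_iff intro!: prod.cong)

lemma kform_fill:
  assumes "I \<subseteq> {..<r}" "J \<subseteq> {..<r}"
  shows "kform r J u (fill r I v) = (if I = J then \<Prod>i\<in>I. \<omega> (v i) (u i) else 0)"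
proof (cases "I = J")
  case True
  have "kform r J u (fill r I v) = (\<Prod>i<r. if i \<in> J then \<omega> (v i) (u i) else 1)"
    unfolding kform_def by (rule prod.cong) (auto simp: True)
  also have "\<dots> = (\<Prod>i\<in>{i \<in> {..<r}. i \<in> J}. \<omega> (v i) (u i))" by (rule prod.inter_filter[symmetric]) simp
  also have "{i \<in> {..<r}. i \<in> J} = I" using assms True by auto
  finally show ?thesis using True by simp
next
  case False
  \<comment> \<open>A slot in only one of the two sets gives a zero factor: either \<eta> is paired
    with a vector, or the \<eta>-coordinate of a vector of V is taken.\<close>
  then obtain i where i: "i < r" "i \<in> I \<longleftrightarrow> i \<notin> J" using assms by blast
  then have "(if i \<in> J then \<omega> (fst (fill r I v ! i)) (u i) else snd (fill r I v ! i)) = 0"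
    by (auto simp: omega_simps)
  then have "kform r J u (fill r I v) = 0"
    unfolding kform_def by (intro prod_zero) (use i(1) in blast)+
  then show ?thesis using False by simp
qed

lemma tens_kform:
  assumes "I \<subseteq> {..<r}" "J \<subseteq> {..<r}"
  shows "tens r I v (kform r J u) = (if I = J then \<Prod>i\<in>I. \<omega> (v i) (u i) else 0)"
  unfolding tens_def pure_eval[OF length_fill multilinear_kform] by (rule kform_fill[OF assms])

text \<open>The letter \<open>None\<close> stands for \<open>\<eta>\<close> and \<open>Some p\<close> for \<open>f p\<close>.\<close>

definition words :: "nat \<Rightarrow> (nat \<Rightarrow> nat option) set"
  where "words r = PiE {..<r} (\<lambda>_. insert None (Some ` {1..n}))"

definition letters :: "nat \<Rightarrow> (nat \<Rightarrow> nat option) \<Rightarrow> nat set"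
  where "letters r w = {i. i < r \<and> w i \<noteq> None}"

lemma letters_sub: "letters r w \<subseteq> {..<r}"
  by (auto simp: letters_def)

text \<open>Expansion in the basis of \<eta> and the \<open>f p\<close>. The non-\<eta> letters of a
  word select the summand, and the coefficient is the test form of that summand at the dual basis
  vectors; hence a tensor is determined by its values on test forms.\<close>

lemma pure_expand_ext:
  fixes ws :: "'v ext list"
  assumes l: "length ws = r"
  shows "pure ws = (\<Sum>w\<in>words r. kform r (letters r w) (\<lambda>i. fd (the (w i))) ws *\<^sub>C
    tens r (letters r w) (\<lambda>i. f (the (w i))))"
proof -
  define c where "c i a = (case a of None \<Rightarrow> snd (ws ! i) | Some p \<Rightarrow> \<omega> (fst (ws ! i)) (fd p))" for i a
  define e where "e a = (case a of None \<Rightarrow> \<eta> | Some p \<Rightarrow> (f p, 0 :: complex))" for a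
  have x: "ws ! i = (\<Sum>a\<in>insert None (Some ` {1..n}). c i a *\<^sub>C e a)" for i
  proof -
    have "(\<Sum>a\<in>insert None (Some ` {1..n}). c i a *\<^sub>C e a)
      = snd (ws ! i) *\<^sub>C \<eta> + (\<Sum>p=1..n. \<omega> (fst (ws ! i)) (fd p) *\<^sub>C (f p, 0))"
      by (subst sum.insert) (auto simp: c_def e_def sum.reindex)
    also have "(\<Sum>p=1..n. \<omega> (fst (ws ! i)) (fd p) *\<^sub>C (f p, 0 :: complex)) = (fst (ws ! i), 0)"
    proof -
      have "(\<Sum>p\<in>K. \<omega> (fst (ws ! i)) (fd p) *\<^sub>C (f p, 0 :: complex))
          = (\<Sum>p\<in>K. \<omega> (fst (ws ! i)) (fd p) *\<^sub>C f p, 0)" for K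
        by (induction K rule: infinite_finite_induct)
          (auto simp: scaleC_prod_def scaleC_complex_def zero_prod_def)
      then show ?thesis by (simp only: expand_basis[symmetric])
    qed
    finally show ?thesis by (simp add: scaleC_prod_def scaleC_complex_def prod_eq_iff)
  qed
  have ws: "ws = map ((!) ws) [0..<r]" using map_nth[of ws] l by simp
  have "pure ws = pure (map ((!) ws) [0..<r])" using ws by simp
  also have "\<dots> = (\<Sum>w\<in>PiE {..<r} (\<lambda>_. insert None (Some ` {1..n})).
      (\<Prod>i\<in>{..<r}. c i (w i)) *\<^sub>C pure (map (e \<circ> w) [0..<r]))"
    by (rule multilinear_on_expand[OF multilinear_on_list[OF multilinear_pure]]) (use x in auto)
  also have "\<dots> = (\<Sum>w\<in>words r. kform r (letters r w) (\<lambda>i. fd (the (w i))) ws *\<^sub>C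
    tens r (letters r w) (\<lambda>i. f (the (w i))))"
    unfolding words_def
  proof (intro sum.cong refl arg_cong2[where f = scaleC])
    fix w
    show "(\<Prod>i\<in>{..<r}. c i (w i)) = kform r (letters r w) (\<lambda>i. fd (the (w i))) ws"
      unfolding kform_def by (rule prod.cong) (auto simp: c_def letters_def split: option.splits)
    have "map (e \<circ> w) [0..<r] = fill r (letters r w) (\<lambda>i. f (the (w i)))"
      by (rule nth_equalityI) (auto simp: e_def letters_def split: option.splits)
    then show "pure (map (e \<circ> w) [0..<r]) = tens r (letters r w) (\<lambda>i. f (the (w i)))"
      by (simp add: tens_def)
  qed
  finally show ?thesis .
qed

lemma sum_fun_apply: "(sum h K) x = (\<Sum>i\<in>K. h i x)"
  by (induction K rule: infinite_finite_induct) simp_all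

lemma tpow_expand_ext:
  fixes x :: "'v ext tensor"
  assumes x: "x \<in> tpow r"
  shows "x m = (\<Sum>w\<in>words r. tens r (letters r w) (\<lambda>i. f (the (w i))) m
    * x (kform r (letters r w) (\<lambda>i. fd (the (w i)))))"
proof -
  have "idmap (tpow r) x m = (\<Sum>w\<in>words r. tens r (letters r w) (\<lambda>i. f (the (w i))) m
    * x (kform r (letters r w) (\<lambda>i. fd (the (w i)))))"
  proof (rule tpow_eval_eqI[OF idmap_Hom[OF csubspace_tpow] x _ multilinear_kform])
    fix ws :: "'v ext list" assume l: "length ws = r"
    show "idmap (tpow r) (pure ws) m = (\<Sum>w\<in>words r. tens r (letters r w) (\<lambda>i. f (the (w i))) m *
      kform r (letters r w) (\<lambda>i. fd (the (w i))) ws)"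
      using pure_in_tpow[OF l]
      by (simp add: idmap_def) (subst pure_expand_ext[OF l], simp add: sum_fun_apply scaleC_apply scaleC_complex_def mult.commute)
  qed
  then show ?thesis using x by (simp add: idmap_def)
qed

lemma tensor_ext_eqI:
  assumes "x \<in> tpow r" "y \<in> tpow r"
    and "\<And>J u. J \<subseteq> {..<r} \<Longrightarrow> x (kform r J u) = y (kform r J u)"
  shows "x = y"
proof
  fix m show "x m = y m"
    unfolding tpow_expand_ext[OF assms(1), of m] tpow_expand_ext[OF assms(2), of m]
    by (simp add: assms(3)[OF letters_sub])
qed

lemma Hom_ext_eqI:
  fixes h k :: "'v ext tensor \<Rightarrow> 'b::complex_vector"
  assumes h: "h \<in> Hom (tpow r) S" and k: "k \<in> Hom (tpow r) S'"
    and eq: "\<And>I v. I \<subseteq> {..<r} \<Longrightarrow> h (tens r I v) = k (tens r I v)"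
  shows "h = k"
proof (rule Hom_tpow_eqI[OF h k])
  fix ws :: "'v ext list" assume l: "length ws = r"
  have t: "c *\<^sub>C tens r I v \<in> tpow r" for c I and v :: "nat \<Rightarrow> 'v"
    by (simp add: complex_vector.subspace_scale[OF csubspace_tpow])
  show "h (pure ws) = k (pure ws)"
    unfolding pure_expand_ext[OF l] Hom_sum[OF h csubspace_tpow t] Hom_sum[OF k csubspace_tpow t]
    by (intro sum.cong refl) (simp add: HomD[OF h] HomD[OF k] eq[OF letters_sub])
qed

lemma pure_expand:
  fixes vs :: "'v list"
  assumes l: "length vs = l"
  shows "pure vs = (\<Sum>w\<in>PiE {..<l} (\<lambda>_. {1..n}). vform l (fd \<circ> w) vs *\<^sub>C pure (map (f \<circ> w) [0..<l]))"
proof -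
  have vs: "vs = map ((!) vs) [0..<l]" using map_nth[of vs] l by simp
  have "pure vs = pure (map ((!) vs) [0..<l])" using vs by simp
  also have "\<dots> = (\<Sum>w\<in>PiE {..<l} (\<lambda>_. {1..n}).
      (\<Prod>i\<in>{..<l}. \<omega> (vs ! i) (fd (w i))) *\<^sub>C pure (map (f \<circ> w) [0..<l]))"
    by (rule multilinear_on_expand[OF multilinear_on_list[OF multilinear_pure], where c = "\<lambda>i p. \<omega> (vs ! i) (fd p)"])
      (simp, simp, rule expand_basis)
  finally show ?thesis by (simp add: vform_def)
qed

lemma tensor_eqI:
  fixes x y :: "'v tensor"
  assumes "x \<in> tpow l" "y \<in> tpow l" and eq: "\<And>u. x (vform l u) = y (vform l u)"
  shows "x = y"
proof
  have ex: "x m = (\<Sum>w\<in>PiE {..<l} (\<lambda>_. {1..n}). pure (map (f \<circ> w) [0..<l]) m * x (vform l (fd \<circ> w)))"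
    if x: "x \<in> tpow l" for x :: "'v tensor" and m
  proof -
    have "idmap (tpow l) x m = (\<Sum>w\<in>PiE {..<l} (\<lambda>_. {1..n}). pure (map (f \<circ> w) [0..<l]) m * x (vform l (fd \<circ> w)))"
    proof (rule tpow_eval_eqI[OF idmap_Hom[OF csubspace_tpow] x _ multilinear_vform])
      fix vs :: "'v list" assume l: "length vs = l"
      show "idmap (tpow l) (pure vs) m = (\<Sum>w\<in>PiE {..<l} (\<lambda>_. {1..n}). pure (map (f \<circ> w) [0..<l]) m *
        vform l (fd \<circ> w) vs)"
        using pure_in_tpow[OF l]
        by (simp add: idmap_def) (subst pure_expand[OF l], simp add: sum_fun_apply scaleC_apply scaleC_complex_def mult.commute)
    qed
    then show ?thesis using x by (simp add: idmap_def)
  qed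
  show "x m = y m" for m
    unfolding ex[OF assms(1), of m] ex[OF assms(2), of m] by (simp add: eq)
qed


lemma finite_slots: "I \<subseteq> {..<r::nat} \<Longrightarrow> finite I"
  by (rule finite_subset[OF _ finite_lessThan])

section \<open>Transposes of the structure maps on test forms\<close>

lemma summand_proj_kform:
  fixes x :: "'v ext tensor"
  assumes x: "x \<in> tpow r" and IJ: "I \<subseteq> {..<r}" "J \<subseteq> {..<r}"
  shows "summand_proj r I x (kform r J u) = (if I = J then x (kform r J u) else 0)"
proof -
  have "summand_proj r I (pure ws) (kform r J u) = (if I = J then 1 else 0) * kform r J u ws"
    if l: "length ws = r" for ws :: "'v ext list"
  proof -
    have *: "summand_proj r I (pure ws) (kform r J u)
      = (\<Prod>i<r. if i \<in> J then \<omega> (if i \<in> I then fst (ws ! i) else 0) (u i) else if i \<in> I then 0 else snd (ws ! i))"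
      unfolding summand_proj_pure[OF l]
      by (subst pure_eval) (auto simp: multilinear_kform kform_def intro!: prod.cong)
    show ?thesis
    proof (cases "I = J")
      case True
      then show ?thesis unfolding * kform_def by (auto intro!: prod.cong)
    next
      case False
      then obtain i where i: "i < r" "i \<in> I \<longleftrightarrow> i \<notin> J" using IJ by blast
      have "summand_proj r I (pure ws) (kform r J u) = 0"
        unfolding * by (rule prod_zero) (use i in \<open>auto simp: omega_simps intro!: bexI[of _ i]\<close>)
      then show ?thesis using False by simp
    qed
  qed
  from tpow_eval_eq1[OF summand_proj_Hom x this multilinear_kform] show ?thesis by simp
qed

lemma summand_proj_tens:
  fixes v :: "nat \<Rightarrow> 'v"
  assumes "I \<subseteq> {..<r}" "J \<subseteq> {..<r}"
  shows "summand_proj r I (tens r J v) = (if I = J then tens r J v else 0)"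
proof (rule tensor_ext_eqI[where r = r])
  show "summand_proj r I (tens r J v) \<in> tpow r" by (simp add: HomD(1)[OF summand_proj_Hom])
  show "(if I = J then tens r J v else 0) \<in> tpow r"
    by (simp add: complex_vector.subspace_0[OF csubspace_tpow])
  show "summand_proj r I (tens r J v) (kform r K u) = (if I = J then tens r J v else 0) (kform r K u)"
    if K: "K \<subseteq> {..<r}" for K u
    unfolding summand_proj_kform[OF tens_in_tpow assms(1) K]
    using tens_kform[OF assms(2) K, of v u] by (cases "I = J"; cases "J = K") auto
qed

lemma perm_action_kform:
  fixes x :: "'v ext tensor"
  assumes x: "x \<in> tpow r" and \<sigma>: "\<sigma> permutes {..<r}"
  shows "perm_action r \<sigma> x (kform r J u) = x (kform r {k. \<sigma> k \<in> J} (u \<circ> \<sigma>))"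
proof -
  have "perm_action r \<sigma> (pure ws) (kform r J u) = 1 * kform r {k. \<sigma> k \<in> J} (u \<circ> \<sigma>) ws"
    if l: "length ws = r" for ws :: "'v ext list"
  proof -
    have "perm_action r \<sigma> (pure ws) (kform r J u) = (\<Prod>i<r. if i \<in> J then \<omega> (fst (ws ! (Hilbert_Choice.inv \<sigma> i))) (u i)
        else snd (ws ! (Hilbert_Choice.inv \<sigma> i)))"
      unfolding perm_action_pure[OF \<sigma> l]
      by (subst pure_eval[of _ r])
        (use l in \<open>auto simp: multilinear_kform kform_def permute_list_def intro!: prod.cong\<close>)
    also have "\<dots> = (\<Prod>k<r. if \<sigma> k \<in> J then \<omega> (fst (ws ! k)) (u (\<sigma> k)) else snd (ws ! k))"
      by (subst prod.permute[OF \<sigma>]) (simp add: permutes_inverses[OF \<sigma>] cong: if_cong)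
    finally show ?thesis by (simp add: kform_def cong: if_cong)
  qed
  from tpow_eval_eq1[OF perm_action_Hom[OF \<sigma>] x this multilinear_kform] show ?thesis by (simp add: comp_def)
qed

lemma perm_action_vform:
  fixes x :: "'v tensor"
  assumes x: "x \<in> tpow l" and \<sigma>: "\<sigma> permutes {..<l}"
  shows "perm_action l \<sigma> x (vform l u) = x (vform l (u \<circ> \<sigma>))"
proof -
  have "perm_action l \<sigma> (pure vs) (vform l u) = 1 * vform l (u \<circ> \<sigma>) vs"
    if l: "length vs = l" for vs :: "'v list"
  proof -
    have "perm_action l \<sigma> (pure vs) (vform l u) = (\<Prod>i<l. \<omega> (vs ! (Hilbert_Choice.inv \<sigma> i)) (u i))"
      unfolding perm_action_pure[OF \<sigma> l]
      by (subst pure_eval[of _ l])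
        (use l in \<open>auto simp: multilinear_vform vform_def permute_list_def intro!: prod.cong\<close>)
    also have "\<dots> = (\<Prod>k<l. \<omega> (vs ! k) (u (\<sigma> k)))"
      by (subst prod.permute[OF \<sigma>]) (simp add: permutes_inverses[OF \<sigma>])
    finally show ?thesis by (simp add: vform_def)
  qed
  from tpow_eval_eq1[OF perm_action_Hom[OF \<sigma>] x this multilinear_vform] show ?thesis by (simp add: comp_def)
qed

lemma slots_in_kform:
  fixes y :: "'v tensor"
  assumes y: "y \<in> tpow (card I)" and IJ: "I \<subseteq> {..<r}" "J \<subseteq> {..<r}"
  shows "slots_in r I y (kform r J u) = (if I = J then y (vform (card I) (u \<circ> enum I)) else 0)"
proof -
  have fin: "finite I" using finite_slots[OF IJ(1)] .
  have "slots_in r I (pure vs) (kform r J u) = (if I = J then 1 else 0) * vform (card I) (u \<circ> enum I) vs"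
    if l: "length vs = card I" for vs :: "'v list"
  proof -
    have "slots_in r I (pure vs) = tens r I (\<lambda>i. vs ! rank I i)"
      unfolding slots_in_pure[OF IJ(1) l] by (simp add: tens_def fill_def)
    moreover have "(\<Prod>i\<in>I. \<omega> (vs ! rank I i) (u i)) = vform (card I) (u \<circ> enum I) vs"
    proof -
      have "(\<Prod>i\<in>I. \<omega> (vs ! rank I i) (u i)) = (\<Prod>k<card I. \<omega> (vs ! rank I (enum I k)) (u (enum I k)))"
        by (rule prod.reindex_bij_betw[OF bij_enum[OF fin], symmetric])
      also have "\<dots> = vform (card I) (u \<circ> enum I) vs"
        unfolding vform_def by (rule prod.cong) (simp_all add: rank_enum fin)
      finally show ?thesis .
    qed
    ultimately show ?thesis by (auto simp: tens_kform[OF IJ])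
  qed
  from tpow_eval_eq1[OF slots_in_Hom[OF IJ(1)] y this multilinear_vform] show ?thesis by (simp add: comp_def)
qed

lemma slots_out_vform:
  fixes x :: "'v ext tensor"
  assumes x: "x \<in> tpow r" and I: "I \<subseteq> {..<r}"
  shows "slots_out r I x (vform (card I) u) = x (kform r I (u \<circ> rank I))"
proof -
  have fin: "finite I" using finite_slots[OF I] .
  have "slots_out r I (pure ws) (vform (card I) u) = 1 * kform r I (u \<circ> rank I) ws"
    if l: "length ws = r" for ws :: "'v ext list"
  proof -
    have "slots_out r I (pure ws) (vform (card I) u)
      = (\<Prod>i\<in>{..<r} - I. snd (ws ! i)) * (\<Prod>k<card I. \<omega> (fst (ws ! enum I k)) (u k))"
      unfolding slots_out_pure[OF I l] scaleC_apply scaleC_complex_def map_sorted_list[OF fin]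
      by (subst pure_eval[of _ "card I"]) (simp_all add: multilinear_vform vform_def)
    also have "(\<Prod>k<card I. \<omega> (fst (ws ! enum I k)) (u k))
      = (\<Prod>k<card I. \<omega> (fst (ws ! enum I k)) (u (rank I (enum I k))))"
      by (rule prod.cong) (simp_all add: rank_enum fin)
    also have "\<dots> = (\<Prod>i\<in>I. \<omega> (fst (ws ! i)) (u (rank I i)))"
      by (rule prod.reindex_bij_betw[OF bij_enum[OF fin]])
    also have "(\<Prod>i\<in>{..<r} - I. snd (ws ! i)) * (\<Prod>i\<in>I. \<omega> (fst (ws ! i)) (u (rank I i)))
      = (\<Prod>i\<in>({..<r} - I) \<union> I. if i \<in> I then \<omega> (fst (ws ! i)) (u (rank I i)) else snd (ws ! i))"
      by (subst prod.union_disjoint) (auto simp: fin intro!: arg_cong2[where f = times] prod.cong)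
    also have "({..<r} - I) \<union> I = {..<r}" using I by auto
    finally show ?thesis by (simp add: kform_def cong: if_cong)
  qed
  from tpow_eval_eq1[OF slots_out_Hom[OF I] x this multilinear_kform] show ?thesis by (simp add: comp_def)
qed

lemma slots_out_tens:
  fixes v :: "nat \<Rightarrow> 'v"
  assumes I: "I \<subseteq> {..<r}" and J: "J \<subseteq> {..<r}"
  shows "slots_out r I (tens r J v) = (if J = I then pure (map (v \<circ> enum I) [0..<card I]) else 0)"
proof (rule tensor_eqI)
  show "slots_out r I (tens r J v) \<in> tpow (card I)" by (simp add: HomD(1)[OF slots_out_Hom[OF I]])
  show "(if J = I then pure (map (v \<circ> enum I) [0..<card I]) else 0) \<in> tpow (card I)"
    by (simp add: pure_in_tpow complex_vector.subspace_0[OF csubspace_tpow])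
  fix u
  have fin: "finite I" using finite_slots[OF I] .
  have "(\<Prod>i\<in>I. \<omega> (v i) ((u \<circ> rank I) i)) = (\<Prod>k<card I. \<omega> (v (enum I k)) ((u \<circ> rank I) (enum I k)))"
    by (rule prod.reindex_bij_betw[OF bij_enum[OF fin], symmetric])
  also have "\<dots> = (\<Prod>k<card I. \<omega> (v (enum I k)) (u k))"
    by (rule prod.cong) (simp_all add: rank_enum fin)
  finally have "(\<Prod>i\<in>I. \<omega> (v i) ((u \<circ> rank I) i)) = pure (map (v \<circ> enum I) [0..<card I]) (vform (card I) u)"
    by (subst pure_eval[of _ "card I"]) (simp_all add: multilinear_vform vform_def)
  then show "slots_out r I (tens r J v) (vform (card I) u)
    = (if J = I then pure (map (v \<circ> enum I) [0..<card I]) else 0) (vform (card I) u)"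
    unfolding slots_out_vform[OF tens_in_tpow I] tens_kform[OF J I] by simp
qed

lemma slots_in_tens:
  fixes v :: "nat \<Rightarrow> 'v"
  assumes I: "I \<subseteq> {..<r}"
  shows "slots_in r I (pure (map (v \<circ> enum I) [0..<card I])) = tens r I v"
proof -
  have fin: "finite I" using finite_slots[OF I] .
  have "map (\<lambda>i. if i \<in> I then (map (v \<circ> enum I) [0..<card I] ! rank I i, 0) else \<eta>) [0..<r] = fill r I v"
    unfolding fill_def by (intro map_cong refl if_cong) (simp_all add: rank_less enum_rank fin)
  then show ?thesis by (subst slots_in_pure[OF I]) (simp_all add: tens_def)
qed

lemma slots_in_out:
  assumes I: "I \<subseteq> {..<r}"
  shows "slots_in r I \<circ> slots_out r I = (summand_proj r I :: 'v ext tensor \<Rightarrow> _)"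
proof (rule Hom_ext_eqI[OF Hom_comp[OF slots_out_Hom[OF I] slots_in_Hom[OF I] csubspace_tpow] summand_proj_Hom])
  fix J and v :: "nat \<Rightarrow> 'v" assume J: "J \<subseteq> {..<r}"
  show "(slots_in r I \<circ> slots_out r I) (tens r J v) = summand_proj r I (tens r J v)"
    unfolding comp_def slots_out_tens[OF I J] summand_proj_tens[OF I J]
    using slots_in_tens[OF I, of v] Hom_0[OF slots_in_Hom[OF I] csubspace_tpow] by (auto simp: comp_def)
qed

lemma on_summand_Hom: "I \<subseteq> {..<r} \<Longrightarrow> \<theta> \<in> Hom (tpow (card I)) (tpow (card I)) \<Longrightarrow>
    on_summand r I \<theta> \<in> Hom (tpow r) (tpow r)"
  unfolding on_summand_def
  by (intro Hom_comp[OF slots_out_Hom] Hom_comp[OF _ slots_in_Hom] Hom_comp csubspace_tpow)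

lemma on_summand_kform:
  fixes x :: "'v ext tensor"
  assumes x: "x \<in> tpow r" and \<theta>: "\<theta> \<in> Hom (tpow (card I)) (tpow (card I))"
    and IJ: "I \<subseteq> {..<r}" "J \<subseteq> {..<r}"
  shows "on_summand r I \<theta> x (kform r J u)
    = (if I = J then \<theta> (slots_out r I x) (vform (card I) (u \<circ> enum I)) else 0)"
  unfolding on_summand_def comp_def
  by (subst slots_in_kform[OF HomD(1)[OF \<theta> HomD(1)[OF slots_out_Hom[OF IJ(1)] x]] IJ]) (simp add: comp_def)

lemma on_summand_perm_kform:
  fixes x :: "'v ext tensor"
  assumes x: "x \<in> tpow r" and \<sigma>: "\<sigma> permutes {..<card I}"
    and IJ: "I \<subseteq> {..<r}" "J \<subseteq> {..<r}"
  shows "on_summand r I (perm_action (card I) \<sigma>) x (kform r J u)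
    = (if I = J then x (kform r I (u \<circ> enum I \<circ> \<sigma> \<circ> rank I)) else 0)"
  unfolding on_summand_kform[OF x perm_action_Hom[OF \<sigma>] IJ]
    perm_action_vform[OF HomD(1)[OF slots_out_Hom[OF IJ(1)] x] \<sigma>] slots_out_vform[OF x IJ(1)]
  by simp

text \<open>The order isomorphism \<open>enum J \<circ> rank I\<close> extends to a permutation by
  any bijection of the complements, which have equal size. Only the two properties proved here are
  used of the choice.\<close>

lemma transfer_perm_exists:
  assumes "I \<subseteq> {..<r}" "J \<subseteq> {..<r}" "card I = card J"
  shows "transfer_perm r J I permutes {..<r}"
    and "k < card I \<Longrightarrow> transfer_perm r J I (enum I k) = enum J k"
proof -
  have fin: "finite I" "finite J" using assms finite_slots by auto
  have rl: "rank I i < card J" if "i \<in> I" for i using rank_less[OF fin(1) that] assms(3) by simp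
  define \<beta> where "\<beta> = enum J \<circ> rank I"
  have \<beta>: "bij_betw \<beta> I J"
    unfolding \<beta>_def
    by (rule bij_betw_trans[of "rank I" I "{..<card I}"],
        rule bij_betw_byWitness[where f' = "enum I"])
      (use fin assms bij_enum[of J] in \<open>auto simp: rank_enum enum_rank rank_less rl enum_in\<close>)
  have "card ({..<r} - I) = card ({..<r} - J)"
    using assms fin by (simp add: card_Diff_subset)
  then obtain \<gamma> where \<gamma>: "bij_betw \<gamma> ({..<r} - I) ({..<r} - J)"
    using finite_same_card_bij[of "{..<r} - I" "{..<r} - J"] by auto
  define \<sigma> where "\<sigma> i = (if i \<in> I then \<beta> i else if i < r then \<gamma> i else i)" for i
  have "bij_betw \<sigma> (I \<union> ({..<r} - I)) (J \<union> ({..<r} - J))"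
  proof (rule bij_betw_combine)
    show "bij_betw \<sigma> I J" using \<beta> by (rule bij_betw_cong[THEN iffD1, rotated]) (simp add: \<sigma>_def)
    show "bij_betw \<sigma> ({..<r} - I) ({..<r} - J)"
      using \<gamma> by (rule bij_betw_cong[THEN iffD1, rotated]) (simp add: \<sigma>_def)
  qed auto
  moreover have "I \<union> ({..<r} - I) = {..<r}" "J \<union> ({..<r} - J) = {..<r}" using assms by auto
  ultimately have "\<sigma> permutes {..<r}"
    by (intro bij_imp_permutes) (use assms in \<open>auto simp: \<sigma>_def\<close>)
  moreover have "\<forall>k<card I. \<sigma> (enum I k) = enum J k"
    using fin by (simp add: \<sigma>_def \<beta>_def enum_in rank_enum)
  ultimately have ex: "\<exists>\<sigma>. \<sigma> permutes {..<r} \<and>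
    (\<forall>k < card I. \<sigma> (sorted_list_of_set I ! k) = sorted_list_of_set J ! k)"
    unfolding enum_def by blast
  show "transfer_perm r J I permutes {..<r}"
    "k < card I \<Longrightarrow> transfer_perm r J I (enum I k) = enum J k"
    unfolding enum_def transfer_perm_def using someI_ex[OF ex] by auto
qed

lemma E_map_Hom:
  assumes "I \<subseteq> {..<r}" "J \<subseteq> {..<r}" "card I = card J"
  shows "E_map r J I \<in> Hom (tpow r) (tpow r)"
  unfolding E_map_def
  by (intro Hom_comp[OF summand_proj_Hom perm_action_Hom[OF transfer_perm_exists(1)[OF assms]]] csubspace_tpow)

lemma E_map_kform:
  fixes x :: "'v ext tensor"
  assumes x: "x \<in> tpow r" and IJ: "I \<subseteq> {..<r}" "J \<subseteq> {..<r}" "card I = card J" and K: "K \<subseteq> {..<r}"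
  shows "E_map r J I x (kform r K u) = (if K = J then x (kform r I (u \<circ> transfer_perm r J I)) else 0)"
proof -
  obtain \<tau> where \<tau>: "\<tau> = transfer_perm r J I" by simp
  have \<sigma>: "\<tau> permutes {..<r}" unfolding \<tau> by (rule transfer_perm_exists[OF IJ])
  have enum_\<tau>: "\<tau> (enum I k) = enum J k" if "k < card I" for k
    unfolding \<tau> using that by (rule transfer_perm_exists(2)[OF IJ])
  have fin: "finite I" "finite J" using IJ finite_slots by auto
  have im: "\<tau> ` I = J"
  proof -
    have "\<tau> ` I = \<tau> ` enum I ` {..<card I}" using bij_enum[OF fin(1)] by (simp add: bij_betw_def)
    also have "\<dots> = enum J ` {..<card I}" unfolding image_image by (rule image_cong) (use enum_\<tau> in auto)
    also have "\<dots> = J" using bij_enum[OF fin(2)] IJ by (simp add: bij_betw_def)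
    finally show ?thesis .
  qed
  have sub: "{k. \<tau> k \<in> K} \<subseteq> {..<r}"
    using K permutes_in_image[OF \<sigma>] by auto
  have "I = {k. \<tau> k \<in> K} \<longleftrightarrow> K = J"
  proof
    assume I: "I = {k. \<tau> k \<in> K}"
    show "K = J"
    proof (intro equalityI subsetI)
      fix y assume y: "y \<in> K"
      obtain k where k: "y = \<tau> k" using permutes_surj[OF \<sigma>] by (elim surjE)
      then have "k \<in> I" using I y by blast
      then show "y \<in> J" using im k by blast
    next
      fix y assume "y \<in> J"
      then show "y \<in> K" unfolding im[symmetric] using I by blast
    qed
  next
    assume "K = J"
    then have "K = \<tau> ` I" using im by simp
    then show "I = {k. \<tau> k \<in> K}" using permutes_inj[OF \<sigma>] by (simp add: inj_image_mem_iff)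
  qed
  moreover have "E_map r J I x (kform r K u) = summand_proj r I x (kform r {k. \<tau> k \<in> K} (u \<circ> \<tau>))"
    by (simp only: E_map_def comp_apply \<tau>[symmetric] perm_action_kform[OF HomD(1)[OF summand_proj_Hom x] \<sigma>])
  ultimately show ?thesis
    unfolding summand_proj_kform[OF x IJ(1) sub] \<tau>[symmetric] by (cases "K = J") simp_all
qed

text \<open>The transfer permutation preserves the order of the slots, so after identifying both
  summands with the tensor power of V the map becomes the identity. This writes a block between
  summands of equal size as \<open>E_map\<close> after \<open>on_summand\<close>.\<close>

lemma E_map_slots_in:
  assumes IJ: "I \<subseteq> {..<r}" "J \<subseteq> {..<r}" "card I = card J"
  shows "E_map r J I \<circ> slots_in r I = (slots_in r J :: 'v tensor \<Rightarrow> _)"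
proof
  have fin: "finite I" "finite J" using IJ finite_slots by auto
  fix y :: "'v tensor"
  show "(E_map r J I \<circ> slots_in r I) y = slots_in r J y"
  proof (cases "y \<in> tpow (card I)")
    case True
    then have yJ: "y \<in> tpow (card J)" using IJ by simp
    note s = HomD(1)[OF slots_in_Hom[OF IJ(1)] True]
    show ?thesis
    proof (rule tensor_ext_eqI)
      show "(E_map r J I \<circ> slots_in r I) y \<in> tpow r" using HomD(1)[OF E_map_Hom[OF IJ] s] by simp
      show "slots_in r J y \<in> tpow r" by (rule HomD(1)[OF slots_in_Hom[OF IJ(2)] yJ])
      fix K u assume K: "K \<subseteq> {..<r}"
      have "vform (card I) (u \<circ> transfer_perm r J I \<circ> enum I) = vform (card J) (u \<circ> enum J)"
        unfolding IJ(3)[symmetric] by (rule vform_cong) (simp add: transfer_perm_exists(2)[OF IJ])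
      then show "(E_map r J I \<circ> slots_in r I) y (kform r K u) = slots_in r J y (kform r K u)"
        using E_map_kform[OF s IJ K] slots_in_kform[OF True IJ(1) IJ(1)] slots_in_kform[OF yJ IJ(2) K] by auto
    qed
  next
    case False
    then have "y \<notin> tpow (card J)" using IJ by simp
    moreover have "E_map r J I (0 :: 'v ext tensor) = 0" by (rule Hom_0[OF E_map_Hom[OF IJ] csubspace_tpow])
    ultimately show ?thesis
      using HomD(4)[OF slots_in_Hom[OF IJ(1)] False] HomD(4)[OF slots_in_Hom[OF IJ(2)], of y] by simp
  qed
qed

end

section \<open>Diagram maps\<close>

lemma card_2_less:
  fixes e :: "nat set"
  assumes "card e = 2"
  obtains i j where "e = {i, j}" "i < j" "Min e = i" "Max e = j"
proof -
  obtain x y where xy: "e = {x, y}" "x \<noteq> y" using assms by (auto simp: card_2_iff)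
  show ?thesis
  proof (cases "x < y")
    case True
    show ?thesis by (rule that[of x y]) (use xy True in auto)
  next
    case False
    show ?thesis by (rule that[of y x]) (use xy False in auto)
  qed
qed

text \<open>Common frame for \<open>brauer_diagrams\<close> and \<open>pairings\<close>; the fold
  lemmas are proved once for it.\<close>

definition pairs_in :: "nat set \<Rightarrow> nat set set \<Rightarrow> bool"
  where "pairs_in S z \<longleftrightarrow> finite z \<and> (\<forall>e\<in>z. e \<subseteq> S \<and> card e = 2) \<and> disjoint z"

lemma pairs_in_insert:
  assumes "pairs_in S (insert e z)" "e \<notin> z"
  obtains i j where "e = {i, j}" "i < j" "Min e = i" "Max e = j" "i \<in> S" "j \<in> S"
    "pairs_in S z" "i \<notin> \<Union>z" "j \<notin> \<Union>z"
proof -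
  have e: "card e = 2" "e \<subseteq> S" using assms by (auto simp: pairs_in_def)
  obtain i j where ij: "e = {i, j}" "i < j" "Min e = i" "Max e = j" using card_2_less[OF e(1)] .
  have "pairs_in S z" using assms by (auto simp: pairs_in_def pairwise_insert disjoint_def)
  moreover have "e \<inter> e' = {}" if "e' \<in> z" for e'
    using assms that by (auto simp: pairs_in_def disjoint_def)
  then have "i \<notin> \<Union>z" "j \<notin> \<Union>z" using ij by blast+
  ultimately show ?thesis using that ij e by blast
qed

text \<open>A fold over a set needs commuting factors. Maps of overlapping pairs need not commute,
  so commutation is required only within the given set, whose distinct members are disjoint.\<close>

lemma pairs_in_fold_insert:
  assumes "pairs_in S (insert e z)" "e \<notin> z"
    and comm: "\<And>i j k l. i \<in> S \<Longrightarrow> j \<in> S \<Longrightarrow> k \<in> S \<Longrightarrow> l \<in> S \<Longrightarrow> distinct [i, j, k, l] \<Longrightarrow> g i j \<circ> g k l = g k l \<circ> g i j"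
  shows "Finite_Set.fold (\<lambda>e h. g (Min e) (Max e) \<circ> h) a (insert e z)
    = g (Min e) (Max e) \<circ> Finite_Set.fold (\<lambda>e h. g (Min e) (Max e) \<circ> h) a z"
proof -
  have "comp_fun_commute_on (insert e z) (\<lambda>e h. g (Min e) (Max e) \<circ> h)"
  proof
    fix x y assume xy: "x \<in> insert e z" "y \<in> insert e z"
    have 1: "card x = 2" "x \<subseteq> S" "card y = 2" "y \<subseteq> S" using assms(1) xy by (auto simp: pairs_in_def)
    obtain i j where ij: "x = {i, j}" "i < j" "Min x = i" "Max x = j" using card_2_less[OF 1(1)] .
    obtain k l where kl: "y = {k, l}" "k < l" "Min y = k" "Max y = l" using card_2_less[OF 1(3)] .
    have "g i j \<circ> g k l = g k l \<circ> g i j"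
    proof (cases "x = y")
      case True
      then show ?thesis using ij kl by metis
    next
      case False
      have "disjoint (insert e z)" using assms(1) by (simp add: pairs_in_def)
      then have "x \<inter> y = {}" using xy False by (rule disjointD)
      then show ?thesis using comm[of i j k l] 1 ij kl by auto
    qed
    then show "(\<lambda>h. g (Min y) (Max y) \<circ> h) \<circ> (\<lambda>h. g (Min x) (Max x) \<circ> h)
      = (\<lambda>h. g (Min x) (Max x) \<circ> h) \<circ> (\<lambda>h. g (Min y) (Max y) \<circ> h)"
      unfolding ij(3,4) kl(3,4) by (auto simp: fun_eq_iff)
  qed
  then interpret comp_fun_commute_on "insert e z" "\<lambda>e h. g (Min e) (Max e) \<circ> h" .
  show ?thesis
    by (rule fold_insert) (use assms in \<open>auto simp: pairs_in_def\<close>)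
qed

lemma pairs_in_fold_Hom:
  assumes "pairs_in S z" "csubspace T" "a \<in> Hom T T"
    and Hom: "\<And>i j. i \<in> S \<Longrightarrow> j \<in> S \<Longrightarrow> i \<noteq> j \<Longrightarrow> g i j \<in> Hom T T"
    and comm: "\<And>i j k l. i \<in> S \<Longrightarrow> j \<in> S \<Longrightarrow> k \<in> S \<Longrightarrow> l \<in> S \<Longrightarrow> distinct [i, j, k, l] \<Longrightarrow> g i j \<circ> g k l = g k l \<circ> g i j"
  shows "Finite_Set.fold (\<lambda>e h. g (Min e) (Max e) \<circ> h) a z \<in> Hom T T"
proof -
  have "finite z" using assms(1) by (simp add: pairs_in_def)
  then show ?thesis using assms(1)
  proof (induction z)
    case (insert e z)
    from pairs_in_insert[OF insert.prems insert.hyps(2)]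
    obtain i j where ij: "e = {i, j}" "i < j" "Min e = i" "Max e = j" "i \<in> S" "j \<in> S" and z: "pairs_in S z"
      by metis
    have ins: "Finite_Set.fold (\<lambda>e h. g (Min e) (Max e) \<circ> h) a (insert e z)
      = g (Min e) (Max e) \<circ> Finite_Set.fold (\<lambda>e h. g (Min e) (Max e) \<circ> h) a z"
      by (rule pairs_in_fold_insert[OF insert.prems insert.hyps(2)]) (rule comm)
    show ?case
      unfolding ins ij(3,4)
      by (rule Hom_comp[OF insert.IH[OF z] Hom assms(2)]) (use ij in auto)
  qed (simp add: assms(3))
qed

lemma prod_remove2:
  assumes "finite A" "i \<in> A" "j \<in> A" "i \<noteq> j"
  shows "prod h A = h i * h j * prod h (A - {i, j})"
proof -
  have "prod h A = h i * prod h (A - {i})" by (rule prod.remove) (use assms in auto)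
  also have "prod h (A - {i}) = h j * prod h (A - {i} - {j})" by (rule prod.remove) (use assms in auto)
  also have "A - {i} - {j} = A - {i, j}" by auto
  finally show ?thesis by (simp add: mult.assoc)
qed

context bilinear_space
begin

text \<open>Interchanging the roles of the basis and the dual basis costs the sign \<epsilon>; this
  is the source of \<epsilon> in \<open>tau_vform\<close>.\<close>

lemma omega_expand_eps: "(\<Sum>q=1..n. \<omega> x (fd q) * \<omega> y (\<epsilon> *\<^sub>C f q)) = \<omega> x y"
proof -
  have "\<omega> y (\<epsilon> *\<^sub>C f q) = \<omega> (f q) y" for q by (simp add: omega_simps sym[of "f q" y])
  then show ?thesis using omega_expand(1)[of x y] by simp
qed

section \<open>Brauer diagram maps on tensor powers of V\<close>

lemma multilinear_tau:
  assumes "i < l" "j < l" "i \<noteq> j"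
  shows "multilinear l (\<lambda>vs. \<omega> (vs ! i) (vs ! j) *\<^sub>C (\<Sum>p=1..n. pure (vs[i := f p, j := fd p])))"
  unfolding complex_vector.scale_sum_right
  by (intro multilinear_sum multilinear_pair_pure[OF assms] clinear_omega)

lemma tau_pure: "i < l \<Longrightarrow> j < l \<Longrightarrow> i \<noteq> j \<Longrightarrow> length vs = l \<Longrightarrow>
    tau \<omega> n f fd l i j (pure vs) = \<omega> (vs ! i) (vs ! j) *\<^sub>C (\<Sum>p=1..n. pure (vs[i := f p, j := fd p]))"
  unfolding tau_def by (rule tlift(2)[OF multilinear_tau])

lemma tau_Hom: "i < l \<Longrightarrow> j < l \<Longrightarrow> i \<noteq> j \<Longrightarrow> tau \<omega> n f fd l i j \<in> Hom (tpow l) (tpow l)"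
  unfolding tau_def
  by (rule tlift_Hom[OF multilinear_tau])
    (auto intro!: complex_vector.subspace_scale[OF csubspace_tpow] complex_vector.subspace_sum[OF csubspace_tpow]
      pure_in_tpow)

text \<open>\<open>tau\<close> is its own transpose: it contracts two arguments and inserts a dual
  pair, and on the test vectors it likewise contracts two of them and inserts a pair. Both sides
  equal \<omega>(v_i, v_j) \<omega>(u_i, u_j) times the factors of the other slots.\<close>

lemma tau_vform:
  assumes ij: "i < l" "j < l" "i \<noteq> j" and x: "x \<in> tpow l"
  shows "tau \<omega> n f fd l i j x (vform l u)
    = (\<Sum>q=1..n. \<omega> (u i) (u j) * x (vform l (u(i := fd q, j := \<epsilon> *\<^sub>C f q))))"
proof (rule tpow_eval_eqI[OF tau_Hom[OF ij] x _ multilinear_vform])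
  fix vs :: "'v list" assume l: "length vs = l"
  let ?R = "\<Prod>k\<in>{..<l} - {i, j}. \<omega> (vs ! k) (u k)"
  have 1: "vform l u (vs[i := x, j := y]) = \<omega> x (u i) * \<omega> y (u j) * ?R" for x y
  proof -
    have "(\<Prod>k\<in>{..<l} - {i, j}. \<omega> (vs[i := x, j := y] ! k) (u k)) = ?R"
      by (rule prod.cong) auto
    then show ?thesis
      unfolding vform_def using ij l by (subst prod_remove2[of _ i j]) auto
  qed
  have 2: "vform l (u(i := a, j := b)) vs = \<omega> (vs ! i) a * \<omega> (vs ! j) b * ?R" for a b
  proof -
    have "(\<Prod>k\<in>{..<l} - {i, j}. \<omega> (vs ! k) ((u(i := a, j := b)) k)) = ?R"
      by (rule prod.cong) auto
    then show ?thesis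
      unfolding vform_def using ij l by (subst prod_remove2[of _ i j]) auto
  qed
  have "tau \<omega> n f fd l i j (pure vs) (vform l u)
    = \<omega> (vs ! i) (vs ! j) * (\<Sum>p=1..n. vform l u (vs[i := f p, j := fd p]))"
    unfolding tau_pure[OF ij l] scaleC_apply sum_fun_apply scaleC_complex_def
    by (intro arg_cong2[where f = times] refl sum.cong pure_eval[OF _ multilinear_vform]) (simp add: l)
  also have "\<dots> = \<omega> (vs ! i) (vs ! j) * (\<omega> (u i) (u j) * ?R)"
    unfolding 1 sum_distrib_right[symmetric] omega_expand(2) ..
  also have "\<dots> = (\<Sum>q=1..n. \<omega> (vs ! i) (fd q) * \<omega> (vs ! j) (\<epsilon> *\<^sub>C f q)) * (\<omega> (u i) (u j) * ?R)"
    unfolding omega_expand_eps ..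
  also have "\<dots> = (\<Sum>q=1..n. \<omega> (u i) (u j) * vform l (u(i := fd q, j := \<epsilon> *\<^sub>C f q)) vs)"
    unfolding 2 sum_distrib_right by (intro sum.cong refl) (simp add: mult_ac)
  finally show "tau \<omega> n f fd l i j (pure vs) (vform l u)
    = (\<Sum>q=1..n. \<omega> (u i) (u j) * vform l (u(i := fd q, j := \<epsilon> *\<^sub>C f q)) vs)" .
qed

lemma tau_commute:
  assumes "i < l" "j < l" "k < l" "m < l" "distinct [i, j, k, m]"
  shows "tau \<omega> n f fd l i j \<circ> tau \<omega> n f fd l k m = tau \<omega> n f fd l k m \<circ> tau \<omega> n f fd l i j"
proof
  fix x
  have d: "i \<noteq> j" "k \<noteq> m" "i \<noteq> k" "i \<noteq> m" "j \<noteq> k" "j \<noteq> m" using assms by auto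
  note H1 = tau_Hom[OF assms(1,2) d(1)] and H2 = tau_Hom[OF assms(3,4) d(2)]
  show "(tau \<omega> n f fd l i j \<circ> tau \<omega> n f fd l k m) x = (tau \<omega> n f fd l k m \<circ> tau \<omega> n f fd l i j) x"
  proof (cases "x \<in> tpow l")
    case True
    note x1 = HomD(1)[OF H1 True] and x2 = HomD(1)[OF H2 True]
    show ?thesis
    proof (rule tensor_eqI[where l = l])
      show "(tau \<omega> n f fd l i j \<circ> tau \<omega> n f fd l k m) x \<in> tpow l"
        "(tau \<omega> n f fd l k m \<circ> tau \<omega> n f fd l i j) x \<in> tpow l"
        using HomD(1)[OF H1 x2] HomD(1)[OF H2 x1] by simp_all
      fix u
      have "(tau \<omega> n f fd l i j \<circ> tau \<omega> n f fd l k m) x (vform l u)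
        = (\<Sum>q=1..n. \<omega> (u i) (u j) * (\<Sum>p=1..n. \<omega> (u k) (u m)
            * x (vform l (u(i := fd q, j := \<epsilon> *\<^sub>C f q, k := fd p, m := \<epsilon> *\<^sub>C f p)))))"
        unfolding comp_apply tau_vform[OF assms(1,2) d(1) x2] tau_vform[OF assms(3,4) d(2) True]
        using d by simp
      also have "\<dots> = (\<Sum>p=1..n. \<omega> (u k) (u m) * (\<Sum>q=1..n. \<omega> (u i) (u j)
            * x (vform l (u(k := fd p, m := \<epsilon> *\<^sub>C f p, i := fd q, j := \<epsilon> *\<^sub>C f q)))))"
      proof -
        have upd: "u(i := a, j := b, k := c, m := e) = u(k := c, m := e, i := a, j := b)" for a b c e
          using d by (auto simp: fun_eq_iff)
        show ?thesis
          unfolding upd sum_distrib_left by (subst sum.swap) (simp add: mult_ac)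
      qed
      also have "\<dots> = (tau \<omega> n f fd l k m \<circ> tau \<omega> n f fd l i j) x (vform l u)"
        unfolding comp_apply tau_vform[OF assms(3,4) d(2) x1] tau_vform[OF assms(1,2) d(1) True]
        using d by simp
      finally show "(tau \<omega> n f fd l i j \<circ> tau \<omega> n f fd l k m) x (vform l u)
        = (tau \<omega> n f fd l k m \<circ> tau \<omega> n f fd l i j) x (vform l u)" .
    qed
  next
    case False
    then show ?thesis
      using Hom_0[OF H1 csubspace_tpow] Hom_0[OF H2 csubspace_tpow] by (simp add: HomD(4)[OF H1] HomD(4)[OF H2])
  qed
qed

lemma tau_diagram_insert:
  assumes "pairs_in {..<l} (insert e z)" "e \<notin> z"
  shows "tau_diagram \<omega> n f fd l (insert e z) = tau \<omega> n f fd l (Min e) (Max e) \<circ> tau_diagram \<omega> n f fd l z"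
  unfolding tau_diagram_def by (rule pairs_in_fold_insert[OF assms]) (rule tau_commute; simp)

lemma brauer_diagrams_pairs_in: "z \<in> brauer_diagrams l \<longleftrightarrow> pairs_in {..<l} z"
proof -
  have "finite z" if "\<forall>e\<in>z. e \<subseteq> {..<l}" for z :: "nat set set"
    by (rule finite_subset[of _ "Pow {..<l}"]) (use that in auto)
  then show ?thesis by (auto simp: brauer_diagrams_def pairs_in_def)
qed

lemma tau_diagram_Hom:
  assumes "pairs_in {..<l} z"
  shows "tau_diagram \<omega> n f fd l z \<in> Hom (tpow l) (tpow l)"
  unfolding tau_diagram_def
  by (rule pairs_in_fold_Hom[OF assms csubspace_tpow idmap_Hom[OF csubspace_tpow]])
    (rule tau_Hom tau_commute; simp)+

text \<open>Read as a picture: each pair of \<open>z\<close> is one arc among the arguments and one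
  arc among the test vectors, and every free position is a vertical string joining the two.\<close>

lemma tau_diagram_vform:
  assumes z: "pairs_in {..<l} z" and vs: "length vs = l"
  shows "tau_diagram \<omega> n f fd l z (pure vs) (vform l u)
    = (\<Prod>e\<in>z. \<omega> (vs ! Min e) (vs ! Max e) * \<omega> (u (Min e)) (u (Max e)))
      * (\<Prod>k\<in>{..<l} - \<Union>z. \<omega> (vs ! k) (u k))"
proof -
  have "finite z" using z by (simp add: pairs_in_def)
  then show ?thesis using z
  proof (induction z arbitrary: u)
    case empty
    show ?case
      using pure_eval[OF vs multilinear_vform, of u] vs
      by (simp add: tau_diagram_def idmap_def pure_in_tpow) (simp add: vform_def)
  next
    case (insert e z)
    from pairs_in_insert[OF insert.prems insert.hyps(2)]
    obtain i j where ij: "e = {i, j}" "i < j" "Min e = i" "Max e = j" "i \<in> {..<l}" "j \<in> {..<l}"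
      and z: "pairs_in {..<l} z" and nin: "i \<notin> \<Union>z" "j \<notin> \<Union>z" by metis
    have ne: "i \<noteq> j" using ij by simp
    have fin: "finite ({..<l} - \<Union>z)" by simp
    let ?P = "\<Prod>e\<in>z. \<omega> (vs ! Min e) (vs ! Max e) * \<omega> (u (Min e)) (u (Max e))"
    let ?R = "\<Prod>k\<in>{..<l} - \<Union>(insert e z). \<omega> (vs ! k) (u k)"
    \<comment> \<open>The hypothesis is needed for modified test vectors, since the transpose of
      \<open>tau\<close> overwrites \<open>u\<close> at \<open>i\<close> and
      \<open>j\<close>.\<close>
    have IH: "tau_diagram \<omega> n f fd l z (pure vs) (vform l (u(i := a, j := b)))
      = ?P * (\<omega> (vs ! i) a * \<omega> (vs ! j) b * ?R)" for a b
    proof -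
      have "(\<Prod>e\<in>z. \<omega> (vs ! Min e) (vs ! Max e) * \<omega> ((u(i := a, j := b)) (Min e)) ((u(i := a, j := b)) (Max e))) = ?P"
      proof (rule prod.cong[OF refl])
        fix e' assume e': "e' \<in> z"
        then have "card e' = 2" using z by (auto simp: pairs_in_def)
        then obtain k m where "e' = {k, m}" "Min e' = k" "Max e' = m" using card_2_less by metis
        then have "Min e' \<notin> {i, j}" "Max e' \<notin> {i, j}" using nin e' by auto
        then show "\<omega> (vs ! Min e') (vs ! Max e') * \<omega> ((u(i := a, j := b)) (Min e')) ((u(i := a, j := b)) (Max e'))
          = \<omega> (vs ! Min e') (vs ! Max e') * \<omega> (u (Min e')) (u (Max e'))" by simp
      qed
      moreover have "(\<Prod>k\<in>{..<l} - \<Union>z. \<omega> (vs ! k) ((u(i := a, j := b)) k)) = \<omega> (vs ! i) a * \<omega> (vs ! j) b * ?R"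
      proof -
        have "{..<l} - \<Union>z - {i, j} = {..<l} - \<Union>(insert e z)" using ij by auto
        moreover have "(\<Prod>k\<in>{..<l} - \<Union>z - {i, j}. \<omega> (vs ! k) ((u(i := a, j := b)) k))
            = (\<Prod>k\<in>{..<l} - \<Union>z - {i, j}. \<omega> (vs ! k) (u k))"
          by (rule prod.cong) auto
        ultimately show ?thesis
          using ij nin ne by (subst prod_remove2[OF fin, of i j]) auto
      qed
      ultimately show ?thesis unfolding insert.IH[OF z] by simp
    qed
    have il: "i < l" "j < l" using ij by auto
    have "tau_diagram \<omega> n f fd l (insert e z) (pure vs) (vform l u)
      = (\<Sum>q=1..n. \<omega> (u i) (u j) * (?P * (\<omega> (vs ! i) (fd q) * \<omega> (vs ! j) (\<epsilon> *\<^sub>C f q) * ?R)))"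
      unfolding tau_diagram_insert[OF insert.prems insert.hyps(2)] ij(3,4) comp_apply
      by (subst tau_vform[OF il ne HomD(1)[OF tau_diagram_Hom[OF z] pure_in_tpow[OF vs]]]) (simp only: IH)
    also have "\<dots> = \<omega> (u i) (u j) * ?P * ?R * (\<Sum>q=1..n. \<omega> (vs ! i) (fd q) * \<omega> (vs ! j) (\<epsilon> *\<^sub>C f q))"
      unfolding sum_distrib_left by (intro sum.cong refl) (simp add: mult_ac)
    also have "\<dots> = \<omega> (u i) (u j) * ?P * ?R * \<omega> (vs ! i) (vs ! j)" unfolding omega_expand_eps ..
    finally show ?case
      using insert.hyps by (simp add: ij(3,4) mult_ac)
  qed
qed


section \<open>Insertion and contraction of pairs on the extended space\<close>

lemma clinear_snd_mult: "clinear (\<lambda>x :: 'v ext. snd x * snd y)" "clinear (\<lambda>x :: 'v ext. snd y * snd x)"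
  by (rule clinearI; simp add: scaleC_prod_def scaleC_complex_def algebra_simps)+

lemma clinear_omega_fst: "clinear (\<lambda>x :: 'v ext. \<omega> (fst x) (fst y))" "clinear (\<lambda>x :: 'v ext. \<omega> (fst y) (fst x))"
  by (rule clinearI; simp add: scaleC_prod_def scaleC_complex_def omega_simps)+

lemma multilinear_insert:
  assumes "i < r" "j < r" "i \<noteq> j"
  shows "multilinear r (\<lambda>ws :: 'v ext list. (snd (ws ! i) * snd (ws ! j)) *\<^sub>C
    (\<Sum>p=1..n. pure (ws[i := (f p, 0), j := (fd p, 0)])))"
  unfolding complex_vector.scale_sum_right
  by (intro multilinear_sum multilinear_pair_pure[OF assms, where c = "\<lambda>x y. snd x * snd y"] clinear_snd_mult)

lemma insert_pair_pure: "i < r \<Longrightarrow> j < r \<Longrightarrow> i \<noteq> j \<Longrightarrow> length ws = r \<Longrightarrow>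
    insert_pair n f fd r i j (pure ws) = (snd (ws ! i) * snd (ws ! j)) *\<^sub>C
    (\<Sum>p=1..n. pure (ws[i := (f p, 0), j := (fd p, 0)]))"
  unfolding insert_pair_def by (rule tlift(2)[OF multilinear_insert])

lemma insert_pair_Hom: "i < r \<Longrightarrow> j < r \<Longrightarrow> i \<noteq> j \<Longrightarrow> insert_pair n f fd r i j \<in> Hom (tpow r) (tpow r)"
  unfolding insert_pair_def
  by (rule tlift_Hom[OF multilinear_insert])
    (auto intro!: complex_vector.subspace_scale[OF csubspace_tpow] complex_vector.subspace_sum[OF csubspace_tpow]
      pure_in_tpow)

lemma multilinear_contract:
  assumes "i < r" "j < r" "i \<noteq> j"
  shows "multilinear r (\<lambda>ws :: 'v ext list. \<omega> (fst (ws ! i)) (fst (ws ! j)) *\<^sub>C pure (ws[i := \<eta>, j := \<eta>]))"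
  by (intro multilinear_pair_pure[OF assms, where c = "\<lambda>x y. \<omega> (fst x) (fst y)"] clinear_omega_fst)

lemma contract_pair_pure: "i < r \<Longrightarrow> j < r \<Longrightarrow> i \<noteq> j \<Longrightarrow> length ws = r \<Longrightarrow>
    contract_pair \<omega> r i j (pure ws) = \<omega> (fst (ws ! i)) (fst (ws ! j)) *\<^sub>C pure (ws[i := \<eta>, j := \<eta>])"
  unfolding contract_pair_def by (rule tlift(2)[OF multilinear_contract])

lemma contract_pair_Hom: "i < r \<Longrightarrow> j < r \<Longrightarrow> i \<noteq> j \<Longrightarrow> contract_pair \<omega> r i j \<in> Hom (tpow r) (tpow r)"
  unfolding contract_pair_def
  by (rule tlift_Hom[OF multilinear_contract])
    (auto intro!: complex_vector.subspace_scale[OF csubspace_tpow] pure_in_tpow)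

lemma insert_pair_kform:
  assumes ij: "i < r" "j < r" "i \<noteq> j" and x: "x \<in> tpow r"
  shows "insert_pair n f fd r i j x (kform r J u)
    = (if i \<in> J \<and> j \<in> J then \<omega> (u i) (u j) * x (kform r (J - {i, j}) u) else 0)"
proof -
  have "insert_pair n f fd r i j (pure ws) (kform r J u)
    = (if i \<in> J \<and> j \<in> J then \<omega> (u i) (u j) else 0) * kform r (J - {i, j}) u ws"
    if l: "length ws = r" for ws :: "'v ext list"
  proof -
    let ?t = "\<lambda>k. if k \<in> J then \<omega> (fst (ws ! k)) (u k) else snd (ws ! k)"
    let ?R = "\<Prod>k\<in>{..<r} - {i, j}. ?t k"
    have 1: "kform r J u (ws[i := (a, 0), j := (b, 0)])
       = (if i \<in> J \<and> j \<in> J then \<omega> a (u i) * \<omega> b (u j) * ?R else 0)" for a b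
    proof -
      let ?ws = "ws[i := (a, 0), j := (b, 0)]"
      have "(\<Prod>k\<in>{..<r} - {i, j}. if k \<in> J then \<omega> (fst (?ws ! k)) (u k) else snd (?ws ! k)) = ?R"
        by (rule prod.cong) auto
      then show ?thesis
        unfolding kform_def using ij l by (subst prod_remove2[of _ i j]) auto
    qed
    have 2: "kform r (J - {i, j}) u ws = snd (ws ! i) * snd (ws ! j) * ?R"
    proof -
      have "(\<Prod>k\<in>{..<r} - {i, j}. if k \<in> J - {i, j} then \<omega> (fst (ws ! k)) (u k) else snd (ws ! k)) = ?R"
        by (rule prod.cong) auto
      then show ?thesis
        unfolding kform_def using ij l by (subst prod_remove2[of _ i j]) auto
    qed
    have "insert_pair n f fd r i j (pure ws) (kform r J u)
      = (snd (ws ! i) * snd (ws ! j)) * (\<Sum>p=1..n. kform r J u (ws[i := (f p, 0), j := (fd p, 0)]))"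
      unfolding insert_pair_pure[OF ij l] scaleC_apply sum_fun_apply scaleC_complex_def
      by (intro arg_cong2[where f = times] refl sum.cong pure_eval[OF _ multilinear_kform]) (simp add: l)
    also have "\<dots> = (if i \<in> J \<and> j \<in> J then \<omega> (u i) (u j) else 0) * kform r (J - {i, j}) u ws"
    proof (cases "i \<in> J \<and> j \<in> J")
      case True
      then have "(\<Sum>p=1..n. kform r J u (ws[i := (f p, 0), j := (fd p, 0)])) = \<omega> (u i) (u j) * ?R"
        unfolding 1 by (simp only: simp_thms if_True sum_distrib_right[symmetric] omega_expand(2))
      then show ?thesis using True by (simp add: 2 mult_ac)
    next
      case False
      then have "(\<Sum>p=1..n. kform r J u (ws[i := (f p, 0), j := (fd p, 0)])) = 0"
        unfolding 1 by (simp only: if_False sum.neutral_const)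
      then show ?thesis using False by auto
    qed
    finally show ?thesis .
  qed
  from tpow_eval_eq1[OF insert_pair_Hom[OF ij] x this multilinear_kform] show ?thesis by simp
qed

text \<open>Contraction pairs the arguments and is therefore computed on tensors; insertion pairs
  the test vectors and is computed on test forms. In this way each stays a single term.\<close>

lemma contract_pair_tens:
  fixes v :: "nat \<Rightarrow> 'v"
  assumes ij: "i < r" "j < r" "i \<noteq> j"
  shows "contract_pair \<omega> r i j (tens r I v)
    = (if i \<in> I \<and> j \<in> I then \<omega> (v i) (v j) *\<^sub>C tens r (I - {i, j}) v else 0)"
proof -
  have "(fill r I v)[i := \<eta>, j := \<eta>] = fill r (I - {i, j}) v"
    by (rule nth_equalityI) (use ij in \<open>auto simp: nth_list_update\<close>)
  then show ?thesis
    unfolding tens_def contract_pair_pure[OF ij length_fill] using ij by (auto simp: omega_simps)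
qed

lemma insert_pair_commute:
  assumes "i < r" "j < r" "k < r" "m < r" "distinct [i, j, k, m]"
  shows "insert_pair n f fd r i j \<circ> insert_pair n f fd r k m = insert_pair n f fd r k m \<circ> insert_pair n f fd r i j"
proof
  fix x
  have d: "i \<noteq> j" "k \<noteq> m" "i \<noteq> k" "i \<noteq> m" "j \<noteq> k" "j \<noteq> m" using assms by auto
  note H1 = insert_pair_Hom[OF assms(1,2) d(1)] and H2 = insert_pair_Hom[OF assms(3,4) d(2)]
  show "(insert_pair n f fd r i j \<circ> insert_pair n f fd r k m) x
    = (insert_pair n f fd r k m \<circ> insert_pair n f fd r i j) x"
  proof (cases "x \<in> tpow r")
    case True
    note x1 = HomD(1)[OF H1 True] and x2 = HomD(1)[OF H2 True]
    show ?thesis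
    proof (rule tensor_ext_eqI[where r = r])
      show "(insert_pair n f fd r i j \<circ> insert_pair n f fd r k m) x \<in> tpow r"
        "(insert_pair n f fd r k m \<circ> insert_pair n f fd r i j) x \<in> tpow r"
        using HomD(1)[OF H1 x2] HomD(1)[OF H2 x1] by simp_all
      fix J u
      have "J - {i, j} - {k, m} = J - {k, m} - {i, j}" by auto
      then show "(insert_pair n f fd r i j \<circ> insert_pair n f fd r k m) x (kform r J u)
        = (insert_pair n f fd r k m \<circ> insert_pair n f fd r i j) x (kform r J u)"
        unfolding comp_apply insert_pair_kform[OF assms(1,2) d(1) x2] insert_pair_kform[OF assms(3,4) d(2) True]
          insert_pair_kform[OF assms(3,4) d(2) x1] insert_pair_kform[OF assms(1,2) d(1) True]
        using d by auto
    qed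
  next
    case False
    then show ?thesis
      using Hom_0[OF H1 csubspace_tpow] Hom_0[OF H2 csubspace_tpow] by (simp add: HomD(4)[OF H1] HomD(4)[OF H2])
  qed
qed

lemma contract_pair_commute:
  assumes "i < r" "j < r" "k < r" "m < r" "distinct [i, j, k, m]"
  shows "contract_pair \<omega> r i j \<circ> contract_pair \<omega> r k m = contract_pair \<omega> r k m \<circ> contract_pair \<omega> r i j"
proof -
  have d: "i \<noteq> j" "k \<noteq> m" "i \<noteq> k" "i \<noteq> m" "j \<noteq> k" "j \<noteq> m" using assms by auto
  note H1 = contract_pair_Hom[OF assms(1,2) d(1)] and H2 = contract_pair_Hom[OF assms(3,4) d(2)]
  note T1 = contract_pair_tens[OF assms(1,2) d(1)] and T2 = contract_pair_tens[OF assms(3,4) d(2)]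
  show ?thesis
  proof (rule Hom_ext_eqI[OF Hom_comp[OF H2 H1 csubspace_tpow] Hom_comp[OF H1 H2 csubspace_tpow]])
    fix I and v :: "nat \<Rightarrow> 'v"
    have "I - {i, j} - {k, m} = I - {k, m} - {i, j}" by auto
    then show "(contract_pair \<omega> r i j \<circ> contract_pair \<omega> r k m) (tens r I v)
      = (contract_pair \<omega> r k m \<circ> contract_pair \<omega> r i j) (tens r I v)"
      unfolding comp_apply T1 T2
      using d Hom_0[OF H1 csubspace_tpow] Hom_0[OF H2 csubspace_tpow]
      by (auto simp: HomD(3)[OF H1] HomD(3)[OF H2] T1 T2 scaleC_scaleC mult.commute)
  qed
qed

lemma D_map_insert:
  assumes "pairs_in {..<r} (insert e U)" "e \<notin> U"
  shows "D_map n f fd r K (insert e U) = insert_pair n f fd r (Min e) (Max e) \<circ> D_map n f fd r K U"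
  unfolding D_map_def by (rule pairs_in_fold_insert[OF assms]) (rule insert_pair_commute; simp)

lemma C_map_insert:
  assumes "pairs_in {..<r} (insert e U)" "e \<notin> U"
  shows "C_map \<omega> r K (insert e U) = contract_pair \<omega> r (Min e) (Max e) \<circ> C_map \<omega> r K U"
  unfolding C_map_def by (rule pairs_in_fold_insert[OF assms]) (rule contract_pair_commute; simp)

lemma D_map_Hom:
  assumes "pairs_in {..<r} U"
  shows "D_map n f fd r K U \<in> Hom (tpow r) (tpow r)"
  unfolding D_map_def
  by (rule pairs_in_fold_Hom[OF assms csubspace_tpow summand_proj_Hom])
    (rule insert_pair_Hom insert_pair_commute; simp)+

lemma C_map_Hom:
  assumes "pairs_in {..<r} U"
  shows "C_map \<omega> r K U \<in> Hom (tpow r) (tpow r)"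
  unfolding C_map_def
  by (rule pairs_in_fold_Hom[OF assms csubspace_tpow summand_proj_Hom])
    (rule contract_pair_Hom contract_pair_commute; simp)+

lemma D_map_kform:
  assumes U: "pairs_in {..<r} U" and K: "K \<subseteq> {..<r}" "K \<inter> \<Union>U = {}" and x: "x \<in> tpow r"
  shows "D_map n f fd r K U x (kform r (K \<union> \<Union>U) u)
    = (\<Prod>e\<in>U. \<omega> (u (Min e)) (u (Max e))) * x (kform r K u)"
proof -
  have "finite U" using U by (simp add: pairs_in_def)
  then show ?thesis using U K(2)
  proof (induction U)
    case empty
    then show ?case by (simp add: D_map_def summand_proj_kform[OF x K(1) K(1)])
  next
    case (insert e U)
    from pairs_in_insert[OF insert.prems(1) insert.hyps(2)]
    obtain i j where ij: "e = {i, j}" "i < j" "Min e = i" "Max e = j" "i \<in> {..<r}" "j \<in> {..<r}"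
      and U: "pairs_in {..<r} U" and nin: "i \<notin> \<Union>U" "j \<notin> \<Union>U" by metis
    have il: "i < r" "j < r" "i \<noteq> j" using ij by auto
    have mem: "i \<in> K \<union> \<Union>(insert e U)" "j \<in> K \<union> \<Union>(insert e U)" using ij by auto
    have eq: "K \<union> \<Union>(insert e U) - {i, j} = K \<union> \<Union>U" using ij nin insert.prems(2) by auto
    have "K \<inter> \<Union>U = {}" using insert.prems(2) by auto
    note IH = insert.IH[OF U this]
    show ?case
      unfolding D_map_insert[OF insert.prems(1) insert.hyps(2)] ij(3,4) comp_apply
        insert_pair_kform[OF il HomD(1)[OF D_map_Hom[OF U] x]] eq
      using mem IH insert.hyps by (simp add: ij(3,4) mult_ac)
  qed
qed

lemma C_map_tens:
  fixes v :: "nat \<Rightarrow> 'v"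
  assumes U: "pairs_in {..<r} U" and L: "L \<subseteq> {..<r}" "\<Union>U \<subseteq> L" and I: "I \<subseteq> {..<r}"
  shows "C_map \<omega> r L U (tens r I v)
    = (if I = L then (\<Prod>e\<in>U. \<omega> (v (Min e)) (v (Max e))) *\<^sub>C tens r (L - \<Union>U) v else 0)"
proof -
  have "finite U" using U by (simp add: pairs_in_def)
  then show ?thesis using U L(2)
  proof (induction U)
    case empty
    show ?case using summand_proj_tens[OF L(1) I, of v] by (auto simp: C_map_def scaleC_one)
  next
    case (insert e U)
    from pairs_in_insert[OF insert.prems(1) insert.hyps(2)]
    obtain i j where ij: "e = {i, j}" "i < j" "Min e = i" "Max e = j" "i \<in> {..<r}" "j \<in> {..<r}"
      and U: "pairs_in {..<r} U" and nin: "i \<notin> \<Union>U" "j \<notin> \<Union>U" by metis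
    have il: "i < r" "j < r" "i \<noteq> j" using ij by auto
    have mem: "i \<in> L - \<Union>U" "j \<in> L - \<Union>U" using ij nin insert.prems(2) by auto
    have eq: "L - \<Union>U - {i, j} = L - \<Union>(insert e U)" using ij by auto
    note H = contract_pair_Hom[OF il]
    have "\<Union>U \<subseteq> L" using insert.prems(2) by auto
    note IH = insert.IH[OF U this]
    show ?case
    proof (cases "I = L")
      case True
      have "C_map \<omega> r L (insert e U) (tens r I v)
        = contract_pair \<omega> r i j ((\<Prod>e\<in>U. \<omega> (v (Min e)) (v (Max e))) *\<^sub>C tens r (L - \<Union>U) v)"
        unfolding C_map_insert[OF insert.prems(1) insert.hyps(2)] ij(3,4) comp_apply IH using True by simp
      also have "\<dots> = (\<Prod>e\<in>U. \<omega> (v (Min e)) (v (Max e))) *\<^sub>C \<omega> (v i) (v j) *\<^sub>C tens r (L - \<Union>(insert e U)) v"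
        unfolding HomD(3)[OF H tens_in_tpow] contract_pair_tens[OF il] eq using mem by simp
      finally show ?thesis using True insert.hyps by (simp add: ij(3,4) scaleC_scaleC mult.commute)
    next
      case False
      then show ?thesis
        unfolding C_map_insert[OF insert.prems(1) insert.hyps(2)] ij(3,4) comp_apply IH
        using Hom_0[OF H csubspace_tpow] by simp
    qed
  qed
qed

end

section \<open>Lists of pairs and bijections between sets of slots\<close>

definition pset :: "(nat \<times> nat) list \<Rightarrow> nat set set"
  where "pset ps = (\<lambda>(i, j). {i, j}) ` set ps"

text \<open>The diagram maps are indexed by sets of two-element sets read through \<open>Min\<close>
  and \<open>Max\<close>. A list with i < j in every pair fixes the same orientation
  (\<open>prod_pset\<close>) and allows recursion.\<close>

definition ordered_pairs :: "(nat \<times> nat) list \<Rightarrow> bool"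
  where "ordered_pairs ps \<longleftrightarrow> distinct (map fst ps @ map snd ps) \<and> (\<forall>(i, j)\<in>set ps. i < j)"

definition psupp :: "('i \<times> 'i) list \<Rightarrow> 'i set"
  where "psupp ps = fst ` set ps \<union> snd ` set ps"

lemma psupp_simps: "psupp [] = {}" "psupp ((i, j) # ps) = {i, j} \<union> psupp ps" "psupp (ps @ qs) = psupp ps \<union> psupp qs"
  by (auto simp: psupp_def)

lemma ordered_pairs_simps: "ordered_pairs []"
  "ordered_pairs ((i, j) # ps) \<longleftrightarrow> i < j \<and> i \<notin> psupp ps \<and> j \<notin> psupp ps \<and> ordered_pairs ps"
  by (auto simp: ordered_pairs_def psupp_def)

lemma ordered_pairs_append:
  "ordered_pairs (ps @ qs) \<longleftrightarrow> ordered_pairs ps \<and> ordered_pairs qs \<and> psupp ps \<inter> psupp qs = {}"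
  by (induction ps) (auto simp: ordered_pairs_simps psupp_simps)

lemma Union_pset: "\<Union>(pset ps) = psupp ps"
  by (auto simp: pset_def psupp_def image_iff) force+

lemma pset_Cons: "pset ((i, j) # ps) = insert {i, j} (pset ps)"
  by (simp add: pset_def)

lemma card_psupp: "ordered_pairs ps \<Longrightarrow> card (psupp ps) = 2 * length ps"
proof (induction ps)
  case (Cons p ps)
  obtain i j where p: "p = (i, j)" by (cases p)
  have "finite (psupp ps)" by (simp add: psupp_def)
  then show ?case using Cons by (auto simp: p ordered_pairs_simps psupp_simps)
qed (simp add: psupp_simps)

lemma pairs_in_pset: "ordered_pairs ps \<Longrightarrow> psupp ps \<subseteq> S \<Longrightarrow> pairs_in S (pset ps)"
proof (induction ps)
  case Nil
  then show ?case by (simp add: pset_def pairs_in_def)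
next
  case (Cons p ps)
  obtain i j where p: "p = (i, j)" by (cases p)
  have "pairs_in S (pset ps)" using Cons by (simp add: p ordered_pairs_simps psupp_simps)
  moreover have "{i, j} \<inter> e = {}" if "e \<in> pset ps" for e
    using Cons.prems that Union_pset[of ps] by (auto simp: p ordered_pairs_simps)
  ultimately show ?case
    using Cons.prems by (auto simp: p pset_Cons pairs_in_def pairwise_insert disjoint_def ordered_pairs_simps psupp_simps)
qed

lemma prod_pset:
  "ordered_pairs ps \<Longrightarrow> (\<Prod>e\<in>pset ps. g (Min e) (Max e)) = (\<Prod>(i, j)\<leftarrow>ps. g i j :: complex)"
proof (induction ps)
  case (Cons p ps)
  obtain i j where p: "p = (i, j)" by (cases p)
  have "{i, j} \<notin> pset ps" using Cons.prems Union_pset[of ps] by (auto simp: p ordered_pairs_simps)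
  moreover have "finite (pset ps)" by (simp add: pset_def)
  moreover have "Min {i, j} = i" "Max {i, j} = j" using Cons.prems by (auto simp: p ordered_pairs_simps)
  ultimately show ?case using Cons by (simp add: p pset_Cons ordered_pairs_simps)
qed (simp add: pset_def)

lemma pairing_exists:
  fixes S :: "nat set"
  assumes "finite S" "even (card S)"
  shows "\<exists>ps. ordered_pairs ps \<and> psupp ps = S"
  using assms
proof (induction "card S" arbitrary: S rule: less_induct)
  case less
  show ?case
  proof (cases "S = {}")
    case True
    then show ?thesis by (intro exI[of _ "[]"]) (simp add: ordered_pairs_simps psupp_simps)
  next
    case False
    then have "card S \<noteq> 0" using less.prems by simp
    moreover have "card S \<noteq> 1" using less.prems by auto
    ultimately have "card S \<ge> 2" by linarith
    then obtain T where T: "T \<subseteq> S" "card T = 2" using obtain_subset_with_card_n by metis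
    obtain i j where ij: "T = {i, j}" "i < j" using card_2_less[OF T(2)] by metis
    have "card (S - T) = card S - 2" using T less.prems by (simp add: card_Diff_subset finite_subset)
    then obtain ps where ps: "ordered_pairs ps" "psupp ps = S - T"
      using less.hyps[of "S - T"] less.prems \<open>card S \<ge> 2\<close> by auto
    then show ?thesis
      using ij T by (intro exI[of _ "(i, j) # ps"]) (auto simp: ordered_pairs_simps psupp_simps)
  qed
qed

lemma list_bijection:
  assumes "distinct xs" "distinct ys" "length xs = length ys"
  shows "\<exists>\<beta>. bij_betw \<beta> (set xs) (set ys) \<and> map \<beta> xs = ys"
proof -
  define \<beta> where "\<beta> x = the (map_of (zip xs ys) x)" for x
  have nth: "\<beta> (xs ! k) = ys ! k" if "k < length xs" for k
    using that assms by (simp add: \<beta>_def map_of_zip_nth)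
  then have "map \<beta> xs = ys" using assms by (intro nth_equalityI) auto
  moreover have "inj_on \<beta> (set xs)"
    using nth assms by (auto simp: inj_on_def in_set_conv_nth nth_eq_iff_index_eq)
  moreover have "\<beta> ` set xs = set ys" using \<open>map \<beta> xs = ys\<close> by (metis set_map)
  ultimately show ?thesis by (auto simp: bij_betw_def)
qed

text \<open>The bijection \<beta> of slots expressed in positions; it is the identity from
  \<open>card J\<close> on, as \<open>permutes\<close> demands.\<close>

definition rank_perm :: "nat set \<Rightarrow> nat set \<Rightarrow> (nat \<Rightarrow> nat) \<Rightarrow> nat \<Rightarrow> nat"
  where "rank_perm J J' \<beta> k = (if k < card J then rank J (\<beta> (enum J' k)) else k)"

text \<open>The bijection from \<open>J'\<close> to \<open>J\<close> carried out by the position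
  permutation \<sigma> on \<open>J'\<close> followed by \<open>E_map\<close>: in the transpose it is
  composed with the test vectors (\<open>E_perm_kform\<close>). Every bijection arises so, by taking
  \<open>rank_perm\<close> for \<sigma>.\<close>

definition slot_map :: "nat set \<Rightarrow> nat set \<Rightarrow> (nat \<Rightarrow> nat) \<Rightarrow> nat \<Rightarrow> nat"
  where "slot_map J J' \<sigma> i = enum J (\<sigma> (rank J' i))"

lemma rank_perm:
  assumes "finite J" "finite J'" "card J' = card J" and \<beta>: "bij_betw \<beta> J' J"
  shows "rank_perm J J' \<beta> permutes {..<card J}"
    and "i \<in> J' \<Longrightarrow> slot_map J J' (rank_perm J J' \<beta>) i = \<beta> i"
proof -
  have "bij_betw (rank J) J {..<card J}"
    by (rule bij_betw_byWitness[where f' = "enum J"])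
      (use assms in \<open>auto simp: rank_enum enum_rank enum_in rank_less\<close>)
  then have "bij_betw (rank J \<circ> (\<beta> \<circ> enum J')) {..<card J} {..<card J}"
    using bij_betw_trans[OF bij_betw_trans[OF bij_enum[OF assms(2)] \<beta>]] assms(3) by simp
  then have "bij_betw (rank_perm J J' \<beta>) {..<card J} {..<card J}"
    by (rule bij_betw_cong[THEN iffD1, rotated]) (simp add: rank_perm_def)
  then show "rank_perm J J' \<beta> permutes {..<card J}"
    by (rule bij_imp_permutes) (simp add: rank_perm_def)
  assume i: "i \<in> J'"
  have "rank J' i < card J" using rank_less[OF assms(2) i] assms(3) by simp
  then show "slot_map J J' (rank_perm J J' \<beta>) i = \<beta> i"
    using i assms(1,2) bij_betw_apply[OF \<beta> i] by (simp add: slot_map_def rank_perm_def enum_rank)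
qed

context bilinear_space
begin

text \<open>The value of the diagram \<open>z\<close>, moved to the slots of \<open>I\<close>, at
  arguments \<open>v\<close> and test vectors \<open>w\<close>.\<close>

definition dform :: "nat set \<Rightarrow> nat set set \<Rightarrow> (nat \<Rightarrow> 'v) \<Rightarrow> (nat \<Rightarrow> 'v) \<Rightarrow> complex"
  where "dform I z v w =
    (\<Prod>e\<in>z. \<omega> (v (enum I (Min e))) (v (enum I (Max e))) * \<omega> (w (enum I (Min e))) (w (enum I (Max e))))
      * (\<Prod>k\<in>{..<card I} - \<Union>z. \<omega> (v (enum I k)) (w (enum I k)))"

lemma on_summand_tau_kform:
  assumes z: "pairs_in {..<card I} z" and I: "I \<subseteq> {..<r}" "I1 \<subseteq> {..<r}"
  shows "on_summand r I (tau_diagram \<omega> n f fd (card I) z) (tens r I1 v) (kform r I w)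
    = (if I1 = I then dform I z v w else 0)"
proof -
  note H = tau_diagram_Hom[OF z]
  show ?thesis
  proof (cases "I1 = I")
    case True
    let ?vs = "map (v \<circ> enum I) [0..<card I]"
    have "(\<Prod>e\<in>z. \<omega> (?vs ! Min e) (?vs ! Max e) * \<omega> ((w \<circ> enum I) (Min e)) ((w \<circ> enum I) (Max e)))
      = (\<Prod>e\<in>z. \<omega> (v (enum I (Min e))) (v (enum I (Max e))) * \<omega> (w (enum I (Min e))) (w (enum I (Max e))))"
    proof (rule prod.cong[OF refl])
      fix e assume "e \<in> z"
      then have e: "card e = 2" "e \<subseteq> {..<card I}" using z by (auto simp: pairs_in_def)
      obtain i j where "e = {i, j}" "Min e = i" "Max e = j" using card_2_less[OF e(1)] by metis
      then show "\<omega> (?vs ! Min e) (?vs ! Max e) * \<omega> ((w \<circ> enum I) (Min e)) ((w \<circ> enum I) (Max e))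
        = \<omega> (v (enum I (Min e))) (v (enum I (Max e))) * \<omega> (w (enum I (Min e))) (w (enum I (Max e)))"
        using e by simp
    qed
    moreover have "(\<Prod>k\<in>{..<card I} - \<Union>z. \<omega> (?vs ! k) ((w \<circ> enum I) k))
      = (\<Prod>k\<in>{..<card I} - \<Union>z. \<omega> (v (enum I k)) (w (enum I k)))"
      by (rule prod.cong) auto
    ultimately show ?thesis
      unfolding on_summand_kform[OF tens_in_tpow H I(1) I(1)] slots_out_tens[OF I(1) I(2)]
      using True tau_diagram_vform[OF z, of ?vs "w \<circ> enum I"] by (simp add: dform_def)
  next
    case False
    then show ?thesis
      unfolding on_summand_kform[OF tens_in_tpow H I(1) I(1)] slots_out_tens[OF I(1) I(2)]
      using Hom_0[OF H csubspace_tpow] by simp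
  qed
qed

lemma dform_invariant:
  "g \<in> isometry_group \<omega> \<Longrightarrow> dform I z (g \<circ> v) (g \<circ> w) = dform I z v w"
  by (simp add: dform_def isometryD)

text \<open>\<open>rank I\<close> is increasing on \<open>I\<close>, so passing from slots to
  positions preserves the orientation of the pairs, and \<open>enum I\<close> brings them
  back.\<close>

lemma dform_pset:
  assumes I: "finite I" and bs: "ordered_pairs bs" "psupp bs \<subseteq> I"
  defines "z \<equiv> pset (map (map_prod (rank I) (rank I)) bs)"
  shows "pairs_in {..<card I} z"
    and "dform I z v w = (\<Prod>(i, j)\<leftarrow>bs. \<omega> (v i) (v j) * \<omega> (w i) (w j)) * (\<Prod>i\<in>I - psupp bs. \<omega> (v i) (w i))"
proof -
  have mono: "rank I i < rank I j" if "i \<in> I" "j \<in> I" "i < j" for i j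
    using that I enum_less_iff[OF I rank_less[OF I that(1)] rank_less[OF I that(2)]] by (simp add: enum_rank)
  have rank_eq: "rank I i = rank I j \<longleftrightarrow> i = j" if "i \<in> I" "j \<in> I" for i j
    using that I by (metis enum_rank)
  let ?bs = "map (map_prod (rank I) (rank I)) bs"
  have supp: "psupp ?bs = rank I ` psupp bs" by (auto simp: psupp_def image_iff) force+
  have ord: "ordered_pairs ?bs"
    using bs
  proof (induction bs)
    case (Cons p bs)
    obtain i j where p: "p = (i, j)" by (cases p)
    have "psupp (map (map_prod (rank I) (rank I)) bs) = rank I ` psupp bs"
      by (auto simp: psupp_def image_iff) force+
    moreover have "rank I k \<notin> rank I ` psupp bs" if "k \<in> I" "k \<notin> psupp bs" for k
      using Cons.prems that rank_eq by (auto simp: p psupp_simps)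
    ultimately show ?case
      using Cons mono by (auto simp: p ordered_pairs_simps psupp_simps)
  qed (simp add: ordered_pairs_simps)
  show "pairs_in {..<card I} z"
    unfolding z_def by (rule pairs_in_pset[OF ord]) (use supp bs I rank_less in auto)
  have "(\<Prod>e\<in>z. \<omega> (v (enum I (Min e))) (v (enum I (Max e))) * \<omega> (w (enum I (Min e))) (w (enum I (Max e))))
    = (\<Prod>(i, j)\<leftarrow>?bs. \<omega> (v (enum I i)) (v (enum I j)) * \<omega> (w (enum I i)) (w (enum I j)))"
    unfolding z_def by (rule prod_pset[OF ord])
  also have "\<dots> = (\<Prod>(i, j)\<leftarrow>bs. \<omega> (v i) (v j) * \<omega> (w i) (w j))"
    using bs(2)
  proof (induction bs)
    case (Cons p bs)
    then show ?case using I by (cases p) (simp add: psupp_simps enum_rank)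
  qed simp
  finally have 1: "(\<Prod>e\<in>z. \<omega> (v (enum I (Min e))) (v (enum I (Max e))) * \<omega> (w (enum I (Min e))) (w (enum I (Max e))))
    = (\<Prod>(i, j)\<leftarrow>bs. \<omega> (v i) (v j) * \<omega> (w i) (w j))" .
  have "bij_betw (enum I) ({..<card I} - \<Union>z) (I - psupp bs)"
    unfolding z_def Union_pset supp
    by (rule bij_betw_byWitness[where f' = "rank I"])
      (use I bs in \<open>auto simp: rank_enum enum_rank enum_in rank_less rank_eq\<close>, metis enum_rank in_mono rank_enum imageI)
  then have 2: "(\<Prod>k\<in>{..<card I} - \<Union>z. \<omega> (v (enum I k)) (w (enum I k))) = (\<Prod>i\<in>I - psupp bs. \<omega> (v i) (w i))"
    by (rule prod.reindex_bij_betw)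
  show "dform I z v w = (\<Prod>(i, j)\<leftarrow>bs. \<omega> (v i) (v j) * \<omega> (w i) (w j)) * (\<Prod>i\<in>I - psupp bs. \<omega> (v i) (w i))"
    unfolding dform_def 1 2 ..
qed

end

section \<open>Equivariant maps between summands\<close>

text \<open>A perfect matching of the disjoint union of \<open>I\<close> and \<open>J\<close>,
  sorted by type: arcs \<open>bs\<close> inside \<open>I\<close>, strings \<open>th\<close> from
  \<open>I\<close> to \<open>J\<close>, arcs \<open>ts\<close> inside \<open>J\<close>.\<close>

definition split_data ::
    "nat set \<Rightarrow> nat set \<Rightarrow> (nat \<times> nat) list \<Rightarrow> (nat \<times> nat) list \<Rightarrow> (nat \<times> nat) list \<Rightarrow> bool"
  where "split_data I J bs th ts \<longleftrightarrow>
    ordered_pairs bs \<and> distinct (map fst th) \<and> psupp bs \<inter> set (map fst th) = {} \<and> psupp bs \<union> set (map fst th) = I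
    \<and> ordered_pairs ts \<and> distinct (map snd th) \<and> psupp ts \<inter> set (map snd th) = {} \<and> psupp ts \<union> set (map snd th) = J"

lemma split_data_Nil: "split_data {} {} [] [] []"
  by (simp add: split_data_def ordered_pairs_simps psupp_simps)

lemma split_data_bottom:
  "split_data (I - {i, j}) J bs th ts \<Longrightarrow> i \<in> I \<Longrightarrow> j \<in> I \<Longrightarrow> i < j \<Longrightarrow> split_data I J ((i, j) # bs) th ts"
  unfolding split_data_def ordered_pairs_simps psupp_simps by blast

lemma split_data_top:
  "split_data I (J - {i, j}) bs th ts \<Longrightarrow> i \<in> J \<Longrightarrow> j \<in> J \<Longrightarrow> i < j \<Longrightarrow> split_data I J bs th ((i, j) # ts)"
  unfolding split_data_def ordered_pairs_simps psupp_simps by blast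

lemma split_data_through:
  "split_data (I - {i}) (J - {j}) bs th ts \<Longrightarrow> i \<in> I \<Longrightarrow> j \<in> J \<Longrightarrow> split_data I J bs ((i, j) # th) ts"
  unfolding split_data_def list.map distinct.simps list.set fst_conv snd_conv by blast

context bilinear_space
begin

definition up_map :: "nat \<Rightarrow> nat set \<Rightarrow> nat set \<Rightarrow> nat set \<Rightarrow> (nat \<Rightarrow> nat) \<Rightarrow> nat set set \<Rightarrow> nat set set \<Rightarrow>
    'v ext tensor \<Rightarrow> 'v ext tensor"
  where "up_map r I J J' \<sigma> U z = E_map r J J' \<circ> on_summand r J' (perm_action (card J) \<sigma>) \<circ> D_map n f fd r I U
    \<circ> on_summand r I (tau_diagram \<omega> n f fd (card I) z)"

definition down_map :: "nat \<Rightarrow> nat set \<Rightarrow> nat set \<Rightarrow> nat set \<Rightarrow> (nat \<Rightarrow> nat) \<Rightarrow> nat set set \<Rightarrow> nat set set \<Rightarrow>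
    'v ext tensor \<Rightarrow> 'v ext tensor"
  where "down_map r I J J' \<sigma> U z = E_map r J J' \<circ> on_summand r J' (perm_action (card J) \<sigma>)
    \<circ> on_summand r J' (tau_diagram \<omega> n f fd (card J) z) \<circ> C_map \<omega> r I U"

lemma pairings_pairs_in:
  assumes "U \<in> pairings K L" "L \<subseteq> {..<r}"
  shows "pairs_in {..<r} U" "\<Union>U = L - K"
proof -
  show un: "\<Union>U = L - K" using assms(1) by (auto simp: pairings_def partition_on_def)
  have "finite U"
    by (rule finite_subset[of _ "Pow {..<r}"]) (use un assms(2) in auto)
  then show "pairs_in {..<r} U"
    using assms un by (auto simp: pairings_def partition_on_def pairs_in_def)
qed

lemma pairs_in_pairings:
  assumes "pairs_in S U" "\<Union>U = L - K"
  shows "U \<in> pairings K L"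
  using assms by (force simp: pairings_def partition_on_def pairs_in_def)

lemma E_perm_Hom:
  assumes J: "J \<subseteq> {..<r}" "J' \<subseteq> {..<r}" "card J' = card J" and \<sigma>: "\<sigma> permutes {..<card J}"
  shows "E_map r J J' \<circ> on_summand r J' (perm_action (card J) \<sigma>) \<in> Hom (tpow r) (tpow r)"
  by (rule Hom_comp[OF on_summand_Hom[OF J(2)] E_map_Hom[OF J(2,1,3)] csubspace_tpow])
    (use \<sigma> perm_action_Hom J in auto)

lemma E_perm_kform:
  fixes x :: "'v ext tensor"
  assumes J: "J \<subseteq> {..<r}" "J' \<subseteq> {..<r}" "card J' = card J" and \<sigma>: "\<sigma> permutes {..<card J}"
    and x: "x \<in> tpow r" and K: "K \<subseteq> {..<r}"
  shows "(E_map r J J' \<circ> on_summand r J' (perm_action (card J) \<sigma>)) x (kform r K u)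
    = (if K = J then x (kform r J' (u \<circ> slot_map J J' \<sigma>)) else 0)"
proof -
  have fin: "finite J'" using J finite_slots by auto
  have \<sigma>': "\<sigma> permutes {..<card J'}" using \<sigma> J by simp
  have y: "on_summand r J' (perm_action (card J') \<sigma>) x \<in> tpow r"
    by (rule HomD(1)[OF on_summand_Hom[OF J(2) perm_action_Hom[OF \<sigma>']] x])
  have "kform r J' (u \<circ> transfer_perm r J J' \<circ> enum J' \<circ> \<sigma> \<circ> rank J') = kform r J' (u \<circ> slot_map J J' \<sigma>)"
  proof (rule kform_cong)
    fix i assume i: "i \<in> J'"
    have "\<sigma> (rank J' i) < card J'"
      using permutes_in_image[OF \<sigma>', of "rank J' i"] rank_less[OF fin i] by simp
    then show "(u \<circ> transfer_perm r J J' \<circ> enum J' \<circ> \<sigma> \<circ> rank J') i = (u \<circ> slot_map J J' \<sigma>) i"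
      by (simp add: slot_map_def transfer_perm_exists(2)[OF J(2,1,3)])
  qed
  then show ?thesis
    unfolding comp_apply J(3)[symmetric] E_map_kform[OF y J(2,1,3) K]
      on_summand_perm_kform[OF x \<sigma>' J(2) J(2)] by simp
qed

text \<open>The factors act on the test form in turn: the outer two relabel the test vectors,
  \<open>D_map\<close> pairs those on the inserted slots and removes these slots, and what remains
  is the value of the diagram on \<open>I\<close>.\<close>

lemma up_map:
  assumes IJ: "I \<subseteq> J'" "J \<subseteq> {..<r}" "J' \<subseteq> {..<r}" "card J' = card J" and \<sigma>: "\<sigma> permutes {..<card J}"
    and U: "U \<in> pairings I J'" and z: "z \<in> brauer_diagrams (card I)"
  shows "up_map r I J J' \<sigma> U z \<in> Hom (tpow r) (tpow r)"
    and "I1 \<subseteq> {..<r} \<Longrightarrow> K \<subseteq> {..<r} \<Longrightarrow> up_map r I J J' \<sigma> U z (tens r I1 v) (kform r K u)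
      = (if I1 = I \<and> K = J then (\<Prod>e\<in>U. \<omega> (u (slot_map J J' \<sigma> (Min e))) (u (slot_map J J' \<sigma> (Max e))))
          * dform I z v (u \<circ> slot_map J J' \<sigma>) else 0)"
proof -
  have I: "I \<subseteq> {..<r}" using IJ by auto
  have z: "pairs_in {..<card I} z" using z by (simp add: brauer_diagrams_pairs_in)
  note U' = pairings_pairs_in[OF U IJ(3)]
  have dis: "I \<inter> \<Union>U = {}" and J': "J' = I \<union> \<Union>U" using U'(2) IJ(1) by auto
  note H = on_summand_Hom[OF I tau_diagram_Hom[OF z]]
  show "up_map r I J J' \<sigma> U z \<in> Hom (tpow r) (tpow r)"
    unfolding up_map_def
    by (intro Hom_comp[OF H] Hom_comp[OF D_map_Hom[OF U'(1)]] E_perm_Hom[OF IJ(2-4) \<sigma>] csubspace_tpow)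
  assume I1: "I1 \<subseteq> {..<r}" and K: "K \<subseteq> {..<r}"
  let ?y = "on_summand r I (tau_diagram \<omega> n f fd (card I) z) (tens r I1 v)"
  have y: "?y \<in> tpow r" by (rule HomD(1)[OF H tens_in_tpow])
  have "up_map r I J J' \<sigma> U z (tens r I1 v) (kform r K u)
    = (E_map r J J' \<circ> on_summand r J' (perm_action (card J) \<sigma>)) (D_map n f fd r I U ?y) (kform r K u)"
    by (simp add: up_map_def)
  also have "\<dots> = (if K = J then D_map n f fd r I U ?y (kform r J' (u \<circ> slot_map J J' \<sigma>)) else 0)"
    by (rule E_perm_kform[OF IJ(2-4) \<sigma> HomD(1)[OF D_map_Hom[OF U'(1)] y] K])
  also have "D_map n f fd r I U ?y (kform r J' (u \<circ> slot_map J J' \<sigma>))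
    = (\<Prod>e\<in>U. \<omega> ((u \<circ> slot_map J J' \<sigma>) (Min e)) ((u \<circ> slot_map J J' \<sigma>) (Max e))) * ?y (kform r I (u \<circ> slot_map J J' \<sigma>))"
    using D_map_kform[OF U'(1) I dis y, of "u \<circ> slot_map J J' \<sigma>"] unfolding J'[symmetric] .
  also have "?y (kform r I (u \<circ> slot_map J J' \<sigma>)) = (if I1 = I then dform I z v (u \<circ> slot_map J J' \<sigma>) else 0)"
    by (rule on_summand_tau_kform[OF z I I1])
  finally show "up_map r I J J' \<sigma> U z (tens r I1 v) (kform r K u)
      = (if I1 = I \<and> K = J then (\<Prod>e\<in>U. \<omega> (u (slot_map J J' \<sigma> (Min e))) (u (slot_map J J' \<sigma> (Max e))))
          * dform I z v (u \<circ> slot_map J J' \<sigma>) else 0)"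
    by simp
qed

lemma down_map:
  assumes IJ: "J' \<subseteq> I" "J \<subseteq> {..<r}" "I \<subseteq> {..<r}" "card J' = card J" and \<sigma>: "\<sigma> permutes {..<card J}"
    and U: "U \<in> pairings J' I" and z: "z \<in> brauer_diagrams (card J)"
  shows "down_map r I J J' \<sigma> U z \<in> Hom (tpow r) (tpow r)"
    and "I1 \<subseteq> {..<r} \<Longrightarrow> K \<subseteq> {..<r} \<Longrightarrow> down_map r I J J' \<sigma> U z (tens r I1 v) (kform r K u)
      = (if I1 = I \<and> K = J then (\<Prod>e\<in>U. \<omega> (v (Min e)) (v (Max e)))
          * dform J' z v (u \<circ> slot_map J J' \<sigma>) else 0)"
proof -
  have J': "J' \<subseteq> {..<r}" using IJ by auto
  have z: "pairs_in {..<card J'} z" using z IJ by (simp add: brauer_diagrams_pairs_in)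
  note U' = pairings_pairs_in[OF U IJ(3)]
  have sub: "\<Union>U \<subseteq> I" and diff: "I - \<Union>U = J'" using U'(2) IJ(1) by auto
  note H = on_summand_Hom[OF J' tau_diagram_Hom[OF z]]
  have df: "down_map r I J J' \<sigma> U z = (E_map r J J' \<circ> on_summand r J' (perm_action (card J) \<sigma>))
    \<circ> (on_summand r J' (tau_diagram \<omega> n f fd (card J') z) \<circ> C_map \<omega> r I U)"
    by (simp add: down_map_def IJ o_assoc)
  show "down_map r I J J' \<sigma> U z \<in> Hom (tpow r) (tpow r)"
    unfolding df
    by (intro Hom_comp[OF Hom_comp[OF C_map_Hom[OF U'(1)] H csubspace_tpow]] E_perm_Hom[OF IJ(2) J' IJ(4) \<sigma>] csubspace_tpow)
  assume I1: "I1 \<subseteq> {..<r}" and K: "K \<subseteq> {..<r}"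
  let ?y = "on_summand r J' (tau_diagram \<omega> n f fd (card J') z) (C_map \<omega> r I U (tens r I1 v))"
  have y: "?y \<in> tpow r" by (rule HomD(1)[OF H HomD(1)[OF C_map_Hom[OF U'(1)] tens_in_tpow]])
  have 1: "?y (kform r J' (u \<circ> slot_map J J' \<sigma>))
    = (if I1 = I then (\<Prod>e\<in>U. \<omega> (v (Min e)) (v (Max e))) * dform J' z v (u \<circ> slot_map J J' \<sigma>) else 0)"
  proof (cases "I1 = I")
    case True
    then show ?thesis
      unfolding C_map_tens[OF U'(1) IJ(3) sub I1] diff
      using on_summand_tau_kform[OF z J' J', of v "u \<circ> slot_map J J' \<sigma>"]
      by (simp add: HomD(3)[OF H] scaleC_apply scaleC_complex_def)
  next
    case False
    then show ?thesis
      unfolding C_map_tens[OF U'(1) IJ(3) sub I1] using Hom_0[OF H csubspace_tpow] by simp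
  qed
  have "down_map r I J J' \<sigma> U z (tens r I1 v) (kform r K u)
    = (E_map r J J' \<circ> on_summand r J' (perm_action (card J) \<sigma>)) ?y (kform r K u)"
    by (simp add: df)
  also have "\<dots> = (if K = J then ?y (kform r J' (u \<circ> slot_map J J' \<sigma>)) else 0)"
    by (rule E_perm_kform[OF IJ(2) J' IJ(4) \<sigma> y K])
  finally show "down_map r I J J' \<sigma> U z (tens r I1 v) (kform r K u)
      = (if I1 = I \<and> K = J then (\<Prod>e\<in>U. \<omega> (v (Min e)) (v (Max e)))
          * dform J' z v (u \<circ> slot_map J J' \<sigma>) else 0)"
    unfolding 1 by simp
qed

section \<open>Components as multilinear forms\<close>

text \<open>The variables \<open>Inl i\<close> are the vectors of the source tensor, the variables
  \<open>Inr j\<close> the test vectors. A single assignment on a sum type makes it a form to which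
  the first fundamental theorem applies.\<close>

definition component :: "nat \<Rightarrow> ('v ext tensor \<Rightarrow> 'v ext tensor) \<Rightarrow> nat set \<Rightarrow> nat set \<Rightarrow> (nat + nat \<Rightarrow> 'v) \<Rightarrow> complex"
  where "component r \<phi> I J v = \<phi> (tens r I (v \<circ> Inl)) (kform r J (v \<circ> Inr))"

lemma clinear_component: "clinear (\<lambda>\<phi>. component r \<phi> I J)"
  by (rule clinearI) (auto simp: component_def fun_eq_iff scaleC_fun_def)

lemma component_eqI:
  assumes "\<phi> \<in> Hom (tpow r) (tpow r)" "\<psi> \<in> Hom (tpow r) (tpow r)"
    and eq: "\<And>I J. I \<subseteq> {..<r} \<Longrightarrow> J \<subseteq> {..<r} \<Longrightarrow> component r \<phi> I J = component r \<psi> I J"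
  shows "\<phi> = \<psi>"
proof (rule Hom_ext_eqI[OF assms(1,2)])
  fix I v assume I: "I \<subseteq> {..<r}"
  show "\<phi> (tens r I v) = \<psi> (tens r I v)"
  proof (rule tensor_ext_eqI)
    show "\<phi> (tens r I v) \<in> tpow r" "\<psi> (tens r I v) \<in> tpow r"
      by (simp_all add: HomD(1)[OF assms(1)] HomD(1)[OF assms(2)])
    fix J u assume J: "J \<subseteq> {..<r}"
    show "\<phi> (tens r I v) (kform r J u) = \<psi> (tens r I v) (kform r J u)"
      using fun_cong[OF eq[OF I J], of "case_sum v u"] by (simp add: component_def o_def)
  qed
qed

lemma multilinear_on_component:
  assumes \<phi>: "\<phi> \<in> Hom (tpow r) (tpow r)" and IJ: "I \<subseteq> {..<r}" "J \<subseteq> {..<r}"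
  shows "multilinear_on (Inl ` I \<union> Inr ` J) (component r \<phi> I J)"
proof (rule multilinear_onI)
  have upd: "v(Inl i := x) \<circ> Inl = (v \<circ> Inl)(i := x)" "v(Inl i := x) \<circ> Inr = v \<circ> Inr"
    "v(Inr i := x) \<circ> Inr = (v \<circ> Inr)(i := x)" "v(Inr i := x) \<circ> Inl = v \<circ> Inl"
    for v :: "nat + nat \<Rightarrow> 'v" and i x
    by (auto simp: fun_eq_iff)
  fix v :: "nat + nat \<Rightarrow> 'v" and k x y c assume k: "k \<in> Inl ` I \<union> Inr ` J"
  have kf: "kform r J (u(j := x + y)) ws = kform r J (u(j := x)) ws + kform r J (u(j := y)) ws"
    "kform r J (u(j := c *\<^sub>C x)) ws = c * kform r J (u(j := x)) ws" if j: "j \<in> J" for u j ws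
  proof -
    have *: "kform r J (u(j := x)) ws = \<omega> (fst (ws ! j)) x *
      (\<Prod>i\<in>{..<r} - {j}. if i \<in> J then \<omega> (fst (ws ! i)) (u i) else snd (ws ! i))" for x
    proof -
      have "(\<Prod>i\<in>{..<r} - {j}. if i \<in> J then \<omega> (fst (ws ! i)) ((u(j := x)) i) else snd (ws ! i))
        = (\<Prod>i\<in>{..<r} - {j}. if i \<in> J then \<omega> (fst (ws ! i)) (u i) else snd (ws ! i))"
        by (rule prod.cong) auto
      then show ?thesis unfolding kform_def using j IJ by (subst prod.remove[of _ j]) auto
    qed
    show "kform r J (u(j := x + y)) ws = kform r J (u(j := x)) ws + kform r J (u(j := y)) ws"
      "kform r J (u(j := c *\<^sub>C x)) ws = c * kform r J (u(j := x)) ws"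
      unfolding * by (simp_all add: omega_simps algebra_simps)
  qed
  \<comment> \<open>Dependence on a test vector goes through the form at which the tensor is
    evaluated, so membership of the value in \<open>tpow r\<close> is used.\<close>
  have ev: "t (kform r J (u(j := x + y))) = t (kform r J (u(j := x))) + t (kform r J (u(j := y)))"
    "t (kform r J (u(j := c *\<^sub>C x))) = c * t (kform r J (u(j := x)))"
    if j: "j \<in> J" and t: "t \<in> tpow r" for t u j
  proof -
    show "t (kform r J (u(j := x + y))) = t (kform r J (u(j := x))) + t (kform r J (u(j := y)))"
      using tpow_form_linear[OF t, of "{True, False}" "\<lambda>b. kform r J (u(j := if b then x else y))" "kform r J (u(j := x + y))" "\<lambda>_. 1"]
      by (simp add: multilinear_kform kf[OF j])
    show "t (kform r J (u(j := c *\<^sub>C x))) = c * t (kform r J (u(j := x)))"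
      using tpow_form_linear[OF t, of "{()}" "\<lambda>_. kform r J (u(j := x))" "kform r J (u(j := c *\<^sub>C x))" "\<lambda>_. c"]
      by (simp add: multilinear_kform kf[OF j])
  qed
  show "component r \<phi> I J (v(k := x + y)) = component r \<phi> I J (v(k := x)) + component r \<phi> I J (v(k := y))"
    using k
  proof
    assume "k \<in> Inl ` I"
    then obtain i where i: "k = Inl i" "i \<in> I" by blast
    show ?thesis
      unfolding component_def i upd clinear_add[OF tens_clinear[OF i(2) IJ(1)]]
      by (simp add: HomD(2)[OF \<phi>])
  next
    assume "k \<in> Inr ` J"
    then obtain j where j: "k = Inr j" "j \<in> J" by blast
    show ?thesis
      unfolding component_def j upd by (rule ev(1)[OF j(2)]) (simp add: HomD(1)[OF \<phi>])
  qed
  show "component r \<phi> I J (v(k := c *\<^sub>C x)) = c *\<^sub>C component r \<phi> I J (v(k := x))"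
    using k
  proof
    assume "k \<in> Inl ` I"
    then obtain i where i: "k = Inl i" "i \<in> I" by blast
    show ?thesis
      unfolding component_def i upd clinear_scale[OF tens_clinear[OF i(2) IJ(1)]]
      by (simp add: HomD(3)[OF \<phi>] scaleC_apply)
  next
    assume "k \<in> Inr ` J"
    then obtain j where j: "k = Inr j" "j \<in> J" by blast
    show ?thesis
      unfolding component_def j upd scaleC_complex_def by (rule ev(2)[OF j(2)]) (simp add: HomD(1)[OF \<phi>])
  qed
next
  fix v w :: "nat + nat \<Rightarrow> 'v" assume vw: "\<And>k. k \<in> Inl ` I \<union> Inr ` J \<Longrightarrow> v k = w k"
  have "tens r I (v \<circ> Inl) = tens r I (w \<circ> Inl)" by (rule tens_cong) (use vw in auto)
  moreover have "kform r J (v \<circ> Inr) = kform r J (w \<circ> Inr)" by (rule kform_cong) (use vw in auto)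
  ultimately show "component r \<phi> I J v = component r \<phi> I J w" by (simp add: component_def)
qed

definition split_form :: "(nat \<times> nat) list \<Rightarrow> (nat \<times> nat) list \<Rightarrow> (nat \<times> nat) list \<Rightarrow> (nat + nat \<Rightarrow> 'v) \<Rightarrow> complex"
  where "split_form bs th ts v = (\<Prod>(i, j)\<leftarrow>bs. \<omega> (v (Inl i)) (v (Inl j)))
    * (\<Prod>(i, j)\<leftarrow>th. \<omega> (v (Inl i)) (v (Inr j))) * (\<Prod>(i, j)\<leftarrow>ts. \<omega> (v (Inr i)) (v (Inr j)))"

lemma split_form_simps:
  "split_form [] [] [] v = 1"
  "split_form ((i, j) # bs) th ts v = \<omega> (v (Inl i)) (v (Inl j)) * split_form bs th ts v"
  "split_form bs ((i, j) # th) ts v = \<omega> (v (Inl i)) (v (Inr j)) * split_form bs th ts v"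
  "split_form bs th ((i, j) # ts) v = \<omega> (v (Inr i)) (v (Inr j)) * split_form bs th ts v"
  by (simp_all add: split_form_def mult_ac)

text \<open>Sort the edges into the three types; an edge that has to be reversed, to run from
  \<open>I\<close> to \<open>J\<close> or to have its ends increasing, contributes a factor
  \<epsilon>.\<close>

lemma split_matching:
  assumes "ps \<in> matchings (Inl ` I \<union> Inr ` J)"
  shows "\<exists>c bs th ts. mform ps = c *\<^sub>C split_form bs th ts \<and> split_data I J bs th ts"
  using assms
proof (induction ps arbitrary: I J)
  case Nil
  then have "I = {}" "J = {}" by (auto simp: matchings_def)
  then show ?case
    by (intro exI[of _ 1] exI[of _ "[]"])
      (simp add: mform_simps split_form_simps split_data_Nil scaleC_one fun_eq_iff)
next
  case (Cons p ps)
  obtain a b where p: "p = (a, b)" by (cases p)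
  have m: "a \<in> Inl ` I \<union> Inr ` J" "b \<in> Inl ` I \<union> Inr ` J" "a \<noteq> b" "ps \<in> matchings (Inl ` I \<union> Inr ` J - {a, b})"
    using Cons.prems by (auto simp: p matchings_Cons)
  have swap: "\<omega> x y * z = \<epsilon> * (\<omega> y x * z)" for x y z using sym[of x y] by simp
  have step: "mform (p # ps) = (d * c) *\<^sub>C split_form bs' th' ts'"
    if "mform ps = c *\<^sub>C split_form bs th ts"
      and "\<And>v. \<omega> (v a) (v b) * split_form bs th ts v = d * split_form bs' th' ts' v"
    for c d bs th ts bs' th' ts'
    unfolding p fun_eq_iff mform_simps scaleC_apply scaleC_complex_def that(1)
    using that(2) by (metis mult.assoc mult.left_commute)
  consider (LL) i j where "a = Inl i" "b = Inl j" | (LR) i j where "a = Inl i" "b = Inr j"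
    | (RL) i j where "a = Inr i" "b = Inl j" | (RR) i j where "a = Inr i" "b = Inr j"
    by (cases a; cases b) auto
  then show ?case
  proof cases
    case LL
    have ij: "i \<in> I" "j \<in> I" "i \<noteq> j" using m LL by auto
    have "Inl ` I \<union> Inr ` J - {a, b} = Inl ` (I - {i, j}) \<union> Inr ` J" using LL by auto
    then obtain c bs th ts where P: "mform ps = c *\<^sub>C split_form bs th ts" "split_data (I - {i, j}) J bs th ts"
      using Cons.IH m(4) by metis
    show ?thesis
    proof (cases "i < j")
      case True
      have "mform (p # ps) = (1 * c) *\<^sub>C split_form ((i, j) # bs) th ts"
        by (rule step[OF P(1)]) (simp add: LL split_form_simps)
      then show ?thesis using split_data_bottom[OF P(2) ij(1,2) True] by blast
    next
      case False
      have "mform (p # ps) = (\<epsilon> * c) *\<^sub>C split_form ((j, i) # bs) th ts"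
        by (rule step[OF P(1)]) (simp only: LL split_form_simps, rule swap)
      moreover have "split_data (I - {j, i}) J bs th ts" using P(2) by (simp add: insert_commute)
      ultimately show ?thesis using split_data_bottom[of I j i] ij False by (metis linorder_neqE_nat)
    qed
  next
    case LR
    have ij: "i \<in> I" "j \<in> J" using m LR by auto
    have "Inl ` I \<union> Inr ` J - {a, b} = Inl ` (I - {i}) \<union> Inr ` (J - {j})" using LR by auto
    then obtain c bs th ts where P: "mform ps = c *\<^sub>C split_form bs th ts" "split_data (I - {i}) (J - {j}) bs th ts"
      using Cons.IH m(4) by metis
    have "mform (p # ps) = (1 * c) *\<^sub>C split_form bs ((i, j) # th) ts"
      by (rule step[OF P(1)]) (simp add: LR split_form_simps)
    then show ?thesis using split_data_through[OF P(2) ij] by blast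
  next
    case RL
    have ij: "j \<in> I" "i \<in> J" using m RL by auto
    have "Inl ` I \<union> Inr ` J - {a, b} = Inl ` (I - {j}) \<union> Inr ` (J - {i})" using RL by auto
    then obtain c bs th ts where P: "mform ps = c *\<^sub>C split_form bs th ts" "split_data (I - {j}) (J - {i}) bs th ts"
      using Cons.IH m(4) by metis
    have "mform (p # ps) = (\<epsilon> * c) *\<^sub>C split_form bs ((j, i) # th) ts"
      by (rule step[OF P(1)]) (simp only: RL split_form_simps, rule swap)
    then show ?thesis using split_data_through[OF P(2) ij] by blast
  next
    case RR
    have ij: "i \<in> J" "j \<in> J" "i \<noteq> j" using m RR by auto
    have "Inl ` I \<union> Inr ` J - {a, b} = Inl ` I \<union> Inr ` (J - {i, j})" using RR by auto
    then obtain c bs th ts where P: "mform ps = c *\<^sub>C split_form bs th ts" "split_data I (J - {i, j}) bs th ts"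
      using Cons.IH m(4) by metis
    show ?thesis
    proof (cases "i < j")
      case True
      have "mform (p # ps) = (1 * c) *\<^sub>C split_form bs th ((i, j) # ts)"
        by (rule step[OF P(1)]) (simp add: RR split_form_simps)
      then show ?thesis using split_data_top[OF P(2) ij(1,2) True] by blast
    next
      case False
      have "mform (p # ps) = (\<epsilon> * c) *\<^sub>C split_form bs th ((j, i) # ts)"
        by (rule step[OF P(1)]) (simp only: RR split_form_simps, rule swap)
      moreover have "split_data I (J - {j, i}) bs th ts" using P(2) by (simp add: insert_commute)
      ultimately show ?thesis using split_data_top[of I J j i] ij False by (metis linorder_neqE_nat)
    qed
  qed
qed

end

lemma prod_list_mult: "(\<Prod>(i, j)\<leftarrow>ps. g i j * h i j) = (\<Prod>(i, j)\<leftarrow>ps. g i j) * (\<Prod>(i, j)\<leftarrow>ps. h i j :: complex)"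
  by (induction ps) (auto simp: mult_ac)

section \<open>Realizing every matching by a diagram map\<close>

text \<open>Listing the string ends and then the arc ends gives two lists of equal length
  enumerating \<open>J'\<close> and \<open>J\<close>. Matching them entry by entry is a bijection,
  hence a \<open>slot_map\<close>; it sends arcs to arcs with their orientation because the order of
  the lists is kept.\<close>

lemma slot_map_exists:
  assumes fin: "finite J" "finite J'"
    and J': "distinct (map fst th)" "ordered_pairs qs" "psupp qs \<inter> set (map fst th) = {}" "psupp qs \<union> set (map fst th) = J'"
    and J: "distinct (map snd th)" "ordered_pairs ts" "psupp ts \<inter> set (map snd th) = {}" "psupp ts \<union> set (map snd th) = J"
    and len: "length qs = length ts"
  obtains \<sigma> where "\<sigma> permutes {..<card J}" "card J' = card J"
    "\<And>i j. (i, j) \<in> set th \<Longrightarrow> slot_map J J' \<sigma> i = j"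
    "map (map_prod (slot_map J J' \<sigma>) (slot_map J J' \<sigma>)) qs = ts"
proof -
  define xs where "xs = map fst th @ map fst qs @ map snd qs"
  define ys where "ys = map snd th @ map fst ts @ map snd ts"
  have xs: "distinct xs" "set xs = J'" "distinct ys" "set ys = J" "length xs = length ys"
    using J' J len by (auto simp: xs_def ys_def ordered_pairs_def psupp_def)
  obtain \<beta> where \<beta>: "bij_betw \<beta> J' J" "map \<beta> xs = ys"
    using list_bijection[OF xs(1,3,5)] xs(2,4) by auto
  have card: "card J' = card J" by (rule bij_betw_same_card[OF \<beta>(1)])
  define \<sigma> where "\<sigma> = rank_perm J J' \<beta>"
  note R = rank_perm[OF fin card \<beta>(1), folded \<sigma>_def]
  have eq: "slot_map J J' \<sigma> x = \<beta> x" if "x \<in> set xs" for x using R(2) that xs by simp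
  have "map (slot_map J J' \<sigma>) xs = ys" using \<beta>(2) eq by (metis map_eq_conv)
  then have m: "map (slot_map J J' \<sigma> \<circ> fst) th = map snd th"
    "map (slot_map J J' \<sigma> \<circ> fst) qs = map fst ts" "map (slot_map J J' \<sigma> \<circ> snd) qs = map snd ts"
    using len by (simp_all add: xs_def ys_def)
  show ?thesis
  proof (rule that[of \<sigma>])
    show "\<sigma> permutes {..<card J}" by (rule R(1))
    show "card J' = card J" by (rule card)
    show "slot_map J J' \<sigma> i = j" if "(i, j) \<in> set th" for i j
      using m(1) that by (auto simp: map_eq_conv)
    show "map (map_prod (slot_map J J' \<sigma>) (slot_map J J' \<sigma>)) qs = ts"
      by (rule pair_list_eqI) (use m in \<open>simp_all add: o_def\<close>)
  qed
qed

context bilinear_space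
begin

lemma through_product:
  assumes "distinct (map fst th)" "\<And>i j. (i, j) \<in> set th \<Longrightarrow> s i = j"
  shows "(\<Prod>i\<in>set (map fst th). \<omega> (v i) ((u \<circ> s) i)) = (\<Prod>(i, j)\<leftarrow>th. \<omega> (v i) (u j))"
proof -
  have "(\<Prod>i\<in>set (map fst th). \<omega> (v i) ((u \<circ> s) i)) = (\<Prod>i\<leftarrow>map fst th. \<omega> (v i) ((u \<circ> s) i))"
    by (rule prod.distinct_set_conv_list[OF assms(1)])
  also have "\<dots> = (\<Prod>(i, j)\<leftarrow>th. \<omega> (v i) (u j))"
    unfolding map_map by (rule arg_cong[where f = prod_list], rule map_cong) (auto simp: assms(2))
  finally show ?thesis .
qed

text \<open>As \<open>card I < card J\<close>, there are more arcs in \<open>ts\<close> than in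
  \<open>bs\<close>. The diagram made from \<open>bs\<close> has the arcs \<open>bs\<close> at the
  source and as many at the target; the missing target arcs \<open>us\<close> are inserted in fresh
  slots \<open>X\<close>, and the slot permutation carries \<open>bs @ us\<close> to
  \<open>ts\<close> and closes the strings.\<close>

lemma up_map_realizes:
  assumes sd: "split_data I J bs th ts" and IJ: "I \<subseteq> {..<r}" "J \<subseteq> {..<r}" "card I < card J"
  shows "\<exists>J' \<sigma> U z. I \<subseteq> J' \<and> J' \<subseteq> {..<r} \<and> card J' = card J \<and> \<sigma> permutes {..<card J}
    \<and> U \<in> pairings I J' \<and> z \<in> brauer_diagrams (card I)
    \<and> component r (up_map r I J J' \<sigma> U z) I J = split_form bs th ts"
proof -
  have fin: "finite I" "finite J" using IJ finite_slots by auto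
  have sd: "ordered_pairs bs" "distinct (map fst th)" "psupp bs \<inter> set (map fst th) = {}" "psupp bs \<union> set (map fst th) = I"
    "ordered_pairs ts" "distinct (map snd th)" "psupp ts \<inter> set (map snd th) = {}" "psupp ts \<union> set (map snd th) = J"
    using sd by (auto simp: split_data_def)
  have fps: "finite (psupp ps)" for ps :: "(nat \<times> nat) list" by (simp add: psupp_def)
  have cI: "card I = 2 * length bs + length th"
    using card_Un_disjoint[OF fps[of bs] _ sd(3)] sd(4) card_psupp[OF sd(1)] distinct_card[OF sd(2)] by simp
  have cJ: "card J = 2 * length ts + length th"
    using card_Un_disjoint[OF fps[of ts] _ sd(7)] sd(8) card_psupp[OF sd(5)] distinct_card[OF sd(6)] by simp
  have "card J \<le> r" using card_mono[OF _ IJ(2)] by simp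
  moreover have "card ({..<r} - I) = r - card I" using IJ fin by (simp add: card_Diff_subset)
  ultimately have "card J - card I \<le> card ({..<r} - I)" by simp
  \<comment> \<open>There is room for the new arcs because \<open>card J \<le> r\<close>; that
    \<open>X\<close> has even size follows from the two arc counts.\<close>
  then obtain X where X: "X \<subseteq> {..<r} - I" "card X = card J - card I"
    using obtain_subset_with_card_n by metis
  have fX: "finite X" using X(1) by (rule finite_subset) simp
  have "even (card X)" using X cI cJ IJ by simp
  then obtain us where us: "ordered_pairs us" "psupp us = X" using pairing_exists[OF fX] by blast
  have lus: "2 * length us = 2 * length ts - 2 * length bs"
    using card_psupp[OF us(1)] us(2) X(2) cI cJ by simp
  have disj: "psupp bs \<inter> X = {}" "set (map fst th) \<inter> X = {}" using X sd by auto
  define J' where "J' = I \<union> X"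
  define U where "U = pset us"
  define z where "z = pset (map (map_prod (rank I) (rank I)) bs)"
  have J': "I \<subseteq> J'" "J' \<subseteq> {..<r}" "finite J'" using IJ X fin fX by (auto simp: J'_def)
  have q: "ordered_pairs (bs @ us)" "psupp (bs @ us) \<inter> set (map fst th) = {}"
    "psupp (bs @ us) \<union> set (map fst th) = J'" "length (bs @ us) = length ts"
    using sd us disj lus IJ cI cJ by (auto simp: ordered_pairs_append psupp_simps J'_def)
  obtain \<sigma> where \<sigma>: "\<sigma> permutes {..<card J}" "card J' = card J"
    and th: "\<And>i j. (i, j) \<in> set th \<Longrightarrow> slot_map J J' \<sigma> i = j"
    and ts: "map (map_prod (slot_map J J' \<sigma>) (slot_map J J' \<sigma>)) (bs @ us) = ts"
    by (rule slot_map_exists[OF fin(2) J'(3) sd(2) q(1,2,3) sd(6,5,7,8) q(4)]) (rule that, assumption+)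
  have U: "U \<in> pairings I J'"
    unfolding U_def
    by (rule pairs_in_pairings[OF pairs_in_pset[OF us(1) subset_refl]]) (use us X in \<open>auto simp: Union_pset J'_def\<close>)
  have bsI: "psupp bs \<subseteq> I" using sd by auto
  note dz = dform_pset[OF fin(1) sd(1) bsI, folded z_def]
  have z: "z \<in> brauer_diagrams (card I)" using dz(1) by (simp add: brauer_diagrams_pairs_in)
  have rest: "I - psupp bs = set (map fst th)" using sd by auto
  have "component r (up_map r I J J' \<sigma> U z) I J w = split_form bs th ts w" for w
  proof -
    let ?s = "slot_map J J' \<sigma>" and ?v = "w \<circ> Inl" and ?u = "w \<circ> Inr"
    have "component r (up_map r I J J' \<sigma> U z) I J w
      = (\<Prod>e\<in>U. \<omega> (?u (?s (Min e))) (?u (?s (Max e)))) * dform I z ?v (?u \<circ> ?s)"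
      unfolding component_def up_map(2)[OF J'(1) IJ(2) J'(2) \<sigma>(2,1) U z IJ(1,2)] by simp
    also have "(\<Prod>e\<in>U. \<omega> (?u (?s (Min e))) (?u (?s (Max e)))) = (\<Prod>(i, j)\<leftarrow>us. \<omega> (?u (?s i)) (?u (?s j)))"
      unfolding U_def by (rule prod_pset[OF us(1)])
    also have "dform I z ?v (?u \<circ> ?s) = (\<Prod>(i, j)\<leftarrow>bs. \<omega> (?v i) (?v j)) * (\<Prod>(i, j)\<leftarrow>bs. \<omega> (?u (?s i)) (?u (?s j)))
        * (\<Prod>(i, j)\<leftarrow>th. \<omega> (?v i) (?u j))"
      unfolding dz(2) rest prod_list_mult
      by (simp only: comp_apply through_product[OF sd(2) th, where v = ?v and u = ?u, unfolded comp_apply])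
    finally have "component r (up_map r I J J' \<sigma> U z) I J w
      = (\<Prod>(i, j)\<leftarrow>bs. \<omega> (?v i) (?v j)) * (\<Prod>(i, j)\<leftarrow>th. \<omega> (?v i) (?u j))
        * (\<Prod>(i, j)\<leftarrow>bs @ us. \<omega> (?u (?s i)) (?u (?s j)))"
      by (simp add: mult_ac)
    also have "(\<Prod>(i, j)\<leftarrow>bs @ us. \<omega> (?u (?s i)) (?u (?s j)))
      = (\<Prod>(i, j)\<leftarrow>map (map_prod ?s ?s) (bs @ us). \<omega> (?u i) (?u j))"
      by (simp add: o_def case_prod_unfold)
    finally show ?thesis unfolding ts by (simp add: split_form_def)
  qed
  then have "component r (up_map r I J J' \<sigma> U z) I J = split_form bs th ts" by (rule ext)
  then show ?thesis using J' \<sigma> U z by blast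
qed

text \<open>Now the source has more arcs. As many of them as \<open>ts\<close> has, the list
  \<open>qs\<close>, go into the diagram, which also creates their counterparts at the target; the
  remaining arcs \<open>us\<close> are removed by \<open>C_map\<close>.\<close>

lemma down_map_realizes:
  assumes sd: "split_data I J bs th ts" and IJ: "I \<subseteq> {..<r}" "J \<subseteq> {..<r}" "card J < card I"
  shows "\<exists>J' \<sigma> U z. J' \<subseteq> I \<and> card J' = card J \<and> \<sigma> permutes {..<card J}
    \<and> U \<in> pairings J' I \<and> z \<in> brauer_diagrams (card J)
    \<and> component r (down_map r I J J' \<sigma> U z) I J = split_form bs th ts"
proof -
  have fin: "finite I" "finite J" using IJ finite_slots by auto
  have sd: "ordered_pairs bs" "distinct (map fst th)" "psupp bs \<inter> set (map fst th) = {}" "psupp bs \<union> set (map fst th) = I"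
    "ordered_pairs ts" "distinct (map snd th)" "psupp ts \<inter> set (map snd th) = {}" "psupp ts \<union> set (map snd th) = J"
    using sd by (auto simp: split_data_def)
  have fps: "finite (psupp ps)" for ps :: "(nat \<times> nat) list" by (simp add: psupp_def)
  have cI: "card I = 2 * length bs + length th"
    using card_Un_disjoint[OF fps[of bs] _ sd(3)] sd(4) card_psupp[OF sd(1)] distinct_card[OF sd(2)] by simp
  have cJ: "card J = 2 * length ts + length th"
    using card_Un_disjoint[OF fps[of ts] _ sd(7)] sd(8) card_psupp[OF sd(5)] distinct_card[OF sd(6)] by simp
  define qs where "qs = take (length ts) bs"
  define us where "us = drop (length ts) bs"
  have bs: "bs = qs @ us" by (simp add: qs_def us_def)
  have q: "length qs = length ts" using cI cJ IJ by (simp add: qs_def)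
  have o: "ordered_pairs qs" "ordered_pairs us" "psupp qs \<inter> psupp us = {}"
    using sd(1) unfolding bs ordered_pairs_append by auto
  have supp: "psupp bs = psupp qs \<union> psupp us" by (simp add: bs psupp_simps)
  define J' where "J' = I - psupp us"
  have J': "J' \<subseteq> I" "finite J'" "J' \<subseteq> {..<r}" using IJ fin by (auto simp: J'_def)
  define U where "U = pset us"
  define z where "z = pset (map (map_prod (rank J') (rank J')) qs)"
  have q': "psupp qs \<inter> set (map fst th) = {}" "psupp qs \<union> set (map fst th) = J'"
    using sd(3,4) o(3) unfolding supp J'_def by auto
  obtain \<sigma> where \<sigma>: "\<sigma> permutes {..<card J}" "card J' = card J"
    and th: "\<And>i j. (i, j) \<in> set th \<Longrightarrow> slot_map J J' \<sigma> i = j"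
    and ts: "map (map_prod (slot_map J J' \<sigma>) (slot_map J J' \<sigma>)) qs = ts"
    by (rule slot_map_exists[OF fin(2) J'(2) sd(2) o(1) q' sd(6,5,7,8) q]) (rule that, assumption+)
  have U: "U \<in> pairings J' I"
    unfolding U_def
    by (rule pairs_in_pairings[OF pairs_in_pset[OF o(2) subset_refl]]) (use sd(4) supp in \<open>auto simp: Union_pset J'_def\<close>)
  have qsJ': "psupp qs \<subseteq> J'" using q' by auto
  note dz = dform_pset[OF J'(2) o(1) qsJ', folded z_def]
  have z: "z \<in> brauer_diagrams (card J)" using dz(1) \<sigma>(2) by (simp add: brauer_diagrams_pairs_in)
  have rest: "J' - psupp qs = set (map fst th)" using q' by auto
  have "component r (down_map r I J J' \<sigma> U z) I J w = split_form bs th ts w" for w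
  proof -
    let ?s = "slot_map J J' \<sigma>" and ?v = "w \<circ> Inl" and ?u = "w \<circ> Inr"
    have "component r (down_map r I J J' \<sigma> U z) I J w
      = (\<Prod>e\<in>U. \<omega> (?v (Min e)) (?v (Max e))) * dform J' z ?v (?u \<circ> ?s)"
      unfolding component_def down_map(2)[OF J'(1) IJ(2,1) \<sigma>(2,1) U z IJ(1,2)] by simp
    also have "(\<Prod>e\<in>U. \<omega> (?v (Min e)) (?v (Max e))) = (\<Prod>(i, j)\<leftarrow>us. \<omega> (?v i) (?v j))"
      unfolding U_def by (rule prod_pset[OF o(2)])
    also have "dform J' z ?v (?u \<circ> ?s) = (\<Prod>(i, j)\<leftarrow>qs. \<omega> (?v i) (?v j)) * (\<Prod>(i, j)\<leftarrow>qs. \<omega> (?u (?s i)) (?u (?s j)))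
        * (\<Prod>(i, j)\<leftarrow>th. \<omega> (?v i) (?u j))"
      unfolding dz(2) rest prod_list_mult
      by (simp only: comp_apply through_product[OF sd(2) th, where v = ?v and u = ?u, unfolded comp_apply])
    finally have "component r (down_map r I J J' \<sigma> U z) I J w
      = (\<Prod>(i, j)\<leftarrow>qs @ us. \<omega> (?v i) (?v j)) * (\<Prod>(i, j)\<leftarrow>th. \<omega> (?v i) (?u j))
        * (\<Prod>(i, j)\<leftarrow>qs. \<omega> (?u (?s i)) (?u (?s j)))"
      by (simp add: mult_ac)
    also have "(\<Prod>(i, j)\<leftarrow>qs. \<omega> (?u (?s i)) (?u (?s j)))
      = (\<Prod>(i, j)\<leftarrow>map (map_prod ?s ?s) qs. \<omega> (?u i) (?u j))"
      by (simp add: o_def case_prod_unfold)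
    finally show ?thesis unfolding ts bs[symmetric] by (simp add: split_form_def)
  qed
  then have "component r (down_map r I J J' \<sigma> U z) I J = split_form bs th ts" by (rule ext)
  then show ?thesis using J' \<sigma> U z by blast
qed

section \<open>Spaces of maps with prescribed invariant components\<close>

text \<open>The common normal form of the spaces in the theorem: \<open>Q\<close> constantly true
  gives the commutant of \<open>G\<close>, equality of sizes the enhanced Brauer algebra, fixed
  sizes \<open>B_st\<close> for s \<noteq> t, and a single pair \<open>B_IJ\<close> for sets of
  different size.\<close>

definition equivariant :: "nat \<Rightarrow> (nat set \<Rightarrow> nat set \<Rightarrow> bool) \<Rightarrow> ('v ext tensor \<Rightarrow> 'v ext tensor) set"
  where "equivariant r Q = {\<phi> \<in> Hom (tpow r) (tpow r). \<forall>I J. I \<subseteq> {..<r} \<longrightarrow> J \<subseteq> {..<r} \<longrightarrow>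
    invariant (component r \<phi> I J) \<and> (\<not> Q I J \<longrightarrow> component r \<phi> I J = 0)}"

lemma equivariantI:
  assumes "\<phi> \<in> Hom (tpow r) (tpow r)"
    "\<And>I J. I \<subseteq> {..<r} \<Longrightarrow> J \<subseteq> {..<r} \<Longrightarrow> Q I J \<Longrightarrow> invariant (component r \<phi> I J)"
    "\<And>I J. I \<subseteq> {..<r} \<Longrightarrow> J \<subseteq> {..<r} \<Longrightarrow> \<not> Q I J \<Longrightarrow> component r \<phi> I J = 0"
  shows "\<phi> \<in> equivariant r Q"
proof -
  have "invariant (component r \<phi> I J)" if "I \<subseteq> {..<r}" "J \<subseteq> {..<r}" for I J
    using assms(2)[OF that] assms(3)[OF that] by (cases "Q I J") (auto simp: invariant_def)
  then show ?thesis using assms by (simp add: equivariant_def)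
qed

lemma equivariantD:
  assumes "\<phi> \<in> equivariant r Q"
  shows "\<phi> \<in> Hom (tpow r) (tpow r)"
    and "I \<subseteq> {..<r} \<Longrightarrow> J \<subseteq> {..<r} \<Longrightarrow> invariant (component r \<phi> I J)"
    and "I \<subseteq> {..<r} \<Longrightarrow> J \<subseteq> {..<r} \<Longrightarrow> \<not> Q I J \<Longrightarrow> component r \<phi> I J = 0"
  using assms by (simp_all add: equivariant_def)

lemma csubspace_equivariant: "csubspace (equivariant r Q)"
proof (rule complex_vector.subspaceI)
  note H = csubspace_Hom[OF csubspace_tpow[of r], of "tpow r"]
  have comp: "component r 0 I J = 0" "component r (\<phi> + \<psi>) I J = component r \<phi> I J + component r \<psi> I J"
    "component r (c *\<^sub>C \<phi>) I J = c *\<^sub>C component r \<phi> I J" for \<phi> \<psi> c I J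
    using clinear_0[OF clinear_component[of r I J]] clinear_add[OF clinear_component[of r I J]]
      clinear_scale[OF clinear_component[of r I J]] by auto
  have inv: "invariant 0" "invariant F \<Longrightarrow> invariant K \<Longrightarrow> invariant (F + K)" "invariant F \<Longrightarrow> invariant (c *\<^sub>C F)"
    for F K :: "(nat + nat \<Rightarrow> 'v) \<Rightarrow> complex" and c
    by (auto simp: invariant_def scaleC_fun_def)
  show "0 \<in> equivariant r Q"
    by (rule equivariantI) (simp_all only: comp inv complex_vector.subspace_0[OF H])
  show "\<phi> + \<psi> \<in> equivariant r Q" if "\<phi> \<in> equivariant r Q" "\<psi> \<in> equivariant r Q" for \<phi> \<psi>
    by (rule equivariantI)
      (simp_all only: comp inv equivariantD[OF that(1)] equivariantD[OF that(2)] complex_vector.subspace_add[OF H] add_0 simp_thms)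
  show "c *\<^sub>C \<phi> \<in> equivariant r Q" if "\<phi> \<in> equivariant r Q" for c \<phi>
    by (rule equivariantI)
      (simp_all only: comp inv equivariantD[OF that(1)] complex_vector.subspace_scale[OF H] complex_vector.scale_zero_right simp_thms)
qed

text \<open>By the first fundamental theorem the component at (I, J) is a combination of matching
  forms, which \<open>split_matching\<close> reduces to the forms realized in \<open>S\<close>. A
  map supported on (I, J) is determined by this component.\<close>

lemma equivariant_spanned:
  assumes IJ: "I \<subseteq> {..<r}" "J \<subseteq> {..<r}"
    and S: "S \<subseteq> equivariant r (\<lambda>I' J'. I' = I \<and> J' = J)"
    and real: "\<And>bs th ts. split_data I J bs th ts \<Longrightarrow> \<exists>\<phi>\<in>S. component r \<phi> I J = split_form bs th ts"
  shows "cspan S = equivariant r (\<lambda>I' J'. I' = I \<and> J' = J)"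
proof
  show sub: "cspan S \<subseteq> equivariant r (\<lambda>I' J'. I' = I \<and> J' = J)"
    by (rule complex_vector.span_minimal[OF S csubspace_equivariant])
  show "equivariant r (\<lambda>I' J'. I' = I \<and> J' = J) \<subseteq> cspan S"
  proof
    fix \<phi> assume \<phi>: "\<phi> \<in> equivariant r (\<lambda>I' J'. I' = I \<and> J' = J)"
    let ?A = "Inl ` I \<union> Inr ` J :: (nat + nat) set"
    have "component r \<phi> I J \<in> cspan (mform ` matchings ?A)"
      by (rule first_fundamental_theorem)
        (use IJ finite_slots equivariantD[OF \<phi>] multilinear_on_component in auto)
    moreover have "cspan (mform ` matchings ?A) \<subseteq> (\<lambda>\<phi>. component r \<phi> I J) ` cspan S"
    proof (rule complex_vector.span_minimal)
      show "csubspace ((\<lambda>\<phi>. component r \<phi> I J) ` cspan S)"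
        by (rule complex_vector_pair.linear_subspace_image[OF clinear_component complex_vector.subspace_span])
      show "mform ` matchings ?A \<subseteq> (\<lambda>\<phi>. component r \<phi> I J) ` cspan S"
      proof
        fix F :: "(nat + nat \<Rightarrow> 'v) \<Rightarrow> complex" assume "F \<in> mform ` matchings ?A"
        then obtain ps where ps: "F = mform ps" "ps \<in> matchings ?A" by blast
        obtain c bs th ts where F: "F = c *\<^sub>C split_form bs th ts" "split_data I J bs th ts"
          using split_matching[OF ps(2)] ps(1) by blast
        obtain \<psi> where \<psi>: "\<psi> \<in> S" "component r \<psi> I J = split_form bs th ts" using real[OF F(2)] by blast
        have "F = component r (c *\<^sub>C \<psi>) I J"
          unfolding clinear_scale[OF clinear_component[of r I J]] \<psi>(2) by (rule F(1))
        moreover have "c *\<^sub>C \<psi> \<in> cspan S" using \<psi>(1) by (intro complex_vector.span_scale complex_vector.span_base)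
        ultimately show "F \<in> (\<lambda>\<phi>. component r \<phi> I J) ` cspan S" by blast
      qed
    qed
    ultimately obtain \<psi> where \<psi>: "\<psi> \<in> cspan S" "component r \<phi> I J = component r \<psi> I J" by blast
    have \<psi>': "\<psi> \<in> equivariant r (\<lambda>I' J'. I' = I \<and> J' = J)" using \<psi>(1) sub by blast
    have "\<phi> = \<psi>"
    proof (rule component_eqI[OF equivariantD(1)[OF \<phi>] equivariantD(1)[OF \<psi>']])
      fix I' J' assume "I' \<subseteq> {..<r}" "J' \<subseteq> {..<r}"
      then show "component r \<phi> I' J' = component r \<psi> I' J'"
        using \<psi>(2) equivariantD(3)[OF \<phi>, of I' J'] equivariantD(3)[OF \<psi>', of I' J'] by (cases "I' = I \<and> J' = J") auto
    qed
    then show "\<phi> \<in> cspan S" using \<psi>(1) by simp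
  qed
qed

lemma B_IJ_equivariant:
  assumes IJ: "I \<subseteq> {..<r}" "J \<subseteq> {..<r}" "card I \<noteq> card J"
  shows "B_IJ \<omega> n f fd r I J = equivariant r (\<lambda>I' J'. I' = I \<and> J' = J)"
proof (cases "card I < card J")
  case True
  let ?S = "{up_map r I J J' \<sigma> U z | J' \<sigma> U z. I \<subseteq> J' \<and> J' \<subseteq> {..<r} \<and> card J' = card J \<and> \<sigma> permutes {..<card J}
                \<and> U \<in> pairings I J' \<and> z \<in> brauer_diagrams (card I)}"
  have "B_IJ \<omega> n f fd r I J = cspan ?S" using True by (simp add: B_IJ_def up_map_def Let_def)
  also have "\<dots> = equivariant r (\<lambda>I' J'. I' = I \<and> J' = J)"
  proof (rule equivariant_spanned[OF IJ(1,2)])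
    show "?S \<subseteq> equivariant r (\<lambda>I' J'. I' = I \<and> J' = J)"
    proof clarify
      fix J' \<sigma> U z assume *: "I \<subseteq> J'" "J' \<subseteq> {..<r}" "card J' = card J" "\<sigma> permutes {..<card J}"
        "U \<in> pairings I J'" "z \<in> brauer_diagrams (card I)"
      note g = up_map[OF *(1) IJ(2) *(2-6)]
      show "up_map r I J J' \<sigma> U z \<in> equivariant r (\<lambda>I' J'. I' = I \<and> J' = J)"
      proof (rule equivariantI[OF g(1)])
        fix I1 K assume IK: "I1 \<subseteq> {..<r}" "K \<subseteq> {..<r}" "I1 = I \<and> K = J"
        have "dform I z ((h \<circ> v) \<circ> Inl) (((h \<circ> v) \<circ> Inr) \<circ> slot_map J J' \<sigma>)
          = dform I z (v \<circ> Inl) ((v \<circ> Inr) \<circ> slot_map J J' \<sigma>)" if "h \<in> isometry_group \<omega>" for h v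
          by (simp only: comp_assoc dform_invariant[OF that])
        then show "invariant (component r (up_map r I J J' \<sigma> U z) I1 K)"
          unfolding invariant_def component_def g(2)[OF IK(1,2)] using IK(3) by (simp add: isometryD)
      next
        fix I1 K assume IK: "I1 \<subseteq> {..<r}" "K \<subseteq> {..<r}" "\<not> (I1 = I \<and> K = J)"
        show "component r (up_map r I J J' \<sigma> U z) I1 K = 0"
          unfolding component_def g(2)[OF IK(1,2)] fun_eq_iff using IK(3) by auto
      qed
    qed
    show "\<exists>\<phi>\<in>?S. component r \<phi> I J = split_form bs th ts" if "split_data I J bs th ts" for bs th ts
      using up_map_realizes[OF that IJ(1,2) True] by blast
  qed
  finally show ?thesis .
next
  case False
  then have lt: "card J < card I" using IJ by simp
  let ?S = "{down_map r I J J' \<sigma> U z | J' \<sigma> z U. J' \<subseteq> I \<and> card J' = card J \<and> \<sigma> permutes {..<card J}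
                \<and> z \<in> brauer_diagrams (card J) \<and> U \<in> pairings J' I}"
  have "B_IJ \<omega> n f fd r I J = cspan ?S" using False by (simp add: B_IJ_def down_map_def Let_def)
  also have "\<dots> = equivariant r (\<lambda>I' J'. I' = I \<and> J' = J)"
  proof (rule equivariant_spanned[OF IJ(1,2)])
    show "?S \<subseteq> equivariant r (\<lambda>I' J'. I' = I \<and> J' = J)"
    proof clarify
      fix J' \<sigma> U z assume *: "J' \<subseteq> I" "card J' = card J" "\<sigma> permutes {..<card J}"
        "z \<in> brauer_diagrams (card J)" "U \<in> pairings J' I"
      note g = down_map[OF *(1) IJ(2,1) *(2,3,5,4)]
      show "down_map r I J J' \<sigma> U z \<in> equivariant r (\<lambda>I' J'. I' = I \<and> J' = J)"
      proof (rule equivariantI[OF g(1)])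
        fix I1 K assume IK: "I1 \<subseteq> {..<r}" "K \<subseteq> {..<r}" "I1 = I \<and> K = J"
        have "dform J' z ((h \<circ> v) \<circ> Inl) (((h \<circ> v) \<circ> Inr) \<circ> slot_map J J' \<sigma>)
          = dform J' z (v \<circ> Inl) ((v \<circ> Inr) \<circ> slot_map J J' \<sigma>)" if "h \<in> isometry_group \<omega>" for h v
          by (simp only: comp_assoc dform_invariant[OF that])
        then show "invariant (component r (down_map r I J J' \<sigma> U z) I1 K)"
          unfolding invariant_def component_def g(2)[OF IK(1,2)] using IK(3) by (simp add: isometryD)
      next
        fix I1 K assume IK: "I1 \<subseteq> {..<r}" "K \<subseteq> {..<r}" "\<not> (I1 = I \<and> K = J)"
        show "component r (down_map r I J J' \<sigma> U z) I1 K = 0"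
          unfolding component_def g(2)[OF IK(1,2)] fun_eq_iff using IK(3) by auto
      qed
    qed
    show "\<exists>\<phi>\<in>?S. component r \<phi> I J = split_form bs th ts" if "split_data I J bs th ts" for bs th ts
      using down_map_realizes[OF that IJ(1,2) lt] by blast
  qed
  finally show ?thesis .
qed

end

section \<open>Group actions\<close>

lemma is_subalgebraD:
  assumes "is_subalgebra S A"
  shows "csubspace A" "idmap S \<in> A" "\<phi> \<in> A \<Longrightarrow> \<psi> \<in> A \<Longrightarrow> \<phi> \<circ> \<psi> \<in> A"
  using assms by (auto simp: is_subalgebra_def)

lemma diag_action_comp:
  assumes "clinear g" "clinear h"
  shows "diag_action l (g \<circ> h) = diag_action l g \<circ> diag_action l h"
proof (rule Hom_tpow_eqI[OF diag_action_Hom Hom_comp[OF diag_action_Hom diag_action_Hom csubspace_tpow]])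
  show gh: "clinear (g \<circ> h)" using clinear_compose[OF assms(2,1)] by (simp add: comp_def)
  fix vs :: "'a list" assume "length vs = l"
  then show "diag_action l (g \<circ> h) (pure vs) = (diag_action l g \<circ> diag_action l h) (pure vs)"
    by (simp add: diag_action_pure assms gh)
qed (rule assms)+

lemma diag_action_id: "diag_action l id = idmap (tpow l)"
proof (rule Hom_tpow_eqI[OF diag_action_Hom idmap_Hom[OF csubspace_tpow]])
  show lin: "clinear id" by (rule clinearI) simp_all
  show "diag_action l id (pure vs) = idmap (tpow l) (pure vs)" if "length vs = l" for vs
    unfolding diag_action_pure[OF lin that] using pure_in_tpow[OF that] by (simp add: idmap_def)
qed

lemma End_grp_Un: "End_grp l (H \<union> K) = End_grp l H \<inter> End_grp l K"
  by (auto simp: End_grp_def)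

lemma End_grpD: "\<phi> \<in> End_grp l H \<Longrightarrow> \<phi> \<in> Hom (tpow l) (tpow l)"
  "\<phi> \<in> End_grp l H \<Longrightarrow> g \<in> H \<Longrightarrow> diag_action l g \<circ> \<phi> = \<phi> \<circ> diag_action l g"
  by (auto simp: End_grp_def)

lemma End_grp_subalgebra:
  assumes H: "\<And>g. g \<in> H \<Longrightarrow> clinear g"
  shows "is_subalgebra (tpow l) (End_grp l H)"
  unfolding is_subalgebra_def
proof (intro conjI ballI)
  note T = csubspace_tpow[of l]
  show "End_grp l H \<subseteq> Hom (tpow l) (tpow l)" by (auto simp: End_grp_def)
  show "csubspace (End_grp l H)"
  proof (rule complex_vector.subspaceI)
    note S = csubspace_Hom[OF T, of "tpow l"]
    show "0 \<in> End_grp l H"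
      using complex_vector.subspace_0[OF S] Hom_0[OF diag_action_Hom[OF H] T]
      by (auto simp: End_grp_def fun_eq_iff)
    show "\<phi> + \<psi> \<in> End_grp l H" if "\<phi> \<in> End_grp l H" "\<psi> \<in> End_grp l H" for \<phi> \<psi>
    proof -
      note D = End_grpD[OF that(1)] End_grpD[OF that(2)]
      have "diag_action l g ((\<phi> + \<psi>) x) = (\<phi> + \<psi>) (diag_action l g x)" if g: "g \<in> H" for g x
      proof (cases "x \<in> tpow l")
        case True
        then show ?thesis
          using HomD(2)[OF diag_action_Hom[OF H[OF g]]] HomD(1)[OF D(1)] HomD(1)[OF D(3)]
            fun_cong[OF D(2)[OF g], of x] fun_cong[OF D(4)[OF g], of x] by simp
      next
        case False
        then show ?thesis
          using HomD(4)[OF D(1)] HomD(4)[OF D(3)] HomD(4)[OF diag_action_Hom[OF H[OF g]]]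
            Hom_0[OF D(1) T] Hom_0[OF D(3) T] Hom_0[OF diag_action_Hom[OF H[OF g]] T] by simp
      qed
      then show ?thesis
        using complex_vector.subspace_add[OF S D(1) D(3)] by (auto simp: End_grp_def fun_eq_iff)
    qed
    show "c *\<^sub>C \<phi> \<in> End_grp l H" if "\<phi> \<in> End_grp l H" for c \<phi>
    proof -
      note D = End_grpD[OF that]
      have "diag_action l g ((c *\<^sub>C \<phi>) x) = (c *\<^sub>C \<phi>) (diag_action l g x)" if g: "g \<in> H" for g x
      proof (cases "x \<in> tpow l")
        case True
        then show ?thesis
          using HomD(3)[OF diag_action_Hom[OF H[OF g]]] HomD(1)[OF D(1)]
            fun_cong[OF D(2)[OF g], of x] by (simp add: scaleC_apply)
      next
        case False
        then show ?thesis
          using HomD(4)[OF D(1)] HomD(4)[OF diag_action_Hom[OF H[OF g]]]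
            Hom_0[OF D(1) T] Hom_0[OF diag_action_Hom[OF H[OF g]] T] by (simp add: scaleC_apply)
      qed
      then show ?thesis
        using complex_vector.subspace_scale[OF S D(1)] by (auto simp: End_grp_def fun_eq_iff)
    qed
  qed
  show "idmap (tpow l) \<in> End_grp l H"
    using idmap_Hom[OF T] Hom_idmap[OF diag_action_Hom[OF H] T] idmap_Hom_comp[OF diag_action_Hom[OF H] T]
    by (auto simp: End_grp_def)
  show "\<phi> \<circ> \<psi> \<in> End_grp l H" if "\<phi> \<in> End_grp l H" "\<psi> \<in> End_grp l H" for \<phi> \<psi>
  proof -
    note D = End_grpD[OF that(1)] End_grpD[OF that(2)]
    have "diag_action l g \<circ> (\<phi> \<circ> \<psi>) = (\<phi> \<circ> \<psi>) \<circ> diag_action l g" if g: "g \<in> H" for g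
      by (metis D(2)[OF g] D(4)[OF g] comp_assoc)
    then show ?thesis using Hom_comp[OF D(3) D(1) T] by (simp add: End_grp_def)
  qed
qed

lemma group_GL: "group (GL :: ('a::complex_vector \<Rightarrow> 'a) monoid)"
proof (rule groupI)
  fix g h k :: "'a \<Rightarrow> 'a" assume g: "g \<in> carrier GL" and h: "h \<in> carrier GL"
  show "g \<otimes>\<^bsub>GL\<^esub> h \<in> carrier GL"
    using g h clinear_compose[of h g] by (auto simp: GL_def comp_def bij_comp[unfolded comp_def])
  show "g \<otimes>\<^bsub>GL\<^esub> h \<otimes>\<^bsub>GL\<^esub> k = g \<otimes>\<^bsub>GL\<^esub> (h \<otimes>\<^bsub>GL\<^esub> k)" by (simp add: GL_def o_assoc)
next
  show "\<one>\<^bsub>GL\<^esub> \<in> carrier (GL :: ('a \<Rightarrow> 'a) monoid)" by (simp add: GL_def clinear_iff)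
  fix g :: "'a \<Rightarrow> 'a" assume g: "g \<in> carrier GL"
  show "\<one>\<^bsub>GL\<^esub> \<otimes>\<^bsub>GL\<^esub> g = g" by (simp add: GL_def)
  have lin: "clinear g" and bij: "bij g" using g by (auto simp: GL_def)
  let ?h = "Hilbert_Choice.inv g"
  have "?h \<in> carrier GL" using clinear_inv[OF lin bij] bij_imp_bij_inv[OF bij] by (simp add: GL_def)
  moreover have "?h \<otimes>\<^bsub>GL\<^esub> g = \<one>\<^bsub>GL\<^esub>"
    using bij by (simp add: GL_def fun_eq_iff bij_is_inj inv_f_f)
  ultimately show "\<exists>y\<in>carrier GL. y \<otimes>\<^bsub>GL\<^esub> g = \<one>\<^bsub>GL\<^esub>" by blast
qed

text \<open>The products with the torus are defined by generation; commuting with an action passes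
  to products and inverses, so generators suffice.\<close>

lemma End_grp_generate:
  fixes S :: "('a::complex_vector \<Rightarrow> 'a) set"
  assumes S: "S \<subseteq> carrier GL"
  shows "End_grp l (generate GL S) = End_grp l S"
proof
  interpret group "GL :: ('a \<Rightarrow> 'a) monoid" by (rule group_GL)
  note T = csubspace_tpow[of l]
  have lin: "clinear g" if "g \<in> carrier GL" for g :: "'a \<Rightarrow> 'a" using that by (simp add: GL_def)
  show "End_grp l (generate GL S) \<subseteq> End_grp l S" by (auto simp: End_grp_def intro: generate.incl)
  show "End_grp l S \<subseteq> End_grp l (generate GL S)"
  proof
    fix \<phi> assume \<phi>: "\<phi> \<in> End_grp l S"
    note D = End_grpD[OF \<phi>]
    have "diag_action l g \<circ> \<phi> = \<phi> \<circ> diag_action l g" if "g \<in> generate GL S" for g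
      using that
    proof (induction rule: generate.induct)
      case one
      have "\<one>\<^bsub>GL\<^esub> = (id :: 'a \<Rightarrow> 'a)" by (simp add: GL_def)
      show ?case
        unfolding \<open>\<one>\<^bsub>GL\<^esub> = (id :: 'a \<Rightarrow> 'a)\<close> diag_action_id Hom_idmap[OF D(1) T] idmap_Hom_comp[OF D(1) T] ..
    next
      case (incl h)
      then show ?case by (rule D(2))
    next
      case (inv h)
      let ?k = "inv\<^bsub>GL\<^esub> h"
      have h: "h \<in> carrier GL" and k: "?k \<in> carrier GL" using inv S by auto
      have "?k \<circ> h = id" "h \<circ> ?k = id" using l_inv[OF h] r_inv[OF h] by (simp_all add: GL_def)
      then have kh: "diag_action l ?k \<circ> diag_action l h = idmap (tpow l)" "diag_action l h \<circ> diag_action l ?k = idmap (tpow l)"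
        using diag_action_comp[OF lin[OF k] lin[OF h], of l] diag_action_comp[OF lin[OF h] lin[OF k], of l]
        by (simp_all add: diag_action_id)
      \<comment> \<open>Insert \<open>h\<close> after its inverse on the right and move \<phi> past
        \<open>h\<close>. On tensor powers the neutral element is \<open>idmap\<close>, not
        \<open>id\<close>.\<close>
      have "diag_action l ?k \<circ> \<phi> = diag_action l ?k \<circ> (\<phi> \<circ> (diag_action l h \<circ> diag_action l ?k))"
        by (simp only: kh Hom_idmap[OF D(1) T])
      also have "\<dots> = (diag_action l ?k \<circ> diag_action l h) \<circ> \<phi> \<circ> diag_action l ?k"
        using D(2)[OF inv] by (metis comp_assoc)
      also have "\<dots> = \<phi> \<circ> diag_action l ?k" by (simp only: kh idmap_Hom_comp[OF D(1) T])
      finally show ?case .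
    next
      case (eng h1 h2)
      have h: "clinear h1" "clinear h2"
        using eng.hyps generate_incl[OF S] lin by blast+
      have "h1 \<otimes>\<^bsub>GL\<^esub> h2 = h1 \<circ> h2" by (simp add: GL_def)
      then show ?case using eng.IH diag_action_comp[OF h] by (metis comp_assoc)
    qed
    then show "\<phi> \<in> End_grp l (generate GL S)" using D(1) by (simp add: End_grp_def)
  qed
qed

context bilinear_space
begin

section \<open>The actions of G and of the torus on components\<close>

text \<open>Covers both groups: c = 1 for \<open>G\<close>, g = \<open>id\<close> for the
  torus.\<close>

definition ext_map :: "('v \<Rightarrow> 'v) \<Rightarrow> complex \<Rightarrow> 'v ext \<Rightarrow> 'v ext"
  where "ext_map g c = (\<lambda>(u, a). (g u, c * a))"

lemma clinear_ext_map: "clinear g \<Longrightarrow> clinear (ext_map g c)"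
  by (rule clinearI)
    (simp_all add: ext_map_def case_prod_unfold scaleC_prod_def scaleC_complex_def clinear_add clinear_scale distrib_left)

text \<open>Each of the r - card I slots that hold \<eta> contributes one factor
  \<open>c\<close>.\<close>

lemma diag_ext_map_tens:
  assumes g: "clinear g"
  shows "I \<subseteq> {..<r} \<Longrightarrow> diag_action r (ext_map g c) (tens r I v) = c ^ (r - card I) *\<^sub>C tens r I (g \<circ> v)"
proof -
  assume I: "I \<subseteq> {..<r}"
  have fin: "finite I" using finite_slots[OF I] .
  show ?thesis
  proof (rule tensor_ext_eqI[where r = r])
    note H = diag_action_Hom[OF clinear_ext_map[OF g], of r c]
    show "diag_action r (ext_map g c) (tens r I v) \<in> tpow r" by (rule HomD(1)[OF H tens_in_tpow])
    show "c ^ (r - card I) *\<^sub>C tens r I (g \<circ> v) \<in> tpow r"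
      by (rule complex_vector.subspace_scale[OF csubspace_tpow tens_in_tpow])
    fix J u assume J: "J \<subseteq> {..<r}"
    have "diag_action r (ext_map g c) (tens r I v) (kform r J u)
      = (\<Prod>i<r. if i \<in> J then \<omega> (if i \<in> I then g (v i) else 0) (u i) else if i \<in> I then 0 else c)"
      unfolding tens_def diag_action_pure[OF clinear_ext_map[OF g] length_fill]
      by (subst pure_eval[of _ r])
        (auto simp: multilinear_kform kform_def ext_map_def clinear_0[OF g] intro!: prod.cong)
    also have "\<dots> = c ^ (r - card I) * (if I = J then \<Prod>i\<in>I. \<omega> (g (v i)) (u i) else 0)"
    proof (cases "I = J")
      case True
      have "(\<Prod>i<r. if i \<in> J then \<omega> (if i \<in> I then g (v i) else 0) (u i) else if i \<in> I then 0 else c)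
        = (\<Prod>i\<in>I \<union> ({..<r} - I). if i \<in> I then \<omega> (g (v i)) (u i) else c)"
        by (rule prod.cong) (use I True in auto)
      also have "\<dots> = (\<Prod>i\<in>I. \<omega> (g (v i)) (u i)) * (\<Prod>i\<in>{..<r} - I. c)"
        by (subst prod.union_disjoint) (auto simp: fin intro!: arg_cong2[where f = times] prod.cong)
      finally show ?thesis using True card_Diff_subset[OF fin I] by simp
    next
      case False
      then obtain i where "i < r" "i \<in> I \<longleftrightarrow> i \<notin> J" using I J by blast
      then have "(\<Prod>i<r. if i \<in> J then \<omega> (if i \<in> I then g (v i) else 0) (u i) else if i \<in> I then 0 else c) = 0"
        by (intro prod_zero) (auto simp: omega_simps intro!: bexI[of _ i])
      then show ?thesis using False by simp
    qed
    finally show "diag_action r (ext_map g c) (tens r I v) (kform r J u)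
      = (c ^ (r - card I) *\<^sub>C tens r I (g \<circ> v)) (kform r J u)"
      using tens_kform[OF I J, of "g \<circ> v" u] by (simp add: scaleC_apply scaleC_complex_def)
  qed
qed

lemma diag_ext_map_kform:
  assumes g: "g \<in> isometry_group \<omega>" and x: "x \<in> tpow r" and J: "J \<subseteq> {..<r}"
  shows "diag_action r (ext_map g c) x (kform r J (g \<circ> u)) = c ^ (r - card J) * x (kform r J u)"
proof (rule tpow_eval_eq1[OF diag_action_Hom[OF clinear_ext_map[OF isometryD(1)[OF g]]] x _ multilinear_kform])
  fix ws :: "'v ext list" assume l: "length ws = r"
  have fin: "finite J" using finite_slots[OF J] .
  have "diag_action r (ext_map g c) (pure ws) (kform r J (g \<circ> u))
    = (\<Prod>i<r. if i \<in> J then \<omega> (fst (ws ! i)) (u i) else c * snd (ws ! i))"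
    unfolding diag_action_pure[OF clinear_ext_map[OF isometryD(1)[OF g]] l]
    by (subst pure_eval[of _ r])
      (auto simp: l multilinear_kform kform_def ext_map_def case_prod_unfold isometryD(3)[OF g] intro!: prod.cong)
  also have "\<dots> = (\<Prod>i<r. (if i \<in> J then 1 else c) * (if i \<in> J then \<omega> (fst (ws ! i)) (u i) else snd (ws ! i)))"
    by (rule prod.cong) auto
  also have "\<dots> = (\<Prod>i<r. if i \<in> J then 1 else c) * kform r J u ws"
    by (simp add: prod.distrib kform_def)
  also have "(\<Prod>i<r. if i \<in> J then 1 else c) = (\<Prod>i\<in>J \<union> ({..<r} - J). if i \<in> J then 1 else c)"
    by (rule prod.cong) (use J in auto)
  also have "\<dots> = (\<Prod>i\<in>J. 1) * (\<Prod>i\<in>{..<r} - J. c)"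
    by (subst prod.union_disjoint) (auto simp: fin intro!: prod.cong)
  also have "\<dots> = c ^ (r - card J)" using J fin by (simp add: card_Diff_subset)
  finally show "diag_action r (ext_map g c) (pure ws) (kform r J (g \<circ> u)) = c ^ (r - card J) * kform r J u ws" .
qed

lemma id_isometry: "id \<in> isometry_group \<omega>"
  by (auto simp: isometry_group_def GL_def clinear_iff)

text \<open>Testing at \<open>kform r J (g \<circ> u)\<close> loses nothing as \<open>g\<close> is
  bijective, and an isometry applied to both the tensor and the test vectors cancels. What remains
  on each side is a power of \<open>c\<close> counting the \<eta> slots of \<open>J\<close> and of
  \<open>I\<close>.\<close>

lemma commute_ext_map_iff:
  assumes g: "g \<in> isometry_group \<omega>" and \<phi>: "\<phi> \<in> Hom (tpow r) (tpow r)"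
  shows "diag_action r (ext_map g c) \<circ> \<phi> = \<phi> \<circ> diag_action r (ext_map g c) \<longleftrightarrow>
    (\<forall>I J v. I \<subseteq> {..<r} \<longrightarrow> J \<subseteq> {..<r} \<longrightarrow>
      c ^ (r - card J) * component r \<phi> I J v = c ^ (r - card I) * component r \<phi> I J (g \<circ> v))"
proof -
  let ?d = "diag_action r (ext_map g c)"
  note H = diag_action_Hom[OF clinear_ext_map[OF isometryD(1)[OF g]], of r c]
  have 1: "(?d \<circ> \<phi>) (tens r I v) (kform r J (g \<circ> u)) = c ^ (r - card J) * \<phi> (tens r I v) (kform r J u)"
    if "J \<subseteq> {..<r}" for I J v u
    using diag_ext_map_kform[OF g HomD(1)[OF \<phi> tens_in_tpow] that] by simp
  have 2: "(\<phi> \<circ> ?d) (tens r I v) (kform r J (g \<circ> u)) = c ^ (r - card I) * \<phi> (tens r I (g \<circ> v)) (kform r J (g \<circ> u))"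
    if "I \<subseteq> {..<r}" for I J v u
    using diag_ext_map_tens[OF isometryD(1)[OF g] that, of c v] by (simp add: HomD(3)[OF \<phi>] scaleC_apply scaleC_complex_def)
  show ?thesis
  proof
    assume eq: "?d \<circ> \<phi> = \<phi> \<circ> ?d"
    show "\<forall>I J v. I \<subseteq> {..<r} \<longrightarrow> J \<subseteq> {..<r} \<longrightarrow>
      c ^ (r - card J) * component r \<phi> I J v = c ^ (r - card I) * component r \<phi> I J (g \<circ> v)"
    proof (intro allI impI)
      fix I J and v :: "nat + nat \<Rightarrow> 'v" assume IJ: "I \<subseteq> {..<r}" "J \<subseteq> {..<r}"
      show "c ^ (r - card J) * component r \<phi> I J v = c ^ (r - card I) * component r \<phi> I J (g \<circ> v)"
        using 1[OF IJ(2), of I "v \<circ> Inl" "v \<circ> Inr"] 2[OF IJ(1), of "v \<circ> Inl" J "v \<circ> Inr"] unfolding eq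
        by (simp add: component_def o_assoc)
    qed
  next
    assume eq: "\<forall>I J v. I \<subseteq> {..<r} \<longrightarrow> J \<subseteq> {..<r} \<longrightarrow>
      c ^ (r - card J) * component r \<phi> I J v = c ^ (r - card I) * component r \<phi> I J (g \<circ> v)"
    show "?d \<circ> \<phi> = \<phi> \<circ> ?d"
    proof (rule Hom_ext_eqI[OF Hom_comp[OF \<phi> H csubspace_tpow] Hom_comp[OF H \<phi> csubspace_tpow]])
      fix I and v :: "nat \<Rightarrow> 'v" assume I: "I \<subseteq> {..<r}"
      show "(?d \<circ> \<phi>) (tens r I v) = (\<phi> \<circ> ?d) (tens r I v)"
      proof (rule tensor_ext_eqI[where r = r])
        show "(?d \<circ> \<phi>) (tens r I v) \<in> tpow r" "(\<phi> \<circ> ?d) (tens r I v) \<in> tpow r"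
          by (simp_all add: HomD(1)[OF H] HomD(1)[OF \<phi>])
        fix J and u :: "nat \<Rightarrow> 'v" assume J: "J \<subseteq> {..<r}"
        have u: "u = g \<circ> (Hilbert_Choice.inv g \<circ> u)" by (simp add: fun_eq_iff isometryD(4)[OF g])
        have v: "case_sum v w \<circ> Inl = v" "case_sum v w \<circ> Inr = w" for w :: "nat \<Rightarrow> 'v"
          by (auto simp: fun_eq_iff)
        have "c ^ (r - card J) * \<phi> (tens r I v) (kform r J (Hilbert_Choice.inv g \<circ> u))
          = c ^ (r - card I) * \<phi> (tens r I (g \<circ> v)) (kform r J (g \<circ> (Hilbert_Choice.inv g \<circ> u)))"
          using eq[rule_format, OF I J, of "case_sum v (Hilbert_Choice.inv g \<circ> u)"]
          unfolding component_def comp_assoc v .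
        then show "(?d \<circ> \<phi>) (tens r I v) (kform r J u) = (\<phi> \<circ> ?d) (tens r I v) (kform r J u)"
          using 1[OF J, of I v "Hilbert_Choice.inv g \<circ> u"] 2[OF I, of v J "Hilbert_Choice.inv g \<circ> u"] u by simp
      qed
    qed
  qed
qed

lemma G_in_GL_ext_map: "G_in_GL \<omega> = {ext_map g 1 | g. g \<in> isometry_group \<omega>}"
  by (simp add: G_in_GL_def ext_map_def)

lemma Gm_in_GL_ext_map: "(Gm_in_GL :: ('v ext \<Rightarrow> 'v ext) set) = {ext_map id c | c. c \<noteq> 0}"
  by (simp add: Gm_in_GL_def ext_map_def)

lemma End_G: "End_grp r (G_in_GL \<omega>) = equivariant r (\<lambda>_ _. True)"
proof (intro equalityI subsetI)
  fix \<phi> assume \<phi>: "\<phi> \<in> End_grp r (G_in_GL \<omega>)"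
  show "\<phi> \<in> equivariant r (\<lambda>_ _. True)"
  proof (rule equivariantI[OF End_grpD(1)[OF \<phi>]])
    fix I J assume IJ: "I \<subseteq> {..<r}" "J \<subseteq> {..<r}"
    show "invariant (component r \<phi> I J)"
      unfolding invariant_def
    proof (intro ballI allI)
      fix g v assume g: "g \<in> isometry_group \<omega>"
      then have "diag_action r (ext_map g 1) \<circ> \<phi> = \<phi> \<circ> diag_action r (ext_map g 1)"
        by (intro End_grpD(2)[OF \<phi>]) (auto simp: G_in_GL_ext_map)
      from this[unfolded commute_ext_map_iff[OF g End_grpD(1)[OF \<phi>]], rule_format, OF IJ, of v]
      show "component r \<phi> I J (g \<circ> v) = component r \<phi> I J v" by simp
    qed
  qed simp
next
  fix \<phi> assume \<phi>: "\<phi> \<in> equivariant r (\<lambda>_ _. True)"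
  have "diag_action r (ext_map g 1) \<circ> \<phi> = \<phi> \<circ> diag_action r (ext_map g 1)" if g: "g \<in> isometry_group \<omega>" for g
    unfolding commute_ext_map_iff[OF g equivariantD(1)[OF \<phi>]]
  proof (intro allI impI)
    fix I J v assume "I \<subseteq> {..<r}" "J \<subseteq> {..<r}"
    then have "component r \<phi> I J (g \<circ> v) = component r \<phi> I J v"
      using equivariantD(2)[OF \<phi>] g unfolding invariant_def by blast
    then show "1 ^ (r - card J) * component r \<phi> I J v = 1 ^ (r - card I) * component r \<phi> I J (g \<circ> v)" by simp
  qed
  then show "\<phi> \<in> End_grp r (G_in_GL \<omega>)"
    using equivariantD(1)[OF \<phi>] by (auto simp: End_grp_def G_in_GL_ext_map)
qed

lemma End_G_Gm: "End_grp r (G_in_GL \<omega> \<union> Gm_in_GL) = equivariant r (\<lambda>I J. card I = card J)"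
proof -
  have Gm: "\<phi> \<in> End_grp r Gm_in_GL \<longleftrightarrow>
      (\<forall>I J. I \<subseteq> {..<r} \<longrightarrow> J \<subseteq> {..<r} \<longrightarrow> card I \<noteq> card J \<longrightarrow> component r \<phi> I J = 0)"
    if \<phi>: "\<phi> \<in> Hom (tpow r) (tpow r)" for \<phi>
  proof
    assume "\<phi> \<in> End_grp r Gm_in_GL"
    \<comment> \<open>One torus element is enough: 2 is not a root of unity, so the powers for
      different sizes differ.\<close>
    then have "diag_action r (ext_map id 2) \<circ> \<phi> = \<phi> \<circ> diag_action r (ext_map id 2)"
      by (rule End_grpD(2)) (auto simp: Gm_in_GL_ext_map)
    note eq = this[unfolded commute_ext_map_iff[OF id_isometry \<phi>], rule_format]
    show "\<forall>I J. I \<subseteq> {..<r} \<longrightarrow> J \<subseteq> {..<r} \<longrightarrow> card I \<noteq> card J \<longrightarrow> component r \<phi> I J = 0"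
    proof (intro allI impI)
      fix I J assume IJ: "I \<subseteq> {..<r}" "J \<subseteq> {..<r}" "card I \<noteq> card J"
      have "card I \<le> r" "card J \<le> r" using card_mono[OF _ IJ(1)] card_mono[OF _ IJ(2)] by auto
      then have ne: "r - card I \<noteq> r - card J" using IJ(3) by simp
      have "(2::complex) ^ (r - card J) \<noteq> 2 ^ (r - card I)"
      proof
        assume "(2::complex) ^ (r - card J) = 2 ^ (r - card I)"
        then have "cmod (2 ^ (r - card J)) = cmod (2 ^ (r - card I))" by simp
        then have "(2::real) ^ (r - card J) = 2 ^ (r - card I)" by (simp add: norm_power)
        then show False using ne by simp
      qed
      moreover have "(2 ^ (r - card J) - 2 ^ (r - card I)) * component r \<phi> I J v = 0" for v
        using eq[OF IJ(1,2), of v] by (simp add: left_diff_distrib)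
      ultimately show "component r \<phi> I J = 0" by (simp add: fun_eq_iff)
    qed
  next
    assume z: "\<forall>I J. I \<subseteq> {..<r} \<longrightarrow> J \<subseteq> {..<r} \<longrightarrow> card I \<noteq> card J \<longrightarrow> component r \<phi> I J = 0"
    have "diag_action r (ext_map id c) \<circ> \<phi> = \<phi> \<circ> diag_action r (ext_map id c)" for c
      unfolding commute_ext_map_iff[OF id_isometry \<phi>]
    proof (intro allI impI)
      fix I J v assume "I \<subseteq> {..<r}" "J \<subseteq> {..<r}"
      then show "c ^ (r - card J) * component r \<phi> I J v = c ^ (r - card I) * component r \<phi> I J (id \<circ> v)"
        using z by (cases "card I = card J") auto
    qed
    then show "\<phi> \<in> End_grp r Gm_in_GL" using \<phi> by (auto simp: End_grp_def Gm_in_GL_ext_map)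
  qed
  show ?thesis
    unfolding End_grp_Un End_G
  proof (intro equalityI subsetI)
    fix \<phi> assume "\<phi> \<in> equivariant r (\<lambda>_ _. True) \<inter> End_grp r Gm_in_GL"
    then show "\<phi> \<in> equivariant r (\<lambda>I J. card I = card J)"
      using Gm equivariantD by (intro equivariantI) auto
  next
    fix \<phi> assume \<phi>: "\<phi> \<in> equivariant r (\<lambda>I J. card I = card J)"
    then show "\<phi> \<in> equivariant r (\<lambda>_ _. True) \<inter> End_grp r Gm_in_GL"
      using Gm[OF equivariantD(1)[OF \<phi>]] equivariantD[OF \<phi>] by (auto intro: equivariantI)
  qed
qed

end

section \<open>The decomposition\<close>

context bilinear_space
begin

definition block :: "nat \<Rightarrow> ('v ext tensor \<Rightarrow> 'v ext tensor) \<Rightarrow> nat set \<Rightarrow> nat set \<Rightarrow> 'v ext tensor \<Rightarrow> 'v ext tensor"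
  where "block r \<phi> I J = summand_proj r J \<circ> \<phi> \<circ> summand_proj r I"

text \<open>Keeps the blocks selected by \<open>Q\<close>. A map supported on \<open>Q\<close>
  equals its own cut, hence is a sum of blocks that can be treated one at a time.\<close>

definition cut :: "nat \<Rightarrow> (nat set \<Rightarrow> nat set \<Rightarrow> bool) \<Rightarrow> ('v ext tensor \<Rightarrow> 'v ext tensor) \<Rightarrow> 'v ext tensor \<Rightarrow> 'v ext tensor"
  where "cut r Q \<phi> = (\<Sum>(I, J)\<in>{(I, J). I \<subseteq> {..<r} \<and> J \<subseteq> {..<r} \<and> Q I J}. block r \<phi> I J)"

lemma block_Hom: "\<phi> \<in> Hom (tpow r) (tpow r) \<Longrightarrow> block r \<phi> I J \<in> Hom (tpow r) (tpow r)"
  unfolding block_def by (intro Hom_comp[OF summand_proj_Hom] Hom_comp[OF _ summand_proj_Hom] csubspace_tpow)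

lemma component_block:
  assumes \<phi>: "\<phi> \<in> Hom (tpow r) (tpow r)"
    and IJ: "I \<subseteq> {..<r}" "J \<subseteq> {..<r}" "I' \<subseteq> {..<r}" "J' \<subseteq> {..<r}"
  shows "component r (block r \<phi> I J) I' J' = (if I' = I \<and> J' = J then component r \<phi> I' J' else 0)"
proof
  fix v
  have "block r \<phi> I J (tens r I' (v \<circ> Inl)) (kform r J' (v \<circ> Inr))
    = (if I' = I then summand_proj r J (\<phi> (tens r I' (v \<circ> Inl))) (kform r J' (v \<circ> Inr)) else 0)"
  proof -
    have "summand_proj r J (0 :: 'v ext tensor) = 0" by (rule Hom_0[OF summand_proj_Hom csubspace_tpow])
    then show ?thesis
      unfolding block_def comp_apply summand_proj_tens[OF IJ(1,3)]
      using Hom_0[OF \<phi> csubspace_tpow] by (cases "I = I'") simp_all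
  qed
  then show "component r (block r \<phi> I J) I' J' v = (if I' = I \<and> J' = J then component r \<phi> I' J' else 0) v"
    unfolding component_def summand_proj_kform[OF HomD(1)[OF \<phi> tens_in_tpow] IJ(2,4)]
    by (cases "I' = I"; cases "J' = J") auto
qed

lemma component_sum: "component r (sum h K) I J = (\<Sum>k\<in>K. component r (h k) I J)"
  by (rule clinear_sum[OF clinear_component])

lemma finite_blocks: "finite {(I, J). I \<subseteq> {..<r::nat} \<and> J \<subseteq> {..<r} \<and> Q I J}"
  by (rule finite_subset[of _ "Pow {..<r} \<times> Pow {..<r}"]) auto

lemma component_cut:
  assumes \<phi>: "\<phi> \<in> Hom (tpow r) (tpow r)" and IJ: "I \<subseteq> {..<r}" "J \<subseteq> {..<r}"
  shows "component r (cut r Q \<phi>) I J = (if Q I J then component r \<phi> I J else 0)"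
proof -
  let ?K = "{(I, J). I \<subseteq> {..<r} \<and> J \<subseteq> {..<r} \<and> Q I J}"
  have "component r (cut r Q \<phi>) I J = (\<Sum>k\<in>?K. if k = (I, J) then component r \<phi> I J else 0)"
    unfolding cut_def component_sum
  proof (rule sum.cong[OF refl], clarify)
    fix I' J' assume "I' \<subseteq> {..<r}" "J' \<subseteq> {..<r}"
    then show "component r (block r \<phi> I' J') I J = (if (I', J') = (I, J) then component r \<phi> I J else 0)"
      using component_block[OF \<phi> _ _ IJ, of I' J'] by auto
  qed
  also have "\<dots> = (if Q I J then component r \<phi> I J else 0)"
    by (subst sum.delta[OF finite_blocks]) (use IJ in simp)
  finally show ?thesis .
qed

lemma cut_Hom: "\<phi> \<in> Hom (tpow r) (tpow r) \<Longrightarrow> cut r Q \<phi> \<in> Hom (tpow r) (tpow r)"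
  unfolding cut_def
  by (rule complex_vector.subspace_sum[OF csubspace_Hom[OF csubspace_tpow]]) (auto intro: block_Hom)

lemma cut_equivariant:
  assumes "\<phi> \<in> equivariant r Q'"
  shows "cut r Q \<phi> \<in> equivariant r Q"
  by (rule equivariantI) (simp_all add: cut_Hom component_cut equivariantD[OF assms])

lemma cut_eq:
  assumes \<phi>: "\<phi> \<in> equivariant r Q"
  shows "cut r Q \<phi> = \<phi>"
proof (rule component_eqI[OF cut_Hom[OF equivariantD(1)[OF \<phi>]] equivariantD(1)[OF \<phi>]])
  fix I J assume IJ: "I \<subseteq> {..<r}" "J \<subseteq> {..<r}"
  show "component r (cut r Q \<phi>) I J = component r \<phi> I J"
    using equivariantD(3)[OF \<phi> IJ] component_cut[OF equivariantD(1)[OF \<phi>] IJ, of Q] by simp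
qed

lemma equivariant_mono:
  assumes "\<phi> \<in> equivariant r Q" "\<And>I J. Q I J \<Longrightarrow> Q' I J"
  shows "\<phi> \<in> equivariant r Q'"
  using assms by (auto simp: equivariant_def)

lemma block_equivariant:
  assumes \<phi>: "\<phi> \<in> equivariant r Q" and IJ: "I \<subseteq> {..<r}" "J \<subseteq> {..<r}"
  shows "block r \<phi> I J \<in> equivariant r (\<lambda>I' J'. I' = I \<and> J' = J)"
proof (rule equivariantI[OF block_Hom[OF equivariantD(1)[OF \<phi>]]])
  fix I' J' assume IJ': "I' \<subseteq> {..<r}" "J' \<subseteq> {..<r}"
  note c = component_block[OF equivariantD(1)[OF \<phi>] IJ IJ']
  show "invariant (component r (block r \<phi> I J) I' J')" if "I' = I \<and> J' = J"
    using that c equivariantD(2)[OF \<phi> IJ'] by simp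
  show "component r (block r \<phi> I J) I' J' = 0" if "\<not> (I' = I \<and> J' = J)"
    unfolding c using that by auto
qed

lemma B_st_equivariant:
  assumes "s \<noteq> t"
  shows "B_st \<omega> n f fd r s t = equivariant r (\<lambda>I J. card I = s \<and> card J = t)"
proof -
  let ?K = "{I. I \<subseteq> {..<r} \<and> card I = s} \<times> {J. J \<subseteq> {..<r} \<and> card J = t}"
  have B: "B_IJ \<omega> n f fd r I J = equivariant r (\<lambda>I' J'. I' = I \<and> J' = J)" if "(I, J) \<in> ?K" for I J
    using that assms by (intro B_IJ_equivariant) auto
  show ?thesis
  proof (intro equalityI subsetI)
    fix \<phi> assume "\<phi> \<in> B_st \<omega> n f fd r s t"
    then obtain x where x: "\<phi> = (\<Sum>k\<in>?K. x k)" "\<And>I J. (I, J) \<in> ?K \<Longrightarrow> x (I, J) \<in> B_IJ \<omega> n f fd r I J"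
      unfolding B_st_def subspace_sum_def by blast
    show "\<phi> \<in> equivariant r (\<lambda>I J. card I = s \<and> card J = t)"
      unfolding x(1)
    proof (rule complex_vector.subspace_sum[OF csubspace_equivariant])
      fix k assume k: "k \<in> ?K"
      obtain I J where IJ: "k = (I, J)" by (cases k)
      show "x k \<in> equivariant r (\<lambda>I J. card I = s \<and> card J = t)"
        using x(2)[of I J] B[of I J] k unfolding IJ by (auto intro: equivariant_mono)
    qed
  next
    fix \<phi> assume \<phi>: "\<phi> \<in> equivariant r (\<lambda>I J. card I = s \<and> card J = t)"
    have "\<phi> = cut r (\<lambda>I J. card I = s \<and> card J = t) \<phi>" by (rule cut_eq[OF \<phi>, symmetric])
    also have "\<dots> = (\<Sum>k\<in>?K. case k of (I, J) \<Rightarrow> block r \<phi> I J)"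
      unfolding cut_def by (rule sum.cong) auto
    finally have eq: "\<phi> = (\<Sum>k\<in>?K. (\<lambda>(I, J). block r \<phi> I J) k)" .
    define x where "x = (\<lambda>(I, J). block r \<phi> I J)"
    have mem: "\<forall>k\<in>?K. x k \<in> (case k of (I, J) \<Rightarrow> B_IJ \<omega> n f fd r I J)"
      unfolding x_def
    proof
      fix k assume k: "k \<in> ?K"
      obtain I J where IJ: "k = (I, J)" by (cases k)
      show "(\<lambda>(I, J). block r \<phi> I J) k \<in> (case k of (I, J) \<Rightarrow> B_IJ \<omega> n f fd r I J)"
        using B[of I J] k block_equivariant[OF \<phi>, of I J] unfolding IJ by auto
    qed
    show "\<phi> \<in> B_st \<omega> n f fd r s t"
      unfolding B_st_def subspace_sum_def using eq[folded x_def] mem by blast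
  qed
qed

section \<open>The enhanced Brauer algebra\<close>

lemma perm_equivariant:
  assumes \<sigma>: "\<sigma> permutes {..<r}"
  shows "perm_action r \<sigma> \<in> equivariant r (\<lambda>I J. card I = card J)"
proof (rule equivariantI[OF perm_action_Hom[OF \<sigma>]])
  fix I J assume IJ: "I \<subseteq> {..<r}" "J \<subseteq> {..<r}"
  define L where "L = {k. \<sigma> k \<in> J}"
  have L: "L \<subseteq> {..<r}" using IJ(2) permutes_in_image[OF \<sigma>] by (auto simp: L_def)
  have comp: "component r (perm_action r \<sigma>) I J v = (if I = L then \<Prod>i\<in>I. \<omega> (v (Inl i)) (v (Inr (\<sigma> i))) else 0)" for v
    unfolding component_def perm_action_kform[OF tens_in_tpow \<sigma>] L_def[symmetric] tens_kform[OF IJ(1) L]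
    by (simp only: comp_apply)
  show "invariant (component r (perm_action r \<sigma>) I J)"
    unfolding invariant_def comp by (simp add: isometryD(3))
  have "\<sigma> ` L = J"
    using surj_image_vimage_eq[OF permutes_surj[OF \<sigma>], of J] by (simp add: L_def vimage_def)
  then have "card L = card J" using card_image[of \<sigma> L] inj_on_subset[OF permutes_inj[OF \<sigma>]] by auto
  then show "component r (perm_action r \<sigma>) I J = 0" if "card I \<noteq> card J"
    unfolding fun_eq_iff comp using that by auto
qed

lemma diag_vform:
  assumes g: "g \<in> isometry_group \<omega>" and x: "x \<in> tpow l"
  shows "diag_action l g x (vform l (g \<circ> u)) = x (vform l u)"
proof -
  note lin = isometryD(1)[OF g]
  have "diag_action l g x (vform l (g \<circ> u)) = 1 * x (vform l u)"
  proof (rule tpow_eval_eq1[OF diag_action_Hom[OF lin] x _ multilinear_vform])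
    fix vs :: "'v list" assume l: "length vs = l"
    show "diag_action l g (pure vs) (vform l (g \<circ> u)) = 1 * vform l u vs"
      unfolding diag_action_pure[OF lin l]
      by (subst pure_eval[of _ l]) (auto simp: l multilinear_vform vform_def isometryD(3)[OF g])
  qed
  then show ?thesis by simp
qed

lemma on_summand_equivariant:
  assumes I: "I \<subseteq> {..<r}" and \<theta>: "\<theta> \<in> brauer \<omega> (card I)"
  shows "on_summand r I \<theta> \<in> equivariant r (\<lambda>I J. card I = card J)"
proof -
  note D = End_grpD[OF \<theta>[unfolded brauer_def]]
  have comp: "component r (on_summand r I \<theta>) I1 K v = (if I = K \<and> I1 = I then
      \<theta> (pure (map (v \<circ> Inl \<circ> enum I) [0..<card I])) (vform (card I) (v \<circ> Inr \<circ> enum I)) else 0)"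
    if IK: "I1 \<subseteq> {..<r}" "K \<subseteq> {..<r}" for I1 K v
    unfolding component_def on_summand_kform[OF tens_in_tpow D(1) I IK(2)] slots_out_tens[OF I IK(1)]
    using Hom_0[OF D(1) csubspace_tpow] by auto
  show ?thesis
  proof (rule equivariantI[OF on_summand_Hom[OF I D(1)]])
    fix I1 K assume IK: "I1 \<subseteq> {..<r}" "K \<subseteq> {..<r}"
    show "component r (on_summand r I \<theta>) I1 K = 0" if "card I1 \<noteq> card K"
      unfolding fun_eq_iff comp[OF IK] using that by auto
    show "invariant (component r (on_summand r I \<theta>) I1 K)"
      unfolding invariant_def comp[OF IK]
    proof (intro ballI allI if_cong refl)
      fix g and v :: "nat + nat \<Rightarrow> 'v" assume g: "g \<in> isometry_group \<omega>"
      let ?vs = "map (v \<circ> Inl \<circ> enum I) [0..<card I]"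
      have l: "length ?vs = card I" by simp
      have "pure (map (g \<circ> v \<circ> Inl \<circ> enum I) [0..<card I]) = diag_action (card I) g (pure ?vs)"
        unfolding diag_action_pure[OF isometryD(1)[OF g] l] by (simp add: comp_assoc)
      then have "\<theta> (pure (map (g \<circ> v \<circ> Inl \<circ> enum I) [0..<card I])) = diag_action (card I) g (\<theta> (pure ?vs))"
        using fun_cong[OF D(2)[OF g], of "pure ?vs"] by simp
      then show "\<theta> (pure (map (g \<circ> v \<circ> Inl \<circ> enum I) [0..<card I])) (vform (card I) (g \<circ> v \<circ> Inr \<circ> enum I))
        = \<theta> (pure ?vs) (vform (card I) (v \<circ> Inr \<circ> enum I))"
        using diag_vform[OF g HomD(1)[OF D(1) pure_in_tpow[OF l]], of "v \<circ> Inr \<circ> enum I"] by (simp add: comp_assoc)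
    qed
  qed
qed

text \<open>Carries the block of \<phi> at (I, J) to the tensor power of V; invariance of the
  component says that the result commutes with \<open>G\<close>. The block is thereby a generator of
  the enhanced Brauer algebra followed by a permutation.\<close>

lemma transported_brauer:
  assumes \<phi>: "\<phi> \<in> equivariant r Q" and IJ: "I \<subseteq> {..<r}" "J \<subseteq> {..<r}" "card I = card J"
  shows "slots_out r J \<circ> \<phi> \<circ> slots_in r I \<in> brauer \<omega> (card I)"
proof -
  let ?\<theta> = "slots_out r J \<circ> \<phi> \<circ> slots_in r I"
  note H = equivariantD(1)[OF \<phi>]
  have Hom: "?\<theta> \<in> Hom (tpow (card I)) (tpow (card I))"
    using Hom_comp[OF slots_in_Hom[OF IJ(1)] Hom_comp[OF H slots_out_Hom[OF IJ(2)] csubspace_tpow] csubspace_tpow] IJ(3)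
    by simp
  have fin: "finite I" using IJ finite_slots by auto
  have val: "?\<theta> (pure (map (v \<circ> enum I) [0..<card I])) (vform (card I) u)
    = component r \<phi> I J (case_sum v (u \<circ> rank J))" for u v :: "nat \<Rightarrow> 'v"
  proof -
    have "case_sum v (u \<circ> rank J) \<circ> Inl = v" "case_sum v (u \<circ> rank J) \<circ> Inr = u \<circ> rank J"
      by (auto simp: fun_eq_iff)
    then show ?thesis
      using slots_out_vform[OF HomD(1)[OF H tens_in_tpow[of r I v]] IJ(2), of u]
      by (simp add: component_def slots_in_tens[OF IJ(1)] IJ(3)[symmetric])
  qed
  have "diag_action (card I) g \<circ> ?\<theta> = ?\<theta> \<circ> diag_action (card I) g" if g: "g \<in> isometry_group \<omega>" for g
  proof (rule Hom_tpow_eqI)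
    note G = diag_action_Hom[OF isometryD(1)[OF g], of "card I"]
    show "diag_action (card I) g \<circ> ?\<theta> \<in> Hom (tpow (card I)) (tpow (card I))"
      "?\<theta> \<circ> diag_action (card I) g \<in> Hom (tpow (card I)) (tpow (card I))"
      by (rule Hom_comp[OF Hom G csubspace_tpow], rule Hom_comp[OF G Hom csubspace_tpow])
    fix vs :: "'v list" assume l: "length vs = card I"
    define v where "v i = vs ! rank I i" for i
    have vs: "vs = map (v \<circ> enum I) [0..<card I]"
      by (rule nth_equalityI) (simp_all add: l v_def rank_enum fin)
    show "(diag_action (card I) g \<circ> ?\<theta>) (pure vs) = (?\<theta> \<circ> diag_action (card I) g) (pure vs)"
    proof (rule tensor_eqI[where l = "card I"])
      have p: "pure vs \<in> tpow (card I)" by (rule pure_in_tpow[OF l])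
      show "(diag_action (card I) g \<circ> ?\<theta>) (pure vs) \<in> tpow (card I)"
        "(?\<theta> \<circ> diag_action (card I) g) (pure vs) \<in> tpow (card I)"
        using HomD(1)[OF G HomD(1)[OF Hom p]] HomD(1)[OF Hom HomD(1)[OF G p]] by simp_all
      fix u :: "nat \<Rightarrow> 'v"
      define u' where "u' = Hilbert_Choice.inv g \<circ> u"
      have u: "u = g \<circ> u'" by (simp add: u'_def fun_eq_iff isometryD(4)[OF g])
      have "(diag_action (card I) g \<circ> ?\<theta>) (pure vs) (vform (card I) u) = ?\<theta> (pure vs) (vform (card I) u')"
        unfolding u comp_apply[of "diag_action (card I) g"] by (rule diag_vform[OF g HomD(1)[OF Hom p]])
      also have "\<dots> = component r \<phi> I J (case_sum v (u' \<circ> rank J))" unfolding vs by (rule val)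
      also have "\<dots> = component r \<phi> I J (g \<circ> case_sum v (u' \<circ> rank J))"
        using equivariantD(2)[OF \<phi> IJ(1,2)] g unfolding invariant_def by metis
      also have "g \<circ> case_sum v (u' \<circ> rank J) = case_sum (g \<circ> v) (u \<circ> rank J)"
        unfolding u by (auto simp: fun_eq_iff split: sum.split)
      also have "component r \<phi> I J (case_sum (g \<circ> v) (u \<circ> rank J))
        = ?\<theta> (pure (map (g \<circ> v \<circ> enum I) [0..<card I])) (vform (card I) u)" by (rule val[symmetric])
      also have "pure (map (g \<circ> v \<circ> enum I) [0..<card I]) = diag_action (card I) g (pure vs)"
      proof -
        have "map g vs = map (g \<circ> v \<circ> enum I) [0..<card I]" by (subst vs) (simp add: comp_assoc)
        then show ?thesis unfolding diag_action_pure[OF isometryD(1)[OF g] l] by simp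
      qed
      finally show "(diag_action (card I) g \<circ> ?\<theta>) (pure vs) (vform (card I) u)
        = (?\<theta> \<circ> diag_action (card I) g) (pure vs) (vform (card I) u)" by (simp only: comp_apply)
    qed
  qed
  then show ?thesis using Hom by (simp add: brauer_def End_grp_def)
qed

lemma idmap_brauer: "idmap (tpow l) \<in> brauer \<omega> l"
  using is_subalgebraD(2)[OF End_grp_subalgebra[of "isometry_group \<omega>" l]] isometryD(1) by (simp add: brauer_def)

lemma on_summand_idmap:
  "I \<subseteq> {..<r} \<Longrightarrow> on_summand r I (idmap (tpow (card I))) = (summand_proj r I :: 'v ext tensor \<Rightarrow> _)"
  unfolding on_summand_def Hom_idmap[OF slots_in_Hom csubspace_tpow] by (rule slots_in_out)

lemma sum_summand_proj: "(\<Sum>I\<in>Pow {..<r}. summand_proj r I) = (idmap (tpow r) :: 'v ext tensor \<Rightarrow> _)"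
proof (rule component_eqI)
  show "(\<Sum>I\<in>Pow {..<r}. summand_proj r I) \<in> Hom (tpow r) (tpow r)"
    by (rule complex_vector.subspace_sum[OF csubspace_Hom[OF csubspace_tpow] summand_proj_Hom])
  show "idmap (tpow r) \<in> Hom (tpow r) (tpow r)" by (rule idmap_Hom[OF csubspace_tpow])
  fix I J assume IJ: "I \<subseteq> {..<r}" "J \<subseteq> {..<r}"
  have "component r (\<Sum>I\<in>Pow {..<r}. summand_proj r I) I J
    = (\<Sum>L\<in>Pow {..<r}. if L = I then component r (idmap (tpow r)) I J else 0)"
    unfolding component_sum
  proof (rule sum.cong[OF refl])
    fix L assume "L \<in> Pow {..<r}"
    then have L: "L \<subseteq> {..<r}" by simp
    show "component r (summand_proj r L) I J = (if L = I then component r (idmap (tpow r)) I J else 0)"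
      unfolding component_def summand_proj_tens[OF L IJ(1)] by (auto simp: fun_eq_iff idmap_def)
  qed
  then show "component r (\<Sum>I\<in>Pow {..<r}. summand_proj r I) I J = component r (idmap (tpow r)) I J"
    using IJ by simp
qed

text \<open>The right side is a subalgebra, being the commutant of \<open>G\<close> and the torus,
  and it contains the generators. Conversely, a map on the right is the sum of its blocks between
  summands of equal size, and each of these is built from generators inside any subalgebra
  containing them.\<close>

lemma enhanced_brauer_equivariant: "enhanced_brauer \<omega> r = equivariant r (\<lambda>I J. card I = card J)"
proof
  let ?G = "{perm_action r \<sigma> | \<sigma>. \<sigma> permutes {..<r}} \<union>
     {on_summand r I \<sigma> | I \<sigma>. I \<subseteq> {..<r} \<and> I \<noteq> {} \<and> \<sigma> \<in> brauer \<omega> (card I)} :: ('v ext tensor \<Rightarrow> 'v ext tensor) set"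
  have lin: "clinear g" if "g \<in> G_in_GL \<omega> \<union> Gm_in_GL" for g
    using that clinear_ext_map isometryD(1) id_isometry by (auto simp: G_in_GL_ext_map Gm_in_GL_ext_map)
  have "is_subalgebra (tpow r) (End_grp r (G_in_GL \<omega> \<union> Gm_in_GL))"
    by (rule End_grp_subalgebra) (rule lin)
  then have alg: "is_subalgebra (tpow r) (equivariant r (\<lambda>I J. card I = card J))" by (simp only: End_G_Gm)
  have "?G \<subseteq> equivariant r (\<lambda>I J. card I = card J)"
    using perm_equivariant on_summand_equivariant by auto
  then show "enhanced_brauer \<omega> r \<subseteq> equivariant r (\<lambda>I J. card I = card J)"
    unfolding enhanced_brauer_def
    by (rule hull_minimal) (rule alg)
  show "equivariant r (\<lambda>I J. card I = card J) \<subseteq> enhanced_brauer \<omega> r"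
    unfolding enhanced_brauer_def hull_def
  proof (rule Inter_greatest, rule subsetI)
    fix A \<phi> assume A: "A \<in> {t. is_subalgebra (tpow r) t \<and> ?G \<subseteq> t}"
      and \<phi>: "\<phi> \<in> equivariant r (\<lambda>I J. card I = card J)"
    note S = is_subalgebraD[of "tpow r" A]
    have alg: "is_subalgebra (tpow r) A" and gen: "?G \<subseteq> A" using A by auto
    have proj: "summand_proj r I \<in> A" if I: "I \<subseteq> {..<r}" "I \<noteq> {}" for I
    proof -
      have "on_summand r I (idmap (tpow (card I))) \<in> ?G" using I idmap_brauer by blast
      then show ?thesis using gen unfolding on_summand_idmap[OF I(1)] by (rule rev_subsetD)
    qed
    \<comment> \<open>Generators exist for nonempty index sets only, so the projection to the
      summand of {} is obtained as the identity minus all other projections.\<close>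
    have "(summand_proj r {} :: 'v ext tensor \<Rightarrow> _) = idmap (tpow r) - (\<Sum>I\<in>Pow {..<r} - {{}}. summand_proj r I)"
    proof -
      have "(\<Sum>I\<in>Pow {..<r}. summand_proj r I)
        = summand_proj r {} + (\<Sum>I\<in>Pow {..<r} - {{}}. summand_proj r I :: 'v ext tensor \<Rightarrow> _)"
        by (rule sum.remove) auto
      from this[symmetric] show ?thesis unfolding sum_summand_proj by (simp only: eq_diff_eq)
    qed
    also have "\<dots> \<in> A"
      by (intro complex_vector.subspace_diff[OF S(1)[OF alg]] S(2)[OF alg] complex_vector.subspace_sum[OF S(1)[OF alg]] proj)
        auto
    finally have proj0: "(summand_proj r {} :: 'v ext tensor \<Rightarrow> _) \<in> A" .
    note H = equivariantD(1)[OF \<phi>]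
    have "block r \<phi> I J \<in> A" if IJ: "I \<subseteq> {..<r}" "J \<subseteq> {..<r}" "card I = card J" for I J
    proof (cases "I = {}")
      case True
      then have J: "J = {}" using IJ finite_slots by auto
      have e: "{} \<subseteq> {..<r}" by simp
      \<comment> \<open>The summand of {} is a line, so the block is a scalar. This scalar is a
        component without variables, so any assignment computes it.\<close>
      have "block r \<phi> {} {} = component r \<phi> {} {} (\<lambda>_. 0) *\<^sub>C summand_proj r {}"
      proof (rule component_eqI[OF block_Hom[OF H]
            complex_vector.subspace_scale[OF csubspace_Hom[OF csubspace_tpow] summand_proj_Hom]])
        fix I' J' assume IJ': "I' \<subseteq> {..<r}" "J' \<subseteq> {..<r}"
        show "component r (block r \<phi> {} {}) I' J'
          = component r (component r \<phi> {} {} (\<lambda>_. 0) *\<^sub>C summand_proj r {}) I' J'"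
        proof
          fix v
          have "component r \<phi> {} {} v = component r \<phi> {} {} (\<lambda>_. 0)"
            by (rule multilinear_on_cong[OF multilinear_on_component[OF H e e]]) simp
          then show "component r (block r \<phi> {} {}) I' J' v
            = component r (component r \<phi> {} {} (\<lambda>_. 0) *\<^sub>C summand_proj r {}) I' J' v"
            unfolding component_block[OF H e e IJ'] clinear_scale[OF clinear_component] scaleC_apply
            unfolding component_def[of r "summand_proj r {}"] summand_proj_tens[OF e IJ'(1)] scaleC_complex_def
            using tens_kform[OF IJ', of "v \<circ> Inl" "v \<circ> Inr"]
            by (cases "I' = {}"; cases "J' = {}") simp_all
        qed
      qed
      then show ?thesis using proj0 True J by (simp add: complex_vector.subspace_scale[OF S(1)[OF alg]])
    next
      case False
      let ?\<theta> = "slots_out r J \<circ> \<phi> \<circ> slots_in r I"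
      have "on_summand r I ?\<theta> \<in> A"
        using gen transported_brauer[OF \<phi> IJ] IJ False by blast
      moreover have "perm_action r (transfer_perm r J I) \<in> A"
        using gen transfer_perm_exists(1)[OF IJ] by blast
      ultimately have "E_map r J I \<circ> on_summand r I ?\<theta> \<in> A"
        unfolding E_map_def by (intro S(3)[OF alg] proj[OF IJ(1) False])
      moreover have "E_map r J I \<circ> on_summand r I ?\<theta> = block r \<phi> I J"
      proof -
        have "E_map r J I \<circ> on_summand r I ?\<theta> = (E_map r J I \<circ> slots_in r I) \<circ> slots_out r J \<circ> \<phi> \<circ> (slots_in r I \<circ> slots_out r I)"
          by (simp add: on_summand_def o_assoc)
        then show ?thesis
          unfolding E_map_slots_in[OF IJ] slots_in_out[OF IJ(1)] slots_in_out[OF IJ(2)] block_def .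
      qed
      ultimately show ?thesis by simp
    qed
    then have "cut r (\<lambda>I J. card I = card J) \<phi> \<in> A"
      unfolding cut_def by (intro complex_vector.subspace_sum[OF S(1)[OF alg]]) auto
    then show "\<phi> \<in> A" unfolding cut_eq[OF \<phi>] .
  qed
qed


section \<open>Commutants of the generated groups\<close>

lemma ext_map_GL:
  assumes g: "g \<in> isometry_group \<omega>" and c: "c \<noteq> 0"
  shows "ext_map g c \<in> carrier GL"
proof -
  have "bij (ext_map g c)"
    by (rule o_bij[of "ext_map (Hilbert_Choice.inv g) (1 / c)"])
      (use c in \<open>auto simp: fun_eq_iff ext_map_def isometryD(4,5)[OF g]\<close>)
  then show ?thesis using clinear_ext_map[OF isometryD(1)[OF g]] by (simp add: GL_def)
qed

lemma clinear_enhanced_act: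
  assumes "clinear g"
  shows "clinear (enhanced_act (g, v))"
  by (rule clinearI)
    (simp_all add: enhanced_act_def case_prod_unfold scaleC_prod_def scaleC_complex_def clinear_add[OF assms]
      clinear_scale[OF assms] scaleC_add_left scaleC_add_right scaleC_scaleC)

lemma Enh_in_GL_iff: "h \<in> Enh_in_GL \<omega> \<longleftrightarrow> (\<exists>g v. h = enhanced_act (g, v) \<and> g \<in> isometry_group \<omega>)"
  unfolding Enh_in_GL_def enhanced_group_def by force

lemma Enh_in_GL_carrier: "Enh_in_GL \<omega> \<subseteq> carrier GL"
proof
  fix h assume "h \<in> Enh_in_GL \<omega>"
  then obtain g v where h: "h = enhanced_act (g, v)" and g: "g \<in> isometry_group \<omega>"
    using Enh_in_GL_iff by blast
  let ?k = "\<lambda>(u, a). (Hilbert_Choice.inv g (u - a *\<^sub>C v), a)"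
  have "bij h"
    by (rule o_bij[of ?k]) (auto simp: h fun_eq_iff enhanced_act_def isometryD(4,5)[OF g])
  then show "h \<in> carrier GL" using clinear_enhanced_act[OF isometryD(1)[OF g]] by (simp add: GL_def h)
qed

lemma enhanced_act_factor:
  "enhanced_act (g, v) = enhanced_act (id, v) \<circ> ext_map g 1"
  by (auto simp: fun_eq_iff enhanced_act_def ext_map_def)

lemma End_grp_antimono: "H \<subseteq> K \<Longrightarrow> End_grp l K \<subseteq> End_grp l H"
  unfolding End_grp_def by blast

text \<open>Every element (g, v) acts as the translation by \<open>v\<close> after \<open>g\<close>,
  so commuting with the enhanced group means commuting with \<open>G\<close> and with all
  translations.\<close>

lemma End_Enh:
  "End_grp r (Enh_in_GL \<omega>) = {\<phi> \<in> End_grp r (G_in_GL \<omega>).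
    \<forall>v. diag_action r (enhanced_act (id, v)) \<circ> \<phi> = \<phi> \<circ> diag_action r (enhanced_act (id, v))}"
proof (intro equalityI subsetI)
  fix \<phi> assume \<phi>: "\<phi> \<in> End_grp r (Enh_in_GL \<omega>)"
  have "G_in_GL \<omega> \<subseteq> Enh_in_GL \<omega>"
    unfolding G_in_GL_ext_map
  proof clarify
    fix g assume "g \<in> isometry_group \<omega>"
    moreover have "ext_map g 1 = enhanced_act (g, 0)" by (auto simp: ext_map_def enhanced_act_def)
    ultimately show "ext_map g 1 \<in> Enh_in_GL \<omega>" using Enh_in_GL_iff by metis
  qed
  moreover have "enhanced_act (id, v) \<in> Enh_in_GL \<omega>" for v
    using id_isometry Enh_in_GL_iff by blast
  ultimately show "\<phi> \<in> {\<phi> \<in> End_grp r (G_in_GL \<omega>).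
    \<forall>v. diag_action r (enhanced_act (id, v)) \<circ> \<phi> = \<phi> \<circ> diag_action r (enhanced_act (id, v))}"
    using End_grp_antimono[of "G_in_GL \<omega>" "Enh_in_GL \<omega>" r] End_grpD(2)[OF \<phi>] \<phi> by blast
next
  fix \<phi> assume "\<phi> \<in> {\<phi> \<in> End_grp r (G_in_GL \<omega>).
    \<forall>v. diag_action r (enhanced_act (id, v)) \<circ> \<phi> = \<phi> \<circ> diag_action r (enhanced_act (id, v))}"
  then have \<phi>: "\<phi> \<in> End_grp r (G_in_GL \<omega>)"
    and e: "\<And>v. diag_action r (enhanced_act (id, v)) \<circ> \<phi> = \<phi> \<circ> diag_action r (enhanced_act (id, v))" by blast+
  have "diag_action r h \<circ> \<phi> = \<phi> \<circ> diag_action r h" if "h \<in> Enh_in_GL \<omega>" for h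
  proof -
    obtain g v where h: "h = enhanced_act (g, v)" and g: "g \<in> isometry_group \<omega>"
      using \<open>h \<in> Enh_in_GL \<omega>\<close> Enh_in_GL_iff by blast
    have x: "diag_action r (ext_map g 1) \<circ> \<phi> = \<phi> \<circ> diag_action r (ext_map g 1)"
      by (rule End_grpD(2)[OF \<phi>]) (use g in \<open>unfold G_in_GL_ext_map, blast\<close>)
    have id: "clinear (id :: 'v \<Rightarrow> 'v)" by (rule isometryD(1)[OF id_isometry])
    show ?thesis
      unfolding h enhanced_act_factor[of g v] diag_action_comp[OF clinear_enhanced_act[OF id] clinear_ext_map[OF isometryD(1)[OF g]]]
      by (simp only: comp_assoc x) (simp only: comp_assoc[symmetric] e)
  qed
  then show "\<phi> \<in> End_grp r (Enh_in_GL \<omega>)" unfolding End_grp_def using End_grpD(1)[OF \<phi>] by blast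
qed

lemma End_G_times_Gm: "End_grp r (G_times_Gm \<omega>) = enhanced_brauer \<omega> r"
proof -
  have "G_in_GL \<omega> \<union> Gm_in_GL \<subseteq> carrier GL"
    using ext_map_GL id_isometry by (auto simp: G_in_GL_ext_map Gm_in_GL_ext_map)
  then show ?thesis
    unfolding G_times_Gm_def by (simp only: End_grp_generate End_G_Gm enhanced_brauer_equivariant)
qed

lemma End_Enh_semidirect_Gm:
  "End_grp r (Enh_semidirect_Gm \<omega>) = translation_invariants r (enhanced_brauer \<omega> r)"
proof -
  have "Enh_in_GL \<omega> \<union> Gm_in_GL \<subseteq> carrier GL"
    using ext_map_GL id_isometry Enh_in_GL_carrier by (auto simp: Gm_in_GL_ext_map)
  then have "End_grp r (Enh_semidirect_Gm \<omega>) = End_grp r (Enh_in_GL \<omega>) \<inter> End_grp r Gm_in_GL"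
    unfolding Enh_semidirect_Gm_def by (simp only: End_grp_generate End_grp_Un)
  also have "\<dots> = {\<phi> \<in> End_grp r (G_in_GL \<omega> \<union> Gm_in_GL).
    \<forall>v. diag_action r (enhanced_act (id, v)) \<circ> \<phi> = \<phi> \<circ> diag_action r (enhanced_act (id, v))}"
    unfolding End_Enh End_grp_Un by blast
  finally show ?thesis by (simp only: End_G_Gm enhanced_brauer_equivariant translation_invariants_def)
qed

section \<open>The direct sum decomposition\<close>

text \<open>The component is a combination of matching forms on card I + card J variables, and a set
  of odd size has no perfect matching.\<close>

lemma component_odd:
  assumes \<phi>: "\<phi> \<in> equivariant r Q" and IJ: "I \<subseteq> {..<r}" "J \<subseteq> {..<r}" and odd: "odd (int (card I) - int (card J))"
  shows "component r \<phi> I J = 0"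
proof -
  let ?A = "Inl ` I \<union> Inr ` J :: (nat + nat) set"
  have fin: "finite I" "finite J" using IJ finite_slots by auto
  have card: "card ?A = card I + card J"
    using fin by (subst card_Un_disjoint) (auto simp: card_image)
  have "matchings ?A = {}"
  proof (rule ccontr)
    assume "matchings ?A \<noteq> {}"
    then obtain ps where ps: "distinct (map fst ps @ map snd ps)" "set (map fst ps @ map snd ps) = ?A"
      by (auto simp: matchings_def)
    have "card ?A = 2 * length ps" using distinct_card[OF ps(1)] unfolding ps(2) by simp
    then show False using card odd by presburger
  qed
  moreover have "component r \<phi> I J \<in> cspan (mform ` matchings ?A)"
    by (rule first_fundamental_theorem)
      (use fin IJ multilinear_on_component[OF equivariantD(1)[OF \<phi>]] equivariantD(2)[OF \<phi>] in auto)
  ultimately show ?thesis by simp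
qed

text \<open>The summands correspond to disjoint classes of pairs (I, J) that together contain every
  pair with card I - card J even; the other components vanish by \<open>component_odd\<close>. Both
  generation and directness are then checked one component at a time.\<close>

theorem End_G_direct_sum:
  "is_direct_sum (End_grp r (G_in_GL \<omega>))
     (insert None (Some ` {(s, t). s \<le> r \<and> t \<le> r \<and> s \<noteq> t \<and> even (int s - int t)}))
     (\<lambda>k. case k of None \<Rightarrow> enhanced_brauer \<omega> r | Some (s, t) \<Rightarrow> B_st \<omega> n f fd r s t)"
proof -
  define K where "K = insert None (Some ` {(s, t). s \<le> r \<and> t \<le> r \<and> s \<noteq> t \<and> even (int s - int t)})"
  define W where "W = (\<lambda>k. case k of None \<Rightarrow> enhanced_brauer \<omega> r | Some (s, t) \<Rightarrow> B_st \<omega> n f fd r s t)"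
  \<comment> \<open>The class of pairs belonging to the summand \<open>k\<close>;
    \<open>uniq\<close> and \<open>ex\<close> below say that each relevant pair lies in exactly one
    class.\<close>
  define Q where "Q k I J \<longleftrightarrow> (case k of None \<Rightarrow> card I = card J | Some (s, t) \<Rightarrow> card I = s \<and> card J = t)"
    for k and I J :: "nat set"
  have fin: "finite K"
  proof -
    have "finite {(s, t). s \<le> r \<and> t \<le> r \<and> s \<noteq> t \<and> even (int s - int t)}"
      by (rule finite_subset[of _ "{..r} \<times> {..r}"]) auto
    then show ?thesis unfolding K_def by (intro finite.insertI finite_imageI)
  qed
  have W: "W k = equivariant r (Q k)" if "k \<in> K" for k
  proof (cases k)
    case None
    then show ?thesis by (simp add: W_def Q_def[abs_def] enhanced_brauer_equivariant)
  next
    case (Some p)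
    obtain s t where p: "p = (s, t)" by (cases p)
    then have "s \<noteq> t" using that Some by (auto simp: K_def)
    then show ?thesis by (simp add: W_def Q_def[abs_def] Some p B_st_equivariant)
  qed
  have uniq: "k = l" if "k \<in> K" "l \<in> K" "Q k I J" "Q l I J" for k l I J
    using that by (cases k; cases l) (auto simp: K_def Q_def)
  have ex: "\<exists>k\<in>K. Q k I J" if IJ: "I \<subseteq> {..<r}" "J \<subseteq> {..<r}" "even (int (card I) - int (card J))" for I J
  proof (cases "card I = card J")
    case True
    then show ?thesis by (auto simp: K_def Q_def)
  next
    case False
    have "card I \<le> r" "card J \<le> r" using card_mono[OF _ IJ(1)] card_mono[OF _ IJ(2)] by auto
    then have "Some (card I, card J) \<in> K" using False IJ(3) by (auto simp: K_def)
    then show ?thesis by (rule bexI[rotated]) (simp add: Q_def)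
  qed
  have "is_direct_sum (equivariant r (\<lambda>_ _. True)) K W"
    unfolding is_direct_sum_def
  proof (intro conjI ballI allI impI)
    show "finite K" by (rule fin)
    show "csubspace (W k)" if "k \<in> K" for k unfolding W[OF that] by (rule csubspace_equivariant)
    show "equivariant r (\<lambda>_ _. True) = subspace_sum K W"
    proof (intro equalityI subsetI)
      fix \<phi> assume \<phi>: "\<phi> \<in> equivariant r (\<lambda>_ _. True)"
      note H = equivariantD(1)[OF \<phi>]
      have "\<phi> = (\<Sum>k\<in>K. cut r (Q k) \<phi>)"
      proof (rule component_eqI[OF H])
        show "(\<Sum>k\<in>K. cut r (Q k) \<phi>) \<in> Hom (tpow r) (tpow r)"
          by (rule complex_vector.subspace_sum[OF csubspace_Hom[OF csubspace_tpow] cut_Hom[OF H]])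
        fix I J assume IJ: "I \<subseteq> {..<r}" "J \<subseteq> {..<r}"
        have s: "component r (\<Sum>k\<in>K. cut r (Q k) \<phi>) I J = (\<Sum>k\<in>K. if Q k I J then component r \<phi> I J else 0)"
          unfolding component_sum by (intro sum.cong refl component_cut[OF H IJ])
        show "component r \<phi> I J = component r (\<Sum>k\<in>K. cut r (Q k) \<phi>) I J"
        proof (cases "even (int (card I) - int (card J))")
          case True
          obtain l where l: "l \<in> K" "Q l I J" using ex[OF IJ True] by blast
          have "(\<Sum>k\<in>K. if Q k I J then component r \<phi> I J else 0) = (\<Sum>k\<in>K. if k = l then component r \<phi> I J else 0)"
          proof (rule sum.cong[OF refl])
            fix k assume k: "k \<in> K"
            have "Q k I J \<longleftrightarrow> k = l" using uniq[OF k l(1) _ l(2)] l(2) by blast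
            then show "(if Q k I J then component r \<phi> I J else 0) = (if k = l then component r \<phi> I J else 0)" by simp
          qed
          also have "\<dots> = component r \<phi> I J" by (subst sum.delta[OF fin]) (use l in simp)
          finally show ?thesis unfolding s ..
        next
          case False
          then have z: "component r \<phi> I J = 0" by (rule component_odd[OF \<phi> IJ])
          show ?thesis unfolding s z by (simp only: if_cancel sum.neutral_const)
        qed
      qed
      moreover have "\<forall>k\<in>K. cut r (Q k) \<phi> \<in> W k" using W cut_equivariant[OF \<phi>] by simp
      ultimately show "\<phi> \<in> subspace_sum K W" unfolding subspace_sum_def by blast
    next
      fix \<phi> assume "\<phi> \<in> subspace_sum K W"
      then obtain x where x: "\<phi> = (\<Sum>k\<in>K. x k)" "\<And>k. k \<in> K \<Longrightarrow> x k \<in> W k"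
        unfolding subspace_sum_def by blast
      show "\<phi> \<in> equivariant r (\<lambda>_ _. True)"
        unfolding x(1)
      proof (rule complex_vector.subspace_sum[OF csubspace_equivariant])
        fix k assume k: "k \<in> K"
        show "x k \<in> equivariant r (\<lambda>_ _. True)"
          using x(2)[OF k] unfolding W[OF k] by (rule equivariant_mono) simp
      qed
    qed
    fix x k assume x: "(\<forall>i\<in>K. x i \<in> W i) \<and> (\<Sum>i\<in>K. x i) = 0" and k: "k \<in> K"
    have xW: "x i \<in> equivariant r (Q i)" if "i \<in> K" for i
      using x that unfolding W[OF that, symmetric] by blast
    show "x k = 0"
    proof (rule component_eqI[OF equivariantD(1)[OF xW[OF k]]])
      show "0 \<in> Hom (tpow r) (tpow r)" by (rule complex_vector.subspace_0[OF csubspace_Hom[OF csubspace_tpow]])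
      fix I J assume IJ: "I \<subseteq> {..<r}" "J \<subseteq> {..<r}"
      have "component r (x k) I J = 0"
      proof (cases "Q k I J")
        case True
        have "0 = component r (\<Sum>i\<in>K. x i) I J"
          using x clinear_0[OF clinear_component[of r I J]] by simp
        also have "\<dots> = (\<Sum>i\<in>K. if i = k then component r (x k) I J else 0)"
          unfolding component_sum
        proof (rule sum.cong[OF refl])
          fix i assume i: "i \<in> K"
          show "component r (x i) I J = (if i = k then component r (x k) I J else 0)"
            using equivariantD(3)[OF xW[OF i] IJ] uniq[OF i k _ True] by (cases "i = k") auto
        qed
        also have "\<dots> = component r (x k) I J" by (subst sum.delta[OF fin]) (use k in simp)
        finally show ?thesis ..
      next
        case False
        then show ?thesis by (rule equivariantD(3)[OF xW[OF k] IJ])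
      qed
      then show "component r (x k) I J = component r 0 I J"
        using clinear_0[OF clinear_component[of r I J]] by simp
    qed
  qed
  then show ?thesis by (simp only: End_G K_def W_def)
qed

end

theorem theorem0p1:
  fixes \<omega> :: "'v::complex_vector \<Rightarrow> 'v \<Rightarrow> complex"
    and f fd :: "nat \<Rightarrow> 'v" and n r :: nat
  assumes "is_basis n f"
    and "nondegenerate_bilinear \<omega>"
    and "(\<forall>u v. \<omega> v u = \<omega> u v) \<or> (\<forall>u v. \<omega> v u = - \<omega> u v)"
    and "is_dual_basis \<omega> n f fd"
    and "r \<ge> 1"
  shows
    "is_direct_sum (End_grp r (G_in_GL \<omega>))
       (insert None (Some ` {(s, t). s \<le> r \<and> t \<le> r \<and> s \<noteq> t \<and> even (int s - int t)}))
       (\<lambda>k. case k of None \<Rightarrow> enhanced_brauer \<omega> r | Some (s, t) \<Rightarrow> B_st \<omega> n f fd r s t)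
     \<and> End_grp r (G_times_Gm \<omega>) = enhanced_brauer \<omega> r
     \<and> End_grp r (Enh_semidirect_Gm \<omega>) = translation_invariants r (enhanced_brauer \<omega> r)"
proof -
  obtain \<epsilon> :: complex where \<epsilon>: "\<And>u v. \<omega> v u = \<epsilon> * \<omega> u v" "\<epsilon> = 1 \<or> \<epsilon> = - 1"
    using assms(3)
  proof
    assume a: "\<forall>u v. \<omega> v u = \<omega> u v"
    show thesis
    proof (rule that)
      show "\<omega> v u = 1 * \<omega> u v" for u v using a[rule_format, of v u] by simp
    qed simp
  next
    assume a: "\<forall>u v. \<omega> v u = - \<omega> u v"
    show thesis
    proof (rule that)
      show "\<omega> v u = - 1 * \<omega> u v" for u v using a[rule_format, of v u] by simp
    qed simp
  qed
  interpret bilinear_space \<omega> f fd n \<epsilon>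
    by (rule bilinear_space.intro[OF assms(1,2,4) \<epsilon>])
  show ?thesis
    using End_G_direct_sum End_G_times_Gm End_Enh_semidirect_Gm by blast
qed

end
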